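(* Let $\kappa>0$, $M\ge1$, $\rho_1,\dots,\rho_M\in\mathbb{R}$, and let $(X_t;Y^1_t,\dots,Y^M_t;g_t)_{t\in[0,\tau)}$ be an SLE$_\kappa(\rho_1,\dots,\rho_M)$ as defined in the context, with partition function $Z$. Put $\alpha=\frac{1}{\sqrt\kappa}$, $\alpha_K=\frac{\rho_K}{2\sqrt\kappa}$ and $\beta=\alpha+\sum_{K=1}^M\alpha_K$. Then the "SLE state" $$M_t:=\frac{1}{Z(X_t;Y^1_t,\dots,Y^M_t)}\,G_{g_t}\,V_{\alpha;\alpha_1,\dots,\alpha_M}(X_t;Y^1_t,\dots,Y^M_t)\,v_0=\mathrm{const.}\times G_{g_t}\,U^-_{\alpha;\alpha_1,\dots,\alpha_M}(X_t;Y^1_t,\dots,Y^M_t)\,v_\beta$$ is an $\hat F_\beta$-valued local martingale, meaning that in the expansion of $M_t$ in the basis vectors $a_{-n_1}\cdots a_{-n_k}v_\beta$ ($k\ge0$, $1\le n_1\le\dots\le n_k$) every coefficient is a local martingale on $[0,\tau)$.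
   Context: SLE$_\kappa(\underline\rho)$. Let $A$ be a continuous martingale with quadratic variation $\langle A\rangle_t$, and let $X_0,Y^1_0,\dots,Y^M_0\in\mathbb{R}$ be distinct. The processes satisfy $$dX_t=\sqrt\kappa\,dA_t+\sum_{K=1}^M\frac{\rho_K}{X_t-Y^K_t}\,d\langle A\rangle_t,\qquad dY^K_t=\frac{2}{Y^K_t-X_t}\,d\langle A\rangle_t,$$ on $[0,\tau)$, where $\tau$ is a stopping time not larger than the first time at which two of the processes $X,Y^1,\dots,Y^M$ collide. The conformal maps $g_t$ satisfy $g_0(z)=z$ and $dg_t(z)=\frac{2}{g_t(z)-X_t}\,d\langle A\rangle_t$ for $z$ in the upper half plane; $g_t(z)=z+\sum_{m\le-2}g^{(t)}_mz^{1+m}$ near $\infty$. The partition function is $$Z(x;y_1,\dots,y_M)=\prod_{K}(y_K-x)^{\rho_K/\kappa}\prod_{1\le J<K\le M}(y_J-y_K)^{\rho_J\rho_K/2\kappa},$$ defined for arguments ordered on the line as the initial points; powers of negative reals are taken with a fixed branch, which only affects $Z$ by a constant factor, chosen so that $Z>0$. Fock spaces. Let $a_n$ ($n\in\mathbb{Z}$) generate the Heisenberg algebra $[a_n,a_m]=2n\,\delta_{n+m,0}$. For a charge $\gamma$, $F_\gamma$ has basis $a_{-n_1}\cdots a_{-n_k}v_\gamma$ ($k\ge0$, $1\le n_1\le\dots\le n_k$), with $a_0v_\gamma=2\gamma v_\gamma$ and $a_nv_\gamma=0$ for $n>0$. Put $\alpha_0=\frac12\big(\frac{\sqrt\kappa}{2}-\frac{2}{\sqrt\kappa}\big)$.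 The Virasoro algebra (central charge $1-24\alpha_0^2$) acts on $F_\gamma$ by $L_n=\frac14\sum_{j\in\mathbb{Z}}{:}a_{n-j}a_j{:}-\alpha_0(n+1)a_n$, where ${:}a_na_m{:}$ equals $a_na_m$ if $n\le m$ and $a_ma_n$ otherwise. $F_\gamma=\bigoplus_{m\ge0}(F_\gamma)_m$ is graded by $n_1+\dots+n_k=m$, and $\hat F_\gamma=\prod_{m\ge0}(F_\gamma)_m$. Vertex operators. $V_{\alpha;\alpha_1,\dots,\alpha_M}(x;y_1,\dots,y_M)$ applied to $v_0\in F_0$ is $$V_{\alpha;\alpha_1,\dots,\alpha_M}(x;y_1,\dots,y_M)v_0=\prod_K(x-y_K)^{2\alpha\alpha_K}\prod_{J<K}(y_J-y_K)^{2\alpha_J\alpha_K}\;U^-_{\alpha;\alpha_1,\dots,\alpha_M}(x;y_1,\dots,y_M)\,v_\beta\in\hat F_\beta,$$ $$U^-_{\alpha;\alpha_1,\dots,\alpha_M}(x;y_1,\dots,y_M)=\exp\Big(\sum_{n=1}^\infty\frac1n\Big(\alpha x^n+\sum_K\alpha_Ky_K^n\Big)a_{-n}\Big)$$ (again with a fixed branch of the powers). The operator $G_f$. For $f(z)=z+\sum_{m\le-2}f_mz^{1+m}$, $G_f$ is the element of the completion $\overline{\mathcal{U}(\mathfrak{vir}_-)}$ (infinite sums of elements of increasing degree) of the universal enveloping algebra of the span of the $L_k$, $k<0$, with coefficients polynomial in $f_{-2},f_{-3},\dots$, determined by $G_{\mathrm{id}}=1$ and $$\frac{\partial}{\partial f_m}G_f=-\sum_{k\le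 m}\mathrm{Res}_w\Big(w^{1+m}\frac{f'(w)}{f(w)^{2+k}}\Big)\,G_fL_k\qquad(m\le-2),$$ where $\mathrm{Res}_w$ is the coefficient of $w^{-1}$ in the expansion at $w=\infty$. $G_f$ acts on $\hat F_\beta$ through the action of the $L_k$. $G_{g_t}$ is $G_f$ evaluated at $f_m=g^{(t)}_m$. *)

theory Defs
  imports
    "HOL-Probability.Probability"
    "HOL-Library.Groups_Big_Fun"
    "HOL-Library.Multiset"
    "HOL-Computational_Algebra.Formal_Laurent_Series"
begin

section \<open>Continuous local martingales up to a stopping time\<close>

text \<open>Times of processes are reals \<open>t \<ge> 0\<close>. Filtrations and stopping times are indexed by
  \<^typ>\<open>ennreal\<close>, so that the value \<open>\<infinity>\<close> is allowed for the latter. No completeness or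
  right-continuity of the filtration is assumed.\<close>

definition martingale ::
    "'a measure \<Rightarrow> (ennreal \<Rightarrow> 'a measure) \<Rightarrow> (real \<Rightarrow> 'a \<Rightarrow> real) \<Rightarrow> bool" where
  "martingale P F N \<longleftrightarrow>
     (\<forall>t\<ge>0. N t \<in> borel_measurable (F (ennreal t)) \<and> integrable P (N t)) \<and>
     (\<forall>s\<ge>0. \<forall>t\<ge>s. AE \<omega> in P. real_cond_exp P (F (ennreal s)) (N t) \<omega> = N s \<omega>)"

text \<open>Revuz and Yor, Exercise IV.1.48: \<open>N\<close> is a continuous local martingale on \<open>[0,\<tau>)\<close> if there
  are stopping times \<open>T\<^sub>n\<close> increasing to \<open>\<tau>\<close> and continuous martingales \<open>N\<^sup>n\<close> with
  \<open>N = N\<^sup>n\<close> on \<open>{t < T\<^sub>n}\<close>. The values of \<open>N\<close> from time \<open>\<tau>\<close> on are irrelevant, and \<open>\<tau>\<close> need not be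
  predictable.\<close>

definition local_martingale_on ::
    "'a measure \<Rightarrow> (ennreal \<Rightarrow> 'a measure) \<Rightarrow> ('a \<Rightarrow> ennreal) \<Rightarrow> (real \<Rightarrow> 'a \<Rightarrow> real) \<Rightarrow> bool" where
  "local_martingale_on P F \<tau> N \<longleftrightarrow>
     (\<exists>T :: nat \<Rightarrow> 'a \<Rightarrow> ennreal. \<exists>Nn :: nat \<Rightarrow> real \<Rightarrow> 'a \<Rightarrow> real.
        (\<forall>n. stopping_time F (T n)) \<and>
        (AE \<omega> in P. incseq (\<lambda>n. T n \<omega>) \<and> (\<lambda>n. T n \<omega>) \<longlonglongrightarrow> \<tau> \<omega>) \<and>
        (\<forall>n. martingale P F (Nn n)) \<and>
        (\<forall>n. AE \<omega> in P. continuous_on {0..} (\<lambda>t. Nn n t \<omega>)) \<and>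
        (\<forall>n. AE \<omega> in P. \<forall>t\<ge>0. ennreal t < T n \<omega> \<longrightarrow> N t \<omega> = Nn n t \<omega>))"

definition complex_local_martingale_on ::
    "'a measure \<Rightarrow> (ennreal \<Rightarrow> 'a measure) \<Rightarrow> ('a \<Rightarrow> ennreal) \<Rightarrow> (real \<Rightarrow> 'a \<Rightarrow> complex) \<Rightarrow> bool" where
  "complex_local_martingale_on P F \<tau> N \<longleftrightarrow>
     local_martingale_on P F \<tau> (\<lambda>t \<omega>. Re (N t \<omega>)) \<and>
     local_martingale_on P F \<tau> (\<lambda>t \<omega>. Im (N t \<omega>))"

text \<open>The quadratic variation of a continuous (local) martingale \<open>A\<close> is the continuous nondecreasing
  adapted process \<open>Q\<close> with \<open>Q\<^sub>0 = 0\<close> that makes \<open>A\<^sup>2 - Q\<close> a local martingale (Karatzas and Shreve,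
  Definition 1.5.3 and Problem 1.5.17; Revuz and Yor, Theorem IV.1.8).\<close>

definition quadratic_variation ::
    "'a measure \<Rightarrow> (ennreal \<Rightarrow> 'a measure) \<Rightarrow> (real \<Rightarrow> 'a \<Rightarrow> real) \<Rightarrow> (real \<Rightarrow> 'a \<Rightarrow> real) \<Rightarrow> bool" where
  "quadratic_variation P F A Q \<longleftrightarrow>
     (\<forall>t\<ge>0. Q t \<in> borel_measurable (F (ennreal t))) \<and>
     (\<forall>\<omega>\<in>space P. Q 0 \<omega> = 0 \<and> continuous_on {0..} (\<lambda>t. Q t \<omega>) \<and> mono_on {0..} (\<lambda>t. Q t \<omega>)) \<and>
     local_martingale_on P F (\<lambda>_. \<infinity>) (\<lambda>t \<omega>. (A t \<omega>)\<^sup>2 - Q t \<omega>)"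

section \<open>SLE with force points\<close>

text \<open>The Lebesgue--Stieltjes measure \<open>dq\<close> of a nondecreasing continuous function \<open>q\<close> on \<open>[0,\<infinity>)\<close>.\<close>

definition stieltjes :: "(real \<Rightarrow> real) \<Rightarrow> real measure" where
  "stieltjes q = interval_measure (\<lambda>s. q (max 0 s))"

text \<open>\<open>w\<close> solves the Loewner equation \<open>dw\<^sub>s = 2 / (w\<^sub>s - x\<^sub>s) dq\<^sub>s\<close>, \<open>w\<^sub>0 = z\<close> on \<open>[0,t]\<close>.\<close>

definition loewner_solution ::
    "(real \<Rightarrow> real) \<Rightarrow> (real \<Rightarrow> real) \<Rightarrow> real \<Rightarrow> complex \<Rightarrow> (real \<Rightarrow> complex) \<Rightarrow> bool" where
  "loewner_solution q x t z w \<longleftrightarrow>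
     continuous_on {0..t} w \<and>
     (\<forall>s\<in>{0..t}. w s \<noteq> of_real (x s) \<and>
        w s = z + (LINT r:{0..s}|stieltjes q. 2 / (w r - of_real (x r))))"

text \<open>The driving process is \<open>X\<close>, the force points are \<open>Y 1, \<dots>, Y M\<close>, and \<open>Q\<close> is \<open>\<langle>A\<rangle>\<close>. Since the
  martingale \<open>A\<close> enters the equation of \<open>X\<close> with a constant coefficient, no stochastic integral occurs.
  The domain of \<open>g\<^sub>t\<close> consists of those points of the upper half plane from which the Loewner equation
  can be solved up to time \<open>t\<close>; values of \<open>g\<^sub>t\<close> elsewhere are arbitrary. \<open>gc t \<omega> m\<close> is the
  coefficient of \<open>z\<^bsup>1+m\<^esup>\<close>, \<open>m \<le> -2\<close>, in the expansion of \<open>g\<^sub>t\<close> at \<open>\<infinity>\<close>. All processes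
  \<open>X, Y, g, gc\<close> matter on \<open>[0,\<tau>)\<close> only.\<close>

locale sle_kappa_rho = prob_space P + filtration "space P" F
  for P :: "'a measure" and F :: "ennreal \<Rightarrow> 'a measure" +
  fixes \<kappa> :: real and M :: nat and \<rho> :: "nat \<Rightarrow> real"
    and A Q :: "real \<Rightarrow> 'a \<Rightarrow> real" and \<tau> :: "'a \<Rightarrow> ennreal"
    and x0 :: real and y0 :: "nat \<Rightarrow> real"
    and X :: "real \<Rightarrow> 'a \<Rightarrow> real" and Y :: "nat \<Rightarrow> real \<Rightarrow> 'a \<Rightarrow> real"
    and g :: "real \<Rightarrow> 'a \<Rightarrow> complex \<Rightarrow> complex" and gc :: "real \<Rightarrow> 'a \<Rightarrow> int \<Rightarrow> complex"
  assumes subalg: "\<And>t. subalgebra P (F t)"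
    and A_martingale: "martingale P F A"
    and A_continuous: "\<And>\<omega>. \<omega> \<in> space P \<Longrightarrow> continuous_on {0..} (\<lambda>t. A t \<omega>)"
    and Q_quadratic_variation: "quadratic_variation P F A Q"
    and initial_distinct: "inj_on y0 {1..M}" "x0 \<notin> y0 ` {1..M}"
    and \<tau>_stopping: "stopping_time F \<tau>"
    and X_adapted: "\<And>t. t \<ge> 0 \<Longrightarrow> X t \<in> borel_measurable (F (ennreal t))"
    and Y_adapted: "\<And>K t. K \<in> {1..M} \<Longrightarrow> t \<ge> 0 \<Longrightarrow> Y K t \<in> borel_measurable (F (ennreal t))"
    and X_continuous:
      "\<And>\<omega>. \<omega> \<in> space P \<Longrightarrow> continuous_on {t. 0 \<le> t \<and> ennreal t < \<tau> \<omega>} (\<lambda>t. X t \<omega>)"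
    and Y_continuous:
      "\<And>K \<omega>. K \<in> {1..M} \<Longrightarrow> \<omega> \<in> space P \<Longrightarrow>
         continuous_on {t. 0 \<le> t \<and> ennreal t < \<tau> \<omega>} (\<lambda>t. Y K t \<omega>)"
    and no_collision:
      "\<And>\<omega> t. \<omega> \<in> space P \<Longrightarrow> t \<ge> 0 \<Longrightarrow> ennreal t < \<tau> \<omega> \<Longrightarrow>
         inj_on (\<lambda>K. Y K t \<omega>) {1..M} \<and> X t \<omega> \<notin> (\<lambda>K. Y K t \<omega>) ` {1..M}"
    and X_sde:
      "AE \<omega> in P. \<forall>t\<ge>0. ennreal t < \<tau> \<omega> \<longrightarrow>
         X t \<omega> = x0 + sqrt \<kappa> * (A t \<omega> - A 0 \<omega>)
           + (LINT s:{0..t}|stieltjes (\<lambda>r. Q r \<omega>). (\<Sum>K=1..M. \<rho> K / (X s \<omega> - Y K s \<omega>)))"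
    and Y_ode:
      "AE \<omega> in P. \<forall>K\<in>{1..M}. \<forall>t\<ge>0. ennreal t < \<tau> \<omega> \<longrightarrow>
         Y K t \<omega> = y0 K + (LINT s:{0..t}|stieltjes (\<lambda>r. Q r \<omega>). 2 / (Y K s \<omega> - X s \<omega>))"
    and loewner:
      "AE \<omega> in P. \<forall>t\<ge>0. ennreal t < \<tau> \<omega> \<longrightarrow> (\<forall>z. Im z > 0 \<longrightarrow>
         (\<exists>w. loewner_solution (\<lambda>s. Q s \<omega>) (\<lambda>s. X s \<omega>) t z w) \<longrightarrow>
         loewner_solution (\<lambda>s. Q s \<omega>) (\<lambda>s. X s \<omega>) t z (\<lambda>s. g s \<omega> z))"
    and expansion:
      "AE \<omega> in P. \<forall>t\<ge>0. ennreal t < \<tau> \<omega> \<longrightarrow> (\<exists>R. \<forall>z. Im z > 0 \<longrightarrow> norm z > R \<longrightarrow>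
         ((\<lambda>m. gc t \<omega> m * z powi (1 + m)) has_sum (g t \<omega> z - z)) {..-2})"

text \<open>The branch of the powers that makes \<open>Z > 0\<close> amounts to taking absolute values of the bases.\<close>

definition sle_Z :: "real \<Rightarrow> nat \<Rightarrow> (nat \<Rightarrow> real) \<Rightarrow> real \<Rightarrow> (nat \<Rightarrow> real) \<Rightarrow> real" where
  "sle_Z \<kappa> M \<rho> x y =
     (\<Prod>K=1..M. \<bar>y K - x\<bar> powr (\<rho> K / \<kappa>)) *
     (\<Prod>K=1..M. \<Prod>J\<in>{1..<K}. \<bar>y J - y K\<bar> powr (\<rho> J * \<rho> K / (2 * \<kappa>)))"

section \<open>Fock spaces\<close>

text \<open>A vector of \<open>\<hat>F\<^sub>\<gamma>\<close> is given by its coefficients in the basis \<open>a\<^bsub>-n\<^sub>1\<^esub> \<cdots> a\<^bsub>-n\<^sub>k\<^esub> v\<^sub>\<gamma>\<close>, the basis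
  vector being indexed by the multiset \<open>{#n\<^sub>1, \<dots>, n\<^sub>k#}\<close> of positive numbers (cf. \<open>fock_basis_heis\<close> below).
  As the graded pieces are finite-dimensional, \<open>\<hat>F\<^sub>\<gamma>\<close> contains all families of coefficients. Only
  multisets without \<open>0\<close> are meaningful; all vectors built below have coefficient \<open>0\<close> at the others.
  The operators \<open>a\<^sub>n\<close> extend to \<open>\<hat>F\<^sub>\<gamma>\<close>.\<close>

type_synonym fock = "nat multiset \<Rightarrow> complex"

definition fock_basis :: "nat multiset \<Rightarrow> fock" where
  "fock_basis \<mu> = (\<lambda>\<nu>. of_bool (\<nu> = \<mu>))"

abbreviation fock_vac :: fock where
  "fock_vac \<equiv> fock_basis {#}"

definition heis :: "real \<Rightarrow> int \<Rightarrow> fock \<Rightarrow> fock" where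
  "heis \<gamma> n \<phi> = (\<lambda>\<nu>.
     if n < 0 then (if nat (-n) \<in># \<nu> then \<phi> (\<nu> - {#nat (-n)#}) else 0)
     else if n = 0 then of_real (2 * \<gamma>) * \<phi> \<nu>
     else of_int (2 * n) * of_nat (count \<nu> (nat n) + 1) * \<phi> (add_mset (nat n) \<nu>))"

lemma heis_neg: "i > 0 \<Longrightarrow> heis \<gamma> (- int i) \<phi> \<nu> = (if i \<in># \<nu> then \<phi> (\<nu> - {#i#}) else 0)"
  and heis_pos: "i > 0 \<Longrightarrow> heis \<gamma> (int i) \<phi> \<nu>
      = of_nat (2 * i) * of_nat (count \<nu> i + 1) * \<phi> (add_mset i \<nu>)"
  and heis_0: "heis \<gamma> 0 \<phi> \<nu> = of_real (2 * \<gamma>) * \<phi> \<nu>"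
  by (simp_all add: heis_def)

lemma heis_commutator_pos_neg:
  assumes "i > 0" "j > 0"
  shows "heis \<gamma> (int i) (heis \<gamma> (- int j) \<phi>) \<nu> - heis \<gamma> (- int j) (heis \<gamma> (int i) \<phi>) \<nu>
    = (if i = j then of_nat (2 * i) * \<phi> \<nu> else 0)"
proof (cases "j \<in># \<nu>")
  case True
  then obtain \<mu> where \<mu>: "\<nu> = add_mset j \<mu>"
    by (meson mset_add)
  show ?thesis
  proof (cases "i = j")
    case True
    show ?thesis
      by (simp add: True heis_neg[OF assms(2)] heis_pos[OF assms(2)] \<mu> algebra_simps)
  next
    case False
    then have "add_mset i (add_mset j \<mu>) - {#j#} = add_mset i \<mu>"
      by simp
    with False show ?thesis
      unfolding heis_neg[OF assms(2)] heis_pos[OF assms(1)] \<mu> by simp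
  qed
next
  case False
  then have "count \<nu> j = 0"
    by (simp add: not_in_iff)
  with False show ?thesis
    unfolding heis_neg[OF assms(2)] heis_pos[OF assms(1)] by auto
qed

lemma heis_commutator:
  "heis \<gamma> n (heis \<gamma> m \<phi>) \<nu> - heis \<gamma> m (heis \<gamma> n \<phi>) \<nu> = (if n + m = 0 then of_int (2 * n) * \<phi> \<nu> else 0)"
proof -
  define i j where "i = nat \<bar>n\<bar>" and "j = nat \<bar>m\<bar>"
  consider "n = 0 \<or> m = 0" | "n < 0" "m < 0" | "n > 0" "m > 0" | "n > 0" "m < 0" | "n < 0" "m > 0"
    by linarith
  then show ?thesis
  proof cases
    case 1
    have zero: "heis \<gamma> 0 \<psi> = (\<lambda>\<nu>. of_real (2 * \<gamma>) * \<psi> \<nu>)" for \<psi>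
      by (rule ext) (rule heis_0)
    have scale: "heis \<gamma> k (\<lambda>\<nu>. c * \<phi> \<nu>) \<nu> = c * heis \<gamma> k \<phi> \<nu>" for k c
      by (simp add: heis_def)
    from 1 show ?thesis
    proof
      assume n: "n = 0"
      show ?thesis
        unfolding n zero scale by simp
    next
      assume m: "m = 0"
      show ?thesis
        unfolding m zero scale by simp
    qed
  next
    case 2
    then have nm: "n = - int i" "m = - int j" "i > 0" "j > 0"
      by (simp_all add: i_def j_def)
    have "heis \<gamma> (- int i) (heis \<gamma> (- int j) \<phi>) \<nu> = heis \<gamma> (- int j) (heis \<gamma> (- int i) \<phi>) \<nu>"
    proof (cases "i = j")
      case False
      then have mem: "j \<in># \<nu> - {#i#} \<longleftrightarrow> j \<in># \<nu>" "i \<in># \<nu> - {#j#} \<longleftrightarrow> i \<in># \<nu>"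
        by (auto simp: in_diff_count)
      have minus: "\<nu> - {#i#} - {#j#} = \<nu> - {#j#} - {#i#}"
        by (rule diff_right_commute)
      show ?thesis
        unfolding heis_neg[OF nm(3)] heis_neg[OF nm(4)] mem minus by argo
    qed simp
    with nm show ?thesis
      by simp
  next
    case 3
    then have nm: "n = int i" "m = int j" "i > 0" "j > 0"
      by (simp_all add: i_def j_def)
    have "heis \<gamma> (int i) (heis \<gamma> (int j) \<phi>) \<nu> = heis \<gamma> (int j) (heis \<gamma> (int i) \<phi>) \<nu>"
    proof (cases "i = j")
      case False
      have "\<phi> (add_mset j (add_mset i \<nu>)) = \<phi> (add_mset i (add_mset j \<nu>))"
        by (rule arg_cong[OF add_mset_commute])
      with False show ?thesis
        unfolding heis_pos[OF nm(3)] heis_pos[OF nm(4)] by simp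
    qed simp
    with nm show ?thesis
      by simp
  next
    case 4
    then have nm: "n = int i" "m = - int j" "i > 0" "j > 0"
      by (simp_all add: i_def j_def)
    from nm heis_commutator_pos_neg[OF nm(3,4), of \<gamma> \<phi> \<nu>] show ?thesis
      by simp
  next
    case 5
    then have nm: "n = - int i" "m = int j" "i > 0" "j > 0"
      by (simp_all add: i_def j_def)
    from nm heis_commutator_pos_neg[OF nm(4,3), of \<gamma> \<phi> \<nu>] show ?thesis
      by (simp add: minus_diff_eq[of "heis \<gamma> (int j) (heis \<gamma> (- int i) \<phi>) \<nu>", symmetric]
          del: minus_diff_eq)
  qed
qed

lemma heis_vac: "n > 0 \<Longrightarrow> heis \<gamma> n fock_vac = (\<lambda>_. 0)"
  and heis_0_vac: "heis \<gamma> 0 fock_vac = (\<lambda>\<nu>. of_real (2 * \<gamma>) * fock_vac \<nu>)"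
  by (auto simp: heis_def fock_basis_def)

lemma heis_fock_basis:
  assumes "n \<ge> 1"
  shows "heis \<gamma> (- int n) (fock_basis \<mu>) = fock_basis (add_mset n \<mu>)"
proof
  fix \<nu>
  show "heis \<gamma> (- int n) (fock_basis \<mu>) \<nu> = fock_basis (add_mset n \<mu>) \<nu>"
  proof (cases "n \<in># \<nu>")
    case True
    then obtain \<nu>' where "\<nu> = add_mset n \<nu>'"
      by (meson mset_add)
    with assms show ?thesis
      by (simp add: heis_def fock_basis_def)
  next
    case False
    with assms show ?thesis
      by (auto simp: heis_def fock_basis_def)
  qed
qed

lemma fock_basis_heis:
  assumes "\<forall>n\<in>set ns. n \<ge> 1"
  shows "foldr (\<lambda>n. heis \<gamma> (- int n)) ns fock_vac = fock_basis (mset ns)"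
  using assms
proof (induction ns)
  case (Cons n ns)
  then show ?case
    by (simp add: heis_fock_basis)
qed simp

section \<open>Virasoro action and the completed enveloping algebra\<close>

definition alpha0 :: "real \<Rightarrow> real" where
  "alpha0 \<kappa> = (sqrt \<kappa> / 2 - 2 / sqrt \<kappa>) / 2"

definition heis_ordered :: "real \<Rightarrow> int \<Rightarrow> int \<Rightarrow> fock \<Rightarrow> fock" where
  "heis_ordered \<gamma> n m \<phi> = (if n \<le> m then heis \<gamma> n (heis \<gamma> m \<phi>) else heis \<gamma> m (heis \<gamma> n \<phi>))"

text \<open>\<^const>\<open>Sum_any\<close> sums over all indices. Here and below, for each fixed \<open>\<nu>\<close> only finitely many
  terms are nonzero.\<close>

definition vir_L :: "real \<Rightarrow> real \<Rightarrow> int \<Rightarrow> fock \<Rightarrow> fock" where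
  "vir_L \<kappa> \<gamma> n \<phi> = (\<lambda>\<nu>.
     Sum_any (\<lambda>j::int. heis_ordered \<gamma> (n - j) j \<phi> \<nu>) / 4
     - of_real (alpha0 \<kappa> * of_int (n + 1)) * heis \<gamma> n \<phi> \<nu>)"

text \<open>Elements of the completed enveloping algebra of \<open>vir\<^sub>-\<close> are represented by infinite linear
  combinations of words in the letters \<open>L\<^sub>k\<close>, \<open>k < 0\<close> (lists of negative integers), modulo
  the relations \<open>L\<^sub>j L\<^sub>k - L\<^sub>k L\<^sub>j = (j - k) L\<^bsub>j+k\<^esub>\<close>. The algebra is graded by
  minus the sum of the letters, and equality in the completion is equality in each degree,
  where it means that the difference is a finite linear combination of relations multiplied by words
  on both sides.\<close>

type_synonym vir_series = "int list \<Rightarrow> complex"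

definition vir_series :: "vir_series set" where
  "vir_series = {u. \<forall>w. u w \<noteq> 0 \<longrightarrow> (\<forall>k\<in>set w. k < 0)}"

definition vir_word :: "int list \<Rightarrow> vir_series" where
  "vir_word v = (\<lambda>w. of_bool (w = v))"

definition vir_mult :: "vir_series \<Rightarrow> vir_series \<Rightarrow> vir_series" where
  "vir_mult u v = (\<lambda>w. \<Sum>i\<le>length w. u (take i w) * v (drop i w))"

inductive_set vir_relations :: "vir_series set" where
  zero: "(\<lambda>_. 0) \<in> vir_relations"
| add: "u \<in> vir_relations \<Longrightarrow> j < 0 \<Longrightarrow> k < 0 \<Longrightarrow> \<forall>i\<in>set p \<union> set q. i < 0 \<Longrightarrow>
    (\<lambda>w. u w + c * (vir_word (p @ [j, k] @ q) w - vir_word (p @ [k, j] @ q) w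
                    - of_int (j - k) * vir_word (p @ [j + k] @ q) w)) \<in> vir_relations"

definition vir_eq :: "vir_series \<Rightarrow> vir_series \<Rightarrow> bool" where
  "vir_eq u v \<longleftrightarrow> (\<forall>d. (\<lambda>w. if sum_list w = d then u w - v w else 0) \<in> vir_relations)"

definition vir_action :: "real \<Rightarrow> real \<Rightarrow> vir_series \<Rightarrow> fock \<Rightarrow> fock" where
  "vir_action \<kappa> \<gamma> u \<phi> = (\<lambda>\<nu>. Sum_any (\<lambda>w. u w * foldr (vir_L \<kappa> \<gamma>) w \<phi> \<nu>))"

section \<open>The operators \<open>G\<^sub>f\<close>\<close>

text \<open>Sequences \<open>f :: int \<Rightarrow> complex\<close> stand for \<open>f(w) = w + \<Sum>\<^bsub>m\<le>-2\<^esub> f\<^sub>m w\<^bsup>1+m\<^esup>\<close>; values at \<open>m > -2\<close> are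
  not used. Expansions at \<open>w = \<infinity>\<close> are formal Laurent series in \<open>u = 1/w\<close>, so that
  \<open>d/dw = -u\<^sup>2 d/du\<close> and \<open>Res\<^sub>w\<close> is the coefficient of \<open>u\<close>.\<close>

definition fls_at_inf :: "(int \<Rightarrow> complex) \<Rightarrow> complex fls" where
  "fls_at_inf f = fls_X_inv + fps_to_fls (Abs_fps (\<lambda>n. if n = 0 then 0 else f (- 1 - int n)))"

definition fls_at_inf_deriv :: "complex fls \<Rightarrow> complex fls" where
  "fls_at_inf_deriv h = - (fls_X ^ 2 * fls_deriv h)"

text \<open>\<open>Res\<^sub>w (w\<^bsup>1+m\<^esup> f'(w) / f(w)\<^bsup>2+k\<^esup>)\<close>\<close>

definition G_residue :: "(int \<Rightarrow> complex) \<Rightarrow> int \<Rightarrow> int \<Rightarrow> complex" where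
  "G_residue f m k =
     fls_nth (fls_X_intpow (- (1 + m)) * fls_at_inf_deriv (fls_at_inf f)
              / fls_at_inf f powi (2 + k)) 1"

inductive_set poly_coeffs :: "((int \<Rightarrow> complex) \<Rightarrow> complex) set" where
  const: "(\<lambda>_. c) \<in> poly_coeffs"
| coord: "m \<le> -2 \<Longrightarrow> (\<lambda>f. f m) \<in> poly_coeffs"
| add: "p \<in> poly_coeffs \<Longrightarrow> q \<in> poly_coeffs \<Longrightarrow> (\<lambda>f. p f + q f) \<in> poly_coeffs"
| mult: "p \<in> poly_coeffs \<Longrightarrow> q \<in> poly_coeffs \<Longrightarrow> (\<lambda>f. p f * q f) \<in> poly_coeffs"

text \<open>\<open>G\<close> is a family of representatives of the elements \<open>G\<^sub>f\<close>. The second factor of the product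
  is \<open>\<Sum>\<^bsub>k\<le>m\<^esub> Res\<^sub>w(\<dots>) L\<^sub>k\<close>. The conditions determine each \<open>G f\<close> up to \<^const>\<open>vir_eq\<close>.\<close>

definition is_G :: "((int \<Rightarrow> complex) \<Rightarrow> vir_series) \<Rightarrow> bool" where
  "is_G G \<longleftrightarrow>
     (\<forall>f. G f \<in> vir_series) \<and>
     (\<forall>w. (\<lambda>f. G f w) \<in> poly_coeffs) \<and>
     vir_eq (G (\<lambda>_. 0)) (vir_word []) \<and>
     (\<forall>m\<le>-2. \<forall>f.
        vir_eq (\<lambda>w. deriv (\<lambda>c. G (f(m := c)) w) (f m))
               (\<lambda>w. - vir_mult (G f)
                       (\<lambda>v. case v of [k] \<Rightarrow> (if k \<le> m then G_residue f m k else 0) | _ \<Rightarrow> 0) w))"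

section \<open>Vertex operators and the SLE state\<close>

text \<open>Real powers of nonzero reals; on negative bases \<open>b\<close> selects the branch with
  \<open>arg = (2 b + 1) \<pi>\<close>.\<close>

definition branch_power :: "int \<Rightarrow> real \<Rightarrow> real \<Rightarrow> complex" where
  "branch_power b r p =
     exp (of_real p * (of_real (ln \<bar>r\<bar>) + (if r < 0 then \<i> * of_real (pi * of_int (2 * b + 1)) else 0)))"

definition fock_exp :: "(fock \<Rightarrow> fock) \<Rightarrow> fock \<Rightarrow> fock" where
  "fock_exp E \<phi> = (\<lambda>\<nu>. Sum_any (\<lambda>k. (E ^^ k) \<phi> \<nu> / fact k))"

definition U_minus ::
    "real \<Rightarrow> real \<Rightarrow> nat \<Rightarrow> (nat \<Rightarrow> real) \<Rightarrow> real \<Rightarrow> (nat \<Rightarrow> real) \<Rightarrow> fock \<Rightarrow> fock" where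
  "U_minus \<gamma> \<alpha> M \<alpha>s x y = fock_exp (\<lambda>\<phi> \<nu>. Sum_any (\<lambda>n::nat.
     if n \<ge> 1
     then of_real ((\<alpha> * x ^ n + (\<Sum>K=1..M. \<alpha>s K * y K ^ n)) / real n) * heis \<gamma> (- int n) \<phi> \<nu>
     else 0))"

text \<open>The vector \<open>V\<^bsub>\<alpha>;\<alpha>\<^sub>1,\<dots>,\<alpha>\<^sub>M\<^esub>(x;y\<^sub>1,\<dots>,y\<^sub>M) v\<^sub>0 \<in> \<hat>F\<^sub>\<beta>\<close>, where \<open>\<beta> = \<alpha> + \<alpha>\<^sub>1 + \<dots> + \<alpha>\<^sub>M\<close>.\<close>

definition V_vac :: "int \<Rightarrow> real \<Rightarrow> nat \<Rightarrow> (nat \<Rightarrow> real) \<Rightarrow> real \<Rightarrow> (nat \<Rightarrow> real) \<Rightarrow> fock" where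
  "V_vac b \<alpha> M \<alpha>s x y = (\<lambda>\<nu>.
     (\<Prod>K=1..M. branch_power b (x - y K) (2 * \<alpha> * \<alpha>s K)) *
     (\<Prod>K=1..M. \<Prod>J\<in>{1..<K}. branch_power b (y J - y K) (2 * \<alpha>s J * \<alpha>s K)) *
     U_minus (\<alpha> + (\<Sum>K=1..M. \<alpha>s K)) \<alpha> M \<alpha>s x y fock_vac \<nu>)"

end

theory Submission
  imports Defs
begin

text \<open>Up to a constant, a coefficient of \<open>M\<^sub>t\<close> is a polynomial \<open>p\<close> in \<open>X\<^sub>t\<close>, the \<open>Y\<^sup>K\<^sub>t\<close> and finitely many
  coefficients of \<open>g\<^sub>t\<close>. The vector \<open>U\<^sup>- v\<^sub>\<beta>\<close> satisfies a second order (null vector) equation whose right-hand side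
  is \<open>2 \<Sum>\<^sub>n x\<^sup>n L\<^bsub>-2-n\<^esub> U\<^sup>- v\<^sub>\<beta>\<close>; the Loewner flow acts on \<open>G\<^sub>f\<close> by right multiplication with minus the same
  series, after the change of variables \<open>u = f(w)\<close> in the residues. Hence the generator annihilates \<open>p\<close>.

  As \<open>A\<close> enters the equation of \<open>X\<close> with a constant coefficient, the Ito formula for polynomials follows from a second
  order Taylor expansion along a partition, with error at most \<open>e ((\<Delta>A)\<^sup>2 + \<Delta>Q)\<close> on a step on which \<open>A\<close> and \<open>Q\<close>
  oscillate by at most \<open>e\<close>. Up to the exit time of a bounded region the sums of \<open>(\<Delta>A)\<^sup>2\<close> are bounded in
  \<open>L\<^sup>2\<close>, so that the errors vanish in the limit and \<open>p\<close> is a martingale.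

  The coefficients of \<open>g\<^sub>t\<close> are not assumed to be adapted or to solve any equation. Solving the Loewner equation from high
  points of the imaginary axis and comparing asymptotic expansions identifies them with the solution of a triangular system
  of integral equations driven by \<open>X\<close>.\<close>

section \<open>Graded operators on the Fock space\<close>

text \<open>The SLE data are controlled strictly before \<tau> only, \<tau> need not be announced by
  smaller stopping times, and the filtration need not be complete. Hence a stopped version of M
  cannot be obtained by changing X, Y, g on null sets or by always stopping before \<tau>. It is
  built from A, Q and forces cut off at an exit time. The resulting process is continuous for every
  sample point, adapted once stopped, makes sense at the exit time even if this equals \<tau>, and
  agrees almost surely with the SLE data before it. The exit level consists of A, Q and the inverse
  distances of X from the force points, because these bound the forces and thereby the driving
  function and the coefficients of g. Z is never differentiated: by \<open>V_vac_eq\<close> it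
  divides out up to a phase that depends on the order of the points only, and the null vector
  equation concerns the polynomial state that remains. G is given up to \<open>vir_eq\<close> only,
  so its equations are used after acting on Fock space; this is why the commutators of the L_k are
  computed there first.\<close>

definition fock_linear :: "(fock \<Rightarrow> fock) \<Rightarrow> bool" where
  "fock_linear T \<longleftrightarrow> (\<forall>c \<phi> \<psi>. T (\<lambda>\<nu>. c * \<phi> \<nu> + \<psi> \<nu>) = (\<lambda>\<nu>. c * T \<phi> \<nu> + T \<psi> \<nu>))"

lemma fock_linearD:
  assumes "fock_linear T"
  shows "T (\<lambda>\<nu>. c * \<phi> \<nu> + \<psi> \<nu>) = (\<lambda>\<nu>. c * T \<phi> \<nu> + T \<psi> \<nu>)"
  using assms by (simp add: fock_linear_def)

lemma fock_linear_zero: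
  assumes "fock_linear T"
  shows "T (\<lambda>_. 0) = (\<lambda>_. 0)"
  using fock_linearD[OF assms, of 1 "\<lambda>_. 0" "\<lambda>_. 0"] by (simp add: fun_eq_iff)

lemma fock_linear_add:
  assumes "fock_linear T"
  shows "T (\<lambda>\<nu>. \<phi> \<nu> + \<psi> \<nu>) = (\<lambda>\<nu>. T \<phi> \<nu> + T \<psi> \<nu>)"
  using fock_linearD[OF assms, of 1 \<phi> \<psi>] by simp

lemma fock_linear_scale:
  assumes "fock_linear T"
  shows "T (\<lambda>\<nu>. c * \<phi> \<nu>) = (\<lambda>\<nu>. c * T \<phi> \<nu>)"
  using fock_linearD[OF assms, of c \<phi> "\<lambda>_. 0"] by (simp add: fock_linear_zero[OF assms])

lemma fock_linear_sum:
  assumes "fock_linear T"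
  shows "T (\<lambda>\<nu>. \<Sum>i\<in>I. f i \<nu>) = (\<lambda>\<nu>. \<Sum>i\<in>I. T (f i) \<nu>)"
proof (cases "finite I")
  case True
  then show ?thesis
    by (induction I) (simp_all add: fock_linear_zero[OF assms] fock_linear_add[OF assms])
qed (simp add: fock_linear_zero[OF assms])

lemma fock_linear_heis: "fock_linear (heis \<gamma> n)"
  by (auto simp: fock_linear_def heis_def algebra_simps)

lemmas heis_linear_simps =
  fock_linear_zero[OF fock_linear_heis] fock_linear_add[OF fock_linear_heis]
  fock_linear_scale[OF fock_linear_heis] fock_linear_sum[OF fock_linear_heis]

lemma heis_commutator':
  "heis \<gamma> n (heis \<gamma> m \<phi>) =
     (\<lambda>\<nu>. heis \<gamma> m (heis \<gamma> n \<phi>) \<nu> + (if n + m = 0 then of_int (2 * n) * \<phi> \<nu> else 0))"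
  using heis_commutator[of \<gamma> n m \<phi>] by (auto simp: fun_eq_iff algebra_simps)

lemma heis_commute: "n + m \<noteq> 0 \<Longrightarrow> heis \<gamma> n (heis \<gamma> m \<phi>) = heis \<gamma> m (heis \<gamma> n \<phi>)"
  by (subst heis_commutator') simp

section \<open>Locality of the operators with respect to the degree\<close>

definition mdeg :: "nat multiset \<Rightarrow> int" where
  "mdeg \<nu> = int (sum_mset \<nu>)"

lemma mdeg_nonneg: "mdeg \<nu> \<ge> 0"
  and mdeg_add_mset: "mdeg (add_mset n \<nu>) = int n + mdeg \<nu>"
  by (simp_all add: mdeg_def del: of_nat_sum_mset)

text \<open>Replaces projections to graded pieces: an operator of degree n reads, for a coefficient
  of degree d, only coefficients of degree d + n. The flag restricts this to multisets without 0,
  since adding 0 does not change \<open>mdeg\<close> and only the 0-free multisets of a given degree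
  are finite in number.\<close>

definition agree_at :: "bool \<Rightarrow> int \<Rightarrow> fock \<Rightarrow> fock \<Rightarrow> bool" where
  "agree_at z d \<phi> \<psi> \<longleftrightarrow> (\<forall>\<mu>. (z \<longrightarrow> 0 \<notin># \<mu>) \<longrightarrow> mdeg \<mu> = d \<longrightarrow> \<phi> \<mu> = \<psi> \<mu>)"

lemma agree_at_negative: "d < 0 \<Longrightarrow> agree_at z d \<phi> \<psi>"
  using mdeg_nonneg by (auto simp: agree_at_def simp flip: not_le)

lemma agree_atD:
  "agree_at z d \<phi> \<psi> \<Longrightarrow> (z \<Longrightarrow> 0 \<notin># \<mu>) \<Longrightarrow> mdeg \<mu> = d \<Longrightarrow> \<phi> \<mu> = \<psi> \<mu>"
  by (auto simp: agree_at_def)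

lemma heis_agree_at:
  assumes "agree_at z (d + n) \<phi> \<psi>"
  shows "agree_at z d (heis \<gamma> n \<phi>) (heis \<gamma> n \<psi>)"
  unfolding agree_at_def
proof (intro allI impI)
  fix \<mu> assume z: "z \<longrightarrow> 0 \<notin># \<mu>" and d: "mdeg \<mu> = d"
  consider "n < 0" | "n = 0" | "n > 0" by linarith
  then show "heis \<gamma> n \<phi> \<mu> = heis \<gamma> n \<psi> \<mu>"
  proof cases
    case 1
    show ?thesis
    proof (cases "nat (- n) \<in># \<mu>")
      case True
      then obtain \<mu>' where \<mu>': "\<mu> = add_mset (nat (- n)) \<mu>'"
        by (meson mset_add)
      have "\<phi> \<mu>' = \<psi> \<mu>'"
        using z d 1 by (intro agree_atD[OF assms]) (auto simp: \<mu>' mdeg_add_mset)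
      then show ?thesis
        using 1 by (simp add: heis_def \<mu>')
    qed (use 1 in \<open>simp add: heis_def\<close>)
  next
    case 2
    then show ?thesis
      using agree_atD[OF assms, of \<mu>] z d by (simp add: heis_def)
  next
    case 3
    have "\<phi> (add_mset (nat n) \<mu>) = \<psi> (add_mset (nat n) \<mu>)"
      using z d 3 by (intro agree_atD[OF assms]) (auto simp: mdeg_add_mset)
    then show ?thesis
      using 3 by (simp add: heis_def)
  qed
qed

section \<open>The operators L_k as locally finite sums\<close>

text \<open>Normal ordering only matters between a_j and a_{-j}, and these do not meet in L_k for k
  nonzero.\<close>

lemma heis_ordered_eq:
  "k \<noteq> 0 \<Longrightarrow> heis_ordered \<gamma> (k - j) j \<phi> = heis \<gamma> (k - j) (heis \<gamma> j \<phi>)"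
  by (auto simp: heis_ordered_def intro: heis_commute)

lemma vir_L_agree_at:
  assumes "agree_at z (d + k) \<phi> \<psi>" "k \<noteq> 0"
  shows "agree_at z d (vir_L \<kappa> \<gamma> k \<phi>) (vir_L \<kappa> \<gamma> k \<psi>)"
proof -
  have "agree_at z d (heis \<gamma> (k - j) (heis \<gamma> j \<phi>)) (heis \<gamma> (k - j) (heis \<gamma> j \<psi>))" for j
    using assms(1) by (intro heis_agree_at) simp
  moreover have "agree_at z d (heis \<gamma> k \<phi>) (heis \<gamma> k \<psi>)"
    by (intro heis_agree_at assms)
  ultimately show ?thesis
    unfolding agree_at_def vir_L_def heis_ordered_eq[OF assms(2)] by simp
qed

lemma heis_vanishes:
  assumes "mdeg \<nu> + n < 0"
  shows "heis \<gamma> n \<phi> \<nu> = 0"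
  using agree_atD[OF heis_agree_at[OF agree_at_negative[OF assms]], of False \<nu> \<gamma> \<phi> "\<lambda>_. 0"]
  by (simp add: heis_linear_simps)

text \<open>For j above the first bound the outer factor reads a coefficient of negative degree;
  below the second bound the same happens after exchanging the two factors. Hence only a window of j
  around 0 contributes.\<close>

lemma heis_heis_vanishes:
  assumes "k < 0" "j > mdeg \<nu> - k \<or> j < - mdeg \<nu> + k"
  shows "heis \<gamma> (k - j) (heis \<gamma> j \<phi>) \<nu> = 0"
  using assms(2)
proof
  assume "j > mdeg \<nu> - k"
  then show ?thesis
    using assms(1) by (intro heis_vanishes) simp
next
  assume "j < - mdeg \<nu> + k"
  then have "heis \<gamma> j (heis \<gamma> (k - j) \<phi>) \<nu> = 0"
    using assms(1) by (intro heis_vanishes) simp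
  then show ?thesis
    using assms(1) by (subst heis_commute) auto
qed

text \<open>The window may be any sufficiently large one: computations with several operators use
  one common B with room for all index shifts.\<close>

lemma vir_L_eq_sum:
  assumes "k < 0" "B \<ge> mdeg \<nu> - k"
  shows "vir_L \<kappa> \<gamma> k \<phi> \<nu> = (\<Sum>j\<in>{-B..B}. heis \<gamma> (k - j) (heis \<gamma> j \<phi>) \<nu>) / 4
     - of_real (alpha0 \<kappa> * of_int (k + 1)) * heis \<gamma> k \<phi> \<nu>"
proof -
  have "Sum_any (\<lambda>j. heis_ordered \<gamma> (k - j) j \<phi> \<nu>) = (\<Sum>j\<in>{-B..B}. heis_ordered \<gamma> (k - j) j \<phi> \<nu>)"
  proof (rule Sum_any.expand_superset)
    show "{j. heis_ordered \<gamma> (k - j) j \<phi> \<nu> \<noteq> 0} \<subseteq> {-B..B}"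
    proof (rule subsetI, rule ccontr)
      fix j assume j: "j \<in> {j. heis_ordered \<gamma> (k - j) j \<phi> \<nu> \<noteq> 0}" "j \<notin> {-B..B}"
      then have "j > mdeg \<nu> - k \<or> j < - mdeg \<nu> + k"
        using assms(2) by auto
      from heis_heis_vanishes[OF assms(1) this] j(1) show False
        using assms(1) by (simp add: heis_ordered_eq)
    qed
  qed simp
  then show ?thesis
    using assms(1) by (simp add: vir_L_def heis_ordered_eq)
qed

lemma fock_linear_vir_L:
  assumes "k < 0"
  shows "fock_linear (vir_L \<kappa> \<gamma> k)"
  unfolding fock_linear_def
proof (intro allI ext)
  fix c \<phi> \<psi> \<nu>
  show "vir_L \<kappa> \<gamma> k (\<lambda>\<nu>. c * \<phi> \<nu> + \<psi> \<nu>) \<nu> = c * vir_L \<kappa> \<gamma> k \<phi> \<nu> + vir_L \<kappa> \<gamma> k \<psi> \<nu>"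
    unfolding vir_L_eq_sum[OF assms order_refl]
    by (simp add: heis_linear_simps sum.distrib sum_distrib_left[symmetric] algebra_simps
        add_divide_distrib)
qed

lemma fock_linear_foldr:
  assumes "\<And>k. k \<in> set w \<Longrightarrow> fock_linear (T k)"
  shows "fock_linear (foldr T w)"
  using assms
proof (induction w)
  case Nil
  then show ?case by (simp add: fock_linear_def)
next
  case (Cons k w)
  then have "fock_linear (foldr T w)" "fock_linear (T k)" by auto
  then show ?case
    by (simp add: fock_linear_def)
qed

lemma fock_linear_vir_word:
  assumes "\<And>k. k \<in> set w \<Longrightarrow> k < 0"
  shows "fock_linear (foldr (vir_L \<kappa> \<gamma>) w)"
  by (rule fock_linear_foldr) (use assms fock_linear_vir_L in auto)

lemma vir_word_agree_at:
  assumes "\<And>k. k \<in> set w \<Longrightarrow> k < 0" "agree_at z (d + sum_list w) \<phi> \<psi>"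
  shows "agree_at z d (foldr (vir_L \<kappa> \<gamma>) w \<phi>) (foldr (vir_L \<kappa> \<gamma>) w \<psi>)"
  using assms
proof (induction w arbitrary: d)
  case (Cons k w)
  then have "agree_at z (d + k) (foldr (vir_L \<kappa> \<gamma>) w \<phi>) (foldr (vir_L \<kappa> \<gamma>) w \<psi>)"
    by (simp add: add.assoc)
  then show ?case
    using Cons.prems(1)[of k] by (auto intro!: vir_L_agree_at)
qed simp

lemma vir_word_vanishes:
  assumes "\<And>k. k \<in> set w \<Longrightarrow> k < 0" "mdeg \<nu> + sum_list w < 0"
  shows "foldr (vir_L \<kappa> \<gamma>) w \<phi> \<nu> = 0"
proof -
  have "agree_at False (mdeg \<nu>) (foldr (vir_L \<kappa> \<gamma>) w \<phi>) (foldr (vir_L \<kappa> \<gamma>) w (\<lambda>_. 0))"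
    by (rule vir_word_agree_at[OF assms(1) agree_at_negative[OF assms(2)]])
  then show ?thesis
    by (auto dest!: agree_atD[where \<mu> = \<nu>] simp: fock_linear_zero[OF fock_linear_vir_word[OF assms(1)]])
qed

definition vir_words :: "int \<Rightarrow> int list set" where
  "vir_words N = {w. (\<forall>k\<in>set w. k < 0) \<and> - sum_list w \<le> N}"

text \<open>Every letter is at most -1, so minus the sum bounds both the length of a word and the
  size of its letters.\<close>

lemma finite_vir_words: "finite (vir_words N)"
proof (rule finite_subset)
  have "(\<forall>k\<in>set w. k < 0) \<Longrightarrow> set w \<subseteq> {sum_list w..-1} \<and> int (length w) \<le> - sum_list w" for w :: "int list"
  proof (induction w)
    case (Cons k w)
    then have "set w \<subseteq> {sum_list w..-1}" "int (length w) \<le> - sum_list w" "k < 0" by auto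
    then show ?case by force
  qed simp
  then show "vir_words N \<subseteq> {w. set w \<subseteq> {-N..-1} \<and> length w \<le> nat N}"
    unfolding vir_words_def by fastforce
  show "finite {w. set w \<subseteq> {-N..-1} \<and> length w \<le> nat N}"
    by (rule finite_lists_length_le) simp
qed

lemma vir_action_eq_sum:
  assumes "u \<in> vir_series" "mdeg \<nu> \<le> N"
  shows "vir_action \<kappa> \<gamma> u \<phi> \<nu> = (\<Sum>w\<in>vir_words N. u w * foldr (vir_L \<kappa> \<gamma>) w \<phi> \<nu>)"
  unfolding vir_action_def
proof (rule Sum_any.expand_superset[OF finite_vir_words], rule subsetI, rule ccontr)
  fix w assume w: "w \<in> {w. u w * foldr (vir_L \<kappa> \<gamma>) w \<phi> \<nu> \<noteq> 0}" "w \<notin> vir_words N"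
  then have "\<forall>k\<in>set w. k < 0"
    using assms(1) by (auto simp: vir_series_def)
  with w vir_word_vanishes[of w \<nu> \<kappa> \<gamma> \<phi>] assms(2) show False
    by (force simp: vir_words_def)
qed

section \<open>Commutation relations on Fock space\<close>

text \<open>Each of the two Heisenberg factors in the terms of L_j contributes one half of - n
  a_{n+j}. The scalar comes from commuting a_n with the background charge term, the multiple of a_j
  in L_j.\<close>

lemma vir_L_heis:
  assumes "j < 0"
  shows "vir_L \<kappa> \<gamma> j (heis \<gamma> n \<phi>) = (\<lambda>\<nu>. heis \<gamma> n (vir_L \<kappa> \<gamma> j \<phi>) \<nu> - of_int n * heis \<gamma> (n + j) \<phi> \<nu>
     - (if j + n = 0 then of_real (2 * alpha0 \<kappa> * of_int (j * (j + 1))) * \<phi> \<nu> else 0))"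
proof
  fix \<nu>
  \<comment> \<open>Large enough for \<open>T\<close> to represent L_j at all degrees up to mdeg
    \<nu> + |n|, which a_n can reach, and to contain the two exceptional indices - n and j +
    n.\<close>
  define B where "B = mdeg \<nu> + 2 * \<bar>n\<bar> - 2 * j"
  define c where "c = complex_of_real (alpha0 \<kappa> * of_int (j + 1))"
  define T where "T = (\<lambda>\<phi> \<nu>. (\<Sum>i\<in>{-B..B}. heis \<gamma> (j - i) (heis \<gamma> i \<phi>) \<nu>) / 4 - c * heis \<gamma> j \<phi> \<nu>)"
  have T: "vir_L \<kappa> \<gamma> j \<phi> \<mu> = T \<phi> \<mu>" if "mdeg \<mu> \<le> mdeg \<nu> + \<bar>n\<bar>" for \<phi> \<mu>
    unfolding T_def c_def using that assms by (intro vir_L_eq_sum) (auto simp: B_def)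
  have lin: "heis \<gamma> n (T \<phi>) \<nu> =
      (\<Sum>i\<in>{-B..B}. heis \<gamma> n (heis \<gamma> (j - i) (heis \<gamma> i \<phi>)) \<nu>) / 4 - c * heis \<gamma> n (heis \<gamma> j \<phi>) \<nu>"
  proof -
    have "T \<phi> = (\<lambda>\<nu>. (1/4) * (\<Sum>i\<in>{-B..B}. heis \<gamma> (j - i) (heis \<gamma> i \<phi>) \<nu>) + (- c) * heis \<gamma> j \<phi> \<nu>)"
      by (simp add: T_def)
    then show ?thesis
      by (simp only: heis_linear_simps) simp
  qed
  have 1: "heis \<gamma> n (vir_L \<kappa> \<gamma> j \<phi>) \<nu> = heis \<gamma> n (T \<phi>) \<nu>"
  proof (rule agree_atD[of False "mdeg \<nu>"])
    show "agree_at False (mdeg \<nu>) (heis \<gamma> n (vir_L \<kappa> \<gamma> j \<phi>)) (heis \<gamma> n (T \<phi>))"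
      by (rule heis_agree_at) (auto simp: agree_at_def T)
  qed auto
  have trm: "heis \<gamma> (j - i) (heis \<gamma> i (heis \<gamma> n \<phi>)) \<nu> = heis \<gamma> n (heis \<gamma> (j - i) (heis \<gamma> i \<phi>)) \<nu>
      + (if i = - n then - of_int (2 * n) * heis \<gamma> (n + j) \<phi> \<nu> else 0)
      + (if i = j + n then - of_int (2 * n) * heis \<gamma> (n + j) \<phi> \<nu> else 0)" for i
  proof -
    have a: "heis \<gamma> i (heis \<gamma> n \<phi>) = (\<lambda>\<nu>. (if i + n = 0 then of_int (2 * i) else 0) * \<phi> \<nu> + heis \<gamma> n (heis \<gamma> i \<phi>) \<nu>)"
      by (subst heis_commutator') auto
    have b: "heis \<gamma> (j - i) (heis \<gamma> n \<psi>) = (\<lambda>\<nu>. (if j - i + n = 0 then of_int (2 * (j - i)) else 0) * \<psi> \<nu> + heis \<gamma> n (heis \<gamma> (j - i) \<psi>) \<nu>)" for \<psi>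
      by (subst heis_commutator') auto
    have "heis \<gamma> (j - i) (heis \<gamma> i (heis \<gamma> n \<phi>)) \<nu> = (if i + n = 0 then of_int (2 * i) else 0) * heis \<gamma> (j - i) \<phi> \<nu> +
        ((if j - i + n = 0 then of_int (2 * (j - i)) else 0) * heis \<gamma> i \<phi> \<nu> + heis \<gamma> n (heis \<gamma> (j - i) (heis \<gamma> i \<phi>)) \<nu>)"
      by (simp only: a heis_linear_simps b)
    moreover have "(if i + n = 0 then of_int (2 * i) else 0) * heis \<gamma> (j - i) \<phi> \<nu>
        = (if i = - n then - of_int (2 * n) * heis \<gamma> (n + j) \<phi> \<nu> else 0)"
      by (cases "i = - n") (auto simp: add.commute)
    moreover have "(if j - i + n = 0 then of_int (2 * (j - i)) else 0) * heis \<gamma> i \<phi> \<nu>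
        = (if i = j + n then - of_int (2 * n) * heis \<gamma> (n + j) \<phi> \<nu> else 0)"
      by (auto simp: add.commute algebra_simps)
    ultimately show ?thesis by simp
  qed
  have in_range: "- n \<in> {-B..B}" "j + n \<in> {-B..B}"
    using assms mdeg_nonneg[of \<nu>] by (auto simp: B_def)
  have sum: "(\<Sum>i\<in>{-B..B}. heis \<gamma> (j - i) (heis \<gamma> i (heis \<gamma> n \<phi>)) \<nu>)
      = (\<Sum>i\<in>{-B..B}. heis \<gamma> n (heis \<gamma> (j - i) (heis \<gamma> i \<phi>)) \<nu>) - of_int (4 * n) * heis \<gamma> (n + j) \<phi> \<nu>"
    using in_range by (simp add: trm sum.distrib sum.delta)
  have comm: "heis \<gamma> j (heis \<gamma> n \<phi>) \<nu> = heis \<gamma> n (heis \<gamma> j \<phi>) \<nu> + (if j + n = 0 then of_int (2 * j) * \<phi> \<nu> else 0)"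
    by (subst heis_commutator') simp
  have "vir_L \<kappa> \<gamma> j (heis \<gamma> n \<phi>) \<nu> = T (heis \<gamma> n \<phi>) \<nu>"
    by (rule T) simp
  also have "\<dots> = heis \<gamma> n (T \<phi>) \<nu> - of_int n * heis \<gamma> (n + j) \<phi> \<nu>
      - c * (if j + n = 0 then of_int (2 * j) * \<phi> \<nu> else 0)"
    unfolding lin unfolding T_def sum comm by (simp add: field_simps)
  also have "c * (if j + n = 0 then of_int (2 * j) * \<phi> \<nu> else 0) =
      (if j + n = 0 then of_real (2 * alpha0 \<kappa> * of_int (j * (j + 1))) * \<phi> \<nu> else 0)"
    by (simp add: c_def algebra_simps)
  finally show "vir_L \<kappa> \<gamma> j (heis \<gamma> n \<phi>) \<nu> = heis \<gamma> n (vir_L \<kappa> \<gamma> j \<phi>) \<nu> - of_int n * heis \<gamma> (n + j) \<phi> \<nu>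
     - (if j + n = 0 then of_real (2 * alpha0 \<kappa> * of_int (j * (j + 1))) * \<phi> \<nu> else 0)"
    by (simp add: 1)
qed

text \<open>No central term appears, as j + k < 0. L_k is replaced by its finite sum of Heisenberg
  pairs and L_j is moved through each pair by \<open>vir_L_heis\<close>; after an index shift the
  coefficients linear in the summation index cancel and leave j - k.\<close>

lemma vir_L_commutator:
  assumes "j < 0" "k < 0"
  shows "vir_L \<kappa> \<gamma> j (vir_L \<kappa> \<gamma> k \<phi>) =
    (\<lambda>\<nu>. vir_L \<kappa> \<gamma> k (vir_L \<kappa> \<gamma> j \<phi>) \<nu> + of_int (j - k) * vir_L \<kappa> \<gamma> (j + k) \<phi> \<nu>)"
proof
  fix \<nu>
  define B where "B = mdeg \<nu> - 2 * j - 2 * k"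
  define c where "c = (\<lambda>k. complex_of_real (alpha0 \<kappa> * of_int (k + 1)))"
  note lin = fock_linear_add[OF fock_linear_vir_L[OF assms(1)]] fock_linear_scale[OF fock_linear_vir_L[OF assms(1)]]
    fock_linear_sum[OF fock_linear_vir_L[OF assms(1)]]
  define T where "T = (\<lambda>\<phi> \<nu>. (1/4) * (\<Sum>i\<in>{-B..B}. heis \<gamma> (k - i) (heis \<gamma> i \<phi>) \<nu>) + (- c k) * heis \<gamma> k \<phi> \<nu>)"
  have T: "vir_L \<kappa> \<gamma> k \<phi> \<mu> = T \<phi> \<mu>" if "mdeg \<mu> \<le> mdeg \<nu>" for \<phi> \<mu>
  proof -
    have "mdeg \<mu> - k \<le> B" using that assms by (auto simp: B_def)
    from vir_L_eq_sum[OF assms(2) this] show ?thesis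
      unfolding T_def c_def by simp
  qed
  have 1: "vir_L \<kappa> \<gamma> j (vir_L \<kappa> \<gamma> k \<phi>) \<nu> = vir_L \<kappa> \<gamma> j (T \<phi>) \<nu>"
  proof (rule agree_atD[of False "mdeg \<nu>"])
    show "agree_at False (mdeg \<nu>) (vir_L \<kappa> \<gamma> j (vir_L \<kappa> \<gamma> k \<phi>)) (vir_L \<kappa> \<gamma> j (T \<phi>))"
      by (rule vir_L_agree_at) (use assms in \<open>auto simp: agree_at_def T\<close>)
  qed auto
  define h where "h = (\<lambda>i. heis \<gamma> (j + k - i) (heis \<gamma> i \<phi>) \<nu>)"
  define e where "e = complex_of_real (2 * alpha0 \<kappa> * of_int (j * (j + 1)))"
  have two: "vir_L \<kappa> \<gamma> j (heis \<gamma> (k - i) (heis \<gamma> i \<phi>)) \<nu> = heis \<gamma> (k - i) (heis \<gamma> i (vir_L \<kappa> \<gamma> j \<phi>)) \<nu>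
     - of_int (k - i) * h i - of_int i * h (i + j)
     - (if i = j + k then e * heis \<gamma> (j + k) \<phi> \<nu> else 0) - (if i = - j then e * heis \<gamma> (j + k) \<phi> \<nu> else 0)" for i
  proof -
    have eq: "vir_L \<kappa> \<gamma> j (heis \<gamma> i \<phi>) = (\<lambda>\<nu>. (heis \<gamma> i (vir_L \<kappa> \<gamma> j \<phi>) \<nu> + (- of_int i) * heis \<gamma> (i + j) \<phi> \<nu>)
       + (- (if j + i = 0 then e else 0)) * \<phi> \<nu>)"
      unfolding vir_L_heis[OF assms(1)] e_def by auto
    have "heis \<gamma> (k - i) (vir_L \<kappa> \<gamma> j (heis \<gamma> i \<phi>)) \<nu> = heis \<gamma> (k - i) (heis \<gamma> i (vir_L \<kappa> \<gamma> j \<phi>)) \<nu>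
       - of_int i * heis \<gamma> (k - i) (heis \<gamma> (i + j) \<phi>) \<nu> - (if j + i = 0 then e else 0) * heis \<gamma> (k - i) \<phi> \<nu>"
      unfolding eq heis_linear_simps by simp
    moreover have "(if j + i = 0 then e else 0) * heis \<gamma> (k - i) \<phi> \<nu> = (if i = - j then e * heis \<gamma> (j + k) \<phi> \<nu> else 0)"
      by (cases "i = - j") (auto simp: add.commute)
    moreover have "heis \<gamma> (k - i) (heis \<gamma> (i + j) \<phi>) \<nu> = h (i + j)"
      by (simp add: h_def algebra_simps)
    moreover have "(if j + (k - i) = 0 then e * heis \<gamma> i \<phi> \<nu> else 0) = (if i = j + k then e * heis \<gamma> (j + k) \<phi> \<nu> else 0)"
      by auto
    moreover have "heis \<gamma> (k - i + j) (heis \<gamma> i \<phi>) \<nu> = h i"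
      by (simp add: h_def algebra_simps)
    ultimately show ?thesis
      unfolding vir_L_heis[OF assms(1), of \<kappa> \<gamma> "k - i"] e_def by simp
  qed
  have h0: "h i = 0" if "i > mdeg \<nu> - j - k \<or> i < - mdeg \<nu> + j + k" for i
    using heis_heis_vanishes[of "j + k" \<nu> i \<gamma> \<phi>] that assms by (auto simp: h_def)
  \<comment> \<open>The shifted window differs from the original one only in indices at which h
    vanishes.\<close>
  have shift: "(\<Sum>i\<in>{-B..B}. of_int i * h (i + j)) = (\<Sum>i\<in>{-B..B}. of_int (i - j) * h i)"
  proof -
    have "(\<Sum>i\<in>{-B..B}. of_int i * h (i + j)) = (\<Sum>i\<in>{-B+j..B+j}. of_int (i - j) * h i)"
      by (rule sum.reindex_bij_witness[of _ "\<lambda>i. i - j" "\<lambda>i. i + j"]) auto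
    also have "\<dots> = (\<Sum>i\<in>{-B+j..B}. of_int (i - j) * h i)"
      using assms by (intro sum.mono_neutral_left) (auto simp: B_def intro!: h0)
    also have "\<dots> = (\<Sum>i\<in>{-B..B}. of_int (i - j) * h i)"
      using assms by (intro sum.mono_neutral_right) (auto simp: B_def intro!: h0)
    finally show ?thesis .
  qed
  have in_range: "j + k \<in> {-B..B}" "- j \<in> {-B..B}"
    using assms mdeg_nonneg[of \<nu>] by (auto simp: B_def)
  have sum: "(\<Sum>i\<in>{-B..B}. vir_L \<kappa> \<gamma> j (heis \<gamma> (k - i) (heis \<gamma> i \<phi>)) \<nu>)
      = (\<Sum>i\<in>{-B..B}. heis \<gamma> (k - i) (heis \<gamma> i (vir_L \<kappa> \<gamma> j \<phi>)) \<nu>) + of_int (j - k) * (\<Sum>i\<in>{-B..B}. h i)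
        - 2 * e * heis \<gamma> (j + k) \<phi> \<nu>"
    unfolding two sum_subtractf sum.delta[OF finite_atLeastAtMost_int] shift using in_range
    by (simp add: algebra_simps sum.distrib sum_subtractf sum_distrib_left)
  have lk: "vir_L \<kappa> \<gamma> j (heis \<gamma> k \<phi>) \<nu> = heis \<gamma> k (vir_L \<kappa> \<gamma> j \<phi>) \<nu> - of_int k * heis \<gamma> (j + k) \<phi> \<nu>"
    using assms by (subst vir_L_heis) (auto simp: add.commute)
  have jk: "vir_L \<kappa> \<gamma> (j + k) \<phi> \<nu> = (\<Sum>i\<in>{-B..B}. h i) / 4 - c (j + k) * heis \<gamma> (j + k) \<phi> \<nu>"
    unfolding h_def c_def using assms by (intro vir_L_eq_sum) (auto simp: B_def)
  have "vir_L \<kappa> \<gamma> j (T \<phi>) \<nu> = (1/4) * (\<Sum>i\<in>{-B..B}. vir_L \<kappa> \<gamma> j (heis \<gamma> (k - i) (heis \<gamma> i \<phi>)) \<nu>)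
      + (- c k) * vir_L \<kappa> \<gamma> j (heis \<gamma> k \<phi>) \<nu>"
    unfolding T_def by (simp only: lin)
  also have "\<dots> = T (vir_L \<kappa> \<gamma> j \<phi>) \<nu> + of_int (j - k) * (\<Sum>i\<in>{-B..B}. h i) / 4
      - (e / 2 - c k * of_int k) * heis \<gamma> (j + k) \<phi> \<nu>"
  proof -
    have alg: "(1/4) * (a + d * s - 2 * e * h) + (- c) * (b - k * h)
        = ((1/4) * a + (- c) * b) + d * s / 4 - (e / 2 - c * k) * h" for a b c d e h k s :: complex
    proof -
      have "e / 2 = 2 * (e/4)" "d * s / 4 = d * (s/4)" by simp_all
      moreover have "(1/4) * (a + d * s - 2 * e * h) = a/4 + d * (s/4) - 2 * (e/4) * h"
        by (simp add: add_divide_distrib diff_divide_distrib)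
      ultimately show ?thesis by (simp add: algebra_simps)
    qed
    show ?thesis
      unfolding sum lk T_def by (rule alg)
  qed
  \<comment> \<open>The charge terms match because j (j + 1) - k (k + 1) = (j - k) (j + k +
    1).\<close>
  also have "e / 2 - c k * of_int k = of_int (j - k) * c (j + k)"
  proof -
    have "2 * alpha0 \<kappa> * of_int (j * (j + 1)) / 2 - alpha0 \<kappa> * of_int (k + 1) * of_int k
        = of_int (j - k) * (alpha0 \<kappa> * of_int (j + k + 1))"
      by (simp add: algebra_simps)
    from arg_cong[OF this, of complex_of_real] show ?thesis
      unfolding e_def c_def by simp
  qed
  finally show "vir_L \<kappa> \<gamma> j (vir_L \<kappa> \<gamma> k \<phi>) \<nu> =
     vir_L \<kappa> \<gamma> k (vir_L \<kappa> \<gamma> j \<phi>) \<nu> + of_int (j - k) * vir_L \<kappa> \<gamma> (j + k) \<phi> \<nu>"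
    unfolding 1 jk T[OF order_refl] by (simp add: algebra_simps)
qed

section \<open>The action of the completed enveloping algebra\<close>

lemma vir_action_word: "vir_action \<kappa> \<gamma> (vir_word v) \<phi> \<nu> = foldr (vir_L \<kappa> \<gamma>) v \<phi> \<nu>"
proof -
  have "Sum_any (\<lambda>w. vir_word v w * foldr (vir_L \<kappa> \<gamma>) w \<phi> \<nu>)
      = (\<Sum>w\<in>{v}. vir_word v w * foldr (vir_L \<kappa> \<gamma>) w \<phi> \<nu>)"
    by (rule Sum_any.expand_superset) (auto simp: vir_word_def)
  then show ?thesis by (simp add: vir_action_def vir_word_def)
qed

lemma vir_action_zero: "vir_action \<kappa> \<gamma> (\<lambda>_. 0) \<phi> \<nu> = 0"
  by (simp add: vir_action_def)

lemma vir_series_add: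
  assumes "u \<in> vir_series" "v \<in> vir_series"
  shows "(\<lambda>w. u w + c * v w) \<in> vir_series"
  using assms unfolding vir_series_def by (auto, metis add_0 mult_zero_right)

lemma vir_action_add:
  assumes "u \<in> vir_series" "v \<in> vir_series"
  shows "vir_action \<kappa> \<gamma> (\<lambda>w. u w + c * v w) \<phi> \<nu> = vir_action \<kappa> \<gamma> u \<phi> \<nu> + c * vir_action \<kappa> \<gamma> v \<phi> \<nu>"
proof -
  have "(\<lambda>w. u w + c * v w) \<in> vir_series"
    by (rule vir_series_add[OF assms])
  then show ?thesis
    using assms by (simp add: vir_action_eq_sum[OF _ order_refl] sum.distrib sum_distrib_left algebra_simps)
qed

lemma vir_word_in_series: "(\<And>k. k \<in> set w \<Longrightarrow> k < 0) \<Longrightarrow> vir_word w \<in> vir_series"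
  by (auto simp: vir_word_def vir_series_def)

lemma vir_action_relation:
  assumes "j < 0" "k < 0" "\<forall>i\<in>set p \<union> set q. i < 0"
  shows "foldr (vir_L \<kappa> \<gamma>) (p @ [j, k] @ q) \<phi> \<nu> - foldr (vir_L \<kappa> \<gamma>) (p @ [k, j] @ q) \<phi> \<nu>
    - of_int (j - k) * foldr (vir_L \<kappa> \<gamma>) (p @ [j + k] @ q) \<phi> \<nu> = 0"
proof -
  define \<psi> where "\<psi> = foldr (vir_L \<kappa> \<gamma>) q \<phi>"
  have p: "fock_linear (foldr (vir_L \<kappa> \<gamma>) p)"
    using assms by (intro fock_linear_vir_word) auto
  show ?thesis
    by (simp add: \<psi>_def[symmetric] vir_L_commutator[OF assms(1,2), of \<kappa> \<gamma> \<psi>]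
        fock_linear_add[OF p] fock_linear_scale[OF p])
qed

text \<open>Membership in \<open>vir_series\<close> is carried along in the induction because
  additivity of the action goes through the finite sums of \<open>vir_action_eq_sum\<close>, which
  concern series in negative letters.\<close>

lemma vir_relations_action:
  assumes "r \<in> vir_relations"
  shows "r \<in> vir_series \<and> vir_action \<kappa> \<gamma> r \<phi> \<nu> = 0"
  using assms
proof induction
  case zero
  then show ?case by (simp add: vir_action_zero vir_series_def)
next
  case (add u j k p q c)
  define w1 w2 w3 where "w1 = vir_word (p @ [j, k] @ q)" and "w2 = vir_word (p @ [k, j] @ q)"
    and "w3 = vir_word (p @ [j + k] @ q)"
  have ser: "w1 \<in> vir_series" "w2 \<in> vir_series" "w3 \<in> vir_series"
    unfolding w1_def w2_def w3_def using add.hyps by (auto intro!: vir_word_in_series)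
  define e where "e = (\<lambda>w. (w1 w + (-1) * w2 w) + (- of_int (j - k)) * w3 w)"
  have s12: "(\<lambda>w. w1 w + (-1) * w2 w) \<in> vir_series"
    by (rule vir_series_add[OF ser(1,2)])
  have e: "e \<in> vir_series"
    unfolding e_def by (rule vir_series_add[OF s12 ser(3)])
  have ue: "(\<lambda>w. u w + c * e w) \<in> vir_series"
    by (rule vir_series_add[OF conjunct1[OF add.IH] e])
  note ser' = s12 e ue
  have eq: "(\<lambda>w. u w + c * (w1 w - w2 w - of_int (j - k) * w3 w)) = (\<lambda>w. u w + c * e w)"
    by (simp add: e_def algebra_simps)
  have "vir_action \<kappa> \<gamma> e \<phi> \<nu> = 0"
    unfolding e_def vir_action_add[OF ser'(1) ser(3)] vir_action_add[OF ser(1,2)]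
    using vir_action_relation[OF add.hyps(2-4), of \<kappa> \<gamma> \<phi> \<nu>]
    unfolding w1_def w2_def w3_def vir_action_word
    by (rule_tac back_subst[of "\<lambda>x. x = 0"]) (assumption, simp only: mult_minus_left mult_1_left add_uminus_conv_diff)
  then show ?case
    using add.IH ser' unfolding w1_def[symmetric] w2_def[symmetric] w3_def[symmetric] eq
    by (simp add: vir_action_add)
qed

text \<open>The difference of u and v is a finite combination of relations in each degree, not as a
  whole. The action at \<nu> involves finitely many degrees, so the slices from - mdeg \<nu> to 0
  are treated separately and added up.\<close>

lemma vir_eq_action:
  assumes "vir_eq u v" "u \<in> vir_series" "v \<in> vir_series"
  shows "vir_action \<kappa> \<gamma> u \<phi> \<nu> = vir_action \<kappa> \<gamma> v \<phi> \<nu>"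
proof -
  define L where "L = (\<lambda>w. foldr (vir_L \<kappa> \<gamma>) w \<phi> \<nu>)"
  define N where "N = mdeg \<nu>"
  define r where "r = (\<lambda>d w. if sum_list w = d then u w - v w else 0)"
  have sl: "sum_list ` vir_words N \<subseteq> {-N..0}"
  proof -
    have "(\<forall>k\<in>set w. k < 0) \<Longrightarrow> sum_list w \<le> 0" for w :: "int list"
      by (induction w) auto
    then show ?thesis by (auto simp: vir_words_def)
  qed
  have "vir_action \<kappa> \<gamma> (r d) \<phi> \<nu> = 0 \<and> r d \<in> vir_series" for d
    using assms(1) vir_relations_action unfolding vir_eq_def r_def by blast
  then have "(\<Sum>w\<in>vir_words N. r d w * L w) = 0" for d
    using vir_action_eq_sum[of "r d" \<nu> N \<kappa> \<gamma> \<phi>] unfolding L_def N_def by auto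
  then have "0 = (\<Sum>d\<in>{-N..0}. \<Sum>w\<in>vir_words N. r d w * L w)"
    by simp
  also have "\<dots> = (\<Sum>w\<in>vir_words N. \<Sum>d\<in>{-N..0}. r d w * L w)"
    by (rule sum.swap)
  also have "\<dots> = (\<Sum>w\<in>vir_words N. (u w - v w) * L w)"
  proof (rule sum.cong[OF refl])
    fix w assume "w \<in> vir_words N"
    with sl have "sum_list w \<in> {-N..0}" by auto
    then show "(\<Sum>d\<in>{-N..0}. r d w * L w) = (u w - v w) * L w"
      by (simp add: r_def if_distrib[of "\<lambda>x. x * _"] cong: if_cong)
  qed
  finally show ?thesis
    using assms(2,3) unfolding L_def N_def
    by (simp add: vir_action_eq_sum[OF _ order_refl] left_diff_distrib sum_subtractf)
qed

text \<open>From here on the right factor r is a combination of single letters; of all splittings in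
  the concatenation product only the one that detaches the last letter survives.\<close>

lemma vir_mult_single_Nil:
  assumes "\<And>w. length w \<noteq> 1 \<Longrightarrow> r w = 0"
  shows "vir_mult u r [] = 0"
  using assms by (simp add: vir_mult_def)

lemma vir_mult_single_snoc:
  assumes "\<And>w. length w \<noteq> 1 \<Longrightarrow> r w = 0"
  shows "vir_mult u r (v @ [k]) = u v * r [k]"
proof -
  have "vir_mult u r (v @ [k]) = (\<Sum>i\<in>{length v}. u (take i (v @ [k])) * r (drop i (v @ [k])))"
    unfolding vir_mult_def by (rule sum.mono_neutral_right) (auto intro!: assms)
  then show ?thesis by simp
qed

lemma vir_mult_single_series:
  assumes "u \<in> vir_series" "r \<in> vir_series" "\<And>w. length w \<noteq> 1 \<Longrightarrow> r w = 0"
  shows "vir_mult u r \<in> vir_series"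
  unfolding vir_series_def
proof (intro CollectI allI impI)
  fix w assume "vir_mult u r w \<noteq> 0"
  then show "\<forall>k\<in>set w. k < 0"
    using assms(1,2) by (cases w rule: rev_cases)
      (auto simp: vir_mult_single_Nil[OF assms(3)] vir_mult_single_snoc[OF assms(3)] vir_series_def)
qed

text \<open>The last letter of a word acts first, so the right factor is applied to \<phi> before
  u.\<close>

lemma vir_action_mult_single:
  assumes "u \<in> vir_series" "r \<in> vir_series" "\<And>w. length w \<noteq> 1 \<Longrightarrow> r w = 0" "mdeg \<nu> \<le> N"
  shows "vir_action \<kappa> \<gamma> (vir_mult u r) \<phi> \<nu> = (\<Sum>k\<in>{-N..-1}. r [k] * vir_action \<kappa> \<gamma> u (vir_L \<kappa> \<gamma> k \<phi>) \<nu>)"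
proof -
  define L where "L = (\<lambda>w. foldr (vir_L \<kappa> \<gamma>) w \<phi> \<nu>)"
  define S where "S = {(v, k). v \<in> vir_words N \<and> k \<in> {-N..-1}}"
  define S' where "S' = {(v, k). v \<in> vir_words N \<and> k \<in> {-N..-1} \<and> v @ [k] \<in> vir_words N}"
  have fin: "finite S"
    unfolding S_def by (rule finite_subset[of _ "vir_words N \<times> {-N..-1}"]) (auto simp: finite_vir_words)
  have sl: "(\<forall>k\<in>set w. k < 0) \<Longrightarrow> sum_list w \<le> 0" for w :: "int list"
    by (induction w) auto
  have "vir_action \<kappa> \<gamma> (vir_mult u r) \<phi> \<nu> = (\<Sum>w\<in>vir_words N. vir_mult u r w * L w)"
    unfolding L_def by (rule vir_action_eq_sum[OF vir_mult_single_series[OF assms(1-3)] assms(4)])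
  also have "\<dots> = (\<Sum>w\<in>vir_words N - {[]}. vir_mult u r w * L w)"
    by (rule sum.mono_neutral_right[OF finite_vir_words]) (auto simp: vir_mult_single_Nil[OF assms(3)])
  also have "\<dots> = (\<Sum>(v, k)\<in>S'. vir_mult u r (v @ [k]) * L (v @ [k]))"
  proof (rule sum.reindex_bij_witness[of _ "\<lambda>(v, k). v @ [k]" "\<lambda>w. (butlast w, last w)"])
    fix w assume w: "w \<in> vir_words N - {[]}"
    then obtain v k where vk: "w = v @ [k]" by (cases w rule: rev_cases) auto
    have "sum_list v \<le> 0" "k < 0" "\<forall>k\<in>set v. k < 0" "- sum_list v - k \<le> N"
      using w sl[of v] by (auto simp: vk vir_words_def)
    then show "(butlast w, last w) \<in> S'"
      using w by (auto simp: S'_def vir_words_def vk)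
  qed (auto simp: S'_def)
  \<comment> \<open>Pairs of joint degree above N are added to obtain a full product set; their
    words give 0 at \<nu>.\<close>
  also have "\<dots> = (\<Sum>(v, k)\<in>S. u v * r [k] * L (v @ [k]))"
  proof (rule sum.mono_neutral_cong_left[OF fin])
    show "S' \<subseteq> S" by (auto simp: S_def S'_def)
    show "\<forall>i\<in>S - S'. (case i of (v, k) \<Rightarrow> u v * r [k] * L (v @ [k])) = 0"
    proof (clarsimp, goal_cases)
      case (1 v k)
      then have "v \<in> vir_words N" "k < 0" "v @ [k] \<notin> vir_words N" by (auto simp: S_def S'_def)
      then have neg: "\<And>i. i \<in> set (v @ [k]) \<Longrightarrow> i < 0" and "sum_list (v @ [k]) < - N"
        by (auto simp: vir_words_def)
      then have "L (v @ [k]) = 0"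
        unfolding L_def using assms(4) by (intro vir_word_vanishes) auto
      then show ?case using 1 by blast
    qed
  qed (auto simp: vir_mult_single_snoc[OF assms(3)])
  also have "\<dots> = (\<Sum>(v, k)\<in>vir_words N \<times> {-N..-1}. u v * r [k] * L (v @ [k]))"
    by (rule sum.cong) (auto simp: S_def)
  also have "\<dots> = (\<Sum>v\<in>vir_words N. \<Sum>k\<in>{-N..-1}. u v * r [k] * L (v @ [k]))"
    by (rule sum.cartesian_product[symmetric])
  also have "\<dots> = (\<Sum>k\<in>{-N..-1}. \<Sum>v\<in>vir_words N. u v * r [k] * L (v @ [k]))"
    by (rule sum.swap)
  also have "\<dots> = (\<Sum>k\<in>{-N..-1}. r [k] * vir_action \<kappa> \<gamma> u (vir_L \<kappa> \<gamma> k \<phi>) \<nu>)"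
    unfolding vir_action_eq_sum[OF assms(1,4)] L_def
    by (simp add: sum_distrib_left mult_ac)
  finally show ?thesis .
qed

lemma finite_mdeg_multisets: "finite {\<mu>. 0 \<notin># \<mu> \<and> mdeg \<mu> = d}"
proof (rule finite_subset)
  have "int (size \<mu>) \<le> mdeg \<mu> \<and> (\<forall>i\<in>#\<mu>. int i \<le> mdeg \<mu>)" if "0 \<notin># \<mu>" for \<mu>
    using that
  proof (induction \<mu>)
    case (add n \<mu>)
    then show ?case using mdeg_nonneg[of \<mu>] by (auto simp: mdeg_add_mset)
  qed (simp add: mdeg_def)
  then show "{\<mu>. 0 \<notin># \<mu> \<and> mdeg \<mu> = d} \<subseteq> mset ` {xs. set xs \<subseteq> {..nat d} \<and> length xs \<le> nat d}"
  proof (intro subsetI)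
    fix \<mu> assume *: "\<And>\<mu>. 0 \<notin># \<mu> \<Longrightarrow> int (size \<mu>) \<le> mdeg \<mu> \<and> (\<forall>i\<in>#\<mu>. int i \<le> mdeg \<mu>)"
      and \<mu>: "\<mu> \<in> {\<mu>. 0 \<notin># \<mu> \<and> mdeg \<mu> = d}"
    obtain xs where xs: "\<mu> = mset xs" by (metis ex_mset)
    show "\<mu> \<in> mset ` {xs. set xs \<subseteq> {..nat d} \<and> length xs \<le> nat d}"
      using *[of \<mu>] \<mu> unfolding xs by (intro imageI) (force simp: xs)
  qed
  show "finite (mset ` {xs. set xs \<subseteq> {..nat d} \<and> length xs \<le> nat d})"
    by (intro finite_imageI finite_lists_length_le) simp
qed

text \<open>On 0-free multisets a word acts on each coefficient through a finite matrix row. This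
  keeps coefficients polynomial and allows differentiation under the action.\<close>

lemma vir_word_coeff_expansion:
  assumes "\<And>k. k \<in> set w \<Longrightarrow> k < 0" "0 \<notin># \<nu>"
  shows "foldr (vir_L \<kappa> \<gamma>) w \<phi> \<nu> =
    (\<Sum>\<mu> | 0 \<notin># \<mu> \<and> mdeg \<mu> = mdeg \<nu> + sum_list w. foldr (vir_L \<kappa> \<gamma>) w (fock_basis \<mu>) \<nu> * \<phi> \<mu>)"
proof -
  define S where "S = {\<mu>. 0 \<notin># \<mu> \<and> mdeg \<mu> = mdeg \<nu> + sum_list w}"
  note lin = fock_linear_vir_word[of w \<kappa> \<gamma>, OF assms(1)]
  have "agree_at True (mdeg \<nu>) (foldr (vir_L \<kappa> \<gamma>) w \<phi>) (foldr (vir_L \<kappa> \<gamma>) w (\<lambda>\<nu>. \<Sum>\<mu>\<in>S. \<phi> \<mu> * fock_basis \<mu> \<nu>))"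
  proof (rule vir_word_agree_at[OF assms(1)])
    have "finite S"
      unfolding S_def by (rule finite_mdeg_multisets)
    then show "agree_at True (mdeg \<nu> + sum_list w) \<phi> (\<lambda>\<nu>. \<Sum>\<mu>\<in>S. \<phi> \<mu> * fock_basis \<mu> \<nu>)"
      by (auto simp: agree_at_def fock_basis_def if_distrib of_bool_def cong: if_cong) (auto simp: S_def)
  qed
  then have "foldr (vir_L \<kappa> \<gamma>) w \<phi> \<nu> = foldr (vir_L \<kappa> \<gamma>) w (\<lambda>\<nu>. \<Sum>\<mu>\<in>S. \<phi> \<mu> * fock_basis \<mu> \<nu>) \<nu>"
    using assms(2) by (auto dest!: agree_atD)
  then show ?thesis
    by (simp add: fock_linear_sum[OF lin] fock_linear_scale[OF lin] S_def mult.commute)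
qed

lemma fock_linear_vir_action:
  assumes "u \<in> vir_series"
  shows "fock_linear (vir_action \<kappa> \<gamma> u)"
  unfolding fock_linear_def
proof (intro allI ext)
  fix c \<phi> \<psi> \<nu>
  have "foldr (vir_L \<kappa> \<gamma>) w (\<lambda>\<nu>. c * \<phi> \<nu> + \<psi> \<nu>) \<nu> = c * foldr (vir_L \<kappa> \<gamma>) w \<phi> \<nu> + foldr (vir_L \<kappa> \<gamma>) w \<psi> \<nu>"
    if "w \<in> vir_words (mdeg \<nu>)" for w
    using fock_linearD[OF fock_linear_vir_word[of w \<kappa> \<gamma>]] that by (auto simp: vir_words_def)
  then show "vir_action \<kappa> \<gamma> u (\<lambda>\<nu>. c * \<phi> \<nu> + \<psi> \<nu>) \<nu> = c * vir_action \<kappa> \<gamma> u \<phi> \<nu> + vir_action \<kappa> \<gamma> u \<psi> \<nu>"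
    by (simp add: vir_action_eq_sum[OF assms order_refl] sum_distrib_left sum.distrib algebra_simps)
qed

text \<open>Lets identities whose form depends on the degree, such as the null vector equation, be
  used under the action: only degrees up to mdeg \<nu> are read.\<close>

lemma vir_action_agree_at:
  assumes "u \<in> vir_series" "\<And>\<mu>. 0 \<notin># \<mu> \<Longrightarrow> mdeg \<mu> \<le> mdeg \<nu> \<Longrightarrow> \<phi> \<mu> = \<psi> \<mu>" "0 \<notin># \<nu>"
  shows "vir_action \<kappa> \<gamma> u \<phi> \<nu> = vir_action \<kappa> \<gamma> u \<psi> \<nu>"
  unfolding vir_action_eq_sum[OF assms(1) order_refl]
proof (rule sum.cong[OF refl])
  fix w assume "w \<in> vir_words (mdeg \<nu>)"
  then have neg: "\<And>k. k \<in> set w \<Longrightarrow> k < 0" by (auto simp: vir_words_def)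
  have sl: "\<forall>k\<in>set w. k < 0 \<Longrightarrow> sum_list w \<le> 0" for w :: "int list"
    by (induction w) force+
  have expand: "foldr (vir_L \<kappa> \<gamma>) w f \<nu> =
      (\<Sum>\<mu> | 0 \<notin># \<mu> \<and> mdeg \<mu> = mdeg \<nu> + sum_list w. foldr (vir_L \<kappa> \<gamma>) w (fock_basis \<mu>) \<nu> * f \<mu>)" for f
    by (rule vir_word_coeff_expansion[OF _ assms(3)]) (rule neg)
  have "foldr (vir_L \<kappa> \<gamma>) w \<phi> \<nu> = foldr (vir_L \<kappa> \<gamma>) w \<psi> \<nu>"
    unfolding expand[of \<phi>] expand[of \<psi>]
  proof (intro sum.cong[OF refl], goal_cases)
    case (1 \<mu>)
    then have "\<phi> \<mu> = \<psi> \<mu>"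
      using sl[of w] neg by (intro assms(2)) auto
    then show ?case by simp
  qed
  then show "u w * foldr (vir_L \<kappa> \<gamma>) w \<phi> \<nu> = u w * foldr (vir_L \<kappa> \<gamma>) w \<psi> \<nu>" by simp
qed

section \<open>Polynomial functions and the residues of the expansion at infinity\<close>

text \<open>One class of functions covers the whole state: coordinate 0 is X, coordinate K is Y^K
  and coordinate m \<le> -2 is f_m. The set I records which variables may occur, and the later
  Taylor estimates are inductions over this construction.\<close>

inductive_set polyfun :: "int set \<Rightarrow> ((int \<Rightarrow> complex) \<Rightarrow> complex) set" for I where
  const: "(\<lambda>_. c) \<in> polyfun I"
| coord: "i \<in> I \<Longrightarrow> (\<lambda>s. s i) \<in> polyfun I"
| add: "p \<in> polyfun I \<Longrightarrow> q \<in> polyfun I \<Longrightarrow> (\<lambda>s. p s + q s) \<in> polyfun I"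
| mult: "p \<in> polyfun I \<Longrightarrow> q \<in> polyfun I \<Longrightarrow> (\<lambda>s. p s * q s) \<in> polyfun I"

text \<open>The same expression as in \<open>is_G\<close>, so that the defining equations of G are
  statements about \<open>pdiff\<close>.\<close>

definition pdiff :: "int \<Rightarrow> ((int \<Rightarrow> complex) \<Rightarrow> complex) \<Rightarrow> (int \<Rightarrow> complex) \<Rightarrow> complex" where
  "pdiff i p s = deriv (\<lambda>c. p (s(i := c))) (s i)"

lemma polyfun_mono: "p \<in> polyfun I \<Longrightarrow> I \<subseteq> J \<Longrightarrow> p \<in> polyfun J"
  by (induction rule: polyfun.induct) (auto intro: polyfun.intros)

lemma polyfun_cong: "p \<in> polyfun I \<Longrightarrow> (\<And>i. i \<in> I \<Longrightarrow> s i = s' i) \<Longrightarrow> p s = p s'"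
  by (induction rule: polyfun.induct) auto

lemma polyfun_sum: "(\<And>a. a \<in> A \<Longrightarrow> p a \<in> polyfun I) \<Longrightarrow> (\<lambda>s. \<Sum>a\<in>A. p a s) \<in> polyfun I"
  by (induction A rule: infinite_finite_induct) (auto intro: polyfun.intros)

lemma polyfun_prod: "(\<And>a. a \<in> A \<Longrightarrow> p a \<in> polyfun I) \<Longrightarrow> (\<lambda>s. \<Prod>a\<in>A. p a s) \<in> polyfun I"
  by (induction A rule: infinite_finite_induct) (auto intro: polyfun.intros)

lemma polyfun_power: "p \<in> polyfun I \<Longrightarrow> (\<lambda>s. p s ^ n) \<in> polyfun I"
  by (induction n) (auto intro: polyfun.intros)

lemma polyfun_cmult: "p \<in> polyfun I \<Longrightarrow> (\<lambda>s. c * p s) \<in> polyfun I"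
  by (auto intro: polyfun.intros)

lemma polyfun_divide: "p \<in> polyfun I \<Longrightarrow> (\<lambda>s. p s / c) \<in> polyfun I"
  using polyfun_cmult[of p I "1 / c"] by simp

lemma poly_coeffs_polyfun: "p \<in> poly_coeffs \<Longrightarrow> \<exists>I. finite I \<and> I \<subseteq> {..-2} \<and> p \<in> polyfun I"
proof (induction rule: poly_coeffs.induct)
  case (const c)
  then show ?case by (auto intro: polyfun.intros)
next
  case (coord m)
  then show ?case by (intro exI[of _ "{m}"]) (auto intro: polyfun.intros)
next
  case (add p q)
  then obtain I J where "finite (I \<union> J)" "I \<union> J \<subseteq> {..-2}" "p \<in> polyfun (I \<union> J)" "q \<in> polyfun (I \<union> J)"
    by (blast intro: polyfun_mono)
  then show ?case by (blast intro: polyfun.add)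
next
  case (mult p q)
  then obtain I J where "finite (I \<union> J)" "I \<union> J \<subseteq> {..-2}" "p \<in> polyfun (I \<union> J)" "q \<in> polyfun (I \<union> J)"
    by (blast intro: polyfun_mono)
  then show ?case by (blast intro: polyfun.mult)
qed

lemma polyfun_differentiable:
  "p \<in> polyfun I \<Longrightarrow> (\<lambda>c. p (s(i := c))) field_differentiable (at c)"
proof (induction rule: polyfun.induct)
  case (coord j)
  then show ?case
    by (cases "j = i") (auto intro!: derivative_intros)
qed (auto intro!: derivative_intros)

lemma has_pdiff:
  "p \<in> polyfun I \<Longrightarrow> ((\<lambda>c. p (s(i := c))) has_field_derivative pdiff i p s) (at (s i))"
  unfolding pdiff_def by (rule field_differentiable_derivI[OF polyfun_differentiable])

lemma pdiff_eqI: "((\<lambda>c. p (s(i := c))) has_field_derivative D) (at (s i)) \<Longrightarrow> pdiff i p s = D"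
  unfolding pdiff_def by (rule DERIV_imp_deriv)

lemma pdiff_const: "pdiff i (\<lambda>_. c) s = 0"
  by (rule pdiff_eqI) simp

lemma pdiff_coord: "pdiff i (\<lambda>s. s j) s = (if i = j then 1 else 0)"
  by (rule pdiff_eqI) (auto intro!: derivative_eq_intros)

lemma pdiff_add:
  "p \<in> polyfun I \<Longrightarrow> q \<in> polyfun I \<Longrightarrow> pdiff i (\<lambda>s. p s + q s) s = pdiff i p s + pdiff i q s"
  by (rule pdiff_eqI) (auto intro!: derivative_eq_intros has_pdiff)

lemma pdiff_mult:
  assumes "p \<in> polyfun I" "q \<in> polyfun I"
  shows "pdiff i (\<lambda>s. p s * q s) s = pdiff i p s * q s + p s * pdiff i q s"
  using DERIV_mult[OF has_pdiff[OF assms(1)] has_pdiff[OF assms(2)], of s i s]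
  by (intro pdiff_eqI) (simp add: algebra_simps)

lemma pdiff_cmult: "p \<in> polyfun I \<Longrightarrow> pdiff i (\<lambda>s. c * p s) s = c * pdiff i p s"
  by (subst pdiff_mult[OF polyfun.const]) (simp_all add: pdiff_const)

lemma pdiff_sum:
  assumes "\<And>a. a \<in> A \<Longrightarrow> p a \<in> polyfun I"
  shows "pdiff i (\<lambda>s. \<Sum>a\<in>A. p a s) s = (\<Sum>a\<in>A. pdiff i (p a) s)"
  by (rule pdiff_eqI) (auto intro!: DERIV_sum has_pdiff assms)

lemma pdiff_polyfun: "p \<in> polyfun I \<Longrightarrow> pdiff i p \<in> polyfun I"
proof (induction rule: polyfun.induct)
  case (const c)
  then show ?case by (simp add: pdiff_const[abs_def] polyfun.const)
next
  case (coord j)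
  then show ?case by (simp add: pdiff_coord[abs_def] polyfun.const)
next
  case (add p q)
  then have "pdiff i (\<lambda>s. p s + q s) = (\<lambda>s. pdiff i p s + pdiff i q s)"
    by (auto simp: pdiff_add)
  with add show ?case by (simp add: polyfun.add)
next
  case (mult p q)
  then have "pdiff i (\<lambda>s. p s * q s) = (\<lambda>s. pdiff i p s * q s + p s * pdiff i q s)"
    by (auto simp: pdiff_mult)
  with mult show ?case by (simp add: polyfun.add polyfun.mult)
qed

lemma pdiff_outside:
  assumes "p \<in> polyfun I" "i \<notin> I"
  shows "pdiff i p s = 0"
proof (rule pdiff_eqI)
  have "p (s(i := c)) = p s" for c
    by (rule polyfun_cong[OF assms(1)]) (use assms(2) in auto)
  then show "((\<lambda>c. p (s(i := c))) has_field_derivative 0) (at (s i))" by simp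
qed

section \<open>The expansion of 1/(f(w) - x) at infinity\<close>

text \<open>The coefficient of w^(-n) in 1/(f(w) - x), where f(w) = w + sum_{i \<ge> 1} c_i w^(-i);
  the recursion compares coefficients in the product with f(w) - x. It is used over the reals for
  the processes and over the complex numbers for G.\<close>

fun hcoef :: "'b::comm_ring_1 \<Rightarrow> (nat \<Rightarrow> 'b) \<Rightarrow> nat \<Rightarrow> 'b" where
  "hcoef x c 0 = 0"
| "hcoef x c (Suc 0) = 1"
| "hcoef x c (Suc (Suc n)) = x * hcoef x c (Suc n) - (\<Sum>i<n. c (Suc i) * hcoef x c (n - i))"

lemma fls_at_inf_conv:
  "fls_at_inf f = fls_X_inv * fps_to_fls (Abs_fps (\<lambda>n. if n = 0 then 1 else if n = 1 then 0 else f (- int n)))"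
  (is "_ = _ * fps_to_fls ?E")
proof -
  have "fls_nth (fls_at_inf f) n = fls_nth (fls_X_inv * fps_to_fls ?E) n" for n
    by (cases "n = -1"; cases "n < -1") (auto simp: fls_at_inf_def fls_X_inv_times_conv_shift nat_add_distrib of_nat_nat)
  then show ?thesis by (intro fls_eqI)
qed

lemma hcoef_inverse:
  fixes f :: "int \<Rightarrow> complex"
  shows "(fls_at_inf f - fls_const x) * fps_to_fls (Abs_fps (hcoef x (\<lambda>i. f (- 1 - int i)))) = 1"
    (is "_ * fps_to_fls ?H = 1")
proof -
  define E where "E = Abs_fps (\<lambda>n. if n = 0 then 1 else if n = 1 then 0 else f (- int n))"
  have "(E - fps_const x * fps_X) * ?H = fps_X"
  proof (rule fps_ext)
    fix n
    consider "n = 0" | "n = 1" | m where "n = Suc (Suc m)"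
      by (metis One_nat_def not0_implies_Suc)
    then show "((E - fps_const x * fps_X) * ?H) $ n = fps_X $ n"
    proof cases
      case 1
      then show ?thesis by (simp add: fps_mult_nth)
    next
      case 2
      then show ?thesis by (simp add: fps_mult_nth E_def)
    next
      case (3 m)
      have 1: "(E * ?H) $ n = ?H $ n + (\<Sum>i<m. f (- 2 - int i) * ?H $ (m - i))"
      proof -
        have "(E * ?H) $ n = E $ 0 * ?H $ n + (E $ 1 * ?H $ (Suc m) + (\<Sum>i=0..m. E $ (i + 2) * ?H $ (m - i)))"
          unfolding fps_mult_nth 3 sum.atLeast0_atMost_Suc_shift by (simp add: comp_def del: fps_nth_Abs_fps)
        also have "(\<Sum>i=0..m. E $ (i + 2) * ?H $ (m - i)) = (\<Sum>i<m. E $ (i + 2) * ?H $ (m - i))"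
          by (rule sum.mono_neutral_right) auto
        finally show ?thesis by (simp add: E_def)
      qed
      have "((E - fps_const x * fps_X) * ?H) $ n = (E * ?H) $ n - x * (fps_X * ?H) $ n"
        by (simp add: algebra_simps)
      also have "\<dots> = 0"
        unfolding 1 by (simp add: 3)
      finally show ?thesis by (simp add: 3)
    qed
  qed
  from arg_cong[OF this, of fps_to_fls]
  have *: "fps_to_fls (E - fps_const x * fps_X) * fps_to_fls ?H = fls_X"
    by (simp only: fls_times_fps_to_fls fps_X_to_fls)
  have "fls_at_inf f - fls_const x = fls_X_inv * fps_to_fls (E - fps_const x * fps_X)"
  proof -
    have "fls_X_inv * (fls_const x * fls_X) = (fls_const x :: complex fls)"
      by (metis fls_inverse_X fls_X_nonzero left_inverse mult.left_commute mult.right_neutral)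
    then show ?thesis
      by (simp add: fls_at_inf_conv E_def fls_times_fps_to_fls algebra_simps)
  qed
  then show ?thesis
    using * by (simp add: mult.assoc flip: fls_inverse_X)
qed

lemma fls_at_inf_subdegree: "fls_subdegree (fls_at_inf f) = -1"
  and fls_at_inf_base: "fls_nth (fls_at_inf f) (-1) = 1"
proof -
  show "fls_nth (fls_at_inf f) (-1) = 1"
    by (simp add: fls_at_inf_def)
  then show "fls_subdegree (fls_at_inf f) = -1"
    by (intro fls_subdegree_eqI) (auto simp: fls_at_inf_def)
qed

lemma fls_at_inf_nz: "fls_at_inf f \<noteq> 0"
  using fls_at_inf_base[of f] by auto

lemma fls_at_inf_deriv_subdegree: "fls_subdegree (fls_at_inf_deriv (fls_at_inf f)) = 0"
proof -
  have "fls_subdegree (fls_deriv (fls_at_inf f)) = -2"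
    by (subst fls_subdegree_deriv) (simp_all add: fls_at_inf_subdegree)
  moreover from this have "fls_deriv (fls_at_inf f) \<noteq> 0" by auto
  ultimately show ?thesis
    by (simp add: fls_at_inf_deriv_def)
qed

lemma fls_at_inf_deriv_nz: "fls_at_inf_deriv (fls_at_inf f) \<noteq> 0"
proof -
  have "fls_subdegree (fls_deriv (fls_at_inf f)) = -2"
    by (subst fls_subdegree_deriv) (simp_all add: fls_at_inf_subdegree)
  then have "fls_deriv (fls_at_inf f) \<noteq> 0" by auto
  then show ?thesis
    by (simp add: fls_at_inf_deriv_def)
qed

lemma fls_deriv_power_int:
  fixes F :: "complex fls"
  assumes "F \<noteq> 0"
  shows "fls_deriv (F powi n) = of_int n * F powi (n - 1) * fls_deriv F"
proof (cases "n \<ge> 0")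
  case True
  then obtain m where n: "n = int m" by (metis nonneg_int_cases)
  show ?thesis
  proof (cases m)
    case (Suc k)
    have "int (Suc k) - 1 = int k" by simp
    then show ?thesis
      by (simp only: n Suc power_int_of_nat fls_deriv_power) simp
  qed (simp add: n)
next
  case False
  then obtain m where n: "n = - int m" "m > 0" by (metis neg_int_cases int_one_le_iff_zero_less linorder_not_le zero_less_imp_eq_int)
  have "F powi n * F ^ m = 1"
    using assms by (simp add: n power_int_minus)
  then have "fls_deriv (F powi n * F ^ m) = 0" by simp
  then have "fls_deriv (F powi n) * F ^ m = - (F powi n * (of_nat m * F ^ (m - 1) * fls_deriv F))"
    by (simp add: fls_deriv_power eq_neg_iff_add_eq_0 algebra_simps)
  then have "fls_deriv (F powi n) * F ^ m * F powi n = of_int n * (F powi n * F ^ (m - 1) * F powi n) * fls_deriv F"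
    by (simp add: n algebra_simps)
  moreover have "F powi n * F ^ (m - 1) * F powi n = F powi (n - 1)"
  proof -
    have "F ^ (m - 1) = F powi (int m - 1)"
      using n(2) by (simp add: power_int_def nat_diff_distrib)
    moreover have "F powi (n - 1) = F powi (n + (int m - 1) + n)"
      by (rule arg_cong[where f = "\<lambda>k. F powi k"]) (simp add: n)
    moreover have "F powi (n + (int m - 1) + n) = F powi n * F powi (int m - 1) * F powi n"
      by (subst power_int_add, use assms in simp)+ simp
    ultimately show ?thesis by simp
  qed
  ultimately show ?thesis
    using \<open>F powi n * F ^ m = 1\<close> by (simp add: mult.assoc mult.commute[of "F ^ m"])
qed

text \<open>f' f^s is a derivative unless s = -1, when it is the logarithmic derivative of f. Since
  d/dw = - u^2 d/du, the coefficient of u is minus the residue at u = 0, where f has a simple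
  pole.\<close>

lemma fls_at_inf_deriv_power_residue:
  "fls_nth (fls_at_inf_deriv (fls_at_inf f) * fls_at_inf f powi s) 1 = (if s = -1 then 1 else 0)"
proof -
  define F where "F = fls_at_inf f"
  have F: "F \<noteq> 0" "fls_subdegree F = -1" "fls_nth F (-1) = 1"
    by (simp_all add: F_def fls_at_inf_nz fls_at_inf_subdegree fls_at_inf_base)
  have "fls_nth (fls_at_inf_deriv F * F powi s) 1 = - fls_nth (fls_X ^ 2 * (fls_deriv F * F powi s)) 1"
    by (simp add: fls_at_inf_deriv_def mult.assoc)
  also have "\<dots> = - fls_residue (fls_deriv F * F powi s)"
    by (simp add: fls_X_power_times_conv_shift)
  also have "fls_residue (fls_deriv F * F powi s) = (if s = -1 then -1 else 0)"
  proof (cases "s = -1")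
    case True
    then show ?thesis
      using fls_residue_deriv_times_inverse_eq_subdegree(1)[of F] F by (simp add: power_int_minus)
  next
    case False
    have "of_int (s + 1) * (fls_deriv F * F powi s) = fls_deriv (F powi (s + 1))"
      using fls_deriv_power_int[OF F(1), of "s + 1"] by (simp only: mult_ac add_diff_cancel_right')
    then have "of_int (s + 1) * fls_residue (fls_deriv F * F powi s) = 0"
      by (metis fls_residue_of_int_times(1) fls_residue_deriv)
    moreover have "of_int (s + 1) \<noteq> (0 :: complex)"
      using False by (simp only: of_int_eq_0_iff)
    ultimately show ?thesis
      using False by simp
  qed
  finally show ?thesis by (simp add: F_def)
qed

text \<open>The finite geometric series of 1/(f - x) in powers of x/f, with exact remainder.\<close>

lemma hcoef_geometric:
  fixes f :: "int \<Rightarrow> complex" and x :: complex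
  defines "H \<equiv> fps_to_fls (Abs_fps (hcoef x (\<lambda>i. f (- 1 - int i))))"
  shows "H = (\<Sum>j<J. fls_const (x ^ j) * fls_at_inf f powi (- 1 - int j)) + fls_const (x ^ J) * fls_at_inf f powi (- int J) * H"
proof (induction J)
  case (Suc J)
  define F where "F = fls_at_inf f"
  have F: "F \<noteq> 0" by (simp add: F_def fls_at_inf_nz)
  have "(F - fls_const x) * H = 1"
    unfolding F_def H_def by (rule hcoef_inverse)
  then have "F * H = 1 + fls_const x * H" by (simp add: algebra_simps)
  then have "H = F powi (-1) + fls_const x * F powi (-1) * H"
    using F by (simp add: power_int_minus field_simps)
  then have "fls_const (x ^ J) * F powi (- int J) * H
      = fls_const (x ^ J) * F powi (- int J) * (F powi (-1) + fls_const x * F powi (-1) * H)"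
    by simp
  also have "\<dots> = fls_const (x ^ J) * F powi (- 1 - int J) + fls_const (x ^ Suc J) * F powi (- int (Suc J)) * H"
  proof -
    have "F powi (- 1 - int J) = F powi (- int J) * F powi (-1)" "F powi (- int (Suc J)) = F powi (- int J) * F powi (-1)"
    proof -
      have e: "- 1 - int J = - int J + (-1)" "- int (Suc J) = - int J + (-1)" by simp_all
      show "F powi (- 1 - int J) = F powi (- int J) * F powi (-1)" "F powi (- int (Suc J)) = F powi (- int J) * F powi (-1)"
        unfolding e by (rule power_int_add, use F in simp)+
    qed
    moreover have "fls_const (x ^ Suc J) = fls_const x * fls_const (x ^ J)"
      by (simp add: fls_const_mult_const)
    ultimately show ?thesis by (simp only: algebra_simps)
  qed
  finally show ?case
    using Suc.IH by (simp add: F_def add.assoc)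
qed simp

text \<open>The change of variables \<open>u = f(w)\<close> in the residue: \<open>2/(f(w) - x)\<close> becomes \<open>2/(u - x)\<close>.\<close>

lemma G_residue_hcoef_sum:
  assumes "k \<le> -2"
  shows "(\<Sum>m\<in>{k..-2}. hcoef x (\<lambda>i. f (- 1 - int i)) (nat (- 1 - m)) * G_residue f m k) = x ^ nat (- 2 - k)"
proof -
  define F where "F = fls_at_inf f"
  define D where "D = fls_at_inf_deriv F"
  define R where "R = D * F powi (- 2 - k)"
  define h where "h = hcoef x (\<lambda>i. f (- 1 - int i))"
  define H where "H = fps_to_fls (Abs_fps h)"
  define n where "n = nat (- 2 - k)"
  have F: "F \<noteq> 0" "fls_subdegree F = -1"
    by (simp_all add: F_def fls_at_inf_nz fls_at_inf_subdegree)
  have D: "D \<noteq> 0" "fls_subdegree D = 0"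
    by (simp_all add: D_def F_def fls_at_inf_deriv_nz fls_at_inf_deriv_subdegree)
  have R: "R \<noteq> 0" "fls_subdegree R = 2 + k"
    using F D by (simp_all add: R_def)
  have H: "fls_nth H i = (if i < 1 then 0 else h (nat i))" for i
    by (cases "i = 0") (auto simp: H_def h_def)
  have H1: "fls_nth H 1 = 1" by (simp add: H h_def)
  have Hnz: "H \<noteq> 0"
  proof
    assume "H = 0"
    then show False using H1 by simp
  qed
  have Hsub: "fls_subdegree H = 1"
    by (rule fls_subdegree_eqI) (auto simp: H h_def)
  \<comment> \<open>The factor w^(1+m) merely shifts coefficients, so the sum over m becomes a
    single coefficient of the product of H and R.\<close>
  have "G_residue f m k = fls_nth R (2 + m)" for m
  proof -
    have "fls_X_intpow (- (1 + m)) * fls_at_inf_deriv (fls_at_inf f) / fls_at_inf f powi (2 + k) = fls_X_intpow (- (1 + m)) * R"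
      unfolding R_def D_def F_def[symmetric] using F(1)
      by (simp add: divide_inverse power_int_minus[symmetric] mult.assoc)
    then show ?thesis
      unfolding G_residue_def by (simp only: fls_X_intpow_times_conv_shift) (simp add: add.commute)
  qed
  then have "(\<Sum>m\<in>{k..-2}. hcoef x (\<lambda>i. f (- 1 - int i)) (nat (- 1 - m)) * G_residue f m k)
      = (\<Sum>m\<in>{k..-2}. fls_nth H (- 1 - m) * fls_nth R (2 + m))"
    by (intro sum.cong) (auto simp: H h_def)
  also have "\<dots> = (\<Sum>i\<in>{1..-1-k}. fls_nth H i * fls_nth R (1 - i))"
    by (rule sum.reindex_bij_witness[of _ "\<lambda>i. - 1 - i" "\<lambda>i. - 1 - i"]) auto
  also have "\<dots> = fls_nth (H * R) 1"
    by (simp add: fls_times_nth(2) Hsub R)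
  also have "H * R = (\<Sum>j<Suc n. fls_const (x ^ j) * (D * F powi (int n - 1 - int j))) +
      fls_const (x ^ Suc n) * (F powi (- int (Suc n)) * H * R)"
  proof -
    have "H * R = (\<Sum>j<Suc n. fls_const (x ^ j) * F powi (- 1 - int j) * R) + fls_const (x ^ Suc n) * F powi (- int (Suc n)) * H * R"
      using arg_cong[OF hcoef_geometric[of x f "Suc n"], of "\<lambda>z. z * R"]
      unfolding h_def[symmetric] H_def[symmetric] F_def[symmetric] distrib_right sum_distrib_right .
    moreover have "fls_const (x ^ j) * F powi (- 1 - int j) * R = fls_const (x ^ j) * (D * F powi (int n - 1 - int j))" for j
    proof -
      have "F powi (int n - 1 - int j) = F powi (- 1 - int j) * F powi (- 2 - k)"
      proof -
        have e: "int n - 1 - int j = (- 1 - int j) + (- 2 - k)"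
          using assms by (simp add: n_def)
        show ?thesis
          unfolding e by (rule power_int_add) (use F(1) in simp)
      qed
      then show ?thesis by (simp add: R_def mult_ac)
    qed
    ultimately show ?thesis by (simp only: mult.assoc)
  qed
  \<comment> \<open>The remainder starts at u^2: its order is (n + 1) + 1 + (2 + k), and n = - 2 -
    k.\<close>
  also have "fls_nth \<dots> 1 = (\<Sum>j<Suc n. x ^ j * fls_nth (D * F powi (int n - 1 - int j)) 1)"
  proof -
    have "fls_nth (F powi (- int (Suc n)) * H * R) 1 = 0"
      using F(1) Hnz R(1) assms by (intro fls_eq0_below_subdegree) (simp add: F(2) Hsub R(2) n_def)
    then show ?thesis by (simp add: fls_nth_sum del: sum.lessThan_Suc of_nat_Suc power_Suc)
  qed
  also have "\<dots> = (\<Sum>j<Suc n. if j = n then x ^ n else 0)"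
    unfolding D_def F_def fls_at_inf_deriv_power_residue by (intro sum.cong) auto
  also have "\<dots> = x ^ n" by simp
  finally show ?thesis by (simp add: n_def)
qed

section \<open>The null vector equation\<close>

text \<open>The coefficients of exp(sum_n z_n a_{-n}) v in the monomial basis: the creation
  operators commute, so each mode contributes its own exponential series.\<close>

definition ucoef :: "(nat \<Rightarrow> complex) \<Rightarrow> fock" where
  "ucoef z \<nu> = (if 0 \<in># \<nu> then 0 else \<Prod>n\<in>set_mset \<nu>. z n ^ count \<nu> n / fact (count \<nu> n))"

text \<open>The coherent state property: it becomes the eigenvalue equation for the annihilation
  operators in \<open>heis_ucoef_pos\<close>.\<close>

lemma ucoef_add_mset:
  assumes "n > 0"
  shows "of_nat (count \<nu> n + 1) * ucoef z (add_mset n \<nu>) = z n * ucoef z \<nu>"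
proof (cases "0 \<in># \<nu>")
  case False
  define A where "A = insert n (set_mset \<nu>)"
  define f where "f = (\<lambda>\<nu> n. z n ^ count \<nu> n / fact (count \<nu> n))"
  have "ucoef z \<nu> = (\<Prod>i\<in>A. f \<nu> i)"
    using False by (simp add: ucoef_def f_def) (intro prod.mono_neutral_left, auto simp: A_def not_in_iff)
  also have "\<dots> = f \<nu> n * (\<Prod>i\<in>A - {n}. f \<nu> i)"
    by (rule prod.remove) (auto simp: A_def)
  finally have 1: "ucoef z \<nu> = f \<nu> n * (\<Prod>i\<in>A - {n}. f \<nu> i)" .
  have "ucoef z (add_mset n \<nu>) = (\<Prod>i\<in>A. f (add_mset n \<nu>) i)"
    unfolding ucoef_def f_def using False assms by (simp add: A_def)
  also have "\<dots> = f (add_mset n \<nu>) n * (\<Prod>i\<in>A - {n}. f (add_mset n \<nu>) i)"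
    by (rule prod.remove) (auto simp: A_def)
  also have "(\<Prod>i\<in>A - {n}. f (add_mset n \<nu>) i) = (\<Prod>i\<in>A - {n}. f \<nu> i)"
    by (rule prod.cong) (auto simp: f_def)
  finally have 2: "ucoef z (add_mset n \<nu>) = f (add_mset n \<nu>) n * (\<Prod>i\<in>A - {n}. f \<nu> i)" .
  have "of_nat (count \<nu> n + 1) * f (add_mset n \<nu>) n = z n * f \<nu> n"
    by (simp add: f_def field_simps del: of_nat_Suc)
  then show ?thesis
    unfolding 1 2 by (metis mult.assoc)
qed (simp add: ucoef_def)

lemma ucoef_remove:
  assumes "n \<in># \<nu>" "n > 0"
  shows "z n * ucoef z (\<nu> - {#n#}) = of_nat (count \<nu> n) * ucoef z \<nu>"
proof -
  obtain \<mu> where "\<nu> = add_mset n \<mu>"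
    using assms(1) by (meson mset_add)
  with ucoef_add_mset[OF assms(2), of \<mu> z] show ?thesis by simp
qed

text \<open>The k-th power of the exponent lives on multisets of size k, so the exponential series
  has a single term at each \<nu>. In the induction step the multiplicities in \<nu> add up to its
  size, which turns k! into (k + 1)!.\<close>

lemma exp_modes_power:
  assumes E: "\<And>\<phi> \<nu>. E \<phi> \<nu> = Sum_any (\<lambda>n::nat. if n \<ge> 1 then z n * heis \<gamma> (- int n) \<phi> \<nu> else 0)"
  shows "(E ^^ k) fock_vac \<nu> = (if size \<nu> = k then fact k * ucoef z \<nu> else 0)"
proof (induction k arbitrary: \<nu>)
  case 0
  then show ?case by (auto simp: fock_basis_def ucoef_def)
next
  case (Suc k)
  define \<psi> where "\<psi> = (E ^^ k) fock_vac"
  have "E \<psi> \<nu> = (\<Sum>n\<in>set_mset \<nu> - {0}. z n * \<psi> (\<nu> - {#n#}))"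
  proof -
    have "E \<psi> \<nu> = (\<Sum>n\<in>set_mset \<nu> - {0}. if n \<ge> 1 then z n * heis \<gamma> (- int n) \<psi> \<nu> else 0)"
      unfolding E by (rule Sum_any.expand_superset) (auto simp: heis_neg split: if_splits)
    then show ?thesis
      by (auto simp: heis_neg intro!: sum.cong)
  qed
  also have "\<dots> = (\<Sum>n\<in>set_mset \<nu> - {0}. if size \<nu> = Suc k then fact k * (of_nat (count \<nu> n) * ucoef z \<nu>) else 0)"
  proof (rule sum.cong[OF refl])
    fix n assume n: "n \<in> set_mset \<nu> - {0}"
    then have "size (\<nu> - {#n#}) = k \<longleftrightarrow> size \<nu> = Suc k"
      by (auto simp: size_Diff_singleton nonempty_has_size gr0_conv_Suc dest: multi_member_split)
    then have "z n * \<psi> (\<nu> - {#n#}) = (if size \<nu> = Suc k then fact k * (z n * ucoef z (\<nu> - {#n#})) else 0)"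
      unfolding \<psi>_def Suc by (simp add: mult_ac)
    then show "z n * \<psi> (\<nu> - {#n#}) = (if size \<nu> = Suc k then fact k * (of_nat (count \<nu> n) * ucoef z \<nu>) else 0)"
      using ucoef_remove[of n \<nu> z] n by auto
  qed
  also have "\<dots> = (if size \<nu> = Suc k then fact (Suc k) * ucoef z \<nu> else 0)"
  proof (cases "0 \<in># \<nu>")
    case True
    then show ?thesis by (simp add: ucoef_def)
  next
    case False
    then have "(\<Sum>n\<in>set_mset \<nu> - {0}. of_nat (count \<nu> n)) = (of_nat (size \<nu>) :: complex)"
      by (simp add: size_multiset_overloaded_eq)
    then show ?thesis
      by (simp add: sum_distrib_left[symmetric] sum_distrib_right[symmetric] del: of_nat_Suc)
  qed
  finally show ?case by (simp add: \<psi>_def)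
qed

lemma U_minus_eq_ucoef:
  "U_minus \<gamma> \<alpha> M \<alpha>s x y fock_vac =
     ucoef (\<lambda>n. of_real ((\<alpha> * x ^ n + (\<Sum>K=1..M. \<alpha>s K * y K ^ n)) / real n))"
proof
  fix \<nu>
  define z where "z = (\<lambda>n. complex_of_real ((\<alpha> * x ^ n + (\<Sum>K=1..M. \<alpha>s K * y K ^ n)) / real n))"
  define E where "E = (\<lambda>\<phi> \<nu>. Sum_any (\<lambda>n::nat. if n \<ge> 1 then z n * heis \<gamma> (- int n) \<phi> \<nu> else 0))"
  have "U_minus \<gamma> \<alpha> M \<alpha>s x y fock_vac \<nu> = Sum_any (\<lambda>k. (E ^^ k) fock_vac \<nu> / fact k)"
    by (simp only: U_minus_def fock_exp_def E_def z_def)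
  also have "\<dots> = Sum_any (\<lambda>k. if k = size \<nu> then ucoef z \<nu> else 0)"
    by (rule arg_cong[where f = Sum_any], rule ext, subst exp_modes_power[of E z \<gamma>]) (auto simp: E_def)
  also have "\<dots> = ucoef z \<nu>" by simp
  finally show "U_minus \<gamma> \<alpha> M \<alpha>s x y fock_vac \<nu> = ucoef (\<lambda>n. of_real ((\<alpha> * x ^ n + (\<Sum>K=1..M. \<alpha>s K * y K ^ n)) / real n)) \<nu>"
    by (simp add: z_def)
qed

lemma heis_ucoef_pos:
  assumes "j > 0"
  shows "heis \<gamma> (int j) (ucoef z) = (\<lambda>\<nu>. of_nat (2 * j) * z j * ucoef z \<nu>)"
  using ucoef_add_mset[OF assms, of _ z] by (auto simp: heis_pos[OF assms] mult.assoc)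

lemma ucoef_polyfun:
  assumes "\<And>n. (\<lambda>s. zf s n) \<in> polyfun I"
  shows "(\<lambda>s. ucoef (zf s) \<nu>) \<in> polyfun I"
  by (cases "0 \<in># \<nu>")
    (auto simp: ucoef_def intro!: polyfun_prod polyfun_divide polyfun_power assms polyfun.const)

text \<open>The chain rule for the exponential: the derivative in z_n is a_{-n} applied to the
  state. Modes above the degree of \<nu> contribute 0, hence the cutoff N.\<close>

lemma pdiff_ucoef:
  assumes zf: "\<And>n. (\<lambda>s. zf s n) \<in> polyfun I" and N: "mdeg \<nu> \<le> int N"
  shows "pdiff i (\<lambda>s. ucoef (zf s) \<nu>) s = (\<Sum>n=1..N. pdiff i (\<lambda>s. zf s n) s * heis \<gamma> (- int n) (ucoef (zf s)) \<nu>)"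
proof (cases "0 \<in># \<nu>")
  case True
  then have "ucoef (zf s) \<nu> = 0" for s by (simp add: ucoef_def)
  moreover have "heis \<gamma> (- int n) (ucoef (zf s)) \<nu> = 0" if "n \<in> {1..N}" for n
    using True that by (auto simp: heis_neg ucoef_def in_diff_count)
  ultimately show ?thesis by (simp add: pdiff_const)
next
  case False
  define A where "A = set_mset \<nu>"
  define f where "f = (\<lambda>s n. zf s n ^ count \<nu> n / fact (count \<nu> n))"
  define D where "D = (\<lambda>n. pdiff i (\<lambda>s. zf s n) s)"
  have U: "ucoef (zf s) \<nu> = (\<Prod>n\<in>A. f s n)" for s
    using False by (simp add: ucoef_def A_def f_def)
  have der: "((\<lambda>c. f (s(i := c)) n) has_field_derivative (of_nat (count \<nu> n) * zf s n ^ (count \<nu> n - 1) * D n / fact (count \<nu> n))) (at (s i))" for n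
    unfolding f_def using DERIV_power[OF has_pdiff[OF zf, of s i n], of "count \<nu> n"]
    by (intro DERIV_cdivide) (simp add: D_def mult_ac)
  have "((\<lambda>c. \<Prod>n\<in>A. f (s(i := c)) n) has_field_derivative
     (\<Sum>n\<in>A. (of_nat (count \<nu> n) * zf s n ^ (count \<nu> n - 1) * D n / fact (count \<nu> n)) * (\<Prod>m\<in>A - {n}. f s m))) (at (s i))"
    by (rule has_field_derivative_prod[THEN DERIV_cong], rule der) simp
  then have "pdiff i (\<lambda>s. ucoef (zf s) \<nu>) s = (\<Sum>n\<in>A. (of_nat (count \<nu> n) * zf s n ^ (count \<nu> n - 1) * D n / fact (count \<nu> n)) * (\<Prod>m\<in>A - {n}. f s m))"
    unfolding U by (rule pdiff_eqI)
  also have "\<dots> = (\<Sum>n\<in>A. D n * heis \<gamma> (- int n) (ucoef (zf s)) \<nu>)"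
  proof (rule sum.cong[OF refl])
    fix n assume n: "n \<in> A"
    then obtain c where c: "count \<nu> n = Suc c"
      unfolding A_def by (metis count_eq_zero_iff not0_implies_Suc)
    have n0: "n > 0" using n False by (cases n) (auto simp: A_def)
    have "ucoef (zf s) (\<nu> - {#n#}) = (\<Prod>m\<in>A. zf s m ^ count (\<nu> - {#n#}) m / fact (count (\<nu> - {#n#}) m))"
    proof -
      have "0 \<notin># \<nu> - {#n#}" using False by (auto dest: in_diffD)
      then show ?thesis
        by (simp add: ucoef_def del: count_diff)
          (intro prod.mono_neutral_left, auto simp: A_def not_in_iff dest: in_diffD)
    qed
    also have "\<dots> = (zf s n ^ c / fact c) * (\<Prod>m\<in>A - {n}. f s m)"
      using n by (subst prod.remove[of A n]) (auto simp: A_def c f_def intro!: prod.cong)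
    finally have "heis \<gamma> (- int n) (ucoef (zf s)) \<nu> = (zf s n ^ c / fact c) * (\<Prod>m\<in>A - {n}. f s m)"
      using n n0 by (simp add: heis_neg A_def)
    then show "(of_nat (count \<nu> n) * zf s n ^ (count \<nu> n - 1) * D n / fact (count \<nu> n)) * (\<Prod>m\<in>A - {n}. f s m) = D n * heis \<gamma> (- int n) (ucoef (zf s)) \<nu>"
      by (simp add: c del: of_nat_Suc)
  qed
  also have "\<dots> = (\<Sum>n=1..N. D n * heis \<gamma> (- int n) (ucoef (zf s)) \<nu>)"
  proof (rule sum.mono_neutral_left)
    have "n \<le> N" if "n \<in> A" for n
    proof -
      obtain \<mu> where "\<nu> = add_mset n \<mu>" using \<open>n \<in> A\<close> unfolding A_def by (meson mset_add)
      then show ?thesis using N mdeg_nonneg[of \<mu>] by (simp add: mdeg_add_mset)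
    qed
    moreover have "n \<ge> 1" if "n \<in> A" for n using that False by (cases n) (auto simp: A_def)
    ultimately show "A \<subseteq> {1..N}" by auto
  qed (auto simp: heis_neg A_def)
  finally show ?thesis by (simp add: D_def)
qed


text \<open>In the pairs of L_{-n}, the modes j \<ge> 0 act on the coherent state by 2 p_j (for j =
  0 through the charge), the modes j \<le> - n are their mirror images under j -> - n - j, and in
  between both factors are creation operators.\<close>

lemma vir_L_ucoef:
  fixes \<nu> :: "nat multiset"
  assumes "n \<ge> 1" "mdeg \<nu> = int D" and p0: "p 0 = of_real \<beta>" and p: "\<And>j. j > 0 \<Longrightarrow> z j = p j / of_nat j"
  defines "e \<equiv> \<lambda>m. heis \<beta> (- int m) (ucoef z) \<nu>"
    and "e2 \<equiv> \<lambda>a b. heis \<beta> (- int a) (heis \<beta> (- int b) (ucoef z)) \<nu>"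
  shows "vir_L \<kappa> \<beta> (- int n) (ucoef z) \<nu> =
     (\<Sum>i=1..n-1. e2 (n - i) i) / 4 + (\<Sum>m=n..D. p (m - n) * e m) + of_real (alpha0 \<kappa> * (real n - 1)) * e n"
proof -
  define B where "B = int D + int n"
  define k where "k = - int n"
  define H where "H = (\<lambda>j. heis \<beta> (k - j) (heis \<beta> j (ucoef z)) \<nu>)"
  have H_pos: "H j = 2 * p (nat j) * e (n + nat j)" if "j \<ge> 0" for j
  proof -
    have "heis \<beta> j (ucoef z) = (\<lambda>\<nu>. (2 * p (nat j)) * ucoef z \<nu>)"
    proof (cases "j = 0")
      case True
      then show ?thesis by (simp add: fun_eq_iff heis_0 p0)
    next
      case False
      then have "nat j > 0" "int (nat j) = j" using that by auto
      then show ?thesis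
        using heis_ucoef_pos[of "nat j" \<beta> z] p[of "nat j"] by simp
    qed
    moreover have "k - j = - int (n + nat j)" using that by (simp add: k_def)
    ultimately show ?thesis
      by (simp only: H_def heis_linear_simps e_def)
  qed
  have H_sym: "H (k - j) = H j" for j
    unfolding H_def using assms(1) by (simp add: heis_commute k_def)
  have e0: "e m = 0" if "m > D" for m
    unfolding e_def using that assms(2) by (intro heis_vanishes) simp
  have pos: "(\<Sum>j\<in>{0..int r}. H j) = 2 * (\<Sum>m=n..D. p (m - n) * e m)" if "D \<le> r + n" for r
  proof -
    have "(\<Sum>j\<in>{0..int r}. H j) = (\<Sum>m=n..n+r. 2 * (p (m - n) * e m))"
      by (rule sum.reindex_bij_witness[of _ "\<lambda>m. int m - int n" "\<lambda>j. n + nat j"])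
        (auto simp: H_pos nat_diff_distrib)
    also have "\<dots> = (\<Sum>m=n..D. 2 * (p (m - n) * e m))"
      using that by (intro sum.mono_neutral_right) (auto intro!: e0)
    finally show ?thesis by (simp add: sum_distrib_left)
  qed
  have neg: "(\<Sum>j\<in>{-B..k}. H j) = (\<Sum>j\<in>{0..int D}. H j)"
    by (rule sum.reindex_bij_witness[of _ "\<lambda>j. k - j" "\<lambda>j. k - j"]) (auto simp: H_sym[unfolded k_def] B_def k_def)
  have mid: "(\<Sum>j\<in>{k+1..-1}. H j) = (\<Sum>i=1..n-1. e2 (n - i) i)"
    by (rule sum.reindex_bij_witness[of _ "\<lambda>i. - int i" "\<lambda>j. nat (- j)"])
      (auto simp: H_def e2_def k_def of_nat_diff minus_diff_commute)
  have "{-B..B} = {-B..k} \<union> ({k+1..-1} \<union> {0..int (D + n)})"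
    using assms(1) by (auto simp: B_def k_def)
  then have "(\<Sum>j\<in>{-B..B}. H j) = (\<Sum>j\<in>{-B..k}. H j) + ((\<Sum>j\<in>{k+1..-1}. H j) + (\<Sum>j\<in>{0..int (D + n)}. H j))"
    using assms(1) by (subst sum.union_disjoint[symmetric], auto simp: k_def)+
  also have "\<dots> = (\<Sum>i=1..n-1. e2 (n - i) i) + 4 * (\<Sum>m=n..D. p (m - n) * e m)"
    unfolding neg mid by (simp only: pos[of D] pos[of "D + n"] le_add1 add_leD1) (simp add: pos)
  finally have "(\<Sum>j\<in>{-B..B}. H j) / 4 = (\<Sum>i=1..n-1. e2 (n - i) i) / 4 + (\<Sum>m=n..D. p (m - n) * e m)"
    by (simp add: add_divide_distrib)
  moreover have "vir_L \<kappa> \<beta> k (ucoef z) \<nu> = (\<Sum>j\<in>{-B..B}. H j) / 4 - of_real (alpha0 \<kappa> * of_int (k + 1)) * e n"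
    unfolding H_def e_def k_def[symmetric] using assms(1,2)
    by (intro vir_L_eq_sum) (auto simp: B_def k_def)
  moreover have "complex_of_real (alpha0 \<kappa> * of_int (k + 1)) = - of_real (alpha0 \<kappa> * (real n - 1))"
    by (simp add: k_def algebra_simps)
  ultimately show ?thesis by (simp add: k_def)
qed

lemma geometric_difference:
  fixes x y :: complex
  assumes "x \<noteq> y" "m \<ge> 1"
  shows "(x ^ (m - 1) - y ^ (m - 1)) / (x - y) = (\<Sum>n=2..m. x ^ (n - 2) * y ^ (m - n))"
proof (cases "m \<ge> 2")
  case True
  then obtain r where m: "m = r + 2" by (metis le_Suc_ex add.commute)
  have "(\<Sum>n=2..m. x ^ (n - 2) * y ^ (m - n)) = (\<Sum>p<Suc r. x ^ p * y ^ (r - p))"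
    by (rule sum.reindex_bij_witness[of _ "\<lambda>p. p + 2" "\<lambda>n. n - 2"]) (auto simp: m)
  then show ?thesis
    using diff_power_eq_sum[of x r y] assms(1) by (simp add: m del: sum.lessThan_Suc)
next
  case False
  with assms have "m = 1" by simp
  then show ?thesis by simp
qed

section \<open>Power sums and the derivatives of the state\<close>

text \<open>Weighted power sums of x and the y_K: divided by n they are the exponents of U^- at
  a_{-n}, and n = 0 gives the charge \<beta>.\<close>

definition usym :: "real \<Rightarrow> nat \<Rightarrow> (nat \<Rightarrow> real) \<Rightarrow> (int \<Rightarrow> complex) \<Rightarrow> nat \<Rightarrow> complex" where
  "usym \<alpha> M \<alpha>s s n = of_real \<alpha> * s 0 ^ n + (\<Sum>K=1..M. of_real (\<alpha>s K) * s (int K) ^ n)"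

definition ustate :: "real \<Rightarrow> nat \<Rightarrow> (nat \<Rightarrow> real) \<Rightarrow> (int \<Rightarrow> complex) \<Rightarrow> fock" where
  "ustate \<alpha> M \<alpha>s s = ucoef (\<lambda>n. usym \<alpha> M \<alpha>s s n / of_nat n)"

lemma usym_polyfun: "(\<lambda>s. usym \<alpha> M \<alpha>s s n) \<in> polyfun {0..int M}"
  unfolding usym_def
  by (intro polyfun.add polyfun_sum polyfun_cmult polyfun_power polyfun.coord) auto

lemma ustate_polyfun: "(\<lambda>s. ustate \<alpha> M \<alpha>s s \<nu>) \<in> polyfun {0..int M}"
  unfolding ustate_def by (intro ucoef_polyfun polyfun_divide usym_polyfun)

lemma pdiff_coord_power: "pdiff i (\<lambda>s. s j ^ n) s = (if i = j then of_nat n * s i ^ (n - 1) else 0)"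
proof (rule pdiff_eqI)
  show "((\<lambda>c. (s(i := c)) j ^ n) has_field_derivative (if i = j then of_nat n * s i ^ (n - 1) else 0)) (at (s i))"
    by (cases "i = j") (auto intro!: derivative_eq_intros)
qed

lemma polyfun_coord_power: "(\<lambda>s. s j ^ n) \<in> polyfun UNIV"
  by (intro polyfun_power polyfun.coord) simp

lemma pdiff_usym:
  assumes "n \<ge> 1"
  shows "pdiff i (\<lambda>s. usym \<alpha> M \<alpha>s s n / of_nat n) s =
    (if i = 0 then of_real \<alpha> * s 0 ^ (n - 1) else if i \<in> {1..int M} then of_real (\<alpha>s (nat i)) * s i ^ (n - 1) else 0)"
proof -
  have "pdiff i (\<lambda>s. usym \<alpha> M \<alpha>s s n / of_nat n) s = pdiff i (\<lambda>s. (1 / of_nat n) * usym \<alpha> M \<alpha>s s n) s"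
    by simp
  also have "\<dots> = (1 / of_nat n) * pdiff i (\<lambda>s. usym \<alpha> M \<alpha>s s n) s"
    by (rule pdiff_cmult[OF usym_polyfun])
  also have "pdiff i (\<lambda>s. usym \<alpha> M \<alpha>s s n) s = pdiff i (\<lambda>s. of_real \<alpha> * s 0 ^ n) s
      + pdiff i (\<lambda>s. \<Sum>K=1..M. of_real (\<alpha>s K) * s (int K) ^ n) s"
    unfolding usym_def
    by (rule pdiff_add) (auto intro!: polyfun_sum polyfun_cmult polyfun_coord_power)
  also have "pdiff i (\<lambda>s. \<Sum>K=1..M. of_real (\<alpha>s K) * s (int K) ^ n) s = (\<Sum>K=1..M. of_real (\<alpha>s K) * pdiff i (\<lambda>s. s (int K) ^ n) s)"
    by (subst pdiff_sum[where I = UNIV])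
      (auto intro!: polyfun_cmult polyfun_coord_power sum.cong pdiff_cmult[OF polyfun_coord_power])
  also have "pdiff i (\<lambda>s. of_real \<alpha> * s 0 ^ n) s = of_real \<alpha> * pdiff i (\<lambda>s. s 0 ^ n) s"
    by (rule pdiff_cmult[OF polyfun_coord_power])
  also have "(\<Sum>K=1..M. of_real (\<alpha>s K) * pdiff i (\<lambda>s. s (int K) ^ n) s)
      = (\<Sum>K=1..M. if K = nat i \<and> i \<ge> 1 then of_real (\<alpha>s (nat i)) * (of_nat n * s i ^ (n - 1)) else 0)"
    by (intro sum.cong) (auto simp: pdiff_coord_power)
  also have "\<dots> = (if i \<in> {1..int M} then of_real (\<alpha>s (nat i)) * (of_nat n * s i ^ (n - 1)) else 0)"
    by (cases "i \<ge> 1") (auto simp: sum.delta)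
  finally show ?thesis
    using assms by (auto simp: pdiff_coord_power)
qed


lemma pdiff_ustate:
  assumes "mdeg \<nu> \<le> int N"
  shows "pdiff i (\<lambda>s. ustate \<alpha> M \<alpha>s s \<nu>) s = (\<Sum>n=1..N. (if i = 0 then of_real \<alpha> * s 0 ^ (n - 1)
      else if i \<in> {1..int M} then of_real (\<alpha>s (nat i)) * s i ^ (n - 1) else 0) * heis \<gamma> (- int n) (ustate \<alpha> M \<alpha>s s) \<nu>)"
  unfolding ustate_def
  by (subst pdiff_ucoef[OF polyfun_divide[OF usym_polyfun] assms, where \<gamma> = \<gamma>])
    (auto intro!: sum.cong simp: pdiff_usym)

lemma pdiff_heis_ustate:
  assumes "n \<ge> 1"
  shows "pdiff i (\<lambda>s. heis \<gamma> (- int n) (ustate \<alpha> M \<alpha>s s) \<nu>) s = heis \<gamma> (- int n) (\<lambda>\<mu>. pdiff i (\<lambda>s. ustate \<alpha> M \<alpha>s s \<mu>) s) \<nu>"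
  using assms by (cases "n \<in># \<nu>") (simp_all add: heis_neg pdiff_const)

lemma heis_ustate_polyfun:
  assumes "n \<ge> 1"
  shows "(\<lambda>s. heis \<gamma> (- int n) (ustate \<alpha> M \<alpha>s s) \<nu>) \<in> polyfun {0..int M}"
  using assms by (cases "n \<in># \<nu>") (simp_all add: heis_neg ustate_polyfun polyfun.const)

text \<open>Differentiating the coefficient \<alpha> x^(n-1) gives the simple sum, differentiating
  the state once more the double sum. At n = 1 the truncated exponent n - 2 is harmless because of
  the factor n - 1.\<close>

lemma pdiff2_ustate:
  assumes "mdeg \<nu> \<le> int N"
  shows "pdiff 0 (pdiff 0 (\<lambda>s. ustate \<alpha> M \<alpha>s s \<nu>)) s =
    (\<Sum>n=1..N. of_real \<alpha> * of_nat (n - 1) * s 0 ^ (n - 2) * heis \<gamma> (- int n) (ustate \<alpha> M \<alpha>s s) \<nu>) +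
    (\<Sum>a=1..N. \<Sum>b=1..N. of_real (\<alpha>\<^sup>2) * (s 0 ^ (a - 1) * s 0 ^ (b - 1)) *
       heis \<gamma> (- int a) (heis \<gamma> (- int b) (ustate \<alpha> M \<alpha>s s)) \<nu>)"
proof -
  define U where "U = ustate \<alpha> M \<alpha>s"
  have one: "pdiff 0 (\<lambda>s. U s \<nu>) s = (\<Sum>n=1..N. (of_real \<alpha> * s 0 ^ (n - 1)) * heis \<gamma> (- int n) (U s) \<nu>)"
    if "mdeg \<nu> \<le> int N" for s \<nu>
    unfolding U_def by (subst pdiff_ustate[OF that, where \<gamma> = \<gamma>]) simp
  have pol: "(\<lambda>s. of_real \<alpha> * s 0 ^ (n - 1)) \<in> polyfun {0..int M}" for n
    by (intro polyfun_cmult polyfun_power polyfun.coord) simp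
  have heis_pol: "(\<lambda>s. heis \<gamma> (- int n) (U s) \<nu>) \<in> polyfun {0..int M}" if "n \<in> {1..N}" for n \<nu>
    unfolding U_def using that by (intro heis_ustate_polyfun) simp
  have "pdiff 0 (pdiff 0 (\<lambda>s. U s \<nu>)) s = pdiff 0 (\<lambda>s. \<Sum>n=1..N. (of_real \<alpha> * s 0 ^ (n - 1)) * heis \<gamma> (- int n) (U s) \<nu>) s"
    by (rule arg_cong[where f = "\<lambda>p. pdiff 0 p s"], rule ext, rule one[OF assms])
  also have "\<dots> = (\<Sum>n=1..N. pdiff 0 (\<lambda>s. (of_real \<alpha> * s 0 ^ (n - 1)) * heis \<gamma> (- int n) (U s) \<nu>) s)"
    by (rule pdiff_sum[where I = "{0..int M}"]) (rule polyfun.mult[OF pol heis_pol])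
  also have "\<dots> = (\<Sum>n=1..N. of_real \<alpha> * of_nat (n - 1) * s 0 ^ (n - 2) * heis \<gamma> (- int n) (U s) \<nu> +
     (\<Sum>b=1..N. of_real (\<alpha>\<^sup>2) * (s 0 ^ (n - 1) * s 0 ^ (b - 1)) * heis \<gamma> (- int n) (heis \<gamma> (- int b) (U s)) \<nu>))"
  proof (rule sum.cong[OF refl])
    fix n assume n: "n \<in> {1..N}"
    then have n1: "n \<ge> 1" by simp
    have a: "pdiff 0 (\<lambda>s. of_real \<alpha> * s 0 ^ (n - 1)) s = of_real \<alpha> * (of_nat (n - 1) * s 0 ^ (n - 2))"
      by (subst pdiff_cmult[OF polyfun_coord_power]) (simp add: pdiff_coord_power numeral_2_eq_2)
    have "pdiff 0 (\<lambda>s. heis \<gamma> (- int n) (U s) \<nu>) s = heis \<gamma> (- int n) (\<lambda>\<mu>. pdiff 0 (\<lambda>s. U s \<mu>) s) \<nu>"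
      unfolding U_def by (rule pdiff_heis_ustate[OF n1])
    also have "\<dots> = heis \<gamma> (- int n) (\<lambda>\<nu>. \<Sum>b=1..N. (of_real \<alpha> * s 0 ^ (b - 1)) * heis \<gamma> (- int b) (U s) \<nu>) \<nu>"
    proof (rule agree_atD[OF heis_agree_at[of False "mdeg \<nu>"]])
      show "agree_at False (mdeg \<nu> + - int n) (\<lambda>\<mu>. pdiff 0 (\<lambda>s. U s \<mu>) s)
          (\<lambda>\<nu>. \<Sum>b=1..N. (of_real \<alpha> * s 0 ^ (b - 1)) * heis \<gamma> (- int b) (U s) \<nu>)"
        using assms one by (simp add: agree_at_def del: One_nat_def)
    qed auto
    also have "\<dots> = (\<Sum>b=1..N. (of_real \<alpha> * s 0 ^ (b - 1)) * heis \<gamma> (- int n) (heis \<gamma> (- int b) (U s)) \<nu>)"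
      by (simp only: heis_linear_simps)
    finally have b: "pdiff 0 (\<lambda>s. heis \<gamma> (- int n) (U s) \<nu>) s =
        (\<Sum>b=1..N. (of_real \<alpha> * s 0 ^ (b - 1)) * heis \<gamma> (- int n) (heis \<gamma> (- int b) (U s)) \<nu>)" .
    show "pdiff 0 (\<lambda>s. (of_real \<alpha> * s 0 ^ (n - 1)) * heis \<gamma> (- int n) (U s) \<nu>) s =
       of_real \<alpha> * of_nat (n - 1) * s 0 ^ (n - 2) * heis \<gamma> (- int n) (U s) \<nu> +
       (\<Sum>b=1..N. of_real (\<alpha>\<^sup>2) * (s 0 ^ (n - 1) * s 0 ^ (b - 1)) * heis \<gamma> (- int n) (heis \<gamma> (- int b) (U s)) \<nu>)"
      unfolding pdiff_mult[OF pol heis_pol[OF n]] a b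
      by (simp add: sum_distrib_left power2_eq_square mult_ac)
  qed
  finally show ?thesis by (simp add: U_def sum.distrib)
qed

text \<open>This is the level-two degeneracy of the boundary condition changing field at \<open>x\<close>; it holds on
  the whole Fock space state, without the factor \<open>Z\<close>, since the singular terms combine to difference
  quotients.\<close>

lemma ustate_null_vector:
  assumes \<kappa>: "\<kappa> > 0" and \<alpha>: "\<alpha> = 1 / sqrt \<kappa>" and \<alpha>s: "\<And>K. \<alpha>s K = \<rho> K / (2 * sqrt \<kappa>)"
    and \<beta>: "\<beta> = \<alpha> + (\<Sum>K=1..M. \<alpha>s K)"
    and ne: "\<And>K. K \<in> {1..M} \<Longrightarrow> s 0 \<noteq> s (int K)" and D: "mdeg \<nu> = int D"
  defines "U \<equiv> ustate \<alpha> M \<alpha>s"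
  shows "of_real (\<kappa> / 2) * pdiff 0 (pdiff 0 (\<lambda>s. U s \<nu>)) s
      + (\<Sum>K=1..M. of_real (\<rho> K) / (s 0 - s (int K))) * pdiff 0 (\<lambda>s. U s \<nu>) s
      + (\<Sum>K=1..M. 2 / (s (int K) - s 0) * pdiff (int K) (\<lambda>s. U s \<nu>) s)
    = 2 * (\<Sum>n=2..D. s 0 ^ (n - 2) * vir_L \<kappa> \<beta> (- int n) (U s) \<nu>)"
proof -
  define x where "x = s 0"
  define e where "e = (\<lambda>m. heis \<beta> (- int m) (U s) \<nu>)"
  define e2 where "e2 = (\<lambda>a b. heis \<beta> (- int a) (heis \<beta> (- int b) (U s)) \<nu>)"
  define p where "p = usym \<alpha> M \<alpha>s s"
  define q where "q = (\<lambda>K m. \<Sum>n=2..m. x ^ (n - 2) * s (int K) ^ (m - n))"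
  define S2 where "S2 = (\<Sum>a=1..D. \<Sum>b=1..D. (x ^ (a - 1) * x ^ (b - 1)) * e2 a b)"
  have sq: "sqrt \<kappa> > 0" "sqrt \<kappa> * sqrt \<kappa> = \<kappa>" using \<kappa> by auto
  have D': "mdeg \<nu> \<le> int D" using D by simp
  have e2_0: "e2 a b = 0" if "a + b > D" for a b
  proof -
    have "agree_at False (int D) (heis \<beta> (- int a) (heis \<beta> (- int b) (U s))) (heis \<beta> (- int a) (\<lambda>_. 0))"
      by (rule heis_agree_at) (use that heis_vanishes in \<open>auto simp: agree_at_def\<close>)
    then show ?thesis
      unfolding e2_def using D by (auto dest!: agree_atD[where \<mu> = \<nu>] simp: heis_linear_simps)
  qed
  have e2_D: "e2 a b \<noteq> 0 \<Longrightarrow> a + b \<le> D" for a b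
    using e2_0[of a b] by linarith
  have p0: "p 0 = of_real \<beta>" by (simp add: p_def usym_def \<beta>)
  have L: "vir_L \<kappa> \<beta> (- int n) (U s) \<nu> =
     (\<Sum>i=1..n-1. e2 (n - i) i) / 4 + (\<Sum>m=n..D. p (m - n) * e m) + of_real (alpha0 \<kappa> * (real n - 1)) * e n"
    if "n \<ge> 1" for n
    unfolding e_def e2_def U_def ustate_def
    by (rule vir_L_ucoef[OF that D]) (auto simp: p_def[symmetric] p0)
  \<comment> \<open>The pairs of creation operators regrouped by a + b = n; the power of x
    factorises accordingly.\<close>
  have S2': "(\<Sum>n=2..D. x ^ (n - 2) * (\<Sum>i=1..n-1. e2 (n - i) i)) = S2"
  proof -
    have "(\<Sum>n=2..D. x ^ (n - 2) * (\<Sum>i=1..n-1. e2 (n - i) i))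
        = (\<Sum>(n, i)\<in>Sigma {2..D} (\<lambda>n. {1..n-1}). x ^ (n - 2) * e2 (n - i) i)"
      by (simp add: sum.Sigma sum_distrib_left)
    also have "\<dots> = (\<Sum>(a, b)\<in>{(a, b). a \<in> {1..D} \<and> b \<in> {1..D} \<and> a + b \<le> D}. (x ^ (a - 1) * x ^ (b - 1)) * e2 a b)"
      by (rule sum.reindex_bij_witness[of _ "\<lambda>(a, b). (a + b, b)" "\<lambda>(n, i). (n - i, i)"])
        (auto simp: numeral_2_eq_2 simp flip: power_add)
    also have "\<dots> = (\<Sum>(a, b)\<in>{1..D} \<times> {1..D}. (x ^ (a - 1) * x ^ (b - 1)) * e2 a b)"
      by (rule sum.mono_neutral_left) (auto dest: e2_D)
    also have "\<dots> = S2" unfolding S2_def by (simp add: sum.cartesian_product)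
    finally show ?thesis .
  qed
  \<comment> \<open>After exchanging the sums over n and m, the contribution of x to p no longer
    depends on n and is counted m - 1 times, while that of y_K adds up to the difference quotient
    q.\<close>
  have pe: "(\<Sum>n=2..D. x ^ (n - 2) * (\<Sum>m=n..D. p (m - n) * e m))
      = (\<Sum>m=1..D. (of_real \<alpha> * of_nat (m - 1) * x ^ (m - 2) + (\<Sum>K=1..M. of_real (\<alpha>s K) * q K m)) * e m)"
  proof -
    have "(\<Sum>n=2..D. x ^ (n - 2) * (\<Sum>m=n..D. p (m - n) * e m))
        = (\<Sum>(n, m)\<in>Sigma {2..D} (\<lambda>n. {n..D}). x ^ (n - 2) * (p (m - n) * e m))"
      by (simp add: sum.Sigma sum_distrib_left)
    also have "\<dots> = (\<Sum>(m, n)\<in>Sigma {1..D} (\<lambda>m. {2..m}). x ^ (n - 2) * (p (m - n) * e m))"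
      by (rule sum.reindex_bij_witness[of _ "\<lambda>(m, n). (n, m)" "\<lambda>(n, m). (m, n)"]) auto
    also have "\<dots> = (\<Sum>m=1..D. (\<Sum>n=2..m. x ^ (n - 2) * p (m - n)) * e m)"
      by (simp add: sum.Sigma[symmetric] sum_distrib_right mult.assoc)
    finally have outer: "(\<Sum>n=2..D. x ^ (n - 2) * (\<Sum>m=n..D. p (m - n) * e m))
        = (\<Sum>m=1..D. (\<Sum>n=2..m. x ^ (n - 2) * p (m - n)) * e m)" .
    have "(\<Sum>n=2..m. x ^ (n - 2) * p (m - n)) = of_real \<alpha> * of_nat (m - 1) * x ^ (m - 2) + (\<Sum>K=1..M. of_real (\<alpha>s K) * q K m)" for m
    proof -
      have "(\<Sum>n=2..m. x ^ (n - 2) * p (m - n)) = (\<Sum>n=2..m. of_real \<alpha> * x ^ (m - 2) + (\<Sum>K=1..M. of_real (\<alpha>s K) * (x ^ (n - 2) * s (int K) ^ (m - n))))"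
      proof (rule sum.cong[OF refl])
        fix n assume "n \<in> {2..m}"
        then have "x ^ (m - 2) = x ^ (n - 2) * x ^ (m - n)" by (simp flip: power_add)
        then show "x ^ (n - 2) * p (m - n) = of_real \<alpha> * x ^ (m - 2) + (\<Sum>K=1..M. of_real (\<alpha>s K) * (x ^ (n - 2) * s (int K) ^ (m - n)))"
          by (simp add: p_def usym_def x_def[symmetric] distrib_left sum_distrib_left mult_ac)
      qed
      also have "\<dots> = of_nat (card {2..m}) * (of_real \<alpha> * x ^ (m - 2)) + (\<Sum>K=1..M. of_real (\<alpha>s K) * q K m)"
        unfolding q_def by (simp add: sum.distrib sum_distrib_left sum.swap[of _ "{2..m}"])
      finally show ?thesis by (simp add: mult_ac)
    qed
    then show ?thesis unfolding outer by simp
  qed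
  have lin: "(\<Sum>n=2..D. x ^ (n - 2) * (of_real (alpha0 \<kappa> * (real n - 1)) * e n))
      = of_real (alpha0 \<kappa>) * (\<Sum>m=1..D. of_nat (m - 1) * x ^ (m - 2) * e m)"
  proof -
    have "(\<Sum>n=2..D. x ^ (n - 2) * (of_real (alpha0 \<kappa> * (real n - 1)) * e n))
        = (\<Sum>n=2..D. of_real (alpha0 \<kappa>) * (of_nat (n - 1) * x ^ (n - 2) * e n))"
      by (intro sum.cong) (auto simp: of_nat_diff)
    also have "\<dots> = (\<Sum>n=1..D. of_real (alpha0 \<kappa>) * (of_nat (n - 1) * x ^ (n - 2) * e n))"
      by (rule sum.mono_neutral_left) (auto simp: not_le less_Suc_eq numeral_2_eq_2)
    finally show ?thesis by (simp add: sum_distrib_left)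
  qed
  define S1 where "S1 = (\<Sum>m=1..D. of_nat (m - 1) * x ^ (m - 2) * e m)"
  define S3 where "S3 = (\<Sum>m=1..D. (\<Sum>K=1..M. of_real (\<alpha>s K) * q K m) * e m)"
  have rhs: "2 * (\<Sum>n=2..D. x ^ (n - 2) * vir_L \<kappa> \<beta> (- int n) (U s) \<nu>)
      = S2 / 2 + of_real (2 * \<alpha> + 2 * alpha0 \<kappa>) * S1 + 2 * S3"
  proof -
    have "(\<Sum>n=2..D. x ^ (n - 2) * vir_L \<kappa> \<beta> (- int n) (U s) \<nu>) =
      (\<Sum>n=2..D. x ^ (n - 2) * (\<Sum>i=1..n-1. e2 (n - i) i) / 4 + x ^ (n - 2) * (\<Sum>m=n..D. p (m - n) * e m)
         + x ^ (n - 2) * (of_real (alpha0 \<kappa> * (real n - 1)) * e n))"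
      by (intro sum.cong) (simp_all add: L distrib_left)
    also have "\<dots> = S2 / 4 + (of_real \<alpha> * S1 + S3) + of_real (alpha0 \<kappa>) * S1"
    proof -
      have "(\<Sum>m=1..D. (of_real \<alpha> * of_nat (m - 1) * x ^ (m - 2) + (\<Sum>K=1..M. of_real (\<alpha>s K) * q K m)) * e m)
          = of_real \<alpha> * S1 + S3"
        by (simp only: S1_def S3_def distrib_right sum.distrib sum_distrib_left mult.assoc)
      then show ?thesis
        unfolding sum.distrib lin pe S2' sum_divide_distrib[symmetric] by (simp only: S1_def)
    qed
    finally show ?thesis by (simp add: algebra_simps)
  qed
  have d2: "pdiff 0 (pdiff 0 (\<lambda>s. U s \<nu>)) s = of_real \<alpha> * S1 + of_real (\<alpha>\<^sup>2) * S2"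
    unfolding U_def pdiff2_ustate[OF D', where \<gamma> = \<beta>] S1_def S2_def e_def e2_def x_def
    by (simp add: sum_distrib_left mult_ac)
  have d1: "pdiff 0 (\<lambda>s. U s \<nu>) s = (\<Sum>m=1..D. of_real \<alpha> * x ^ (m - 1) * e m)"
    unfolding U_def by (subst pdiff_ustate[OF D', where \<gamma> = \<beta>]) (simp add: e_def x_def U_def)
  have dK: "pdiff (int K) (\<lambda>s. U s \<nu>) s = (\<Sum>m=1..D. of_real (\<alpha>s K) * s (int K) ^ (m - 1) * e m)" if "K \<in> {1..M}" for K
    unfolding U_def using that by (subst pdiff_ustate[OF D', where \<gamma> = \<beta>]) (simp add: e_def U_def)
  \<comment> \<open>This relation between the force on X and the charge of Y^K combines the two
    poles at x = y_K into a difference quotient.\<close>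
  have \<rho>: "of_real (\<rho> K) * of_real \<alpha> = (2 * of_real (\<alpha>s K) :: complex)" for K
  proof -
    have "\<rho> K * \<alpha> = 2 * \<alpha>s K" by (simp add: \<alpha> \<alpha>s)
    from arg_cong[OF this, of complex_of_real] show ?thesis by simp
  qed
  have K: "of_real (\<rho> K) / (s 0 - s (int K)) * pdiff 0 (\<lambda>s. U s \<nu>) s + 2 / (s (int K) - s 0) * pdiff (int K) (\<lambda>s. U s \<nu>) s
      = 2 * (\<Sum>m=1..D. of_real (\<alpha>s K) * q K m * e m)" if K: "K \<in> {1..M}" for K
  proof -
    define d where "d = s 0 - s (int K)"
    have d: "d \<noteq> 0" "s (int K) - s 0 = - d" using ne[OF K] by (simp_all add: d_def)
    have "of_real (\<rho> K) / d * (of_real \<alpha> * x ^ (m - 1) * e m) + 2 / (- d) * (of_real (\<alpha>s K) * s (int K) ^ (m - 1) * e m)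
       = 2 * (of_real (\<alpha>s K) * q K m * e m)" if "m \<in> {1..D}" for m
    proof -
      define X Y where "X = x ^ (m - 1) / d" and "Y = s (int K) ^ (m - 1) / d"
      have q: "q K m = X - Y"
        unfolding q_def X_def Y_def diff_divide_distrib[symmetric] unfolding d_def x_def
        using that ne[OF K] by (intro geometric_difference[symmetric]) auto
      have "of_real (\<rho> K) / d * (of_real \<alpha> * x ^ (m - 1) * e m) = (of_real (\<rho> K) * of_real \<alpha>) * X * e m"
        by (simp add: X_def)
      moreover have "2 / (- d) * (of_real (\<alpha>s K) * s (int K) ^ (m - 1) * e m) = - (2 * of_real (\<alpha>s K) * Y * e m)"
        by (simp add: Y_def)
      ultimately show ?thesis
        unfolding \<rho> q by (simp only: algebra_simps) simp
    qed
    then show ?thesis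
      unfolding d(2) d1 dK[OF K] d_def[symmetric] sum_distrib_left sum.distrib[symmetric] by (intro sum.cong) auto
  qed
  have "(\<Sum>K=1..M. of_real (\<rho> K) / (s 0 - s (int K))) * pdiff 0 (\<lambda>s. U s \<nu>) s
      + (\<Sum>K=1..M. 2 / (s (int K) - s 0) * pdiff (int K) (\<lambda>s. U s \<nu>) s)
      = (\<Sum>K=1..M. 2 * (\<Sum>m=1..D. of_real (\<alpha>s K) * q K m * e m))"
    unfolding sum_distrib_right sum.distrib[symmetric] by (rule sum.cong[OF refl]) (rule K)
  also have "\<dots> = 2 * S3"
    unfolding S3_def sum_distrib_left[symmetric] sum_distrib_right by (subst sum.swap) simp
  finally have fo: "(\<Sum>K=1..M. of_real (\<rho> K) / (s 0 - s (int K))) * pdiff 0 (\<lambda>s. U s \<nu>) s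
      + (\<Sum>K=1..M. 2 / (s (int K) - s 0) * pdiff (int K) (\<lambda>s. U s \<nu>) s) = 2 * S3" .
  \<comment> \<open>The degeneracy conditions at level two: here the values of \<alpha> and
    \<open>alpha0\<close> enter.\<close>
  have c1: "\<kappa> / 2 * \<alpha> = 2 * \<alpha> + 2 * alpha0 \<kappa>" "\<kappa> / 2 * \<alpha>\<^sup>2 = 1 / 2"
    using sq \<kappa> by (simp_all add: \<alpha> alpha0_def field_simps power2_eq_square)
  have "of_real (\<kappa> / 2) * pdiff 0 (pdiff 0 (\<lambda>s. U s \<nu>)) s = of_real (\<kappa> / 2 * \<alpha>) * S1 + of_real (\<kappa> / 2 * \<alpha>\<^sup>2) * S2"
    unfolding d2 by (simp add: algebra_simps)
  then have so: "of_real (\<kappa> / 2) * pdiff 0 (pdiff 0 (\<lambda>s. U s \<nu>)) s = of_real (2 * \<alpha> + 2 * alpha0 \<kappa>) * S1 + S2 / 2"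
    unfolding c1 by simp
  show ?thesis
    using rhs fo so unfolding x_def by (simp only: add.assoc) (simp only: add_ac)
qed

section \<open>The generator annihilates the state\<close>

lemma is_G_series: "is_G G \<Longrightarrow> G f \<in> vir_series"
  by (simp add: is_G_def)

text \<open>Polynomiality confines G to the coordinates m \<le> -2. The other entries are
  unspecified in the coefficients of g, and in the state they hold X and Y.\<close>

lemma is_G_cong:
  assumes "is_G G" "\<And>m. m \<le> -2 \<Longrightarrow> f m = f' m"
  shows "G f = G f'"
proof
  fix w
  obtain I where "I \<subseteq> {..-2}" "(\<lambda>f. G f w) \<in> polyfun I"
    using poly_coeffs_polyfun[of "\<lambda>f. G f w"] assms(1) by (auto simp: is_G_def)
  then show "G f w = G f' w"
    using polyfun_cong[of "\<lambda>f. G f w" I f f'] assms(2) by auto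
qed

text \<open>Up to a given degree there are finitely many words, so finitely many variables serve all
  of them at once.\<close>

lemma is_G_support:
  assumes "is_G G"
  obtains N :: nat where "\<And>n w. n \<ge> N \<Longrightarrow> w \<in> vir_words D \<Longrightarrow> (\<lambda>f. G f w) \<in> polyfun {- 1 - int n..-2}"
proof -
  have "\<exists>I. finite I \<and> I \<subseteq> {..-2} \<and> (\<lambda>f. G f w) \<in> polyfun I" for w
    using poly_coeffs_polyfun[of "\<lambda>f. G f w"] assms by (auto simp: is_G_def)
  then obtain I where I: "\<And>w. finite (I w)" "\<And>w. I w \<subseteq> {..-2}" "\<And>w. (\<lambda>f. G f w) \<in> polyfun (I w)"
    by metis
  define J where "J = (\<Union>w\<in>vir_words D. I w)"
  have "finite J"
    unfolding J_def by (intro finite_UN_I finite_vir_words I)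
  then obtain b where b: "\<And>i. i \<in> J \<Longrightarrow> b \<le> i"
    by (meson Min_le)
  show thesis
  proof (rule that)
    fix n w assume n: "n \<ge> nat (- b)" and w: "w \<in> vir_words D"
    have "- 1 - int n \<le> i \<and> i \<le> - 2" if "i \<in> I w" for i
    proof -
      have "b \<le> i" using b[of i] w that unfolding J_def by blast
      then show ?thesis using n that I(2)[of w] by auto
    qed
    then show "(\<lambda>f. G f w) \<in> polyfun {- 1 - int n..-2}"
      by (intro polyfun_mono[OF I(3)]) auto
  qed
qed

lemma vir_word_polyfun:
  assumes "\<And>\<mu>. (\<lambda>s. u s \<mu>) \<in> polyfun I" "w \<in> vir_words D" "0 \<notin># \<nu>"
  shows "(\<lambda>s. foldr (vir_L \<kappa> \<gamma>) w (u s) \<nu>) \<in> polyfun I"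
    and "pdiff i (\<lambda>s. foldr (vir_L \<kappa> \<gamma>) w (u s) \<nu>) s = foldr (vir_L \<kappa> \<gamma>) w (\<lambda>\<mu>. pdiff i (\<lambda>s. u s \<mu>) s) \<nu>"
proof -
  have expand: "foldr (vir_L \<kappa> \<gamma>) w f \<nu> =
    (\<Sum>\<mu> | 0 \<notin># \<mu> \<and> mdeg \<mu> = mdeg \<nu> + sum_list w. foldr (vir_L \<kappa> \<gamma>) w (fock_basis \<mu>) \<nu> * f \<mu>)" for f
    by (rule vir_word_coeff_expansion) (use assms in \<open>auto simp: vir_words_def\<close>)
  have 1: "(\<lambda>s. foldr (vir_L \<kappa> \<gamma>) w (u s) \<nu>) = (\<lambda>s. \<Sum>\<mu> | 0 \<notin># \<mu> \<and> mdeg \<mu> = mdeg \<nu> + sum_list w.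
      foldr (vir_L \<kappa> \<gamma>) w (fock_basis \<mu>) \<nu> * u s \<mu>)"
    by (rule ext) (rule expand)
  show "(\<lambda>s. foldr (vir_L \<kappa> \<gamma>) w (u s) \<nu>) \<in> polyfun I"
    unfolding 1 by (intro polyfun_sum polyfun_cmult assms)
  show "pdiff i (\<lambda>s. foldr (vir_L \<kappa> \<gamma>) w (u s) \<nu>) s = foldr (vir_L \<kappa> \<gamma>) w (\<lambda>\<mu>. pdiff i (\<lambda>s. u s \<mu>) s) \<nu>"
    unfolding 1 expand[of "\<lambda>\<mu>. pdiff i (\<lambda>s. u s \<mu>) s"]
    by (subst pdiff_sum[where I = I]) (auto intro!: polyfun_cmult assms sum.cong pdiff_cmult[OF assms(1)])
qed

text \<open>The derivatives separate: those in x and y meet only the state, because G depends on the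
  negative coordinates, and those in f_m meet only G. Both groups become sums of G L_{-n} U with
  weight 2 x^(n-2), with opposite signs.\<close>

lemma sle_state_generator:
  assumes \<kappa>: "\<kappa> > 0" and \<alpha>: "\<alpha> = 1 / sqrt \<kappa>" and \<alpha>s: "\<And>K. \<alpha>s K = \<rho> K / (2 * sqrt \<kappa>)"
    and \<beta>: "\<beta> = \<alpha> + (\<Sum>K=1..M. \<alpha>s K)" and G: "is_G G" and \<nu>: "0 \<notin># \<nu>"
  defines "p \<equiv> \<lambda>s. vir_action \<kappa> \<beta> (G s) (ustate \<alpha> M \<alpha>s s) \<nu>"
  obtains N :: nat where "p \<in> polyfun ({0..int M} \<union> {- 1 - int N..-2})"
    and "\<And>s. (\<And>K. K \<in> {1..M} \<Longrightarrow> s 0 \<noteq> s (int K)) \<Longrightarrow>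
      of_real (\<kappa> / 2) * pdiff 0 (pdiff 0 p) s
      + (\<Sum>K=1..M. of_real (\<rho> K) / (s 0 - s (int K))) * pdiff 0 p s
      + (\<Sum>K=1..M. 2 / (s (int K) - s 0) * pdiff (int K) p s)
      + (\<Sum>i=1..N. 2 * hcoef (s 0) (\<lambda>i. s (- 1 - int i)) i * pdiff (- 1 - int i) p s) = 0"
proof -
  obtain D where D: "mdeg \<nu> = int D" using mdeg_nonneg[of \<nu>] by (metis nonneg_int_cases)
  obtain N0 where N0: "\<And>n w. n \<ge> N0 \<Longrightarrow> w \<in> vir_words (int D) \<Longrightarrow> (\<lambda>f. G f w) \<in> polyfun {- 1 - int n..-2}"
    using is_G_support[OF G] by metis
  \<comment> \<open>N0 covers the variables of G. D ensures that for each letter k \<ge> - D all m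
    with k \<le> m \<le> -2 occur, so that the residue sum is complete.\<close>
  define N where "N = max N0 D"
  define I where "I = {0..int M} \<union> {- 1 - int N..-2}"
  have GN: "(\<lambda>f. G f w) \<in> polyfun {- 1 - int N..-2}" if "w \<in> vir_words (int D)" for w
    by (rule N0[OF _ that]) (simp add: N_def)
  have GI: "(\<lambda>f. G f w) \<in> polyfun I" if "w \<in> vir_words (int D)" for w
    by (rule polyfun_mono[OF GN[OF that]]) (simp add: I_def)
  have ser: "G s \<in> vir_series" for s by (rule is_G_series[OF G])
  define P where "P = (\<lambda>u s. vir_action \<kappa> \<beta> (G s) (u s) \<nu>)"
  have P: "P u s = (\<Sum>w\<in>vir_words (int D). G s w * foldr (vir_L \<kappa> \<beta>) w (u s) \<nu>)" for u s
    unfolding P_def by (rule vir_action_eq_sum[OF ser]) (simp add: D)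
  have P_poly: "P u \<in> polyfun I" if u: "\<And>\<mu>. (\<lambda>s. u s \<mu>) \<in> polyfun {0..int M}" for u
    unfolding P[abs_def]
    by (intro polyfun_sum polyfun.mult GI polyfun_mono[OF vir_word_polyfun(1)[OF u]] \<nu>) (auto simp: I_def)
  have P_diff_term: "pdiff i (P u) s = (\<Sum>w\<in>vir_words (int D). pdiff i (\<lambda>s. G s w) s * foldr (vir_L \<kappa> \<beta>) w (u s) \<nu>
       + G s w * pdiff i (\<lambda>s. foldr (vir_L \<kappa> \<beta>) w (u s) \<nu>) s)"
    if u: "\<And>\<mu>. (\<lambda>s. u s \<mu>) \<in> polyfun {0..int M}" for u i s
  proof -
    have f: "(\<lambda>s. foldr (vir_L \<kappa> \<beta>) w (u s) \<nu>) \<in> polyfun I" if "w \<in> vir_words (int D)" for w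
      by (rule polyfun_mono[OF vir_word_polyfun(1)[OF u that \<nu>]]) (simp add: I_def)
    have "pdiff i (P u) s = (\<Sum>w\<in>vir_words (int D). pdiff i (\<lambda>s. G s w * foldr (vir_L \<kappa> \<beta>) w (u s) \<nu>) s)"
      unfolding P[abs_def] by (rule pdiff_sum) (rule polyfun.mult[OF GI f])
    also have "\<dots> = (\<Sum>w\<in>vir_words (int D). pdiff i (\<lambda>s. G s w) s * foldr (vir_L \<kappa> \<beta>) w (u s) \<nu>
       + G s w * pdiff i (\<lambda>s. foldr (vir_L \<kappa> \<beta>) w (u s) \<nu>) s)"
      by (rule sum.cong[OF refl]) (rule pdiff_mult[OF GI f])
    finally show ?thesis .
  qed
  have P_diff: "pdiff i (P u) = P (\<lambda>s \<mu>. pdiff i (\<lambda>s. u s \<mu>) s)"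
    if u: "\<And>\<mu>. (\<lambda>s. u s \<mu>) \<in> polyfun {0..int M}" and i: "i \<ge> 0" for u i
  proof
    fix s
    show "pdiff i (P u) s = P (\<lambda>s \<mu>. pdiff i (\<lambda>s. u s \<mu>) s) s"
      unfolding P_diff_term[OF u] P[of "\<lambda>s \<mu>. pdiff i (\<lambda>s. u s \<mu>) s"]
    proof (rule sum.cong[OF refl])
      fix w assume w: "w \<in> vir_words (int D)"
      have "pdiff i (\<lambda>s. G s w) s = 0"
        by (rule pdiff_outside[OF GN[OF w]]) (use i in auto)
      then show "pdiff i (\<lambda>s. G s w) s * foldr (vir_L \<kappa> \<beta>) w (u s) \<nu>
          + G s w * pdiff i (\<lambda>s. foldr (vir_L \<kappa> \<beta>) w (u s) \<nu>) s
          = G s w * foldr (vir_L \<kappa> \<beta>) w (\<lambda>\<mu>. pdiff i (\<lambda>s. u s \<mu>) s) \<nu>"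
        by (simp add: vir_word_polyfun(2)[OF u w \<nu>])
    qed
  qed
  define U where "U = ustate \<alpha> M \<alpha>s"
  have U: "(\<lambda>s. U s \<mu>) \<in> polyfun {0..int M}" for \<mu>
    unfolding U_def by (rule ustate_polyfun)
  have p: "p = P U" by (simp add: p_def P_def U_def)
  define A where "A = (\<lambda>s k. vir_action \<kappa> \<beta> (G s) (vir_L \<kappa> \<beta> k (U s)) \<nu>)"
  \<comment> \<open>The equation of \<open>is_G\<close> holds up to \<open>vir_eq\<close>, so it is
    read after acting on the state, where the right factor turns into a sum over letters.\<close>
  have neg: "pdiff m p s = - (\<Sum>k\<in>{- int D..-1}. (if k \<le> m then G_residue s m k else 0) * A s k)" if m: "m \<le> -2" for m s
  proof -
    define r where "r = (\<lambda>v :: int list. case v of [k] \<Rightarrow> (if k \<le> m then G_residue s m k else 0) | _ \<Rightarrow> 0)"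
    have r1: "r w = 0" if "length w \<noteq> 1" for w
      using that by (auto simp: r_def split: list.splits)
    have rs: "r \<in> vir_series"
      using m by (auto simp: r_def vir_series_def split: list.splits if_splits)
    have dG: "(\<lambda>w. pdiff m (\<lambda>s. G s w) s) \<in> vir_series"
    proof -
      have "pdiff m (\<lambda>s. G s w) s = 0" if "\<not> (\<forall>k\<in>set w. k < 0)" for w
      proof -
        have "G s w = 0" for s using that ser[of s] by (auto simp: vir_series_def)
        then show ?thesis by (simp add: pdiff_const)
      qed
      then show ?thesis by (auto simp: vir_series_def)
    qed
    have mser: "vir_mult (G s) r \<in> vir_series"
      by (rule vir_mult_single_series[OF ser rs r1])
    have mm: "(\<lambda>w. - vir_mult (G s) r w) \<in> vir_series"
      using mser by (auto simp: vir_series_def)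
    have "pdiff m p s = (\<Sum>w\<in>vir_words (int D). pdiff m (\<lambda>s. G s w) s * foldr (vir_L \<kappa> \<beta>) w (U s) \<nu>)"
      unfolding p P_diff_term[OF U]
    proof (rule sum.cong[OF refl])
      fix w assume w: "w \<in> vir_words (int D)"
      have "pdiff m (\<lambda>s. foldr (vir_L \<kappa> \<beta>) w (U s) \<nu>) s = 0"
        by (rule pdiff_outside[OF vir_word_polyfun(1)[OF U w \<nu>]]) (use m in auto)
      then show "pdiff m (\<lambda>s. G s w) s * foldr (vir_L \<kappa> \<beta>) w (U s) \<nu>
          + G s w * pdiff m (\<lambda>s. foldr (vir_L \<kappa> \<beta>) w (U s) \<nu>) s
        = pdiff m (\<lambda>s. G s w) s * foldr (vir_L \<kappa> \<beta>) w (U s) \<nu>" by simp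
    qed
    also have "\<dots> = vir_action \<kappa> \<beta> (\<lambda>w. pdiff m (\<lambda>s. G s w) s) (U s) \<nu>"
      by (rule vir_action_eq_sum[OF dG, symmetric]) (simp add: D)
    also have "\<dots> = vir_action \<kappa> \<beta> (\<lambda>w. - vir_mult (G s) r w) (U s) \<nu>"
    proof (rule vir_eq_action[OF _ dG mm])
      show "vir_eq (\<lambda>w. pdiff m (\<lambda>s. G s w) s) (\<lambda>w. - vir_mult (G s) r w)"
        using G m unfolding is_G_def pdiff_def r_def by blast
    qed
    also have "\<dots> = - vir_action \<kappa> \<beta> (vir_mult (G s) r) (U s) \<nu>"
      unfolding vir_action_eq_sum[OF mm order_refl] vir_action_eq_sum[OF mser order_refl]
      by (simp add: sum_negf)
    also have "vir_action \<kappa> \<beta> (vir_mult (G s) r) (U s) \<nu> = (\<Sum>k\<in>{- int D..-1}. r [k] * A s k)"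
      unfolding A_def by (rule vir_action_mult_single[OF ser rs r1]) (simp_all add: D)
    finally show ?thesis by (simp add: r_def)
  qed
  show thesis
  proof (rule that[of N])
    show "p \<in> polyfun ({0..int M} \<union> {- 1 - int N..-2})"
      using P_poly[OF U] by (simp add: p I_def)
  next
    fix s :: "int \<Rightarrow> complex" assume ne: "\<And>K. K \<in> {1..M} \<Longrightarrow> s 0 \<noteq> s (int K)"
    define x where "x = s 0"
    define h where "h = (\<lambda>i. hcoef x (\<lambda>i. s (- 1 - int i)) i)"
    define v where "v = (\<Sum>K=1..M. of_real (\<rho> K) / (s 0 - s (int K)))"
    define d where "d = (\<lambda>i \<mu>. pdiff i (\<lambda>s. U s \<mu>) s)"
    define dd where "dd = (\<lambda>\<mu>. pdiff 0 (pdiff 0 (\<lambda>s. U s \<mu>)) s)"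
    note lin = fock_linear_add[OF fock_linear_vir_action[OF ser]] fock_linear_scale[OF fock_linear_vir_action[OF ser]]
      fock_linear_sum[OF fock_linear_vir_action[OF ser]]
    have pd1: "pdiff i p s = vir_action \<kappa> \<beta> (G s) (d i) \<nu>" if "i \<ge> 0" for i
      unfolding p P_diff[OF U that] by (simp add: P_def d_def)
    have pd2: "pdiff 0 (pdiff 0 p) s = vir_action \<kappa> \<beta> (G s) dd \<nu>"
    proof -
      have "pdiff 0 (pdiff 0 p) = P (\<lambda>s \<mu>. pdiff 0 (\<lambda>s. pdiff 0 (\<lambda>s. U s \<mu>) s) s)"
        unfolding p P_diff[OF U order_refl] by (rule P_diff[OF pdiff_polyfun[OF U] order_refl])
      then show ?thesis by (simp add: P_def dd_def)
    qed
    have "of_real (\<kappa> / 2) * pdiff 0 (pdiff 0 p) s + v * pdiff 0 p s + (\<Sum>K=1..M. 2 / (s (int K) - s 0) * pdiff (int K) p s)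
      = vir_action \<kappa> \<beta> (G s) (\<lambda>\<mu>. of_real (\<kappa> / 2) * dd \<mu> + v * d 0 \<mu> + (\<Sum>K=1..M. 2 / (s (int K) - s 0) * d (int K) \<mu>)) \<nu>"
      unfolding pd2 pd1[OF order_refl] by (simp only: lin) (simp add: pd1)
    also have "\<dots> = vir_action \<kappa> \<beta> (G s) (\<lambda>\<mu>. 2 * (\<Sum>n=2..D. x ^ (n - 2) * vir_L \<kappa> \<beta> (- int n) (U s) \<mu>)) \<nu>"
    proof (rule vir_action_agree_at[OF ser _ \<nu>])
      fix \<mu> :: "nat multiset" assume \<mu>: "0 \<notin># \<mu>" "mdeg \<mu> \<le> mdeg \<nu>"
      obtain E where E: "mdeg \<mu> = int E" using mdeg_nonneg[of \<mu>] by (metis nonneg_int_cases)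
      have "of_real (\<kappa> / 2) * dd \<mu> + v * d 0 \<mu> + (\<Sum>K=1..M. 2 / (s (int K) - s 0) * d (int K) \<mu>)
          = 2 * (\<Sum>n=2..E. x ^ (n - 2) * vir_L \<kappa> \<beta> (- int n) (U s) \<mu>)"
        unfolding dd_def d_def v_def x_def U_def by (rule ustate_null_vector[OF \<kappa> \<alpha> \<alpha>s \<beta> ne E])
      \<comment> \<open>The bound E depends on \<mu>. It is raised to the common D because L_{-n}
        gives 0 at coefficients of degree below n.\<close>
      also have "(\<Sum>n=2..E. x ^ (n - 2) * vir_L \<kappa> \<beta> (- int n) (U s) \<mu>) = (\<Sum>n=2..D. x ^ (n - 2) * vir_L \<kappa> \<beta> (- int n) (U s) \<mu>)"
      proof (rule sum.mono_neutral_left)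
        have "vir_L \<kappa> \<beta> (- int n) (U s) \<mu> = 0" if "n \<in> {2..D} - {2..E}" for n
          using vir_word_vanishes[of "[- int n]" \<mu> \<kappa> \<beta> "U s"] that E by auto
        then show "\<forall>n\<in>{2..D} - {2..E}. x ^ (n - 2) * vir_L \<kappa> \<beta> (- int n) (U s) \<mu> = 0" by simp
      qed (use \<mu> D E in auto)
      finally show "of_real (\<kappa> / 2) * dd \<mu> + v * d 0 \<mu> + (\<Sum>K=1..M. 2 / (s (int K) - s 0) * d (int K) \<mu>)
          = 2 * (\<Sum>n=2..D. x ^ (n - 2) * vir_L \<kappa> \<beta> (- int n) (U s) \<mu>)" .
    qed
    also have "\<dots> = 2 * (\<Sum>n=2..D. x ^ (n - 2) * A s (- int n))"
      unfolding A_def by (simp only: lin)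
    finally have first: "of_real (\<kappa> / 2) * pdiff 0 (pdiff 0 p) s + v * pdiff 0 p s
        + (\<Sum>K=1..M. 2 / (s (int K) - s 0) * pdiff (int K) p s) = 2 * (\<Sum>n=2..D. x ^ (n - 2) * A s (- int n))" .
    have "(\<Sum>i=1..N. 2 * h i * pdiff (- 1 - int i) p s)
        = (\<Sum>i=1..N. \<Sum>k\<in>{- int D..-1}. - 2 * ((if k \<le> - 1 - int i then h i * G_residue s (- 1 - int i) k else 0) * A s k))"
    proof (rule sum.cong[OF refl])
      fix i assume "i \<in> {1..N}"
      then have i: "- 1 - int i \<le> - 2" by simp
      show "2 * h i * pdiff (- 1 - int i) p s
          = (\<Sum>k\<in>{- int D..-1}. - 2 * ((if k \<le> - 1 - int i then h i * G_residue s (- 1 - int i) k else 0) * A s k))"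
        unfolding neg[OF i] sum_negf[symmetric] sum_distrib_left by (intro sum.cong[OF refl]) simp
    qed
    also have "\<dots> = (\<Sum>k\<in>{- int D..-1}. - 2 * ((\<Sum>i=1..N. if k \<le> - 1 - int i then h i * G_residue s (- 1 - int i) k else 0) * A s k))"
      by (subst sum.swap) (simp add: sum_distrib_left sum_distrib_right)
    also have "\<dots> = (\<Sum>k\<in>{- int D..-1}. if k \<le> -2 then - 2 * (x ^ nat (- 2 - k) * A s k) else 0)"
    proof (rule sum.cong[OF refl])
      fix k assume k: "k \<in> {- int D..-1}"
      \<comment> \<open>For k = -1 every term is 0, in accordance with n \<ge> 2 in the null vector
        equation.\<close>
      have "(\<Sum>i=1..N. if k \<le> - 1 - int i then h i * G_residue s (- 1 - int i) k else 0) = (if k \<le> -2 then x ^ nat (- 2 - k) else 0)"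
      proof (cases "k \<le> -2")
        case True
        have "(\<Sum>i=1..N. if k \<le> - 1 - int i then h i * G_residue s (- 1 - int i) k else 0)
            = (\<Sum>i\<in>{i\<in>{1..N}. k \<le> - 1 - int i}. h i * G_residue s (- 1 - int i) k)"
          by (rule sum.inter_filter[symmetric]) simp
        also have "\<dots> = (\<Sum>m\<in>{k..-2}. h (nat (- 1 - m)) * G_residue s m k)"
          by (rule sum.reindex_bij_witness[of _ "\<lambda>m. nat (- 1 - m)" "\<lambda>i. - 1 - int i"])
            (use k in \<open>auto simp: N_def\<close>)
        also have "\<dots> = x ^ nat (- 2 - k)"
          unfolding h_def by (rule G_residue_hcoef_sum[OF True])
        finally show ?thesis using True by simp
      next
        case False
        then show ?thesis by (auto intro!: sum.neutral)
      qed
      then show "- 2 * ((\<Sum>i=1..N. if k \<le> - 1 - int i then h i * G_residue s (- 1 - int i) k else 0) * A s k)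
          = (if k \<le> -2 then - 2 * (x ^ nat (- 2 - k) * A s k) else 0)"
        by simp
    qed
    also have "\<dots> = (\<Sum>k\<in>{- int D..-2}. - 2 * (x ^ nat (- 2 - k) * A s k))"
      by (rule sum.mono_neutral_cong_right) auto
    also have "\<dots> = (\<Sum>n=2..D. - 2 * (x ^ (n - 2) * A s (- int n)))"
    proof -
      have "nat (- k) - 2 = nat (- 2 - k)" for k :: int by arith
      then show ?thesis
        by (intro sum.reindex_bij_witness[of _ "\<lambda>n. - int n" "\<lambda>k. nat (- k)"]) auto
    qed
    finally have second: "(\<Sum>i=1..N. 2 * h i * pdiff (- 1 - int i) p s) = (\<Sum>n=2..D. - 2 * (x ^ (n - 2) * A s (- int n)))" .
    show "of_real (\<kappa> / 2) * pdiff 0 (pdiff 0 p) s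
      + (\<Sum>K=1..M. of_real (\<rho> K) / (s 0 - s (int K))) * pdiff 0 p s
      + (\<Sum>K=1..M. 2 / (s (int K) - s 0) * pdiff (int K) p s)
      + (\<Sum>i=1..N. 2 * hcoef (s 0) (\<lambda>i. s (- 1 - int i)) i * pdiff (- 1 - int i) p s) = 0"
      unfolding v_def[symmetric] first second[unfolded h_def x_def]
      by (simp add: sum_distrib_left sum_negf x_def)
  qed
qed

section \<open>Stieltjes clocks and the coefficients of the Loewner flow\<close>

text \<open>The Loewner flow is studied path by path, with one path of the quadratic variation as
  its clock.\<close>

locale clock_path =
  fixes q :: "real \<Rightarrow> real"
  assumes q_continuous: "continuous_on {0..} q" and q_mono: "mono_on {0..} q"
begin

lemma q_le: "0 \<le> a \<Longrightarrow> a \<le> b \<Longrightarrow> q a \<le> q b"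
  using q_mono by (auto simp: mono_on_def)

lemma q_max_continuous: "continuous_on UNIV (\<lambda>s. q (max 0 s))"
  by (rule continuous_on_compose2[OF q_continuous]) (auto intro!: continuous_intros)

lemma sets_stieltjes [simp, measurable_cong]: "sets (stieltjes q) = sets borel"
  and space_stieltjes [simp]: "space (stieltjes q) = UNIV"
  by (simp_all add: stieltjes_def)

lemma emeasure_stieltjes_Ioc:
  assumes "0 \<le> a" "a \<le> b"
  shows "emeasure (stieltjes q) {a<..b} = ennreal (q b - q a)"
proof -
  have "continuous (at_right a) (\<lambda>s. q (max 0 s))" for a
    using q_max_continuous by (auto simp: continuous_on_eq_continuous_at intro: continuous_at_imp_continuous_at_within)
  then show ?thesis
    unfolding stieltjes_def using assms
    by (subst emeasure_interval_measure_Ioc) (auto intro!: q_le)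
qed

lemma emeasure_stieltjes_Icc:
  assumes "0 \<le> a" "a \<le> b"
  shows "emeasure (stieltjes q) {a..b} = ennreal (q b - q a)"
  unfolding stieltjes_def using assms q_max_continuous
  by (subst emeasure_interval_measure_Icc) (auto intro!: q_le)

lemma stieltjes_subset_finite:
  assumes "A \<subseteq> {0..t}" "A \<in> sets borel"
  shows "emeasure (stieltjes q) A < \<infinity>"
proof (cases "0 \<le> t")
  case True
  have "emeasure (stieltjes q) A \<le> emeasure (stieltjes q) {0..t}"
    using assms by (intro emeasure_mono) auto
  then show ?thesis
    by (simp add: emeasure_stieltjes_Icc[OF order_refl True] order_le_less_trans)
qed (use assms in auto)

lemma measure_stieltjes_Ioc: "0 \<le> a \<Longrightarrow> a \<le> b \<Longrightarrow> measure (stieltjes q) {a<..b} = q b - q a"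
  by (simp add: measure_def emeasure_stieltjes_Ioc q_le)

lemma stieltjes_set_integrable:
  fixes f :: "real \<Rightarrow> 'b :: {banach, second_countable_topology}"
  assumes "A \<subseteq> {0..t}" "A \<in> sets borel" "set_borel_measurable borel A f" "\<And>r. r \<in> A \<Longrightarrow> norm (f r) \<le> C"
  shows "set_integrable (stieltjes q) A f"
  unfolding set_integrable_def
proof (rule integrableI_bounded_set[of A _ _ C])
  show "(\<lambda>x. indicator A x *\<^sub>R f x) \<in> borel_measurable (stieltjes q)"
    using assms(3) by (simp add: set_borel_measurable_def)
  show "emeasure (stieltjes q) A < \<infinity>"
    by (rule stieltjes_subset_finite[OF assms(1,2)])
qed (use assms in \<open>auto intro!: AE_I2\<close>)

text \<open>Covers non-integrable f as well, whose integral is 0 by convention.\<close>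

lemma stieltjes_integral_bound:
  fixes f :: "real \<Rightarrow> 'b :: {banach, second_countable_topology}"
  assumes "0 \<le> u" "u \<le> v" "\<And>r. r \<in> {u<..v} \<Longrightarrow> norm (f r) \<le> C" "C \<ge> 0"
  shows "norm (LINT r:{u<..v}|stieltjes q. f r) \<le> C * (q v - q u)"
proof (cases "set_integrable (stieltjes q) {u<..v} f")
  case True
  have "norm (LINT r:{u<..v}|stieltjes q. f r) \<le> (LINT r|stieltjes q. norm (indicator {u<..v} r *\<^sub>R f r))"
    unfolding set_lebesgue_integral_def by (rule integral_norm_bound)
  also have "\<dots> \<le> (LINT r|stieltjes q. indicator {u<..v} r * C)"
  proof (rule integral_mono)
    show "integrable (stieltjes q) (\<lambda>r. norm (indicator {u<..v} r *\<^sub>R f r))"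
      using True unfolding set_integrable_def by (rule integrable_norm)
    have "emeasure (stieltjes q) {u<..v} < \<infinity>"
      using assms by (intro stieltjes_subset_finite[of _ v]) auto
    then show "integrable (stieltjes q) (\<lambda>r. indicator {u<..v} r * C)"
      by (intro integrable_mult_left integrable_real_indicator) auto
  qed (use assms(3) in \<open>auto simp: indicator_def\<close>)
  also have "\<dots> = C * (q v - q u)"
    by (simp add: measure_stieltjes_Ioc[OF assms(1,2)])
  finally show ?thesis .
next
  case False
  then have "(LINT r:{u<..v}|stieltjes q. f r) = 0"
    by (simp add: set_integrable_def set_lebesgue_integral_def not_integrable_integral_eq)
  then show ?thesis
    using q_le[OF assms(1,2)] assms(4) by simp
qed

lemma stieltjes_point: "0 \<le> a \<Longrightarrow> emeasure (stieltjes q) {a} = 0"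
  using emeasure_stieltjes_Icc[of a a] by simp

text \<open>Points carry no mass since q is continuous. The definitions use closed intervals,
  additivity and estimates the half-open ones.\<close>

lemma stieltjes_integral_Icc:
  fixes f :: "real \<Rightarrow> 'b :: {banach, second_countable_topology}"
  assumes "0 \<le> u"
  shows "(LINT r:{u..v}|stieltjes q. f r) = (LINT r:{u<..v}|stieltjes q. f r)"
  by (rule set_integral_discrete_difference[of "{u}"]) (auto simp: stieltjes_point[OF assms])

lemma stieltjes_integral_split:
  fixes f :: "real \<Rightarrow> 'b :: {banach, second_countable_topology}"
  assumes "0 \<le> u" "u \<le> v" "set_integrable (stieltjes q) {0..v} f"
  shows "(LINT r:{0..v}|stieltjes q. f r) = (LINT r:{0..u}|stieltjes q. f r) + (LINT r:{u<..v}|stieltjes q. f r)"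
proof -
  have "{0..v} = {0..u} \<union> {u<..v}" using assms by auto
  moreover have "(LINT r:{0..u} \<union> {u<..v}|stieltjes q. f r) = (LINT r:{0..u}|stieltjes q. f r) + (LINT r:{u<..v}|stieltjes q. f r)"
    using assms by (intro set_integral_Un) (auto intro: set_integrable_subset)
  ultimately show ?thesis by simp
qed

end

section \<open>The triangular system for the coefficients of g\<close>

lemma hcoef_cong: "(\<And>i. i < n \<Longrightarrow> c i = c' i) \<Longrightarrow> hcoef x c n = hcoef x c' n"
  by (induction x c n rule: hcoef.induct) (auto intro!: sum.cong arg_cong2[where f = "(*)"])

lemma hcoef_of_real: "hcoef (of_real x) (\<lambda>i. of_real (c i)) n = (of_real (hcoef x c n) :: complex)"
  by (induction x c n rule: hcoef.induct) simp_all

text \<open>The candidate for the n-th coefficient of g: expanding dg = 2/(g - x) dq at infinity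
  gives d c_n = 2 h_n dq with h_n = \<open>hcoef\<close>. As h_n involves only c_i with i < n, the
  system is solved by recursion; the guard i < n exposes this to the termination proof.\<close>

function lcoef :: "(real \<Rightarrow> real) \<Rightarrow> (real \<Rightarrow> real) \<Rightarrow> nat \<Rightarrow> real \<Rightarrow> real" where
  "lcoef q x n t = (LINT r:{0..t}|stieltjes q. 2 * hcoef (x r) (\<lambda>i. if i < n then lcoef q x i r else 0) n)"
  by pat_completeness auto
termination by (relation "Wellfounded.measure (\<lambda>(q, x, n, t). n)") auto

declare lcoef.simps [simp del]

lemma lcoef_eq: "lcoef q x n t = (LINT r:{0..t}|stieltjes q. 2 * hcoef (x r) (\<lambda>i. lcoef q x i r) n)"
proof -
  have "hcoef (x r) (\<lambda>i. if i < n then lcoef q x i r else 0) n = hcoef (x r) (\<lambda>i. lcoef q x i r) n" for r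
    by (rule hcoef_cong) simp
  then show ?thesis by (subst lcoef.simps) simp
qed

lemma hcoef_continuous_on:
  fixes x :: "real \<Rightarrow> real"
  assumes "continuous_on A x" "\<And>i. i < n \<Longrightarrow> continuous_on A (c i)"
  shows "continuous_on A (\<lambda>r. hcoef (x r) (\<lambda>i. c i r) n)"
  using assms(2)
proof (induction n rule: less_induct)
  case (less n)
  consider "n = 0" | "n = 1" | m where "n = Suc (Suc m)"
    by (metis One_nat_def not0_implies_Suc)
  then show ?case
  proof cases
    case (3 m)
    then show ?thesis
      using less by (auto intro!: continuous_intros assms(1))
  qed auto
qed

lemma lcoef_cong:
  assumes "\<And>r. r \<in> {0..t} \<Longrightarrow> x r = x' r" "s \<in> {0..t}"
  shows "lcoef q x n s = lcoef q x' n s"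
  using assms(2)
proof (induction n arbitrary: s rule: less_induct)
  case (less n)
  have "hcoef (x r) (\<lambda>i. lcoef q x i r) n = hcoef (x' r) (\<lambda>i. lcoef q x' i r) n" if "r \<in> {0..s}" for r
  proof -
    have "r \<in> {0..t}" using that less.prems by auto
    then show ?thesis using less.IH assms(1) by (auto intro!: hcoef_cong)
  qed
  then show ?case
    unfolding lcoef_eq[of q _ n] by (intro set_lebesgue_integral_cong) (auto simp: stieltjes_def)
qed

context clock_path
begin

text \<open>Integrals of bounded functions are Lipschitz in the clock q and inherit its
  continuity.\<close>

lemma lipschitz_continuous_on:
  fixes f :: "real \<Rightarrow> 'b :: real_normed_vector"
  assumes "\<And>u v. 0 \<le> u \<Longrightarrow> u \<le> v \<Longrightarrow> v \<le> t \<Longrightarrow> norm (f v - f u) \<le> C * (q v - q u)" "C \<ge> 0"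
  shows "continuous_on {0..t} f"
  unfolding continuous_on_def
proof
  fix u assume u: "u \<in> {0..t}"
  have "((\<lambda>v. C * norm (q v - q u)) \<longlongrightarrow> C * norm (q u - q u)) (at u within {0..t})"
    using continuous_on_subset[OF q_continuous, of "{0..t}"] u
    by (intro tendsto_intros) (auto simp: continuous_on_def)
  then have lim: "((\<lambda>v. C * norm (q v - q u)) \<longlongrightarrow> 0) (at u within {0..t})" by simp
  have "norm (f v - f u) \<le> C * norm (q v - q u)" if "v \<in> {0..t}" for v
    using assms(1)[of u v] assms(1)[of v u] q_le[of u v] q_le[of v u] u that
    by (cases "u \<le> v") (auto simp: norm_minus_commute)
  then have "((\<lambda>v. f v - f u) \<longlongrightarrow> 0) (at u within {0..t})"
    by (intro Lim_null_comparison[OF _ lim]) (auto simp: eventually_at_filter)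
  then show "(f \<longlongrightarrow> f u) (at u within {0..t})"
    by (rule Lim_null[THEN iffD2])
qed

lemma stieltjes_integral_continuous_on:
  fixes f :: "real \<Rightarrow> 'b :: {banach, second_countable_topology}"
  assumes "set_borel_measurable borel {0..t} f" "\<And>r. r \<in> {0..t} \<Longrightarrow> norm (f r) \<le> C"
  shows "continuous_on {0..t} (\<lambda>s. LINT r:{0..s}|stieltjes q. f r)"
proof (cases "0 \<le> t")
  case True
  have C: "C \<ge> 0" using assms(2)[of 0] True norm_ge_zero[of "f 0"] by (simp del: norm_ge_zero)
  have int: "set_integrable (stieltjes q) {0..v} f" if "v \<le> t" for v
    by (rule set_integrable_subset[of _ "{0..t}"], rule stieltjes_set_integrable[of _ t])
      (use that assms in auto)
  show ?thesis
  proof (rule lipschitz_continuous_on[OF _ C])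
    fix u v assume uv: "0 \<le> u" "u \<le> v" "v \<le> t"
    have "(LINT r:{0..v}|stieltjes q. f r) - (LINT r:{0..u}|stieltjes q. f r) = (LINT r:{u<..v}|stieltjes q. f r)"
      using stieltjes_integral_split[OF uv(1,2) int[OF uv(3)]] by simp
    then show "norm ((LINT r:{0..v}|stieltjes q. f r) - (LINT r:{0..u}|stieltjes q. f r)) \<le> C * (q v - q u)"
      using uv C assms(2) by (auto intro!: stieltjes_integral_bound)
  qed
qed simp

lemma continuous_set_borel_measurable:
  fixes f :: "real \<Rightarrow> 'b :: {real_normed_vector, second_countable_topology}"
  assumes "continuous_on A f" "A \<in> sets borel"
  shows "set_borel_measurable borel A f"
  unfolding set_borel_measurable_def using assms by (rule borel_measurable_continuous_on_indicator[rotated])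

lemma continuous_bounded_Icc:
  fixes f :: "real \<Rightarrow> 'b :: real_normed_vector"
  assumes "continuous_on {0..t} f"
  obtains C where "C \<ge> 0" "\<And>r. r \<in> {0..t} \<Longrightarrow> norm (f r) \<le> C"
proof -
  have "bounded (f ` {0..t})"
    by (intro compact_imp_bounded compact_continuous_image assms) simp
  then obtain C where C: "\<And>r. r \<in> {0..t} \<Longrightarrow> norm (f r) \<le> C" unfolding bounded_iff by blast
  show thesis using C
    by (intro that[of "max 0 C"]) (auto simp: le_max_iff_disj)
qed

lemma stieltjes_integral_continuous_on':
  fixes f :: "real \<Rightarrow> 'b :: {banach, second_countable_topology}"
  assumes "continuous_on {0..t} f"
  shows "continuous_on {0..t} (\<lambda>s. LINT r:{0..s}|stieltjes q. f r)"
  using continuous_bounded_Icc[OF assms] continuous_set_borel_measurable[OF assms]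
  by (metis borel_closed closed_real_atLeastAtMost stieltjes_integral_continuous_on)

lemma continuous_set_integrable:
  fixes f :: "real \<Rightarrow> 'b :: {banach, second_countable_topology}"
  assumes "continuous_on {0..t} f"
  shows "set_integrable (stieltjes q) {0..t} f"
proof -
  obtain C where "C \<ge> 0" "\<And>r. r \<in> {0..t} \<Longrightarrow> norm (f r) \<le> C"
    using continuous_bounded_Icc[OF assms] by blast
  then show ?thesis
    by (intro stieltjes_set_integrable[of _ t _ C] continuous_set_borel_measurable assms) auto
qed

lemma lcoef_continuous_on:
  assumes "continuous_on {0..t} x"
  shows "continuous_on {0..t} (lcoef q x n)"
proof (induction n rule: less_induct)
  case (less n)
  have "continuous_on {0..t} (\<lambda>s. LINT r:{0..s}|stieltjes q. 2 * hcoef (x r) (\<lambda>i. lcoef q x i r) n)"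
    by (intro stieltjes_integral_continuous_on' continuous_intros hcoef_continuous_on assms less)
  moreover have "lcoef q x n = (\<lambda>s. LINT r:{0..s}|stieltjes q. 2 * hcoef (x r) (\<lambda>i. lcoef q x i r) n)"
    by (rule ext) (rule lcoef_eq)
  ultimately show ?case by (simp only:)
qed

end

section \<open>Loewner solutions from distant points\<close>

lemma norm_le_three: "norm z \<le> norm (w - x) + norm (w - z) + norm x"
  for w x z :: "'b :: real_normed_vector"
proof -
  have "norm z = norm ((w - x) - (w - z) + x)" by simp
  also have "\<dots> \<le> norm ((w - x) - (w - z)) + norm x" by (rule norm_triangle_ineq)
  also have "\<dots> \<le> norm (w - x) + norm (w - z) + norm x"
    by (intro add_right_mono norm_triangle_ineq4)
  finally show ?thesis .
qed

context clock_path
begin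

text \<open>A first exit argument. With V = q t - q 0: while |w - z| < 1, the distance |w - x| is at
  least 1 + 4 V, so the displacement up to the first exit is at most 2 V / (1 + 4 V) < 1.\<close>

lemma loewner_close:
  assumes t: "t \<ge> 0" and x: "continuous_on {0..t} x" and B: "\<And>r. r \<in> {0..t} \<Longrightarrow> \<bar>x r\<bar> \<le> B"
    and z: "norm z \<ge> B + 2 + 4 * (q t - q 0)"
    and sol: "loewner_solution q x t z w" and s: "s \<in> {0..t}"
  shows "norm (w s - z) < 1"
proof (rule ccontr)
  define V where "V = q t - q 0"
  have V: "V \<ge> 0" using q_le[of 0 t] t by (simp add: V_def)
  assume "\<not> norm (w s - z) < 1"
  then have s1: "norm (w s - z) \<ge> 1" by simp
  have w: "continuous_on {0..t} w" and eq: "\<And>s. s \<in> {0..t} \<Longrightarrow> w s = z + (LINT r:{0..s}|stieltjes q. 2 / (w r - of_real (x r)))"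
    using sol by (auto simp: loewner_solution_def)
  define S where "S = {r \<in> {0..t}. norm (w r - z) \<ge> 1}"
  have "closed S"
    unfolding S_def by (intro continuous_on_closed_Collect_le) (auto intro!: continuous_intros w)
  then have "compact S"
    by (intro compact_eq_bounded_closed[THEN iffD2] conjI bounded_subset[OF bounded_closed_interval[of 0 t]]) (auto simp: S_def)
  moreover have "S \<noteq> {}" using s s1 by (auto simp: S_def)
  ultimately obtain m where m: "m \<in> S" "\<And>r. r \<in> S \<Longrightarrow> m \<le> r"
    using compact_attains_inf[of S] by auto
  have mt: "m \<in> {0..t}" using m(1) by (auto simp: S_def)
  have before: "norm (w r - z) < 1" if "r \<in> {0..<m}" for r
    using m(2)[of r] that mt by (force simp: S_def)
  have far: "norm (2 / (w r - of_real (x r))) \<le> 2 / (1 + 4 * V)" if "r \<in> {0..<m}" for r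
  proof -
    have "norm z \<le> norm (w r - of_real (x r)) + norm (w r - z) + norm (complex_of_real (x r))"
      by (rule norm_le_three)
    then have "norm (w r - of_real (x r)) \<ge> 1 + 4 * V"
      using before[OF that] B[of r] that mt z by (auto simp: V_def)
    then show ?thesis
      using V by (simp add: norm_divide frac_le)
  qed
  have "w m - z = (LINT r:{0..m}|stieltjes q. 2 / (w r - of_real (x r)))"
    using eq[OF mt] by simp
  also have "\<dots> = (LINT r:{0<..m}|stieltjes q. 2 / (w r - of_real (x r)))"
    by (rule stieltjes_integral_Icc) simp
  \<comment> \<open>The estimate \<open>far\<close> is available strictly before m; the endpoint has
    no mass, so the integrand may be set to 0 there.\<close>
  also have "\<dots> = (LINT r:{0<..m}|stieltjes q. if r = m then 0 else 2 / (w r - of_real (x r)))"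
  proof -
    have "(LINT r:{0<..m}|stieltjes q. f r) = (LINT r:{0<..<m}|stieltjes q. f r)" for f :: "real \<Rightarrow> complex"
      using mt by (intro set_integral_discrete_difference[of "{m}"]) (auto simp: stieltjes_point)
    then show ?thesis
      by (auto intro!: set_lebesgue_integral_cong)
  qed
  also have "norm \<dots> \<le> 2 / (1 + 4 * V) * (q m - q 0)"
    using mt V far by (intro stieltjes_integral_bound) auto
  also have "\<dots> \<le> 2 / (1 + 4 * V) * V"
    using mt V by (intro mult_left_mono) (auto simp: V_def q_le)
  also have "\<dots> < 1" using V by (simp add: field_simps)
  finally have "norm (w m - z) < 1" .
  with m(1) show False by (auto simp: S_def)
qed

text \<open>Picard iteration on all of [0, t] at once: for z this far away the integral operator
  preserves the functions within distance 1 of z and contracts with constant 1/2.\<close>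

lemma loewner_exists:
  assumes t: "t \<ge> 0" and x: "continuous_on {0..t} x" and B: "\<And>r. r \<in> {0..t} \<Longrightarrow> \<bar>x r\<bar> \<le> B"
    and z: "norm z \<ge> B + 2 + 4 * (q t - q 0)"
  shows "\<exists>w. loewner_solution q x t z w"
proof -
  define V where "V = q t - q 0"
  have V: "V \<ge> 0" using q_le[of 0 t] t by (simp add: V_def)
  \<comment> \<open>Bounded continuous functions live on the whole line, so time is clamped to
    [0, t].\<close>
  define c where "c = (\<lambda>s. max 0 (min t s))"
  have c: "c s \<in> {0..t}" "s \<in> {0..t} \<Longrightarrow> c s = s" for s using t by (auto simp: c_def)
  have c_cont: "continuous_on UNIV c" unfolding c_def by (intro continuous_intros)
  define S where "S = {w :: real \<Rightarrow>\<^sub>C complex. \<forall>s. norm (apply_bcontfun w s - z) \<le> 1}"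
  have far: "norm (apply_bcontfun w r - of_real (x r)) \<ge> 1 + 4 * V" if "w \<in> S" "r \<in> {0..t}" for w r
  proof -
    have "norm z \<le> norm (apply_bcontfun w r - of_real (x r)) + norm (apply_bcontfun w r - z) + norm (complex_of_real (x r))"
      by (rule norm_le_three)
    then show ?thesis
      using that B[of r] z by (auto simp: V_def S_def dest!: spec[of _ r])
  qed
  define f where "f = (\<lambda>w r. 2 / (apply_bcontfun w r - complex_of_real (x r)))"
  define \<Phi>0 where "\<Phi>0 = (\<lambda>w s. z + (LINT r:{0..c s}|stieltjes q. f w r))"
  have f_cont: "continuous_on {0..t} (f w)" if "w \<in> S" for w
  proof -
    have "apply_bcontfun w r - complex_of_real (x r) \<noteq> 0" if "r \<in> {0..t}" for r
      using far[OF \<open>w \<in> S\<close> that] V by auto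
    then show ?thesis
      unfolding f_def by (intro continuous_intros x) auto
  qed
  have f_bd: "norm (f w r) \<le> 2 / (1 + 4 * V)" if "w \<in> S" "r \<in> {0..t}" for w r
    unfolding f_def using far[OF that] V by (simp add: norm_divide frac_le)
  have int_bd: "norm (LINT r:{0..c s}|stieltjes q. h r) \<le> C * V" if "\<And>r. r \<in> {0..t} \<Longrightarrow> norm (h r) \<le> C" "C \<ge> 0"
    for h :: "real \<Rightarrow> complex" and C s
  proof -
    have "norm (LINT r:{0..c s}|stieltjes q. h r) \<le> C * (q (c s) - q 0)"
      using c(1)[of s] that by (subst stieltjes_integral_Icc) (auto intro!: stieltjes_integral_bound)
    also have "\<dots> \<le> C * V"
      using c(1)[of s] that by (intro mult_left_mono) (auto simp: V_def q_le)
    finally show ?thesis .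
  qed
  have small: "norm (\<Phi>0 w s - z) \<le> 1" if "w \<in> S" for w s
  proof -
    have "norm (\<Phi>0 w s - z) \<le> 2 / (1 + 4 * V) * V"
      unfolding \<Phi>0_def using f_bd[OF that] V by (simp del: times_divide_eq_left) (rule int_bd, auto)
    also have "\<dots> \<le> 1" using V by (simp add: field_simps)
    finally show ?thesis .
  qed
  have "continuous_on UNIV (\<Phi>0 w)" if "w \<in> S" for w
    unfolding \<Phi>0_def
    by (intro continuous_intros continuous_on_compose2[OF stieltjes_integral_continuous_on'[OF f_cont[OF that]] c_cont])
      (use c in auto)
  then have bc: "\<Phi>0 w \<in> bcontfun" if "w \<in> S" for w
    unfolding bcontfun_def using that small[OF that]
    by (auto intro!: bounded_subset[OF bounded_cball[of z 1]] simp: dist_norm norm_minus_commute)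
  define \<Phi> where "\<Phi> = (\<lambda>w. Bcontfun (\<Phi>0 w))"
  have \<Phi>: "apply_bcontfun (\<Phi> w) s = \<Phi>0 w s" if "w \<in> S" for w s
    unfolding \<Phi>_def using bc[OF that] by (simp add: Bcontfun_inverse)
  have "\<exists>!w\<in>S. \<Phi> w = w"
  proof (rule Banach_fix[where c = "1/2"])
    have "closed S"
      unfolding S_def closed_sequential_limits
    proof safe
      fix u w s assume u: "\<forall>n. u n \<in> {w. \<forall>s. norm (apply_bcontfun w s - z) \<le> 1}" and lim: "u \<longlonglongrightarrow> w"
      have "(\<lambda>n. apply_bcontfun (u n) s) \<longlonglongrightarrow> apply_bcontfun w s"
      proof (rule tendstoI)
        fix e :: real assume "e > 0"
        from tendstoD[OF lim this] show "\<forall>\<^sub>F n in sequentially. dist (apply_bcontfun (u n) s) (apply_bcontfun w s) < e"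
          by (rule eventually_mono) (rule le_less_trans[OF dist_bounded])
      qed
      then have "(\<lambda>n. norm (apply_bcontfun (u n) s - z)) \<longlonglongrightarrow> norm (apply_bcontfun w s - z)"
        by (intro tendsto_intros)
      then show "norm (apply_bcontfun w s - z) \<le> 1"
        by (rule LIMSEQ_le_const2) (use u in auto)
    qed
    then show "uniform_space_class.complete S" by (simp add: complete_eq_closed)
    show "S \<noteq> {}"
    proof -
      have "const_bcontfun z \<in> S" by (simp add: S_def)
      then show ?thesis by auto
    qed
    show "\<Phi> ` S \<subseteq> S" using \<Phi> small by (auto simp: S_def)
    show "dist (\<Phi> w) (\<Phi> w') \<le> 1/2 * dist w w'" if ww: "w \<in> S" "w' \<in> S" for w w'
    proof (rule dist_bound)
      fix s
      have int: "set_integrable (stieltjes q) {0..c s} (f w)" if "w \<in> S" for w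
        by (rule set_integrable_subset[OF continuous_set_integrable[OF f_cont[OF that]]]) (use c(1)[of s] in auto)
      have lip: "norm (f w r - f w' r) \<le> 2 * dist w w' / (1 + 4 * V)" if r: "r \<in> {0..t}" for r
      proof -
        define a b where "a = apply_bcontfun w r - complex_of_real (x r)" and "b = apply_bcontfun w' r - complex_of_real (x r)"
        have ab: "norm a \<ge> 1 + 4 * V" "norm b \<ge> 1 + 4 * V"
          using far[OF ww(1) r] far[OF ww(2) r] by (simp_all add: a_def b_def)
        then have nz: "a \<noteq> 0" "b \<noteq> 0" using V by auto
        have "f w r - f w' r = 2 * (b - a) / (a * b)"
          unfolding f_def a_def[symmetric] b_def[symmetric] using nz by (simp add: field_simps)
        then have "norm (f w r - f w' r) = 2 * norm (b - a) / (norm a * norm b)"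
          by (simp only: norm_divide norm_mult norm_numeral)
        also have "\<dots> \<le> 2 * dist w w' / ((1 + 4 * V) * 1)"
        proof (rule frac_le)
          show "2 * norm (b - a) \<le> 2 * dist w w'"
            using dist_bounded[of w r w'] by (simp add: a_def b_def dist_norm norm_minus_commute)
          show "(1 + 4 * V) * 1 \<le> norm a * norm b"
            using ab V by (intro mult_mono) auto
        qed (use V in auto)
        finally show ?thesis by simp
      qed
      have "apply_bcontfun (\<Phi> w) s - apply_bcontfun (\<Phi> w') s = (LINT r:{0..c s}|stieltjes q. f w r - f w' r)"
        unfolding \<Phi>[OF ww(1)] \<Phi>[OF ww(2)] \<Phi>0_def by (simp add: set_integral_diff(2)[OF int[OF ww(1)] int[OF ww(2)]])
      then have "dist (apply_bcontfun (\<Phi> w) s) (apply_bcontfun (\<Phi> w') s) \<le> 2 * dist w w' / (1 + 4 * V) * V"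
        unfolding dist_norm[of "apply_bcontfun (\<Phi> w) s"] using V lip by (simp only:) (rule int_bd, auto)
      also have "\<dots> \<le> 1/2 * dist w w'"
      proof -
        \<comment> \<open>The contraction constant; the 4 in the lower bound on |z| is chosen for
          it.\<close>
        have "2 * V / (1 + 4 * V) \<le> 1 / 2" using V by (simp add: field_simps)
        from mult_right_mono[OF this, of "dist w w'"] show ?thesis by (simp add: mult_ac)
      qed
      finally show "dist (apply_bcontfun (\<Phi> w) s) (apply_bcontfun (\<Phi> w') s) \<le> 1/2 * dist w w'" .
    qed
  qed auto
  then obtain w where w: "w \<in> S" "\<Phi> w = w" by auto
  have "loewner_solution q x t z (apply_bcontfun w)"
    unfolding loewner_solution_def
  proof (intro conjI ballI)
    show "continuous_on {0..t} (apply_bcontfun w)" by simp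
    fix s assume s: "s \<in> {0..t}"
    show "apply_bcontfun w s \<noteq> of_real (x s)"
      using far[OF w(1) s] V by auto
    show "apply_bcontfun w s = z + (LINT r:{0..s}|stieltjes q. 2 / (apply_bcontfun w r - of_real (x r)))"
      using \<Phi>[OF w(1), of s] w(2) c(2)[OF s] by (simp add: \<Phi>0_def f_def)
  qed
  then show ?thesis by blast
qed

end

section \<open>Asymptotic expansions along the imaginary axis\<close>

lemma hcoef_Suc:
  fixes c :: "nat \<Rightarrow> 'b :: comm_ring_1"
  shows "hcoef x c (Suc n) = (if n = 0 then 1 else 0) + x * hcoef x c n - (\<Sum>i\<in>{1..<n}. c i * hcoef x c (n - i))"
proof (cases n)
  case (Suc m)
  have "(\<Sum>i\<in>{1..<Suc m}. c i * hcoef x c (Suc m - i)) = (\<Sum>i<m. c (Suc i) * hcoef x c (m - i))"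
    by (rule sum.reindex_bij_witness[of _ Suc "\<lambda>i. i - 1"]) auto
  then show ?thesis by (simp add: Suc)
qed simp

text \<open>The truncated series of f - x and of its inverse multiply to 1 up to order N: terms with
  i + j < N cancel by the recursion. What remains are at most N^2 products of order at least N and
  the term x h_N \<zeta>^N.\<close>

lemma hcoef_truncation:
  fixes x z :: complex and c :: "nat \<Rightarrow> complex"
  assumes z: "z \<noteq> 0" and \<zeta>: "\<zeta> = 1 / z" "norm \<zeta> \<le> 1"
    and K: "norm x \<le> K" "\<And>i. i < N \<Longrightarrow> norm (c i) \<le> K" "\<And>j. j \<le> N \<Longrightarrow> norm (hcoef x c j) \<le> K"
  shows "norm ((z - x + (\<Sum>i\<in>{1..<N}. c i * \<zeta> ^ i)) * (\<Sum>j\<in>{1..N}. hcoef x c j * \<zeta> ^ j) - 1)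
    \<le> (1 + K * K + real N * real N * (K * K)) * norm \<zeta> ^ N"
proof (cases "N = 0")
  case True
  have "0 \<le> K" using K(1) norm_ge_zero order_trans by blast
  then show ?thesis by (simp add: True)
next
  case False
  define h where "h = hcoef x c"
  have K0: "0 \<le> K" using K(1) norm_ge_zero order_trans by blast
  define A where "A = {1..<N} \<times> {1..N}"
  define lo where "lo = {(i, j). (i, j) \<in> A \<and> i + j < N}"
  define hi where "hi = {(i, j). (i, j) \<in> A \<and> \<not> i + j < N}"
  have fin: "finite lo" "finite hi" "lo \<inter> hi = {}" "A = lo \<union> hi"
    unfolding lo_def hi_def A_def
    by (auto intro: finite_subset[of _ "{1..<N} \<times> {1..N}"])
  have zH: "z * (\<Sum>j\<in>{1..N}. h j * \<zeta> ^ j) = (\<Sum>n<N. h (Suc n) * \<zeta> ^ n)"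
  proof -
    have "z * (\<Sum>j\<in>{1..N}. h j * \<zeta> ^ j) = (\<Sum>j\<in>{1..N}. h j * \<zeta> ^ (j - 1))"
      unfolding sum_distrib_left
    proof (rule sum.cong[OF refl])
      fix j assume "j \<in> {1..N}"
      then obtain m where "j = Suc m" by (cases j) auto
      then show "z * (h j * \<zeta> ^ j) = h j * \<zeta> ^ (j - 1)"
        using z by (simp add: \<zeta>(1))
    qed
    also have "\<dots> = (\<Sum>n<N. h (Suc n) * \<zeta> ^ n)"
      by (rule sum.reindex_bij_witness[of _ Suc "\<lambda>j. j - 1"]) auto
    finally show ?thesis .
  qed
  have xH: "x * (\<Sum>j\<in>{1..N}. h j * \<zeta> ^ j) = (\<Sum>n<N. x * h n * \<zeta> ^ n) + x * h N * \<zeta> ^ N"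
  proof -
    have "(\<Sum>j\<in>{1..N}. h j * \<zeta> ^ j) = (\<Sum>j\<in>{..N}. h j * \<zeta> ^ j)"
    proof (rule sum.mono_neutral_left)
      show "\<forall>i\<in>{..N} - {1..N}. h i * \<zeta> ^ i = 0"
      proof
        fix i assume "i \<in> {..N} - {1..N}"
        then have "i = 0" by auto
        then show "h i * \<zeta> ^ i = 0" by (simp add: h_def)
      qed
    qed auto
    also have "\<dots> = (\<Sum>n<N. h n * \<zeta> ^ n) + h N * \<zeta> ^ N"
      by (simp flip: lessThan_Suc_atMost)
    finally show ?thesis by (simp add: distrib_left sum_distrib_left mult.assoc)
  qed
  have cH: "(\<Sum>i\<in>{1..<N}. c i * \<zeta> ^ i) * (\<Sum>j\<in>{1..N}. h j * \<zeta> ^ j) =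
      (\<Sum>n<N. (\<Sum>i\<in>{1..<n}. c i * h (n - i)) * \<zeta> ^ n) + (\<Sum>(i, j)\<in>hi. c i * h j * \<zeta> ^ (i + j))"
  proof -
    have "(\<Sum>i\<in>{1..<N}. c i * \<zeta> ^ i) * (\<Sum>j\<in>{1..N}. h j * \<zeta> ^ j) = (\<Sum>(i, j)\<in>A. c i * h j * \<zeta> ^ (i + j))"
      unfolding A_def sum_product by (simp add: sum.cartesian_product power_add mult_ac)
    also have "\<dots> = (\<Sum>(i, j)\<in>lo. c i * h j * \<zeta> ^ (i + j)) + (\<Sum>(i, j)\<in>hi. c i * h j * \<zeta> ^ (i + j))"
      unfolding fin(4) by (rule sum.union_disjoint[OF fin(1-3)])
    also have "(\<Sum>(i, j)\<in>lo. c i * h j * \<zeta> ^ (i + j)) = (\<Sum>(n, i)\<in>Sigma {..<N} (\<lambda>n. {1..<n}). c i * h (n - i) * \<zeta> ^ n)"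
      by (rule sum.reindex_bij_witness[of _ "\<lambda>(n, i). (i, n - i)" "\<lambda>(i, j). (i + j, i)"]) (auto simp: lo_def A_def)
    also have "\<dots> = (\<Sum>n<N. (\<Sum>i\<in>{1..<n}. c i * h (n - i)) * \<zeta> ^ n)"
      by (simp add: sum.Sigma sum_distrib_right)
    finally show ?thesis .
  qed
  have one: "(\<Sum>n<N. h (Suc n) * \<zeta> ^ n) = 1 + (\<Sum>n<N. x * h n * \<zeta> ^ n) - (\<Sum>n<N. (\<Sum>i\<in>{1..<n}. c i * h (n - i)) * \<zeta> ^ n)"
  proof -
    have "(\<Sum>n<N. h (Suc n) * \<zeta> ^ n) = (\<Sum>n<N. (if n = 0 then 1 else 0) + x * h n * \<zeta> ^ n - (\<Sum>i\<in>{1..<n}. c i * h (n - i)) * \<zeta> ^ n)"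
      unfolding h_def hcoef_Suc by (intro sum.cong) (auto simp: algebra_simps)
    also have "\<dots> = (\<Sum>n<N. if n = 0 then 1 else 0) + (\<Sum>n<N. x * h n * \<zeta> ^ n) - (\<Sum>n<N. (\<Sum>i\<in>{1..<n}. c i * h (n - i)) * \<zeta> ^ n)"
      by (simp only: sum.distrib sum_subtractf)
    also have "(\<Sum>n<N. if n = 0 then 1 else 0) = (1 :: complex)" using False by simp
    finally show ?thesis .
  qed
  have "(z - x + (\<Sum>i\<in>{1..<N}. c i * \<zeta> ^ i)) * (\<Sum>j\<in>{1..N}. h j * \<zeta> ^ j) - 1
      = (\<Sum>(i, j)\<in>hi. c i * h j * \<zeta> ^ (i + j)) - x * h N * \<zeta> ^ N"
    unfolding distrib_right left_diff_distrib zH xH cH one by simp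
  also have "norm \<dots> \<le> norm (\<Sum>(i, j)\<in>hi. c i * h j * \<zeta> ^ (i + j)) + norm (x * h N * \<zeta> ^ N)"
    by (rule norm_triangle_ineq4)
  also have "norm (x * h N * \<zeta> ^ N) \<le> K * K * norm \<zeta> ^ N"
    unfolding norm_mult norm_power h_def
    by (intro mult_mono K mult_nonneg_nonneg K0) auto
  also have "norm (\<Sum>(i, j)\<in>hi. c i * h j * \<zeta> ^ (i + j)) \<le> (\<Sum>(i, j)\<in>hi. K * K * norm \<zeta> ^ N)"
  proof (rule sum_norm_le, clarify)
    fix i j assume ij: "(i, j) \<in> hi"
    have "norm \<zeta> ^ (i + j) \<le> norm \<zeta> ^ N"
      using ij \<zeta>(2) by (intro power_decreasing) (auto simp: hi_def)
    then show "norm (c i * h j * \<zeta> ^ (i + j)) \<le> K * K * norm \<zeta> ^ N"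
      unfolding norm_mult norm_power h_def using ij
      by (intro mult_mono K mult_nonneg_nonneg K0) (auto simp: hi_def A_def)
  qed
  also have "(\<Sum>(i, j)\<in>hi. K * K * norm \<zeta> ^ N) = real (card hi) * (K * K * norm \<zeta> ^ N)"
    by (simp add: case_prod_unfold)
  also have "\<dots> \<le> (real N * real N) * (K * K * norm \<zeta> ^ N)"
  proof (rule mult_right_mono)
    have "card hi \<le> card A" using fin by (intro card_mono) (auto simp: A_def)
    also have "\<dots> = (N - 1) * N" by (simp add: A_def)
    also have "\<dots> \<le> N * N" by simp
    finally show "real (card hi) \<le> real N * real N" by (metis of_nat_le_iff of_nat_mult)
  qed (use K0 in auto)
  finally have "norm ((z - x + (\<Sum>i\<in>{1..<N}. c i * \<zeta> ^ i)) * (\<Sum>j\<in>{1..N}. h j * \<zeta> ^ j) - 1)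
      \<le> real N * real N * (K * K * norm \<zeta> ^ N) + K * K * norm \<zeta> ^ N" by simp
  also have "\<dots> \<le> (1 + K * K + real N * real N * (K * K)) * norm \<zeta> ^ N"
    by (simp add: algebra_simps)
  finally show ?thesis by (simp add: h_def)
qed

context clock_path
begin

lemma stieltjes_integral_sum:
  fixes f :: "'i \<Rightarrow> real \<Rightarrow> complex"
  assumes "\<And>i. i \<in> I \<Longrightarrow> set_integrable (stieltjes q) A (f i)"
  shows "(LINT r:A|stieltjes q. \<Sum>i\<in>I. f i r) = (\<Sum>i\<in>I. LINT r:A|stieltjes q. f i r)"
  using assms unfolding set_lebesgue_integral_def set_integrable_def
  by (simp add: scaleR_sum_right Bochner_Integration.integral_sum)

text \<open>Bootstrap in N: knowing w up to order y^(-N) gives 2/(w - x) up to y^(-N-1), because |w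
  - x| is of order y; integrating and \<open>lcoef_eq\<close> give the next expansion of w.
  Uniformity in s permits the integration.\<close>

lemma loewner_asymptotics:
  assumes t: "t \<ge> 0" and x: "continuous_on {0..t} x"
    and sol: "\<And>y. y \<ge> Y0 \<Longrightarrow> loewner_solution q x t (\<i> * of_real y) (w y)"
  shows "\<exists>C Y. \<forall>y\<ge>Y. \<forall>s\<in>{0..t}.
    norm (w y s - \<i> * of_real y - (\<Sum>i\<in>{1..<N}. of_real (lcoef q x i s) * (1 / (\<i> * of_real y)) ^ i)) \<le> C / y ^ N"
proof (induction N)
  case 0
  obtain B where B: "B \<ge> 0" "\<And>r. r \<in> {0..t} \<Longrightarrow> norm (x r) \<le> B"
    using continuous_bounded_Icc[OF x] by blast
  show ?case
  proof (intro exI allI ballI impI)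
    fix y s assume y: "y \<ge> max Y0 (B + 2 + 4 * (q t - q 0))" and s: "s \<in> {0..t}"
    have "norm (w y s - \<i> * of_real y) < 1"
      using y B by (intro loewner_close[OF t x _ _ sol s, of B]) (auto simp: norm_mult)
    then show "norm (w y s - \<i> * of_real y - (\<Sum>i\<in>{1..<0}. of_real (lcoef q x i s) * (1 / (\<i> * of_real y)) ^ i)) \<le> 1 / y ^ 0"
      by simp
  qed
next
  case (Suc N)
  define V where "V = q t - q 0"
  have V: "V \<ge> 0" using q_le[of 0 t] t by (simp add: V_def)
  obtain B where B: "B \<ge> 0" "\<And>r. r \<in> {0..t} \<Longrightarrow> norm (x r) \<le> B"
    using continuous_bounded_Icc[OF x] by blast
  define c where "c = lcoef q x"
  define h where "h = (\<lambda>j r. hcoef (x r) (\<lambda>i. c i r) j)"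
  have c_cont: "continuous_on {0..t} (c i)" for i
    unfolding c_def by (rule lcoef_continuous_on[OF x])
  have h_cont: "continuous_on {0..t} (h j)" for j
    unfolding h_def by (intro hcoef_continuous_on x c_cont)
  have "\<exists>K\<ge>0. \<forall>j\<le>N. \<forall>r\<in>{0..t}. norm (f j r) \<le> K" if "\<And>j. continuous_on {0..t} (f j)" for f :: "nat \<Rightarrow> real \<Rightarrow> real"
  proof -
    have "\<exists>K. K \<ge> 0 \<and> (\<forall>r\<in>{0..t}. norm (f j r) \<le> K)" for j
      by (rule continuous_bounded_Icc[OF that[of j]]) blast
    then have "\<forall>j. \<exists>K. K \<ge> 0 \<and> (\<forall>r\<in>{0..t}. norm (f j r) \<le> K)" by blast
    from choice[OF this] obtain K where "\<forall>j. K j \<ge> 0 \<and> (\<forall>r\<in>{0..t}. norm (f j r) \<le> K j)" ..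
    then have K: "\<And>j r. r \<in> {0..t} \<Longrightarrow> norm (f j r) \<le> K j" "\<And>j. K j \<ge> 0"
      by blast+
    have "norm (f j r) \<le> (\<Sum>j\<le>N. K j)" if "j \<le> N" "r \<in> {0..t}" for j r
    proof -
      have "K j \<le> (\<Sum>j\<le>N. K j)"
        using K(2) that(1) by (intro member_le_sum) auto
      with K(1)[OF that(2), of j] show ?thesis by linarith
    qed
    then show ?thesis using K(2) by (auto intro!: exI[of _ "\<Sum>j\<le>N. K j"] sum_nonneg)
  qed
  note bound = this
  obtain K1 where K1: "K1 \<ge> 0" "\<And>j r. j \<le> N \<Longrightarrow> r \<in> {0..t} \<Longrightarrow> norm (c j r) \<le> K1"
    using bound[of c, OF c_cont] by blast
  obtain K2 where K2: "K2 \<ge> 0" "\<And>j r. j \<le> N \<Longrightarrow> r \<in> {0..t} \<Longrightarrow> norm (h j r) \<le> K2"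
    using bound[of h, OF h_cont] by blast
  define K where "K = B + K1 + K2"
  have K: "norm (c j r) \<le> K" "norm (h j r) \<le> K" "norm (x r) \<le> K" if "j \<le> N" "r \<in> {0..t}" for j r
    using K1(1) K1(2)[OF that] K2(1) K2(2)[OF that] B(1) B(2)[OF that(2)] by (auto simp: K_def)
  have K0: "K \<ge> 0" using B K1 K2 by (simp add: K_def)
  from Suc.IH obtain C Y where IH: "\<And>y s. y \<ge> Y \<Longrightarrow> s \<in> {0..t} \<Longrightarrow>
    norm (w y s - \<i> * of_real y - (\<Sum>i\<in>{1..<N}. of_real (c i s) * (1 / (\<i> * of_real y)) ^ i)) \<le> C / y ^ N"
    unfolding c_def by blast
  define C1 where "C1 = 1 + K * K + real N * real N * (K * K)"
  \<comment> \<open>One factor 2 is the numerator of the Loewner equation, the other comes from |w -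
    x| \<ge> y / 2, which follows from y \<ge> 2 (B + 1).\<close>
  define C2 where "C2 = 4 * (C1 + real N * K * max 0 C)"
  define Y1 where "Y1 = Max {1, Y0, Y, B + 2 + 4 * V, 2 * (B + 1)}"
  show ?case
  proof (intro exI allI ballI impI)
    fix y s assume y: "y \<ge> Y1" and s: "s \<in> {0..t}"
    define z where "z = \<i> * of_real y"
    define \<zeta> where "\<zeta> = 1 / z"
    have Y: "y \<ge> 1" "y \<ge> Y0" "y \<ge> Y" "y \<ge> B + 2 + 4 * V" "y \<ge> 2 * (B + 1)"
      using y by (simp_all add: Y1_def)
    have nz: "norm z = y" "z \<noteq> 0" using Y by (auto simp: z_def norm_mult)
    have n\<zeta>: "norm \<zeta> = 1 / y" using nz by (simp add: \<zeta>_def norm_divide)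
    have \<zeta>1: "norm \<zeta> \<le> 1" using n\<zeta> Y by simp
    have sol': "loewner_solution q x t z (w y)" using sol[OF Y(2)] by (simp add: z_def)
    have w_cont: "continuous_on {0..t} (w y)" and w_ne: "\<And>r. r \<in> {0..t} \<Longrightarrow> w y r - of_real (x r) \<noteq> 0"
      and w_eq: "\<And>s. s \<in> {0..t} \<Longrightarrow> w y s = z + (LINT r:{0..s}|stieltjes q. 2 / (w y r - of_real (x r)))"
      using sol' unfolding loewner_solution_def right_minus_eq by blast+
    define H where "H = (\<lambda>r. \<Sum>j\<in>{1..N}. complex_of_real (h j r) * \<zeta> ^ j)"
    define D where "D = (\<lambda>r. 2 / (w y r - of_real (x r)) - 2 * H r)"
    have D_bd: "norm (D r) \<le> C2 / y ^ Suc N" if r: "r \<in> {0..t}" for r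
    proof -
      define e where "e = w y r - z - (\<Sum>i\<in>{1..<N}. of_real (c i r) * \<zeta> ^ i)"
      define d where "d = w y r - of_real (x r)"
      have e: "norm e \<le> max 0 C / y ^ N"
        using IH[OF Y(3) r] Y(1) unfolding e_def \<zeta>_def z_def by (elim order_trans) (simp add: divide_right_mono)
      have "norm (w y r - z) < 1"
        using Y B nz by (intro loewner_close[OF t x _ _ sol' r, of B]) (auto simp: V_def)
      moreover have "norm z \<le> norm d + norm (w y r - z) + norm (complex_of_real (x r))"
        unfolding d_def by (rule norm_le_three)
      ultimately have d: "norm d \<ge> y / 2"
        using nz Y(5) B(2)[OF r] by simp
      then have dnz: "d \<noteq> 0" using Y(1) by auto
      define G where "G = z - of_real (x r) + (\<Sum>i\<in>{1..<N}. of_real (c i r) * \<zeta> ^ i)"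
      have Hh: "H r = (\<Sum>j\<in>{1..N}. hcoef (of_real (x r)) (\<lambda>i. of_real (c i r)) j * \<zeta> ^ j)"
        by (simp add: H_def h_def hcoef_of_real)
      have tr: "norm (G * H r - 1) \<le> C1 * norm \<zeta> ^ N"
        unfolding G_def Hh C1_def
        by (rule hcoef_truncation[OF nz(2) \<zeta>_def \<zeta>1])
          (use r K(1)[of _ r] K(2)[of _ r] K(3)[of 0 r] in \<open>auto simp: hcoef_of_real h_def less_imp_le\<close>)
      have H: "norm (H r) \<le> real N * K"
      proof -
        have "norm (H r) \<le> (\<Sum>j\<in>{1..N}. K)"
          unfolding H_def
        proof (rule sum_norm_le)
          fix j assume "j \<in> {1..N}"
          then have "norm (h j r) * norm \<zeta> ^ j \<le> K * 1"
            using r K(2) \<zeta>1 K0 by (intro mult_mono) (auto intro!: power_le_one)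
          then show "norm (complex_of_real (h j r) * \<zeta> ^ j) \<le> K" by (simp add: norm_mult norm_power)
        qed
        then show ?thesis by simp
      qed
      have "D r = - 2 * (H r * d - 1) / d"
        unfolding D_def d_def[symmetric] using dnz by (simp add: field_simps)
      \<comment> \<open>As d = G + e, the first part is the algebraic truncation error and the
        second the error of the induction hypothesis.\<close>
      also have "H r * d - 1 = (G * H r - 1) + H r * e"
        by (simp add: G_def e_def d_def algebra_simps)
      finally have "norm (D r) = 2 * norm ((G * H r - 1) + H r * e) / norm d"
        by (simp only: norm_divide norm_mult norm_minus_cancel norm_numeral mult_minus_left)
      also have "\<dots> \<le> 2 * (C1 / y ^ N + real N * K * (max 0 C / y ^ N)) / (y / 2)"
      proof (intro frac_le mult_left_mono)
        have "norm ((G * H r - 1) + H r * e) \<le> norm (G * H r - 1) + norm (H r) * norm e"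
          by (metis norm_mult norm_triangle_ineq)
        also have "\<dots> \<le> C1 * norm \<zeta> ^ N + real N * K * (max 0 C / y ^ N)"
          using tr H e K0 by (intro add_mono mult_mono) auto
        finally show "norm ((G * H r - 1) + H r * e) \<le> C1 / y ^ N + real N * K * (max 0 C / y ^ N)"
          by (simp add: n\<zeta> power_divide)
      qed (use d Y(1) K0 in \<open>auto simp: C1_def\<close>)
      also have "\<dots> = C2 / y ^ Suc N"
        using Y(1) by (simp add: C2_def field_simps)
      finally show ?thesis .
    qed
    have int1: "set_integrable (stieltjes q) {0..s} (\<lambda>r. 2 / (w y r - of_real (x r)))"
      by (rule set_integrable_subset[OF continuous_set_integrable[of t]])
        (use s w_ne in \<open>auto intro!: continuous_intros w_cont x\<close>)
    have int2: "set_integrable (stieltjes q) {0..s} (\<lambda>r. 2 * complex_of_real (h j r) * \<zeta> ^ j)" for j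
      by (rule set_integrable_subset[OF continuous_set_integrable[of t]])
        (use s in \<open>auto intro!: continuous_intros h_cont\<close>)
    have int3: "set_integrable (stieltjes q) {0..s} (\<lambda>r. 2 * H r)"
      by (rule set_integrable_subset[OF continuous_set_integrable[of t]])
        (use s in \<open>auto simp: H_def intro!: continuous_intros h_cont\<close>)
    have c_int: "complex_of_real (c j s) * \<zeta> ^ j = (LINT r:{0..s}|stieltjes q. 2 * complex_of_real (h j r) * \<zeta> ^ j)" for j
    proof -
      have "c j s = (LINT r:{0..s}|stieltjes q. 2 * h j r)"
        unfolding c_def h_def by (rule lcoef_eq)
      then have "complex_of_real (c j s) = (LINT r:{0..s}|stieltjes q. complex_of_real (2 * h j r))"
        by (simp only: set_integral_complex_of_real)
      then show ?thesis by simp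
    qed
    have "w y s - z - (\<Sum>i\<in>{1..<Suc N}. of_real (c i s) * \<zeta> ^ i)
       = (LINT r:{0..s}|stieltjes q. 2 / (w y r - of_real (x r))) - (LINT r:{0..s}|stieltjes q. 2 * H r)"
    proof -
      have "(\<Sum>i\<in>{1..<Suc N}. of_real (c i s) * \<zeta> ^ i) = (\<Sum>j\<in>{1..N}. LINT r:{0..s}|stieltjes q. 2 * complex_of_real (h j r) * \<zeta> ^ j)"
        unfolding c_int atLeastLessThanSuc_atLeastAtMost ..
      also have "\<dots> = (LINT r:{0..s}|stieltjes q. \<Sum>j\<in>{1..N}. 2 * complex_of_real (h j r) * \<zeta> ^ j)"
        by (rule stieltjes_integral_sum[symmetric]) (rule int2)
      also have "\<dots> = (LINT r:{0..s}|stieltjes q. 2 * H r)"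
        by (simp add: H_def sum_distrib_left mult.assoc)
      finally show ?thesis using w_eq[OF s] by simp
    qed
    also have "\<dots> = (LINT r:{0..s}|stieltjes q. D r)"
      unfolding D_def by (rule set_integral_diff(2)[OF int1 int3, symmetric])
    also have "\<dots> = (LINT r:{0<..s}|stieltjes q. D r)"
      by (rule stieltjes_integral_Icc) simp
    also have "norm \<dots> \<le> C2 / y ^ Suc N * (q s - q 0)"
      using s D_bd order_trans[OF norm_ge_zero D_bd[OF s]] by (intro stieltjes_integral_bound) auto
    also have "\<dots> \<le> C2 / y ^ Suc N * V"
      using s order_trans[OF norm_ge_zero D_bd[OF s]] q_le[of s t] by (intro mult_left_mono) (auto simp: V_def)
    also have "\<dots> = (C2 * V) / y ^ Suc N" by simp
    finally show "norm (w y s - \<i> * of_real y - (\<Sum>i\<in>{1..<Suc N}. of_real (lcoef q x i s) * (1 / (\<i> * of_real y)) ^ i)) \<le> (C2 * V) / y ^ Suc N"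
      unfolding c_def \<zeta>_def z_def .
  qed
qed

end

lemma has_sum_powi_expansion:
  fixes a :: "int \<Rightarrow> complex"
  assumes "((\<lambda>m. a m * z powi (1 + m)) has_sum S) {..-2}"
  shows "(\<lambda>i. a (- 2 - int i) * (1 / z) ^ Suc i) sums S" and "summable (\<lambda>i. norm (a (- 2 - int i) * (1 / z) ^ Suc i))"
proof -
  have eq: "z powi (- 1 - int i) = (1 / z) ^ Suc i" for i
  proof -
    have "z powi (- 1 - int i) = z powi (- int (Suc i))" by (rule arg_cong[where f = "\<lambda>k. z powi k"]) simp
    also have "\<dots> = (1 / z) ^ Suc i"
      unfolding power_int_minus power_int_of_nat by (simp add: power_one_over inverse_eq_divide del: power_Suc)
    finally show ?thesis .
  qed
  have "((\<lambda>i. a (- 2 - int i) * (1 / z) ^ Suc i) has_sum S) UNIV"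
    using assms
    by (subst has_sum_reindex_bij_witness[of _ "\<lambda>m. nat (- 2 - m)" "\<lambda>i. - 2 - int i" "{..-2}" "\<lambda>m. a m * z powi (1 + m)" _ S])
      (auto simp: eq)
  then show "(\<lambda>i. a (- 2 - int i) * (1 / z) ^ Suc i) sums S" and "summable (\<lambda>i. norm (a (- 2 - int i) * (1 / z) ^ Suc i))"
    by (auto intro: has_sum_imp_sums summable_on_UNIV_nonneg_real_iff[THEN iffD1] simp: has_sum_imp_summable
        summable_on_iff_abs_summable_on_complex[symmetric])
qed

text \<open>A convergent expansion is asymptotic: the series converges absolutely at y0, and for y
  \<ge> y0 its tail is at most (y0/y)^N times the tail of norms at y0.\<close>

lemma expansion_asymptotics:
  fixes a :: "int \<Rightarrow> complex"
  assumes R: "\<And>y. y > R \<Longrightarrow> ((\<lambda>m. a m * (\<i> * of_real y) powi (1 + m)) has_sum (S y)) {..-2}"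
  shows "\<exists>C Y. \<forall>y\<ge>Y. norm (S y - (\<Sum>i\<in>{1..<N}. a (- 1 - int i) * (1 / (\<i> * of_real y)) ^ i)) \<le> C / y ^ N"
proof -
  define y0 where "y0 = max 1 (R + 1)"
  have y0: "y0 > R" "y0 \<ge> 1" by (auto simp: y0_def)
  define b where "b = (\<lambda>i. a (- 2 - int i))"
  have sums: "(\<lambda>i. b i * (1 / (\<i> * of_real y)) ^ Suc i) sums S y" if "y > R" for y
    unfolding b_def by (rule has_sum_powi_expansion(1)[OF R[OF that]])
  define f where "f = (\<lambda>i. norm (b i) * (1 / y0) ^ Suc i)"
  have f: "summable f"
    using has_sum_powi_expansion(2)[OF R[OF y0(1)]] y0 by (simp add: f_def b_def norm_mult norm_power norm_divide)
  define K where "K = suminf (\<lambda>i. f (i + (N - 1)))"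
  have fs: "summable (\<lambda>i. f (i + (N - 1)))" using f by (rule summable_ignore_initial_segment)
  show ?thesis
  proof (intro exI allI impI)
    fix y assume y: "y \<ge> y0"
    define \<zeta> where "\<zeta> = 1 / (\<i> * complex_of_real y)"
    have y': "y > R" "y \<ge> 1" using y y0 by auto
    have n\<zeta>: "norm \<zeta> = 1 / y" using y' by (simp add: \<zeta>_def norm_divide norm_mult)
    have term_bd: "norm (b (i + (N - 1)) * \<zeta> ^ Suc (i + (N - 1))) \<le> (y0 / y) ^ N * f (i + (N - 1))" for i
    proof -
      have "(1 / y) ^ Suc (i + (N - 1)) = (y0 / y) ^ Suc (i + (N - 1)) * (1 / y0) ^ Suc (i + (N - 1))"
        using y0 y' by (simp only: power_mult_distrib[symmetric]) simp
      also have "\<dots> \<le> (y0 / y) ^ N * (1 / y0) ^ Suc (i + (N - 1))"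
        using y0 y y' by (intro mult_right_mono power_decreasing) (auto simp: divide_le_eq_1)
      finally show ?thesis
        unfolding norm_mult norm_power n\<zeta> f_def
        by (metis (no_types, lifting) mult.left_commute mult_left_mono norm_ge_zero)
    qed
    have s: "(\<lambda>i. b i * \<zeta> ^ Suc i) sums S y" using sums[OF y'(1)] by (simp add: \<zeta>_def)
    have "(\<Sum>i\<in>{1..<N}. a (- 1 - int i) * \<zeta> ^ i) = (\<Sum>i<N - 1. b i * \<zeta> ^ Suc i)"
      by (rule sum.reindex_bij_witness[of _ Suc "\<lambda>i. i - 1"]) (auto simp: b_def)
    then have "S y - (\<Sum>i\<in>{1..<N}. a (- 1 - int i) * \<zeta> ^ i) = suminf (\<lambda>i. b (i + (N - 1)) * \<zeta> ^ Suc (i + (N - 1)))"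
      using suminf_minus_initial_segment[OF sums_summable[OF s], of "N - 1"] sums_unique[OF s] by simp
    also have "norm \<dots> \<le> suminf (\<lambda>i. (y0 / y) ^ N * f (i + (N - 1)))"
      by (rule norm_suminf_le[OF term_bd summable_mult[OF fs]])
    also have "\<dots> = (y0 / y) ^ N * K"
      unfolding K_def by (rule suminf_mult[OF fs])
    also have "\<dots> = (y0 ^ N * K) / y ^ N" by (simp add: power_divide)
    finally show "norm (S y - (\<Sum>i\<in>{1..<N}. a (- 1 - int i) * (1 / (\<i> * of_real y)) ^ i)) \<le> (y0 ^ N * K) / y ^ N"
      by (simp add: \<zeta>_def)
  qed
qed

text \<open>Once the lower coefficients agree, two expansions of the same function differ by (a_n -
  c_n) \<zeta>^n up to O(y^(-n-1)). Multiplying by y^n and letting y tend to infinity gives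
  equality.\<close>

lemma asymptotic_coefficients_unique:
  fixes a c :: "nat \<Rightarrow> complex"
  assumes a: "\<And>N. \<exists>C Y. \<forall>y\<ge>Y. norm (S y - (\<Sum>i\<in>{1..<N}. a i * (1 / (\<i> * of_real y)) ^ i)) \<le> C / y ^ N"
    and c: "\<And>N. \<exists>C Y. \<forall>y\<ge>Y. norm (S y - (\<Sum>i\<in>{1..<N}. c i * (1 / (\<i> * of_real y)) ^ i)) \<le> C / y ^ N"
    and "n \<ge> 1"
  shows "a n = c n"
  using \<open>n \<ge> 1\<close>
proof (induction n rule: less_induct)
  case (less n)
  obtain C1 Y1 where 1: "\<And>y. y \<ge> Y1 \<Longrightarrow> norm (S y - (\<Sum>i\<in>{1..<Suc n}. a i * (1 / (\<i> * of_real y)) ^ i)) \<le> C1 / y ^ Suc n"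
    using a[of "Suc n"] by blast
  obtain C2 Y2 where 2: "\<And>y. y \<ge> Y2 \<Longrightarrow> norm (S y - (\<Sum>i\<in>{1..<Suc n}. c i * (1 / (\<i> * of_real y)) ^ i)) \<le> C2 / y ^ Suc n"
    using c[of "Suc n"] by blast
  have "norm (a n - c n) \<le> (C1 + C2) * inverse y" if y: "y \<ge> Max {1, Y1, Y2}" for y
  proof -
    define \<zeta> where "\<zeta> = 1 / (\<i> * complex_of_real y)"
    have y': "y \<ge> 1" "y \<ge> Y1" "y \<ge> Y2" using y by simp_all
    have n\<zeta>: "norm \<zeta> = 1 / y" using y' by (simp add: \<zeta>_def norm_divide norm_mult)
    have "(\<Sum>i\<in>{1..<n}. a i * \<zeta> ^ i) = (\<Sum>i\<in>{1..<n}. c i * \<zeta> ^ i)"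
      by (rule sum.cong) (use less.IH in auto)
    then have "(a n - c n) * \<zeta> ^ n = (S y - (\<Sum>i\<in>{1..<Suc n}. c i * \<zeta> ^ i)) - (S y - (\<Sum>i\<in>{1..<Suc n}. a i * \<zeta> ^ i))"
      using less.prems by (simp add: algebra_simps)
    then have "norm ((a n - c n) * \<zeta> ^ n) \<le> norm (S y - (\<Sum>i\<in>{1..<Suc n}. c i * \<zeta> ^ i)) + norm (S y - (\<Sum>i\<in>{1..<Suc n}. a i * \<zeta> ^ i))"
      by (simp only: norm_triangle_ineq4)
    also have "\<dots> \<le> C2 / y ^ Suc n + C1 / y ^ Suc n"
      unfolding \<zeta>_def by (rule add_mono[OF 2[OF y'(3)] 1[OF y'(2)]])
    finally have "norm ((a n - c n) * \<zeta> ^ n) \<le> C2 / y ^ Suc n + C1 / y ^ Suc n" .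
    then have "norm (a n - c n) / y ^ n \<le> (C1 + C2) / y ^ Suc n"
      by (simp add: norm_mult norm_power n\<zeta> power_divide add_divide_distrib)
    then have "norm (a n - c n) \<le> (C1 + C2) / y ^ Suc n * y ^ n"
      using y'(1) by (simp add: divide_le_eq)
    also have "\<dots> = (C1 + C2) * inverse y"
      using y'(1) by (simp add: field_simps)
    finally show ?thesis .
  qed
  then have "\<forall>\<^sub>F y in at_top. norm (a n - c n) \<le> (C1 + C2) * inverse y"
    unfolding eventually_at_top_linorder by blast
  moreover have "((\<lambda>y :: real. (C1 + C2) * inverse y) \<longlongrightarrow> (C1 + C2) * 0) at_top"
    by (intro tendsto_intros tendsto_inverse_0_at_top filterlim_ident)
  ultimately have "norm (a n - c n) \<le> (C1 + C2) * 0"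
    by (intro tendsto_lowerbound[of _ _ at_top]) auto
  then show ?case by simp
qed

context clock_path
begin

text \<open>g is known to solve the Loewner equation only where some solution exists.
  \<open>loewner_exists\<close> supplies this at the points i y with y large, and these already
  determine all coefficients.\<close>

lemma expansion_coefficients:
  fixes gg :: "real \<Rightarrow> complex \<Rightarrow> complex" and a :: "int \<Rightarrow> complex"
  assumes t: "t \<ge> 0" and x: "continuous_on {0..t} x"
    and sol: "\<And>z. Im z > 0 \<Longrightarrow> \<exists>w. loewner_solution q x t z w \<Longrightarrow> loewner_solution q x t z (\<lambda>s. gg s z)"
    and ex: "\<And>z. Im z > 0 \<Longrightarrow> norm z > R \<Longrightarrow> ((\<lambda>m. a m * z powi (1 + m)) has_sum (gg t z - z)) {..-2}"
    and "n \<ge> 1"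
  shows "a (- 1 - int n) = of_real (lcoef q x n t)"
proof -
  obtain B where B: "B \<ge> 0" "\<And>r. r \<in> {0..t} \<Longrightarrow> norm (x r) \<le> B"
    by (rule continuous_bounded_Icc[OF x]) blast
  define Y0 where "Y0 = max 1 (B + 2 + 4 * (q t - q 0))"
  have w: "loewner_solution q x t (\<i> * of_real y) (\<lambda>s. gg s (\<i> * of_real y))" if "y \<ge> Y0" for y
  proof (rule sol)
    show "Im (\<i> * complex_of_real y) > 0" using that by (simp add: Y0_def)
    show "\<exists>w. loewner_solution q x t (\<i> * complex_of_real y) w"
      using that B by (intro loewner_exists[OF t x, of B]) (auto simp: Y0_def norm_mult)
  qed
  show ?thesis
  proof (rule asymptotic_coefficients_unique[of "\<lambda>y. gg t (\<i> * of_real y) - \<i> * of_real y" "\<lambda>i. a (- 1 - int i)" _ n])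
    show "\<exists>C Y. \<forall>y\<ge>Y. norm (gg t (\<i> * of_real y) - \<i> * of_real y - (\<Sum>i\<in>{1..<N}. a (- 1 - int i) * (1 / (\<i> * of_real y)) ^ i)) \<le> C / y ^ N" for N
    proof (rule expansion_asymptotics)
      fix y assume "y > max 0 R"
      then show "((\<lambda>m. a m * (\<i> * of_real y) powi (1 + m)) has_sum (gg t (\<i> * of_real y) - \<i> * of_real y)) {..-2}"
        by (intro ex) (auto simp: norm_mult)
    qed
    show "\<exists>C Y. \<forall>y\<ge>Y. norm (gg t (\<i> * of_real y) - \<i> * of_real y - (\<Sum>i\<in>{1..<N}. of_real (lcoef q x i t) * (1 / (\<i> * of_real y)) ^ i)) \<le> C / y ^ N" for N
    proof -
      have "\<exists>C Y. \<forall>y\<ge>Y. \<forall>s\<in>{0..t}. norm (gg s (\<i> * of_real y) - \<i> * of_real y - (\<Sum>i\<in>{1..<N}. of_real (lcoef q x i s) * (1 / (\<i> * of_real y)) ^ i)) \<le> C / y ^ N"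
        by (rule loewner_asymptotics[OF t x]) (rule w)
      moreover have "t \<in> {0..t}" using t by simp
      ultimately show ?thesis by blast
    qed
  qed fact
qed

end

section \<open>Stopping\<close>

text \<open>For a condition that stays false once it fails, the switched sum telescopes up to the
  first failure.\<close>

lemma telescoping_until:
  fixes a :: "nat \<Rightarrow> 'b :: ab_group_add"
  assumes "\<And>i j. i \<le> j \<Longrightarrow> p j \<Longrightarrow> p i"
  shows "\<exists>j\<le>k. (\<forall>i<j. p i) \<and> (j < k \<longrightarrow> \<not> p j) \<and> (\<Sum>i<k. if p i then a (Suc i) - a i else 0) = a j - a 0"
proof (induction k)
  case (Suc k)
  then obtain j where j: "j \<le> k" "\<forall>i<j. p i" "j < k \<longrightarrow> \<not> p j" "(\<Sum>i<k. if p i then a (Suc i) - a i else 0) = a j - a 0"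
    by blast
  show ?case
  proof (cases "j < k")
    case True
    then have "\<not> p k" using j(3) assms[of j k] by auto
    with j True show ?thesis by (intro exI[of _ j]) auto
  next
    case False
    then have "j = k" using j(1) by simp
    show ?thesis
    proof (cases "p k")
      case True
      then show ?thesis
        using j \<open>j = k\<close> by (intro exI[of _ "Suc k"]) (auto simp: less_Suc_eq)
    next
      case False
      then show ?thesis
        using j \<open>j = k\<close> by (intro exI[of _ k]) auto
    qed
  qed
qed simp

section \<open>Stopped times and grids\<close>

definition stop :: "ennreal \<Rightarrow> real \<Rightarrow> real" where
  "stop T t = enn2real (min T (ennreal t))"

lemma ennreal_stop: "ennreal (stop T t) = min T (ennreal t)"
  unfolding stop_def by (rule ennreal_enn2real) (auto simp: min_less_iff_disj)

lemma stop_bounds: "0 \<le> stop T t" "0 \<le> t \<Longrightarrow> stop T t \<le> t"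
proof -
  show "0 \<le> stop T t" by (simp add: stop_def)
  show "stop T t \<le> t" if "0 \<le> t"
    using that by (subst ennreal_le_iff[symmetric]) (simp_all add: ennreal_stop)
qed

lemma stop_mono: "0 \<le> s \<Longrightarrow> s \<le> t \<Longrightarrow> stop T s \<le> stop T t"
  by (subst ennreal_le_iff[symmetric]) (auto simp: stop_bounds ennreal_stop min_def ennreal_leI dest: order_trans intro: ennreal_leI)

lemma stop_before: "0 \<le> t \<Longrightarrow> ennreal t \<le> T \<Longrightarrow> stop T t = t"
  by (simp add: stop_def min_absorb2)

lemma stop_le: "ennreal (stop T t) \<le> T"
  by (simp add: ennreal_stop)

lemma stop_after: "T \<le> ennreal s \<Longrightarrow> 0 \<le> s \<Longrightarrow> s \<le> t \<Longrightarrow> stop T t = stop T s"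
  unfolding stop_def by (metis ennreal_leI min_absorb1 order_trans)

lemma stop_lipschitz:
  assumes "0 \<le> s" "s \<le> t"
  shows "stop T t - stop T s \<le> t - s"
proof (cases "ennreal s \<le> T")
  case True
  then show ?thesis using stop_before[OF assms(1)] stop_bounds(2)[of t T] assms by auto
next
  case False
  then have "stop T t = stop T s" using assms by (intro stop_after) auto
  then show ?thesis using assms by simp
qed

lemma stop_continuous_on: "continuous_on {0..} (stop T)"
proof -
  have "1-lipschitz_on {0..} (stop T)"
  proof (rule lipschitz_onI)
    fix s t :: real assume "s \<in> {0..}" "t \<in> {0..}"
    then show "dist (stop T s) (stop T t) \<le> 1 * dist s t"
      using stop_lipschitz[of s t T] stop_lipschitz[of t s T] stop_mono[of s t T] stop_mono[of t s T]
      by (cases "s \<le> t") (auto simp: dist_real_def)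
  qed simp
  then show ?thesis by (rule lipschitz_on_continuous_on)
qed

definition grid :: "real \<Rightarrow> real \<Rightarrow> nat \<Rightarrow> nat \<Rightarrow> real" where
  "grid s t k i = s + (t - s) * real i / real k"

lemma grid_0 [simp]: "grid s t k 0 = s"
  and grid_k: "k > 0 \<Longrightarrow> grid s t k k = t"
  by (simp_all add: grid_def)

lemma grid_mono: "s \<le> t \<Longrightarrow> i \<le> j \<Longrightarrow> grid s t k i \<le> grid s t k j"
  unfolding grid_def by (intro add_left_mono divide_right_mono mult_left_mono) auto

lemma grid_step: "grid s t k (Suc i) - grid s t k i = (t - s) / real k"
  by (simp add: grid_def distrib_left add_divide_distrib)

lemma grid_bounds:
  assumes "s \<le> t"
  shows "s \<le> grid s t k i" "i \<le> k \<Longrightarrow> k > 0 \<Longrightarrow> grid s t k i \<le> t"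
  using grid_mono[OF assms, of 0 i k] grid_mono[OF assms, of i k k] by (simp_all add: grid_k)

text \<open>Increments are switched by the event that T lies after their left endpoint. The sum then
  stops at the first grid point not before T, or at t, hence within one mesh of the stopped time; s
  < T makes the first increment count.\<close>

lemma grid_stopped:
  fixes f :: "real \<Rightarrow> 'b :: ab_group_add"
  assumes st: "0 \<le> s" "s \<le> t" and k: "k > 0" and T: "ennreal s < T"
  shows "\<exists>u\<in>{s..t}. \<bar>u - stop T t\<bar> \<le> (t - s) / real k \<and>
    (\<Sum>i<k. if ennreal (grid s t k i) < T then f (grid s t k (Suc i)) - f (grid s t k i) else 0) = f u - f s"
proof -
  have mono: "ennreal (grid s t k i) < T" if "i \<le> j" "ennreal (grid s t k j) < T" for i j
    using grid_mono[OF st(2) that(1), of k] that(2) by (meson ennreal_leI order_le_less_trans)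
  obtain j where j: "j \<le> k" "\<forall>i<j. ennreal (grid s t k i) < T" "j < k \<longrightarrow> \<not> ennreal (grid s t k j) < T"
    "(\<Sum>i<k. if ennreal (grid s t k i) < T then f (grid s t k (Suc i)) - f (grid s t k i) else 0) = f (grid s t k j) - f (grid s t k 0)"
    using telescoping_until[of "\<lambda>i. ennreal (grid s t k i) < T" k "\<lambda>i. f (grid s t k i)"] mono by blast
  have "j \<noteq> 0"
    using j(3) T k by (auto intro!: Nat.gr0I)
  then obtain i where i: "j = Suc i" by (cases j) auto
  define u where "u = grid s t k j"
  have g0: "0 \<le> grid s t k i" "grid s t k i \<le> t" using grid_bounds[OF st(2), where k = k and i = i] st j(1) i k by auto
  have u: "u \<in> {s..t}" using grid_bounds[OF st(2), where k = k and i = j] j(1) k by (auto simp: u_def)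
  have step: "u - grid s t k i = (t - s) / real k" unfolding u_def i by (rule grid_step)
  have lo: "grid s t k i \<le> stop T t"
  proof -
    have "stop T (grid s t k i) = grid s t k i"
      using j(2) i g0 by (intro stop_before) (auto intro: less_imp_le)
    then show ?thesis using stop_mono[OF g0, of T] by simp
  qed
  have hi: "stop T t \<le> u"
  proof (cases "j < k")
    case True
    then have "T \<le> ennreal u" using j(3) by (simp add: u_def)
    then have "ennreal (stop T t) \<le> ennreal u" using stop_le order_trans by blast
    then show ?thesis using u st by (simp add: ennreal_le_iff)
  next
    case False
    then have "u = t" using j(1) k by (simp add: u_def grid_k)
    then show ?thesis using st by (simp add: stop_bounds)
  qed
  show ?thesis
    using u step lo hi j(4) by (intro bexI[of _ u]) (auto simp: u_def)
qed

lemma grid_stopped_tendsto: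
  fixes f :: "real \<Rightarrow> 'b :: real_normed_vector"
  assumes st: "0 \<le> s" "s \<le> t" and T: "ennreal s < T" and f: "continuous_on {s..t} f"
  shows "(\<lambda>k. \<Sum>i<k. if ennreal (grid s t k i) < T then f (grid s t k (Suc i)) - f (grid s t k i) else 0)
    \<longlonglongrightarrow> f (stop T t) - f s"
proof -
  define Q where "Q = (\<lambda>k u. u \<in> {s..t} \<and> (k > 0 \<longrightarrow> \<bar>u - stop T t\<bar> \<le> (t - s) / real k \<and>
    (\<Sum>i<k. if ennreal (grid s t k i) < T then f (grid s t k (Suc i)) - f (grid s t k i) else 0) = f u - f s))"
  have "\<exists>u. Q k u" for k
  proof (cases "k > 0")
    case True
    from grid_stopped[OF st True T, where f = f] show ?thesis unfolding Q_def by blast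
  next
    case False
    then show ?thesis unfolding Q_def using st by (intro exI[of _ s]) simp
  qed
  then have "\<forall>k. \<exists>u. Q k u" ..
  from choice[OF this] obtain u where Q: "\<And>k. Q k (u k)" by blast
  have u: "\<And>k. u k \<in> {s..t}" "\<And>k. k > 0 \<Longrightarrow> \<bar>u k - stop T t\<bar> \<le> (t - s) / real k"
    "\<And>k. k > 0 \<Longrightarrow> (\<Sum>i<k. if ennreal (grid s t k i) < T then f (grid s t k (Suc i)) - f (grid s t k i) else 0) = f (u k) - f s"
    using Q unfolding Q_def by blast+
  have "(\<lambda>k. (t - s) / real k) \<longlonglongrightarrow> 0" by (rule lim_const_over_n)
  then have "(\<lambda>k. u k - stop T t) \<longlonglongrightarrow> 0"
    by (rule Lim_null_comparison[rotated]) (auto intro!: eventually_sequentiallyI[of 1] u(2))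
  then have "u \<longlonglongrightarrow> stop T t" by (rule Lim_null[THEN iffD2])
  moreover have "stop T t \<in> {s..t}"
    using stop_mono[OF st, of T] stop_before[OF st(1), of T] T st by (auto simp: stop_bounds)
  ultimately have "(\<lambda>k. f (u k)) \<longlonglongrightarrow> f (stop T t)"
    using u(1) by (intro continuous_on_tendsto_compose[OF f]) auto
  then have "(\<lambda>k. f (u k) - f s) \<longlonglongrightarrow> f (stop T t) - f s" by (intro tendsto_intros)
  then show ?thesis
    by (rule Lim_transform_eventually) (auto intro!: eventually_sequentiallyI[of 1] simp: u(3))
qed

section \<open>Martingales and stopping for a general filtration\<close>

locale filtered_prob = prob_space P + filtration "space P" F
  for P :: "'a measure" and F :: "ennreal \<Rightarrow> 'a measure" +
  assumes subalg: "subalgebra P (F t)"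
begin

lemma measurable_F_mono:
  assumes "f \<in> borel_measurable (F s)" "s \<le> t"
  shows "f \<in> borel_measurable (F t)"
  using assms sets_F_mono[OF assms(2)] by (simp add: measurable_def space_F) blast

lemma measurable_F_P: "f \<in> borel_measurable (F s) \<Longrightarrow> f \<in> borel_measurable P"
  by (rule measurable_from_subalg[OF subalg])

lemma sigma_finite_F: "sigma_finite_subalgebra P (F t)"
  by (meson finite_measure_axioms finite_measure_subalgebra.intro finite_measure_subalgebra_axioms.intro
      finite_measure_subalgebra_is_sigma_finite subalg)

lemma integrable_bounded:
  fixes f :: "'a \<Rightarrow> real"
  assumes "f \<in> borel_measurable P" "\<And>w. w \<in> space P \<Longrightarrow> \<bar>f w\<bar> \<le> c"
  shows "integrable P f"
  using assms by (intro integrable_const_bound[of _ c]) (auto intro!: AE_I2)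

lemma martingale_increment:
  assumes N: "martingale P F N" and st: "0 \<le> s" "s \<le> t"
    and H: "H \<in> borel_measurable (F (ennreal s))" "\<And>w. w \<in> space P \<Longrightarrow> \<bar>H w\<bar> \<le> c"
  shows "integrable P (\<lambda>w. H w * (N t w - N s w))" "(LINT w|P. H w * (N t w - N s w)) = 0"
proof -
  interpret F: sigma_finite_subalgebra P "F (ennreal s)" by (rule sigma_finite_F)
  have HP: "H \<in> borel_measurable P" by (rule measurable_F_P[OF H(1)])
  have Nint: "integrable P (N r)" if "0 \<le> r" for r using N that by (auto simp: martingale_def)
  have int: "integrable P (\<lambda>w. H w * N r w)" if "0 \<le> r" for r
    by (rule Bochner_Integration.integrable_bound[OF integrable_mult_right[OF integrable_abs[OF Nint[OF that]], of c]])
      (use HP Nint[OF that] H(2) in \<open>auto intro!: AE_I2 mult_right_mono order_trans[OF H(2) abs_ge_self] simp: abs_mult\<close>)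
  have t: "0 \<le> t" using st by simp
  show "integrable P (\<lambda>w. H w * (N t w - N s w))"
    using int[OF st(1)] int[OF t] by (simp add: right_diff_distrib)
  have "(LINT w|P. H w * N t w) = (LINT w|P. H w * real_cond_exp P (F (ennreal s)) (N t) w)"
    using F.real_cond_exp_intg(2)[OF int[OF t] H(1)] Nint[OF t] by simp
  also have "\<dots> = (LINT w|P. H w * N s w)"
  proof (rule integral_cong_AE)
    have "AE w in P. real_cond_exp P (F (ennreal s)) (N t) w = N s w"
      using N st by (auto simp: martingale_def)
    then show "AE w in P. H w * real_cond_exp P (F (ennreal s)) (N t) w = H w * N s w"
      by eventually_elim simp
  qed (use HP Nint[OF st(1)] in auto)
  finally show "(LINT w|P. H w * (N t w - N s w)) = 0"
    using int[OF st(1)] int[OF t] by (simp add: right_diff_distrib)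
qed

lemma martingaleI:
  assumes meas: "\<And>t. t \<ge> 0 \<Longrightarrow> N t \<in> borel_measurable (F (ennreal t))"
    and int: "\<And>t. t \<ge> 0 \<Longrightarrow> integrable P (N t)"
    and inc: "\<And>s t A. 0 \<le> s \<Longrightarrow> s \<le> t \<Longrightarrow> A \<in> sets (F (ennreal s)) \<Longrightarrow> (LINT w|P. indicator A w * (N t w - N s w)) = 0"
  shows "martingale P F N"
  unfolding martingale_def
proof (intro conjI allI impI)
  fix s t :: real assume st: "0 \<le> s" "s \<le> t"
  interpret F: sigma_finite_subalgebra P "F (ennreal s)" by (rule sigma_finite_F)
  show "AE w in P. real_cond_exp P (F (ennreal s)) (N t) w = N s w"
  proof (rule F.real_cond_exp_charact)
    fix A assume A: "A \<in> sets (F (ennreal s))"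
    then have AP: "A \<in> sets P" using subalg by (auto simp: subalgebra_def)
    have "integrable P (\<lambda>w. indicator A w * N r w)" if "0 \<le> r" for r
      using integrable_real_mult_indicator[OF AP int[OF that]] by (simp add: mult.commute)
    then show "(\<integral>w\<in>A. N t w \<partial>P) = (\<integral>w\<in>A. N s w \<partial>P)"
      using inc[OF st A] st by (simp add: set_lebesgue_integral_def right_diff_distrib)
  qed (use st meas int in auto)
qed (use meas int in auto)

lemma stopping_time_less_measurable:
  assumes "stopping_time F T" "s \<le> t"
  shows "{w \<in> space P. s < T w} \<in> sets (F t)"
  using stopping_timeD2[OF assms(1), of s] sets_F_mono[OF assms(2)] by (auto simp: pred_def space_F)

lemma indicator_before_measurable:
  assumes "stopping_time F T" "f \<in> borel_measurable (F t)" "s \<le> t"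
  shows "(\<lambda>w. if s < T w then f w else 0 :: real) \<in> borel_measurable (F t)"
proof -
  have "Measurable.pred (F t) (\<lambda>w. s < T w)"
    using stopping_time_less_measurable[OF assms(1,3)] by (simp add: pred_def space_F)
  then show ?thesis using assms(2) by (intro measurable_If) auto
qed

lemma indicator_after_measurable:
  assumes "stopping_time F T" "f \<in> borel_measurable (F t)" "s \<le> t"
  shows "(\<lambda>w. if T w \<le> s then f w else 0 :: real) \<in> borel_measurable (F t)"
proof -
  have "(\<lambda>w. if T w \<le> s then f w else 0 :: real) = (\<lambda>w. f w - (if s < T w then f w else 0))"
    by (rule ext) (simp add: not_less[symmetric])
  then show ?thesis
    using assms(2) indicator_before_measurable[OF assms] by simp
qed

text \<open>A pointwise limit of sums of increments that are switched at their left endpoints. All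
  grid times are at most t, so the limit is measurable at time t itself and not just after
  it.\<close>

lemma stopped_adapted:
  fixes N :: "real \<Rightarrow> 'a \<Rightarrow> real"
  assumes T: "stopping_time F T" and N: "\<And>t. t \<ge> 0 \<Longrightarrow> N t \<in> borel_measurable (F (ennreal t))"
    and cont: "\<And>w. w \<in> space P \<Longrightarrow> continuous_on {0..} (\<lambda>t. N t w)" and t: "t \<ge> 0"
  shows "(\<lambda>w. N (stop (T w) t) w) \<in> borel_measurable (F (ennreal t))"
proof (rule borel_measurable_LIMSEQ_real)
  define f where "f = (\<lambda>k w. N 0 w + (\<Sum>i<k. if ennreal (grid 0 t k i) < T w then N (grid 0 t k (Suc i)) w - N (grid 0 t k i) w else 0))"
  have N': "N r \<in> borel_measurable (F (ennreal t))" if "0 \<le> r" "r \<le> t" for r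
    by (rule measurable_F_mono[OF N[OF that(1)]]) (use that in \<open>auto intro: ennreal_leI\<close>)
  show "f k \<in> borel_measurable (F (ennreal t))" for k
    unfolding f_def
  proof (intro borel_measurable_add borel_measurable_sum indicator_before_measurable[OF T] borel_measurable_diff N')
    fix i assume "i \<in> {..<k}"
    then show "0 \<le> grid 0 t k (Suc i)" "grid 0 t k (Suc i) \<le> t" "0 \<le> grid 0 t k i" "grid 0 t k i \<le> t"
      "ennreal (grid 0 t k i) \<le> ennreal t"
      using grid_bounds[OF t, where k = k and i = i] grid_bounds[OF t, where k = k and i = "Suc i"] by (auto intro!: ennreal_leI)
  qed (use t in auto)
  fix w assume "w \<in> space (F (ennreal t))"
  then have w: "w \<in> space P" by (simp add: space_F)
  show "(\<lambda>k. f k w) \<longlonglongrightarrow> N (stop (T w) t) w"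
  proof (cases "0 < T w")
    case True
    have "(\<lambda>k. N 0 w + (\<Sum>i<k. if ennreal (grid 0 t k i) < T w then N (grid 0 t k (Suc i)) w - N (grid 0 t k i) w else 0))
      \<longlonglongrightarrow> N 0 w + (N (stop (T w) t) w - N 0 w)"
      using True t by (intro tendsto_add tendsto_const grid_stopped_tendsto continuous_on_subset[OF cont[OF w]]) auto
    then show ?thesis by (simp add: f_def)
  next
    case False
    then have "T w = 0" by (simp add: not_less)
    then show ?thesis by (simp add: f_def stop_def)
  qed
qed

end

context filtered_prob
begin

text \<open>Discretise \<open>T\<close> from above. The approximations are not bounded, but their tails are
  controlled by the integrable \<open>N t\<close>, by discrete optional stopping.\<close>

lemma optional_stopping_bounded:
  assumes N: "martingale P F N" and cont: "AE w in P. continuous_on {0..} (\<lambda>t. N t w)"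
    and T: "stopping_time F T" and st: "0 \<le> s" "s \<le> t"
    and H: "H \<in> borel_measurable (F (ennreal s))" "\<And>w. w \<in> space P \<Longrightarrow> \<bar>H w\<bar> \<le> h"
    and c: "c \<ge> 0" and bd: "AE w in P. ennreal s < T w \<longrightarrow> \<bar>N (stop (T w) t) w\<bar> \<le> c"
    and D: "D \<in> borel_measurable P" "AE w in P. D w = (if ennreal s < T w then N (stop (T w) t) w - N s w else 0)"
  shows "(LINT w|P. H w * D w) = 0"
proof -
  have t: "0 \<le> t" using st by simp
  have Nint: "integrable P (N r)" if "0 \<le> r" for r using N that by (auto simp: martingale_def)
  have Nmeas: "N r \<in> borel_measurable (F (ennreal r))" if "0 \<le> r" for r using N that by (auto simp: martingale_def)
  have Nm[measurable]: "N s \<in> borel_measurable P" "N t \<in> borel_measurable P"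
    using Nint[OF st(1)] Nint[OF t] by auto
  have HP[measurable]: "H \<in> borel_measurable P" by (rule measurable_F_P[OF H(1)])
  note D(1)[measurable]
  define I where "I = (\<lambda>w. if ennreal s < T w then 1 else (0::real))"
  have IF: "I \<in> borel_measurable (F (ennreal s))"
    unfolding I_def by (rule indicator_before_measurable[OF T]) auto
  have [measurable]: "I \<in> borel_measurable P" by (rule measurable_F_P[OF IF])
  have I01: "\<bar>I w\<bar> \<le> 1" "0 \<le> I w" for w by (auto simp: I_def)
  define g where "g = (\<lambda>k i. grid s t k i)"
  have g: "s \<le> g k i" "0 \<le> g k i" "i < k \<Longrightarrow> g k i \<le> t" "i \<le> j \<Longrightarrow> g k i \<le> g k j" for k i j
    using grid_bounds[OF st(2), where k = k and i = i] grid_mono[OF st(2), of i j k] st by (auto simp: g_def)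
  define d where "d = (\<lambda>k l w. N (g k (Suc l)) w - N (g k l) w)"
  \<comment> \<open>N run from s and stopped at the first grid point not before T.\<close>
  define X where "X = (\<lambda>k i w. N s w + (\<Sum>l<i. if ennreal (g k l) < T w then d k l w else 0))"
  have XF: "X k i \<in> borel_measurable (F (ennreal (g k i)))" for k i
    unfolding X_def d_def
  proof (intro borel_measurable_add borel_measurable_sum indicator_before_measurable[OF T] borel_measurable_diff)
    show "N s \<in> borel_measurable (F (ennreal (g k i)))"
      by (rule measurable_F_mono[OF Nmeas[OF st(1)]]) (use g in \<open>auto intro: ennreal_leI\<close>)
    fix l assume "l \<in> {..<i}"
    then have l: "Suc l \<le> i" "l \<le> i" by auto
    show "N (g k (Suc l)) \<in> borel_measurable (F (ennreal (g k i)))"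
      by (rule measurable_F_mono[OF Nmeas[OF g(2)]]) (intro ennreal_leI g(4) l)
    show "N (g k l) \<in> borel_measurable (F (ennreal (g k i)))"
      by (rule measurable_F_mono[OF Nmeas[OF g(2)]]) (intro ennreal_leI g(4) l)
    show "ennreal (g k l) \<le> ennreal (g k i)" by (intro ennreal_leI g(4) l)
  qed
  have XP[measurable]: "X k i \<in> borel_measurable P" for k i by (rule measurable_F_P[OF XF])
  have dint: "integrable P (d k l)" for k l
    unfolding d_def by (intro Bochner_Integration.integrable_diff Nint g)
  have TP: "{w \<in> space P. u < T w} \<in> sets P" for u
    using stopping_time_less_measurable[OF T order_refl, of u] subalg by (auto simp: subalgebra_def)
  have Xint: "integrable P (X k i)" for k i
  proof -
    have "integrable P (\<lambda>w. if ennreal (g k l) < T w then d k l w else 0)" for l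
    proof -
      have "integrable P (\<lambda>w. indicator {w \<in> space P. ennreal (g k l) < T w} w *\<^sub>R d k l w)"
        by (rule integrable_mult_indicator[OF TP dint])
      moreover have "integrable P (\<lambda>w. if ennreal (g k l) < T w then d k l w else 0) \<longleftrightarrow>
          integrable P (\<lambda>w. indicator {w \<in> space P. ennreal (g k l) < T w} w *\<^sub>R d k l w)"
        by (rule Bochner_Integration.integrable_cong) (auto simp: indicator_def)
      ultimately show ?thesis by simp
    qed
    then show ?thesis unfolding X_def by (intro Bochner_Integration.integrable_add Nint st Bochner_Integration.integrable_sum)
  qed
  have HI: "\<bar>H w * I w\<bar> \<le> h" if "w \<in> space P" for w
    using H(2)[OF that] by (auto simp: I_def)
  have h: "0 \<le> h" using H(2) not_empty by (metis abs_ge_zero all_not_in_conv order_trans)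
  have mult_int: "integrable P (\<lambda>w. A w * B w)"
    if "A \<in> borel_measurable P" "\<And>w. w \<in> space P \<Longrightarrow> \<bar>A w\<bar> \<le> a" "integrable P B" for A B :: "'a \<Rightarrow> real" and a
    by (rule Bochner_Integration.integrable_bound[OF integrable_mult_right[OF integrable_abs[OF that(3)], of a]])
      (use that in \<open>auto intro!: AE_I2 mult_right_mono order_trans[OF that(2) abs_ge_self] simp: abs_mult\<close>)
  have one: "(LINT w|P. H w * I w * X k k w) = (LINT w|P. H w * I w * N s w)" for k
  proof -
    have inc: "integrable P (\<lambda>w. (if ennreal (g k l) < T w then H w * I w else 0) * d k l w)"
      "(LINT w|P. (if ennreal (g k l) < T w then H w * I w else 0) * d k l w) = 0" for l
    proof -
      have m: "(\<lambda>w. if ennreal (g k l) < T w then H w * I w else 0) \<in> borel_measurable (F (ennreal (g k l)))"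
        by (intro indicator_before_measurable[OF T] measurable_F_mono[OF borel_measurable_times[OF H(1) IF]] ennreal_leI g) simp
      have b: "\<bar>if ennreal (g k l) < T w then H w * I w else 0\<bar> \<le> h" if "w \<in> space P" for w
        using HI[OF that] h by auto
      show "integrable P (\<lambda>w. (if ennreal (g k l) < T w then H w * I w else 0) * d k l w)"
        "(LINT w|P. (if ennreal (g k l) < T w then H w * I w else 0) * d k l w) = 0"
        unfolding d_def by (rule martingale_increment[OF N g(2) g(4) m b]; simp)+
    qed
    have eq: "H w * I w * X k k w = H w * I w * N s w + (\<Sum>l<k. (if ennreal (g k l) < T w then H w * I w else 0) * d k l w)" for w
      unfolding X_def distrib_left sum_distrib_left by (intro arg_cong2[where f = "(+)"] refl sum.cong) auto
    show ?thesis
      unfolding eq using inc mult_int[OF _ HI Nint[OF st(1)]]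
      by (subst Bochner_Integration.integral_add) (auto intro!: Bochner_Integration.integrable_sum simp: Bochner_Integration.integral_sum)
  qed
  \<comment> \<open>A test function for the tail: \<psi>(x) x equals |x| if |x| > c + 1, and 0
    otherwise.\<close>
  define \<psi> where "\<psi> = (\<lambda>x :: real. if \<bar>x\<bar> > c + 1 then sgn x else 0)"
  have \<psi>m[measurable]: "\<psi> \<in> borel_measurable borel" unfolding \<psi>_def by measurable
  have \<psi>1: "\<bar>\<psi> x\<bar> \<le> 1" for x by (auto simp: \<psi>_def sgn_if)
  have I\<psi>: "(\<lambda>w. I w * \<psi> (X k k w)) \<in> borel_measurable P" "\<bar>I w * \<psi> x\<bar> \<le> 1" for k w x
    using \<psi>1 by (measurable, auto simp: I_def)
  \<comment> \<open>Once T has passed, X no longer changes, so \<psi>(X) is known and the later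
    increments of N integrate to 0 against it. The tails of all X k k are thereby controlled by the
    single integrable variable N t.\<close>
  have two: "(LINT w|P. I w * \<psi> (X k k w) * X k k w) = (LINT w|P. I w * \<psi> (X k k w) * N t w)" if k: "k > 0" for k
  proof -
    define A where "A = (\<lambda>l w. if T w \<le> ennreal (g k l) then I w * \<psi> (X k l w) else 0)"
    have A1: "\<bar>A l w\<bar> \<le> 1" for l w using \<psi>1 by (auto simp: A_def I_def)
    have inc: "integrable P (\<lambda>w. A l w * d k l w)" "(LINT w|P. A l w * d k l w) = 0" for l
    proof -
      have m: "A l \<in> borel_measurable (F (ennreal (g k l)))"
        unfolding A_def
        by (intro indicator_after_measurable[OF T] borel_measurable_times measurable_F_mono[OF IF] ennreal_leI g order_refl
            measurable_compose[OF XF \<psi>m])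
      show "integrable P (\<lambda>w. A l w * d k l w)" "(LINT w|P. A l w * d k l w) = 0"
        unfolding d_def by (rule martingale_increment[OF N g(2) g(4) m A1]; simp)+
    qed
    have eq: "I w * \<psi> (X k k w) * N t w = I w * \<psi> (X k k w) * X k k w + (\<Sum>l<k. A l w * d k l w)" for w
    proof (cases "ennreal s < T w")
      case True
      have "N t w = N s w + (\<Sum>l<k. d k l w)"
        using sum_lessThan_telescope[of "\<lambda>l. N (grid s t k l) w" k] k by (simp add: d_def g_def grid_k)
      also have "\<dots> = X k k w + (\<Sum>l<k. if T w \<le> ennreal (g k l) then d k l w else 0)"
        unfolding X_def add.assoc sum.distrib[symmetric] by (intro arg_cong2[where f = "(+)"] refl sum.cong) auto
      finally have "I w * \<psi> (X k k w) * N t w = I w * \<psi> (X k k w) * X k k w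
          + (\<Sum>l<k. I w * \<psi> (X k k w) * (if T w \<le> ennreal (g k l) then d k l w else 0))"
        by (simp add: distrib_left sum_distrib_left)
      also have "(\<Sum>l<k. I w * \<psi> (X k k w) * (if T w \<le> ennreal (g k l) then d k l w else 0)) = (\<Sum>l<k. A l w * d k l w)"
      proof (rule sum.cong[OF refl])
        fix l assume l: "l \<in> {..<k}"
        have "X k k w = X k l w" if Tl: "T w \<le> ennreal (g k l)"
        proof -
          have "(\<Sum>i<l. if ennreal (g k i) < T w then d k i w else 0) = (\<Sum>i<k. if ennreal (g k i) < T w then d k i w else 0)"
          proof (rule sum.mono_neutral_left)
            show "\<forall>i\<in>{..<k} - {..<l}. (if ennreal (g k i) < T w then d k i w else 0) = 0"
            proof
              fix i assume "i \<in> {..<k} - {..<l}"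
              then have "g k l \<le> g k i" by (intro g) auto
              then have "T w \<le> ennreal (g k i)" using Tl by (meson ennreal_leI order_trans)
              then show "(if ennreal (g k i) < T w then d k i w else 0) = 0" by simp
            qed
          qed (use l in auto)
          then show ?thesis by (simp add: X_def)
        qed
        then show "I w * \<psi> (X k k w) * (if T w \<le> ennreal (g k l) then d k l w else 0) = A l w * d k l w"
          by (auto simp: A_def)
      qed
      finally show ?thesis .
    next
      case False
      then have "I w = 0" "A l w = 0" for l by (simp_all add: I_def A_def)
      then show ?thesis by simp
    qed
    have "integrable P (\<lambda>w. I w * \<psi> (X k k w) * X k k w)"
      by (rule mult_int[OF I\<psi> Xint])
    then show ?thesis
      unfolding eq using inc
      by (subst Bochner_Integration.integral_add) (auto intro!: Bochner_Integration.integrable_sum simp: Bochner_Integration.integral_sum)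
  qed
  define \<epsilon> where "\<epsilon> = (\<lambda>k. LINT w|P. I w * \<bar>N t w\<bar> * \<bar>\<psi> (X k k w)\<bar>)"
  have X_lim: "AE w in P. ennreal s < T w \<longrightarrow> (\<lambda>k. X k k w) \<longlonglongrightarrow> N (stop (T w) t) w"
    using cont
  proof eventually_elim
    case (elim w)
    show ?case
    proof
      assume "ennreal s < T w"
      then have "(\<lambda>k. N s w + (\<Sum>i<k. if ennreal (grid s t k i) < T w then N (grid s t k (Suc i)) w - N (grid s t k i) w else 0))
        \<longlonglongrightarrow> N s w + (N (stop (T w) t) w - N s w)"
        using st by (intro tendsto_add tendsto_const grid_stopped_tendsto continuous_on_subset[OF elim]) auto
      then show "(\<lambda>k. X k k w) \<longlonglongrightarrow> N (stop (T w) t) w"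
        unfolding X_def d_def g_def by simp
    qed
  qed
  have small: "AE w in P. ennreal s < T w \<longrightarrow> (\<forall>\<^sub>F k in sequentially. \<bar>X k k w\<bar> < c + 1)"
    using X_lim bd
  proof eventually_elim
    case (elim w)
    show ?case
    proof
      assume "ennreal s < T w"
      then have "(\<lambda>k. \<bar>X k k w\<bar>) \<longlonglongrightarrow> \<bar>N (stop (T w) t) w\<bar>" "\<bar>N (stop (T w) t) w\<bar> < c + 1"
        using elim by (auto intro!: tendsto_intros)
      then show "\<forall>\<^sub>F k in sequentially. \<bar>X k k w\<bar> < c + 1" by (rule order_tendstoD(2))
    qed
  qed
  have \<epsilon>_lim: "\<epsilon> \<longlonglongrightarrow> 0"
  proof -
    have "\<epsilon> \<longlonglongrightarrow> (LINT w|P. 0)"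
      unfolding \<epsilon>_def
    proof (rule integral_dominated_convergence)
      show "integrable P (\<lambda>w. \<bar>N t w\<bar>)" using Nint[OF t] by simp
      show "AE w in P. (\<lambda>k. I w * \<bar>N t w\<bar> * \<bar>\<psi> (X k k w)\<bar>) \<longlonglongrightarrow> 0"
        using small
      proof eventually_elim
        case (elim w)
        show ?case
        proof (cases "ennreal s < T w")
          case True
          have "\<forall>\<^sub>F k in sequentially. I w * \<bar>N t w\<bar> * \<bar>\<psi> (X k k w)\<bar> = 0"
            by (rule eventually_mono[OF elim[rule_format, OF True]]) (simp_all add: \<psi>_def)
          then show ?thesis by (rule tendsto_eventually)
        qed (simp add: I_def)
      qed
      show "AE w in P. norm (I w * \<bar>N t w\<bar> * \<bar>\<psi> (X k k w)\<bar>) \<le> \<bar>N t w\<bar>" for k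
        using \<psi>1 by (intro AE_I2) (auto simp: I_def abs_mult mult_left_le)
    qed measurable
    then show ?thesis by simp
  qed
  \<comment> \<open>Truncation at c + 1, above the bound c of the limit: it is invisible in the
    limit and permits dominated convergence, while the loss is bounded by \<psi>(x) x.\<close>
  define \<Phi> where "\<Phi> = (\<lambda>x :: real. max (- (c + 1)) (min (c + 1) x))"
  have \<Phi>m[measurable]: "\<Phi> \<in> borel_measurable borel" unfolding \<Phi>_def by measurable
  have \<Phi>b: "\<bar>\<Phi> x\<bar> \<le> c + 1" for x using c by (auto simp: \<Phi>_def)
  have \<Phi>d: "\<bar>x - \<Phi> x\<bar> \<le> \<psi> x * x" for x using c by (auto simp: \<Phi>_def \<psi>_def sgn_if)
  \<comment> \<open>A measurable version of the stopped value on the event s < T. It is built from D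
    because the paths of N are continuous almost surely only.\<close>
  define Y where "Y = (\<lambda>w. D w + I w * N s w)"
  have Ym[measurable]: "Y \<in> borel_measurable P" unfolding Y_def by measurable
  have Y: "AE w in P. Y w = I w * N (stop (T w) t) w"
    using D(2) by eventually_elim (simp add: Y_def I_def)
  have lim1: "(\<lambda>k. LINT w|P. H w * I w * \<Phi> (X k k w)) \<longlonglongrightarrow> (LINT w|P. H w * Y w)"
  proof (rule integral_dominated_convergence)
    show "integrable P (\<lambda>w. h * (c + 1))" by simp
    show "AE w in P. (\<lambda>k. H w * I w * \<Phi> (X k k w)) \<longlonglongrightarrow> H w * Y w"
      using X_lim bd Y
    proof eventually_elim
      case (elim w)
      show ?case
      proof (cases "ennreal s < T w")
        case True
        have "(\<lambda>k. \<Phi> (X k k w)) \<longlonglongrightarrow> \<Phi> (N (stop (T w) t) w)"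
          unfolding \<Phi>_def using True elim by (intro tendsto_intros) auto
        moreover have "\<Phi> (N (stop (T w) t) w) = N (stop (T w) t) w"
          using True elim by (auto simp: \<Phi>_def)
        ultimately show ?thesis
          using True elim(3) by (auto intro!: tendsto_intros simp: I_def)
      qed (use elim in \<open>simp add: I_def\<close>)
    qed
    show "AE w in P. norm (H w * I w * \<Phi> (X k k w)) \<le> h * (c + 1)" for k
    proof (rule AE_I2)
      fix w assume "w \<in> space P"
      then have "\<bar>H w * I w\<bar> * \<bar>\<Phi> (X k k w)\<bar> \<le> h * (c + 1)"
        using h by (intro mult_mono HI \<Phi>b) auto
      then show "norm (H w * I w * \<Phi> (X k k w)) \<le> h * (c + 1)"
        by (simp add: abs_mult)
    qed
  qed measurable
  have close: "\<bar>(LINT w|P. H w * I w * X k k w) - (LINT w|P. H w * I w * \<Phi> (X k k w))\<bar> \<le> h * \<epsilon> k" if k: "k > 0" for k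
  proof -
    have i1: "integrable P (\<lambda>w. H w * I w * X k k w)"
      by (rule mult_int[OF _ HI Xint]) auto
    have i2: "integrable P (\<lambda>w. H w * I w * \<Phi> (X k k w))"
      by (rule mult_int[OF _ HI integrable_bounded[OF _ \<Phi>b]]) auto
    have i3: "integrable P (\<lambda>w. I w * \<psi> (X k k w) * X k k w)"
      by (rule mult_int[OF I\<psi> Xint])
    have i4: "integrable P (\<lambda>w. I w * \<psi> (X k k w) * N t w)"
      by (rule mult_int[OF I\<psi> Nint[OF t]])
    have i5: "integrable P (\<lambda>w. I w * \<bar>N t w\<bar> * \<bar>\<psi> (X k k w)\<bar>)"
    proof -
      have "\<bar>I w * \<psi> (X k k w) * N t w\<bar> = I w * \<bar>N t w\<bar> * \<bar>\<psi> (X k k w)\<bar>" for w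
        by (auto simp: I_def abs_mult)
      with integrable_abs[OF i4] show ?thesis by simp
    qed
    have "(LINT w|P. H w * I w * X k k w) - (LINT w|P. H w * I w * \<Phi> (X k k w))
        = (LINT w|P. H w * I w * X k k w - H w * I w * \<Phi> (X k k w))"
      by (rule Bochner_Integration.integral_diff[OF i1 i2, symmetric])
    also have "\<bar>\<dots>\<bar> \<le> (LINT w|P. \<bar>H w * I w * X k k w - H w * I w * \<Phi> (X k k w)\<bar>)"
      by (rule integral_abs_bound)
    also have "\<dots> \<le> (LINT w|P. h * (I w * \<psi> (X k k w) * X k k w))"
    proof (rule integral_mono)
      fix w assume "w \<in> space P"
      then have "\<bar>H w\<bar> * (I w * \<bar>X k k w - \<Phi> (X k k w)\<bar>) \<le> h * (I w * (\<psi> (X k k w) * X k k w))"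
        using H(2) \<Phi>d h I01 by (intro mult_mono mult_nonneg_nonneg) auto
      then show "\<bar>H w * I w * X k k w - H w * I w * \<Phi> (X k k w)\<bar> \<le> h * (I w * \<psi> (X k k w) * X k k w)"
        using I01[of w] by (simp add: right_diff_distrib[symmetric] abs_mult mult.assoc)
    qed (use i1 i2 i3 in auto)
    also have "\<dots> = h * (LINT w|P. I w * \<psi> (X k k w) * N t w)"
      using two[OF k] by simp
    also have "\<dots> \<le> h * \<epsilon> k"
      unfolding \<epsilon>_def
    proof (intro mult_left_mono integral_mono i4 i5 h)
      fix w assume "w \<in> space P"
      have "\<psi> (X k k w) * N t w \<le> \<bar>N t w\<bar> * \<bar>\<psi> (X k k w)\<bar>"
        by (metis abs_ge_self abs_mult mult.commute)
      then show "I w * \<psi> (X k k w) * N t w \<le> I w * \<bar>N t w\<bar> * \<bar>\<psi> (X k k w)\<bar>"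
        using I01(2)[of w] by (simp add: mult.assoc mult_left_mono)
    qed
    finally show ?thesis .
  qed
  have "(\<lambda>k. (LINT w|P. H w * I w * X k k w) - (LINT w|P. H w * I w * \<Phi> (X k k w))) \<longlonglongrightarrow> 0"
  proof (rule Lim_null_comparison)
    show "(\<lambda>k. h * \<epsilon> k) \<longlonglongrightarrow> 0" using tendsto_mult_right_zero[OF \<epsilon>_lim] by simp
  qed (auto intro!: eventually_sequentiallyI[of 1] close)
  then have "(\<lambda>k. (LINT w|P. H w * I w * N s w) - (LINT w|P. H w * I w * \<Phi> (X k k w))) \<longlonglongrightarrow> 0"
    by (simp only: one)
  moreover have "(\<lambda>k. (LINT w|P. H w * I w * N s w) - (LINT w|P. H w * I w * \<Phi> (X k k w)))
      \<longlonglongrightarrow> (LINT w|P. H w * I w * N s w) - (LINT w|P. H w * Y w)"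
    by (intro tendsto_intros lim1)
  ultimately have eq: "(LINT w|P. H w * I w * N s w) - (LINT w|P. H w * Y w) = 0"
    using LIMSEQ_unique by blast
  have iN: "integrable P (\<lambda>w. H w * I w * N s w)"
    by (rule mult_int[OF _ HI Nint[OF st(1)]]) auto
  have iY: "integrable P (\<lambda>w. H w * Y w)"
  proof (rule mult_int[OF HP H(2)])
    show "integrable P Y"
    proof (rule integrable_const_bound[of _ c])
      show "AE w in P. norm (Y w) \<le> c"
        using Y bd by eventually_elim (use c in \<open>auto simp: I_def\<close>)
    qed measurable
  qed
  have "(LINT w|P. H w * D w) = (LINT w|P. H w * Y w - H w * I w * N s w)"
    by (rule Bochner_Integration.integral_cong) (simp_all add: Y_def algebra_simps)
  also have "\<dots> = 0"
    using eq by (simp add: Bochner_Integration.integral_diff[OF iY iN])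
  finally show ?thesis .
qed

end

section \<open>A martingale criterion without stochastic integrals\<close>

lemma uniform_grid_oscillation:
  fixes f :: "real \<Rightarrow> real"
  assumes st: "s \<le> t" and f: "continuous_on {s..t} f" and e: "e > 0"
  shows "\<forall>\<^sub>F k in sequentially. \<forall>i<k. \<forall>r\<in>{grid s t k i..grid s t k (Suc i)}. \<bar>f r - f (grid s t k i)\<bar> \<le> e"
proof -
  have "uniformly_continuous_on {s..t} f"
    by (rule compact_uniformly_continuous[OF f]) simp
  then obtain \<delta> where \<delta>: "\<delta> > 0" "\<And>x y. x \<in> {s..t} \<Longrightarrow> y \<in> {s..t} \<Longrightarrow> dist y x < \<delta> \<Longrightarrow> dist (f y) (f x) < e"
    using e unfolding uniformly_continuous_on_def by metis
  have "(\<lambda>k. (t - s) / real k) \<longlonglongrightarrow> 0" by (rule lim_const_over_n)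
  then have "\<forall>\<^sub>F k in sequentially. (t - s) / real k < \<delta>"
    using \<delta>(1) by (rule order_tendstoD)
  then show ?thesis
  proof eventually_elim
    case (elim k)
    show ?case
    proof (intro allI impI ballI)
      fix i r assume i: "i < k" and r: "r \<in> {grid s t k i..grid s t k (Suc i)}"
      have "grid s t k i \<in> {s..t}" "r \<in> {s..t}"
        using i r grid_bounds[OF st, where k = k and i = i] grid_bounds[OF st, where k = k and i = "Suc i"] by auto
      moreover have "dist r (grid s t k i) < \<delta>"
        using r elim grid_step[of s t k i] by (auto simp: dist_real_def)
      ultimately have "dist (f r) (f (grid s t k i)) < e" by (rule \<delta>(2))
      then show "\<bar>f r - f (grid s t k i)\<bar> \<le> e" by (simp add: dist_real_def)
    qed
  qed
qed

text \<open>The interface between stopping and expansion: W and q are bounded, and the martingale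
  properties of W and W^2 - q are stated against bounded weights known at time s, the form in which
  stopping supplies them and the partition sums consume them.\<close>

locale ito_clock = filtered_prob P F
  for P :: "'a measure" and F :: "ennreal \<Rightarrow> 'a measure" +
  fixes W q :: "real \<Rightarrow> 'a \<Rightarrow> real" and c :: real
  assumes W_F: "0 \<le> t \<Longrightarrow> W t \<in> borel_measurable (F (ennreal t))"
    and q_F: "0 \<le> t \<Longrightarrow> q t \<in> borel_measurable (F (ennreal t))"
    and W_cont: "w \<in> space P \<Longrightarrow> continuous_on {0..} (\<lambda>t. W t w)"
    and q_cont: "w \<in> space P \<Longrightarrow> continuous_on {0..} (\<lambda>t. q t w)"
    and q_mono: "w \<in> space P \<Longrightarrow> 0 \<le> s \<Longrightarrow> s \<le> t \<Longrightarrow> q s w \<le> q t w"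
    and W_bd: "w \<in> space P \<Longrightarrow> 0 \<le> t \<Longrightarrow> \<bar>W t w\<bar> \<le> c"
    and q_bd: "w \<in> space P \<Longrightarrow> 0 \<le> t \<Longrightarrow> 0 \<le> q t w \<and> q t w \<le> c"
    and W_mart: "0 \<le> s \<Longrightarrow> s \<le> t \<Longrightarrow> H \<in> borel_measurable (F (ennreal s)) \<Longrightarrow>
      (\<And>w. w \<in> space P \<Longrightarrow> \<bar>H w\<bar> \<le> h) \<Longrightarrow> (LINT w|P. H w * (W t w - W s w)) = 0"
    and W2_mart: "0 \<le> s \<Longrightarrow> s \<le> t \<Longrightarrow> H \<in> borel_measurable (F (ennreal s)) \<Longrightarrow>
      (\<And>w. w \<in> space P \<Longrightarrow> \<bar>H w\<bar> \<le> h) \<Longrightarrow>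
      (LINT w|P. H w * (((W t w)\<^sup>2 - q t w) - ((W s w)\<^sup>2 - q s w))) = 0"
begin

lemma c_nonneg: "0 \<le> c"
proof -
  obtain w where "w \<in> space P" using not_empty by auto
  from W_bd[OF this, of 0] show ?thesis by simp
qed

lemma W_P [measurable]: "0 \<le> t \<Longrightarrow> W t \<in> borel_measurable P"
  and q_P [measurable]: "0 \<le> t \<Longrightarrow> q t \<in> borel_measurable P"
  by (rule measurable_F_P[OF W_F] measurable_F_P[OF q_F]; assumption)+

lemma dW_bd: "w \<in> space P \<Longrightarrow> 0 \<le> s \<Longrightarrow> 0 \<le> t \<Longrightarrow> \<bar>W t w - W s w\<bar> \<le> 2 * c"
  using W_bd[of w s] W_bd[of w t] by linarith

text \<open>(\<Delta>W)^2 - \<Delta>q is the increment of W^2 - q minus 2 W_s \<Delta>W, and H W_s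
  is again an admissible weight.\<close>

lemma quadratic_increment:
  assumes st: "0 \<le> s" "s \<le> t" and H: "H \<in> borel_measurable (F (ennreal s))" "\<And>w. w \<in> space P \<Longrightarrow> \<bar>H w\<bar> \<le> h"
  shows "(LINT w|P. H w * ((W t w - W s w)\<^sup>2 - (q t w - q s w))) = 0"
proof -
  have t: "0 \<le> t" using st by simp
  note [measurable] = measurable_F_P[OF H(1)] W_P[OF st(1)] W_P[OF t] q_P[OF st(1)] q_P[OF t]
  have h: "0 \<le> h" using H(2) not_empty by (metis abs_ge_zero all_not_in_conv order_trans)
  define A where "A = (\<lambda>w. H w * (((W t w)\<^sup>2 - q t w) - ((W s w)\<^sup>2 - q s w)))"
  define B where "B = (\<lambda>w. (H w * W s w) * (W t w - W s w))"
  have Wsq: "(W r w)\<^sup>2 \<le> c\<^sup>2" if "w \<in> space P" "0 \<le> r" for r w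
    using W_bd[OF that] by (simp add: abs_le_square_iff[symmetric] c_nonneg)
  have A: "integrable P A"
  proof (rule integrable_bounded)
    fix w assume w: "w \<in> space P"
    have "\<bar>((W t w)\<^sup>2 - q t w) - ((W s w)\<^sup>2 - q s w)\<bar> \<le> c\<^sup>2 + c"
      using Wsq[OF w t] Wsq[OF w st(1)] q_bd[OF w t] q_bd[OF w st(1)]
        zero_le_power2[of "W t w"] zero_le_power2[of "W s w"] by linarith
    then show "\<bar>A w\<bar> \<le> h * (c\<^sup>2 + c)"
      unfolding A_def abs_mult using H(2)[OF w] h by (intro mult_mono) auto
  qed (unfold A_def, measurable)
  have HW: "\<bar>H w * W s w\<bar> \<le> h * c" if "w \<in> space P" for w
    unfolding abs_mult using H(2)[OF that] W_bd[OF that st(1)] h by (intro mult_mono) auto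
  have B: "integrable P B"
  proof (rule integrable_bounded)
    fix w assume w: "w \<in> space P"
    show "\<bar>B w\<bar> \<le> h * c * (2 * c)"
      unfolding B_def abs_mult[of "H w * W s w"] using HW[OF w] dW_bd[OF w st(1) t] h c_nonneg by (intro mult_mono) auto
  qed (unfold B_def, measurable)
  have "(LINT w|P. H w * ((W t w - W s w)\<^sup>2 - (q t w - q s w))) = (LINT w|P. A w - 2 * B w)"
    by (rule Bochner_Integration.integral_cong) (simp_all add: A_def B_def power2_eq_square algebra_simps)
  also have "\<dots> = (LINT w|P. A w) - 2 * (LINT w|P. B w)"
    using A B by simp
  also have "(LINT w|P. A w) = 0" unfolding A_def by (rule W2_mart[OF st H])
  also have "(LINT w|P. B w) = 0"
    unfolding B_def by (rule W_mart[OF st borel_measurable_times[OF H(1) W_F[OF st(1)]] HW])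
  finally show ?thesis by simp
qed

text \<open>The sums of squared increments are bounded in \<open>L\<^sup>2\<close>, uniformly in the partition: in
  \<open>S\<^sup>2 - 2 S W\<^sup>2 - 4 c\<^sup>2 S\<close> every step contributes at most a martingale increment.\<close>

lemma square_sum_bound:
  fixes g :: "nat \<Rightarrow> real"
  assumes g: "\<And>i. 0 \<le> g i" "\<And>i j. i \<le> j \<Longrightarrow> g i \<le> g j"
  defines "S \<equiv> \<lambda>k w. \<Sum>i<k. (W (g (Suc i)) w - W (g i) w)\<^sup>2"
  shows "S k \<in> borel_measurable P" "\<And>w. w \<in> space P \<Longrightarrow> \<bar>S k w\<bar> \<le> real k * (2 * c)\<^sup>2"
    "(LINT w|P. (S k w)\<^sup>2) \<le> 6 * c\<^sup>2 * c"
proof -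
  define D where "D = (\<lambda>i w. W (g (Suc i)) w - W (g i) w)"
  have S: "S k w = (\<Sum>i<k. (D i w)\<^sup>2)" for k w by (simp add: S_def D_def)
  have gm: "g i \<le> g (Suc i)" for i by (rule g(2)) simp
  have [measurable]: "D i \<in> borel_measurable P" for i unfolding D_def by (intro borel_measurable_diff W_P g)
  show Sm: "S k \<in> borel_measurable P" for k unfolding S[abs_def] by measurable
  have Db: "\<bar>D i w\<bar> \<le> 2 * c" if "w \<in> space P" for i w
    unfolding D_def using that g by (intro dW_bd)
  have Dsq: "(D i w)\<^sup>2 \<le> (2 * c)\<^sup>2" if "w \<in> space P" for i w
    using Db[OF that, of i] c_nonneg by (intro abs_le_square_iff[THEN iffD1]) auto
  have S0: "0 \<le> S k w" for k w unfolding S by (simp add: sum_nonneg)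
  show Sb: "\<bar>S k w\<bar> \<le> real k * (2 * c)\<^sup>2" if "w \<in> space P" for k w
    using S0[of k w] sum_bounded_above[of "{..<k}" "\<lambda>i. (D i w)\<^sup>2" "(2 * c)\<^sup>2"] Dsq[OF that] by (simp add: S)
  have SF: "S k \<in> borel_measurable (F (ennreal (g k)))" for k
    unfolding S_def
    by (intro borel_measurable_sum borel_measurable_power borel_measurable_diff measurable_F_mono[OF W_F] ennreal_leI g) auto
  have WF: "W (g k) \<in> borel_measurable (F (ennreal (g k)))" for k by (rule W_F[OF g(1)])
  have Wm[measurable]: "W (g k) \<in> borel_measurable P" for k by (rule W_P[OF g(1)])
  have Wb: "\<bar>W (g k) w\<bar> \<le> c" if "w \<in> space P" for k w by (rule W_bd[OF that g(1)])
  note Sm[measurable]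
  have Sint: "integrable P (S k)" for k by (rule integrable_bounded[OF Sm Sb])
  have ES: "(LINT w|P. S k w) \<le> c" for k
  proof -
    have qm[measurable]: "q (g i) \<in> borel_measurable P" for i by (rule q_P[OF g(1)])
    have qint: "integrable P (q (g i))" for i
      by (rule integrable_bounded[of _ c]) (use q_bd[OF _ g(1)] in auto)
    have Dint: "integrable P (\<lambda>w. (D i w)\<^sup>2)" for i
      by (rule integrable_bounded[of _ "(2 * c)\<^sup>2"]) (use Dsq in auto)
    have "(LINT w|P. (D i w)\<^sup>2) = (LINT w|P. q (g (Suc i)) w) - (LINT w|P. q (g i) w)" for i
      using quadratic_increment[OF g(1) gm[of i], of "\<lambda>_. 1" 1] Dint[of i] qint by (simp add: D_def)
    then have "(LINT w|P. S k w) = (\<Sum>i<k. (LINT w|P. q (g (Suc i)) w) - (LINT w|P. q (g i) w))"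
      unfolding S using Dint by (simp add: Bochner_Integration.integral_sum)
    also have "\<dots> = (LINT w|P. q (g k) w) - (LINT w|P. q (g 0) w)" by (rule sum_lessThan_telescope)
    also have "\<dots> = (LINT w|P. q (g k) w - q (g 0) w)" using qint by simp
    also have "\<dots> \<le> (LINT w|P. c)"
    proof (rule integral_mono)
      fix w assume w: "w \<in> space P"
      show "q (g k) w - q (g 0) w \<le> c"
        using q_bd[OF w g(1)[of k]] q_bd[OF w g(1)[of 0]] by linarith
    qed (use qint in auto)
    finally show ?thesis by (simp add: prob_space)
  qed
  \<comment> \<open>The expectation of f does not increase along the partition: - 2 S W^2 cancels
    the mixed term 2 S (\<Delta>W)^2 in the growth of S^2, and - 4 c^2 S absorbs (\<Delta>W)^4 \<le>
    4 c^2 (\<Delta>W)^2.\<close>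
  define f where "f = (\<lambda>k w. (S k w)\<^sup>2 - 2 * S k w * (W (g k) w)\<^sup>2 - 4 * c\<^sup>2 * S k w)"
  have Wsq: "(W (g k) w)\<^sup>2 \<le> c\<^sup>2" if "w \<in> space P" for k w
    using Wb[OF that, of k] by (simp add: abs_le_square_iff[symmetric] c_nonneg)
  have S2int: "integrable P (\<lambda>w. (S k w)\<^sup>2)" for k
    by (rule integrable_bounded[of _ "(real k * (2 * c)\<^sup>2)\<^sup>2"])
      (use Sb in \<open>auto simp: abs_le_square_iff[symmetric]\<close>)
  have SWint: "integrable P (\<lambda>w. S k w * (W (g k) w)\<^sup>2)" for k
  proof (rule integrable_bounded)
    fix w assume "w \<in> space P"
    then show "\<bar>S k w * (W (g k) w)\<^sup>2\<bar> \<le> real k * (2 * c)\<^sup>2 * c\<^sup>2"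
      unfolding abs_mult using Sb Wsq by (intro mult_mono) auto
  qed measurable
  have fint: "integrable P (f k)" for k
    unfolding f_def using S2int SWint Sint by (simp add: mult.assoc)
  have MI: "\<bar>S k w * W (g k) w\<bar> \<le> real k * (2 * c)\<^sup>2 * c" if "w \<in> space P" for k w
    unfolding abs_mult using Sb[OF that] Wb[OF that] by (intro mult_mono) auto
  have "(LINT w|P. f k w) \<le> 0" for k
  proof (induction k)
    case 0
    then show ?case by (simp add: f_def S)
  next
    case (Suc k)
    have Mint: "integrable P (\<lambda>w. (S k w * W (g k) w) * D k w)"
    proof (rule integrable_bounded)
      fix w assume "w \<in> space P"
      then show "\<bar>(S k w * W (g k) w) * D k w\<bar> \<le> real k * (2 * c)\<^sup>2 * c * (2 * c)"
        unfolding abs_mult[of "S k w * W (g k) w"] using MI Db c_nonneg by (intro mult_mono) auto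
    qed measurable
    have "(LINT w|P. f (Suc k) w) \<le> (LINT w|P. f k w - 4 * ((S k w * W (g k) w) * D k w))"
    proof (rule integral_mono)
      fix w assume w: "w \<in> space P"
      define x y z where "x = S k w" and "y = W (g k) w" and "z = D k w"
      have W1: "W (g (Suc k)) w = y + z" by (simp add: y_def z_def D_def)
      have S1: "S (Suc k) w = x + z\<^sup>2" by (simp add: S x_def z_def)
      have "z\<^sup>2 * z\<^sup>2 \<le> (2 * c)\<^sup>2 * z\<^sup>2"
        using Dsq[OF w, of k] by (intro mult_right_mono) (auto simp: z_def)
      moreover have "0 \<le> z\<^sup>2 * (y + z)\<^sup>2" by simp
      ultimately have "(x + z\<^sup>2)\<^sup>2 - 2 * (x + z\<^sup>2) * (y + z)\<^sup>2 - 4 * c\<^sup>2 * (x + z\<^sup>2)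
          \<le> x\<^sup>2 - 2 * x * y\<^sup>2 - 4 * c\<^sup>2 * x - 4 * ((x * y) * z)"
        by (simp add: power2_eq_square algebra_simps)
      then show "f (Suc k) w \<le> f k w - 4 * ((S k w * W (g k) w) * D k w)"
        unfolding f_def W1 S1 x_def[symmetric] y_def[symmetric] z_def[symmetric] .
    qed (use fint Mint in auto)
    also have "\<dots> = (LINT w|P. f k w) - 4 * (LINT w|P. (S k w * W (g k) w) * D k w)"
      using fint Mint by simp
    also have "(LINT w|P. (S k w * W (g k) w) * D k w) = 0"
      unfolding D_def by (rule W_mart[OF g(1) gm borel_measurable_times[OF SF WF] MI])
    finally show ?case using Suc.IH by simp
  qed
  then have "(LINT w|P. f k w) \<le> 0" .
  \<comment> \<open>The constant is 6 = 4 + 2, the 2 coming from W^2 \<le> c^2; the first moment of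
    S is at most c by \<open>ES\<close>.\<close>
  moreover have "(LINT w|P. (S k w)\<^sup>2) - (LINT w|P. 6 * c\<^sup>2 * S k w) \<le> (LINT w|P. f k w)"
    unfolding Bochner_Integration.integral_diff[OF S2int integrable_mult_right[OF Sint], symmetric]
  proof (rule integral_mono)
    fix w assume w: "w \<in> space P"
    have "S k w * (W (g k) w)\<^sup>2 \<le> S k w * c\<^sup>2"
      using Wsq[OF w] S0 by (intro mult_left_mono)
    then show "(S k w)\<^sup>2 - 6 * c\<^sup>2 * S k w \<le> f k w" by (simp add: f_def algebra_simps)
  qed (use S2int Sint fint in auto)
  moreover have "(LINT w|P. 6 * c\<^sup>2 * S k w) \<le> 6 * c\<^sup>2 * c"
    using ES[of k] by (simp add: mult_left_mono)
  ultimately show "(LINT w|P. (S k w)\<^sup>2) \<le> 6 * c\<^sup>2 * c" by linarith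
qed

text \<open>Over a partition the increment of R is a sum of martingale increments plus errors of at
  most C e (S + Q), with S the sum of squares and Q the increment of the clock. The oscillation e
  tends to 0 pathwise, but S is not dominated. So the error is factored as Z Y with Z bounded and
  tending to 0, and Y = S + Q + 1 bounded in L^2.\<close>

lemma ito_martingale:
  fixes R H K :: "real \<Rightarrow> 'a \<Rightarrow> real"
  assumes R: "\<And>t. 0 \<le> t \<Longrightarrow> R t \<in> borel_measurable (F (ennreal t))" "\<And>t w. w \<in> space P \<Longrightarrow> 0 \<le> t \<Longrightarrow> \<bar>R t w\<bar> \<le> b"
    and H: "\<And>t. 0 \<le> t \<Longrightarrow> H t \<in> borel_measurable (F (ennreal t))" "\<And>t w. w \<in> space P \<Longrightarrow> 0 \<le> t \<Longrightarrow> \<bar>H t w\<bar> \<le> b"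
    and K: "\<And>t. 0 \<le> t \<Longrightarrow> K t \<in> borel_measurable (F (ennreal t))" "\<And>t w. w \<in> space P \<Longrightarrow> 0 \<le> t \<Longrightarrow> \<bar>K t w\<bar> \<le> b"
    and C: "0 \<le> C"
    and err: "AE w in P. \<forall>s t e. 0 \<le> s \<longrightarrow> s \<le> t \<longrightarrow> e \<le> 2 * c \<longrightarrow>
       (\<forall>r\<in>{s..t}. \<bar>W r w - W s w\<bar> \<le> e \<and> q r w - q s w \<le> e) \<longrightarrow>
       \<bar>R t w - R s w - H s w * (W t w - W s w) - K s w * ((W t w - W s w)\<^sup>2 - (q t w - q s w))\<bar>
         \<le> C * e * ((W t w - W s w)\<^sup>2 + (q t w - q s w))"
  shows "martingale P F R"
proof (rule martingaleI)
  show "R t \<in> borel_measurable (F (ennreal t))" if "0 \<le> t" for t by (rule R(1)[OF that])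
  show "integrable P (R t)" if "0 \<le> t" for t
    by (rule integrable_bounded[OF measurable_F_P[OF R(1)[OF that]] R(2)[OF _ that]])
  fix s t :: real and A assume st: "0 \<le> s" "s \<le> t" and A: "A \<in> sets (F (ennreal s))"
  have t: "0 \<le> t" using st by simp
  define G where "G = (indicator A :: 'a \<Rightarrow> real)"
  have GF: "G \<in> borel_measurable (F (ennreal s))" unfolding G_def using A by measurable
  have [measurable]: "G \<in> borel_measurable P" by (rule measurable_F_P[OF GF])
  have G01: "0 \<le> G w" "\<bar>G w\<bar> \<le> 1" for w by (auto simp: G_def indicator_def)
  have b: "0 \<le> b" using R(2)[of _ 0] not_empty by fastforce
  define g where "g = (\<lambda>k i. grid s t k i)"
  have g: "0 \<le> g k i" "i \<le> j \<Longrightarrow> g k i \<le> g k j" "s \<le> g k i" for k i j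
    using grid_bounds(1)[OF st(2), where k = k and i = i] grid_mono[OF st(2), of i j k] st by (auto simp: g_def)
  define dW where "dW = (\<lambda>k i w. W (g k (Suc i)) w - W (g k i) w)"
  define dq where "dq = (\<lambda>k i w. q (g k (Suc i)) w - q (g k i) w)"
  define E where "E = (\<lambda>k i w. R (g k (Suc i)) w - R (g k i) w - H (g k i) w * dW k i w - K (g k i) w * ((dW k i w)\<^sup>2 - dq k i w))"
  define Er where "Er = (\<lambda>k w. \<Sum>i<k. E k i w)"
  define S where "S = (\<lambda>k w. \<Sum>i<k. (dW k i w)\<^sup>2)"
  have [measurable]: "R (g k i) \<in> borel_measurable P" "H (g k i) \<in> borel_measurable P" "K (g k i) \<in> borel_measurable P"
      "W (g k i) \<in> borel_measurable P" "q (g k i) \<in> borel_measurable P" for k i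
    by (rule measurable_F_P[OF R(1)] measurable_F_P[OF H(1)] measurable_F_P[OF K(1)] measurable_F_P[OF W_F] measurable_F_P[OF q_F]; rule g)+
  have [measurable]: "q s \<in> borel_measurable P" "q t \<in> borel_measurable P" "R s \<in> borel_measurable P" "R t \<in> borel_measurable P"
    using st t by (auto intro: q_P measurable_F_P[OF R(1)])
  have [measurable]: "dW k i \<in> borel_measurable P" "dq k i \<in> borel_measurable P" for k i
    unfolding dW_def dq_def by measurable
  have Em[measurable]: "E k i \<in> borel_measurable P" for k i
    unfolding E_def by measurable
  have Erm[measurable]: "Er k \<in> borel_measurable P" for k
    unfolding Er_def by measurable
  have S: "S k \<in> borel_measurable P" "\<And>w. w \<in> space P \<Longrightarrow> \<bar>S k w\<bar> \<le> real k * (2 * c)\<^sup>2"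
    "(LINT w|P. (S k w)\<^sup>2) \<le> 6 * c\<^sup>2 * c" for k
    unfolding S_def dW_def by (rule square_sum_bound[of "g k", OF g(1) g(2)]; assumption)+
  note S(1)[measurable]
  have S0: "0 \<le> S k w" for k w by (simp add: S_def sum_nonneg)
  define Q where "Q = (\<lambda>w. q t w - q s w)"
  have [measurable]: "Q \<in> borel_measurable P" unfolding Q_def by measurable
  have Q: "0 \<le> Q w" "Q w \<le> c" if "w \<in> space P" for w
    using q_mono[OF that st] q_bd[OF that st(1)] q_bd[OF that t] by (auto simp: Q_def)
  define Y where "Y = (\<lambda>k w. S k w + Q w + 1)"
  have Y1: "1 \<le> Y k w" if "w \<in> space P" for k w using S0[of k w] Q[OF that] by (simp add: Y_def)
  have [measurable]: "Y k \<in> borel_measurable P" for k unfolding Y_def by measurable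
  define Z where "Z = (\<lambda>k w. \<bar>Er k w\<bar> / Y k w)"
  have [measurable]: "Z k \<in> borel_measurable P" for k unfolding Z_def by measurable
  have Ebd: "\<bar>Er k w\<bar> \<le> C * e * (S k w + Q w)"
    if w: "w \<in> space P" and k: "k > 0" and e: "e \<le> 2 * c"
      and osc: "\<forall>i<k. \<forall>r\<in>{g k i..g k (Suc i)}. \<bar>W r w - W (g k i) w\<bar> \<le> e \<and> q r w - q (g k i) w \<le> e"
      and er: "\<forall>s t e. 0 \<le> s \<longrightarrow> s \<le> t \<longrightarrow> e \<le> 2 * c \<longrightarrow>
       (\<forall>r\<in>{s..t}. \<bar>W r w - W s w\<bar> \<le> e \<and> q r w - q s w \<le> e) \<longrightarrow>
       \<bar>R t w - R s w - H s w * (W t w - W s w) - K s w * ((W t w - W s w)\<^sup>2 - (q t w - q s w))\<bar>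
         \<le> C * e * ((W t w - W s w)\<^sup>2 + (q t w - q s w))"
    for k w e
  proof -
    have "\<bar>Er k w\<bar> \<le> (\<Sum>i<k. \<bar>E k i w\<bar>)" unfolding Er_def by (rule sum_abs)
    also have "\<dots> \<le> (\<Sum>i<k. C * e * ((dW k i w)\<^sup>2 + dq k i w))"
    proof (rule sum_mono)
      fix i assume "i \<in> {..<k}"
      then show "\<bar>E k i w\<bar> \<le> C * e * ((dW k i w)\<^sup>2 + dq k i w)"
        unfolding E_def dW_def dq_def using osc
        by (intro er[rule_format] g e) auto
    qed
    also have "\<dots> = C * e * (S k w + (\<Sum>i<k. dq k i w))"
      by (simp add: sum_distrib_left[symmetric] sum.distrib S_def)
    also have "(\<Sum>i<k. dq k i w) = Q w"
      using sum_lessThan_telescope[of "\<lambda>i. q (g k i) w" k] k by (simp add: dq_def Q_def g_def grid_k)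
    finally show ?thesis .
  qed
  have osc_c: "\<bar>W r w - W (g k i) w\<bar> \<le> 2 * c \<and> q r w - q (g k i) w \<le> 2 * c"
    if "w \<in> space P" "r \<in> {g k i..g k (Suc i)}" for w r k i
  proof -
    have r: "0 \<le> r" using that(2) g(1)[of k i] by auto
    show ?thesis
      using dW_bd[OF that(1) g(1)[of k i] r] q_bd[OF that(1) r] q_bd[OF that(1) g(1)[of k i]] c_nonneg by auto
  qed
  have Zb: "AE w in P. \<forall>k>0. \<bar>Z k w\<bar> \<le> C * (2 * c)"
    using err AE_space
  proof eventually_elim
    case (elim w)
    show ?case
    proof (intro allI impI)
      fix k :: nat assume "k > 0"
      then have "\<bar>Er k w\<bar> \<le> C * (2 * c) * (S k w + Q w)"
        using osc_c[OF elim(2)] by (intro Ebd[OF elim(2) _ order_refl _ elim(1)]) auto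
      also have "\<dots> \<le> C * (2 * c) * Y k w"
        using C c_nonneg by (intro mult_left_mono) (auto simp: Y_def)
      finally show "\<bar>Z k w\<bar> \<le> C * (2 * c)"
        using Y1[OF elim(2), of k] by (simp add: Z_def divide_le_eq abs_divide)
    qed
  qed
  have Zlim: "AE w in P. (\<lambda>k. Z k w) \<longlonglongrightarrow> 0"
    using err AE_space
  proof eventually_elim
    case (elim w)
    note w = elim(2)
    show ?case
    proof (rule tendstoI)
      fix \<epsilon> :: real assume \<epsilon>: "\<epsilon> > 0"
      define e where "e = \<epsilon> / (2 * (C + 1))"
      have e: "e > 0" using \<epsilon> C by (simp add: e_def)
      have Ce: "C * e < \<epsilon>"
        using mult_nonneg_nonneg[OF C less_imp_le[OF \<epsilon>]] C \<epsilon>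
        by (simp add: e_def pos_divide_less_eq algebra_simps add_nonneg_pos)
      have "continuous_on {s..t} (\<lambda>r. W r w)" "continuous_on {s..t} (\<lambda>r. q r w)"
        using st by (auto intro: continuous_on_subset[OF W_cont[OF w]] continuous_on_subset[OF q_cont[OF w]])
      from uniform_grid_oscillation[OF st(2) this(1) e] uniform_grid_oscillation[OF st(2) this(2) e] eventually_gt_at_top[of 0]
      show "\<forall>\<^sub>F k in sequentially. dist (Z k w) 0 < \<epsilon>"
      proof eventually_elim
        case (elim k)
        \<comment> \<open>The error hypothesis concerns e \<le> 2 c only, hence the minimum.\<close>
        have "\<bar>Er k w\<bar> \<le> C * (min e (2 * c)) * (S k w + Q w)"
        proof (rule Ebd[OF w elim(3) min.cobounded2 _ \<open>\<forall>s t e. _\<close>], intro allI impI ballI)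
          fix i r assume ir: "i < k" "r \<in> {g k i..g k (Suc i)}"
          have "\<bar>W r w - W (g k i) w\<bar> \<le> e" "\<bar>q r w - q (g k i) w\<bar> \<le> e"
            using elim(1,2) ir unfolding g_def by blast+
          then show "\<bar>W r w - W (g k i) w\<bar> \<le> min e (2 * c) \<and> q r w - q (g k i) w \<le> min e (2 * c)"
            using osc_c[OF w ir(2)] by auto
        qed
        also have "\<dots> \<le> C * e * Y k w"
          using C S0[of k w] Q[OF w] e by (intro mult_mono mult_nonneg_nonneg) (auto simp: Y_def)
        finally have "\<bar>Er k w\<bar> / Y k w \<le> C * e"
          using Y1[OF w, of k] by (simp add: divide_le_eq)
        then show ?case
          using Ce Y1[OF w, of k] by (simp add: Z_def dist_real_def abs_divide)
      qed
    qed
  qed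
  define z where "z = (\<lambda>k. LINT w|P. (Z (Suc k) w)\<^sup>2)"
  have Zsq: "AE w in P. norm ((Z (Suc k) w)\<^sup>2) \<le> (C * (2 * c))\<^sup>2" for k
    using Zb
  proof eventually_elim
    case (elim w)
    then have "\<bar>Z (Suc k) w\<bar> \<le> \<bar>C * (2 * c)\<bar>" using C c_nonneg by auto
    then show ?case by (simp add: abs_le_square_iff)
  qed
  have z_lim: "z \<longlonglongrightarrow> 0"
  proof -
    have "z \<longlonglongrightarrow> (LINT w|P. 0)"
      unfolding z_def
    proof (rule integral_dominated_convergence)
      show "integrable P (\<lambda>w. (C * (2 * c))\<^sup>2)" by simp
      show "AE w in P. (\<lambda>k. (Z (Suc k) w)\<^sup>2) \<longlonglongrightarrow> 0"
        using Zlim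
      proof eventually_elim
        case (elim w)
        from tendsto_power[OF LIMSEQ_Suc[OF elim], of 2] show ?case by simp
      qed
    qed (use Zsq in auto)
    then show ?thesis by simp
  qed
  define K0 where "K0 = 6 * c\<^sup>2 * c"
  define B where "B = 3 * (K0 + c\<^sup>2 + 1)"
  have B: "B > 0" using c_nonneg by (simp add: B_def K0_def add_nonneg_pos)
  have Ybd: "\<bar>Y k w\<bar> \<le> real k * (2 * c)\<^sup>2 + c + 1" if "w \<in> space P" for k w
    using S(2)[OF that, of k] Q[OF that] Y1[OF that, of k] by (simp add: Y_def)
  have Y2int: "integrable P (\<lambda>w. (Y k w)\<^sup>2)" for k
    by (rule integrable_bounded[of _ "(real k * (2 * c)\<^sup>2 + c + 1)\<^sup>2"])
      (use Ybd c_nonneg in \<open>auto simp: abs_le_square_iff[symmetric] intro: order_trans[OF _ abs_ge_self]\<close>)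
  have S2int: "integrable P (\<lambda>w. (S k w)\<^sup>2)" for k
    by (rule integrable_bounded[of _ "(real k * (2 * c)\<^sup>2)\<^sup>2"])
      (use S(2) in \<open>auto simp: abs_le_square_iff[symmetric]\<close>)
  have Z2int: "integrable P (\<lambda>w. (Z (Suc k) w)\<^sup>2)" for k
    by (rule integrable_const_bound[OF Zsq]) measurable
  have EY: "(LINT w|P. (Y k w)\<^sup>2) \<le> B" for k
  proof -
    have "(LINT w|P. (Y k w)\<^sup>2) \<le> (LINT w|P. 3 * (S k w)\<^sup>2 + 3 * (c\<^sup>2 + 1))"
    proof (rule integral_mono)
      fix w assume w: "w \<in> space P"
      have "(Q w)\<^sup>2 \<le> c\<^sup>2" using Q[OF w] by (intro power_mono) auto
      moreover have "(x + y + 1)\<^sup>2 \<le> 3 * x\<^sup>2 + 3 * (y\<^sup>2 + 1)" for x y :: real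
      proof -
        have "0 \<le> (x - y)\<^sup>2 + (x - 1)\<^sup>2 + (y - 1)\<^sup>2" by simp
        then show ?thesis by (simp add: power2_eq_square algebra_simps)
      qed
      from this[of "S k w" "Q w"] have "(Y k w)\<^sup>2 \<le> 3 * (S k w)\<^sup>2 + 3 * ((Q w)\<^sup>2 + 1)" by (simp add: Y_def)
      ultimately show "(Y k w)\<^sup>2 \<le> 3 * (S k w)\<^sup>2 + 3 * (c\<^sup>2 + 1)" by simp
    qed (use Y2int S2int in auto)
    also have "\<dots> = 3 * (LINT w|P. (S k w)\<^sup>2) + 3 * (c\<^sup>2 + 1)"
      using S2int[of k] by (simp add: prob_space)
    also have "\<dots> \<le> B"
    proof -
      have "3 * x + 3 * (y + 1) \<le> 3 * (K0 + y + 1)" if "x \<le> K0" for x y :: real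
        using that by simp
      from this[OF S(3)[of k, folded K0_def]] show ?thesis unfolding B_def .
    qed
    finally show ?thesis .
  qed
  define X where "X = (LINT w|P. G w * (R t w - R s w))"
  have XE: "X = (LINT w|P. G w * Er k w)" "integrable P (\<lambda>w. G w * Er k w)" if k: "k > 0" for k
  proof -
    define h1 where "h1 = (\<lambda>i w. (G w * H (g k i) w) * dW k i w)"
    define h2 where "h2 = (\<lambda>i w. (G w * K (g k i) w) * ((dW k i w)\<^sup>2 - dq k i w))"
    have dWb: "\<bar>dW k i w\<bar> \<le> 2 * c" if "w \<in> space P" for i w
      unfolding dW_def by (rule dW_bd[OF that g(1) g(1)])
    have dqb: "\<bar>dq k i w\<bar> \<le> c" if "w \<in> space P" for i w
      unfolding dq_def using q_bd[OF that g(1)[of k i]] q_bd[OF that g(1)[of k "Suc i"]] by auto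
    have GHb: "\<bar>G w * H (g k i) w\<bar> \<le> b" "\<bar>G w * K (g k i) w\<bar> \<le> b" if "w \<in> space P" for i w
      using H(2)[OF that g(1)[of k i]] K(2)[OF that g(1)[of k i]] b by (auto simp: G_def indicator_def)
    have GF': "G \<in> borel_measurable (F (ennreal (g k i)))" for i
      by (rule measurable_F_mono[OF GF ennreal_leI[OF g(3)]])
    have gm: "g k i \<le> g k (Suc i)" for i by (rule g(2)) simp
    have i1: "integrable P (h1 i)" "(LINT w|P. h1 i w) = 0" for i
    proof -
      show "integrable P (h1 i)"
      proof (rule integrable_bounded)
        fix w assume w: "w \<in> space P"
        show "\<bar>h1 i w\<bar> \<le> b * (2 * c)"
          unfolding h1_def abs_mult[of "G w * H (g k i) w"] using GHb[OF w, of i] dWb[OF w, of i] b by (intro mult_mono) auto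
      qed (unfold h1_def, measurable)
      show "(LINT w|P. h1 i w) = 0"
        unfolding h1_def dW_def
        by (rule W_mart[OF g(1) gm borel_measurable_times[OF GF' H(1)[OF g(1)]] GHb(1)])
    qed
    have i2: "integrable P (h2 i)" "(LINT w|P. h2 i w) = 0" for i
    proof -
      show "integrable P (h2 i)"
      proof (rule integrable_bounded)
        fix w assume w: "w \<in> space P"
        have "(dW k i w)\<^sup>2 \<le> (2 * c)\<^sup>2" using dWb[OF w, of i] c_nonneg by (intro abs_le_square_iff[THEN iffD1]) auto
        then have "\<bar>(dW k i w)\<^sup>2 - dq k i w\<bar> \<le> (2 * c)\<^sup>2 + c" using dqb[OF w, of i] zero_le_power2[of "dW k i w"] by linarith
        then show "\<bar>h2 i w\<bar> \<le> b * ((2 * c)\<^sup>2 + c)"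
          unfolding h2_def abs_mult[of "G w * K (g k i) w"] using GHb[OF w, of i] b by (intro mult_mono) auto
      qed (unfold h2_def, measurable)
      show "(LINT w|P. h2 i w) = 0"
        unfolding h2_def dW_def dq_def
        by (rule quadratic_increment[OF g(1) gm borel_measurable_times[OF GF' K(1)[OF g(1)]] GHb(2)])
    qed
    have i3: "integrable P (\<lambda>w. G w * (R t w - R s w))"
    proof (rule integrable_bounded)
      fix w assume w: "w \<in> space P"
      show "\<bar>G w * (R t w - R s w)\<bar> \<le> 2 * b"
        using R(2)[OF w t] R(2)[OF w st(1)] b by (auto simp: G_def indicator_def)
    qed measurable
    have tel: "(\<Sum>i<k. R (g k (Suc i)) w - R (g k i) w) = R t w - R s w" for w
      using sum_lessThan_telescope[of "\<lambda>i. R (g k i) w" k] k by (simp add: g_def grid_k)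
    have eq: "G w * Er k w = G w * (R t w - R s w) - ((\<Sum>i<k. h1 i w) + (\<Sum>i<k. h2 i w))" for w
      unfolding Er_def E_def sum_subtractf tel[unfolded sum_subtractf] h1_def h2_def
      by (simp add: right_diff_distrib sum_distrib_left mult.assoc sum_subtractf)
    have i4: "integrable P (\<lambda>w. (\<Sum>i<k. h1 i w) + (\<Sum>i<k. h2 i w))"
      using i1 i2 by (intro Bochner_Integration.integrable_add Bochner_Integration.integrable_sum)
    show "integrable P (\<lambda>w. G w * Er k w)"
      unfolding eq by (rule Bochner_Integration.integrable_diff[OF i3 i4])
    have "(LINT w|P. (\<Sum>i<k. h1 i w) + (\<Sum>i<k. h2 i w)) = 0"
      using i1 i2 by (simp add: Bochner_Integration.integral_add Bochner_Integration.integrable_sum Bochner_Integration.integral_sum)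
    then show "X = (LINT w|P. G w * Er k w)"
      unfolding eq X_def by (simp add: Bochner_Integration.integral_diff[OF i3 i4])
  qed
  \<comment> \<open>Young's inequality with a free weight l: the partition is refined for fixed l,
    and l is chosen afterwards.\<close>
  have key: "\<bar>X\<bar> \<le> l / 2 * z k + B / (2 * l)" if l: "l > 0" for l k
  proof -
    have "\<bar>X\<bar> \<le> (LINT w|P. \<bar>G w * Er (Suc k) w\<bar>)"
      unfolding XE(1)[of "Suc k", simplified] by (rule integral_abs_bound)
    also have "\<dots> \<le> (LINT w|P. l / 2 * (Z (Suc k) w)\<^sup>2 + 1 / (2 * l) * (Y (Suc k) w)\<^sup>2)"
    proof (rule integral_mono)
      fix w assume w: "w \<in> space P"
      have am: "x * y \<le> l / 2 * x\<^sup>2 + 1 / (2 * l) * y\<^sup>2" for x y :: real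
      proof -
        have "0 \<le> (l * x - y)\<^sup>2 / (2 * l)" using l by simp
        also have "\<dots> = l / 2 * x\<^sup>2 + 1 / (2 * l) * y\<^sup>2 - x * y"
          using l by (simp add: power2_eq_square field_simps)
        finally show ?thesis by simp
      qed
      have "\<bar>G w * Er (Suc k) w\<bar> \<le> 1 * \<bar>Er (Suc k) w\<bar>"
        unfolding abs_mult using G01(2) by (intro mult_right_mono) auto
      also have "\<dots> = Z (Suc k) w * Y (Suc k) w"
        using Y1[OF w, of "Suc k"] by (simp add: Z_def)
      also note am
      finally show "\<bar>G w * Er (Suc k) w\<bar> \<le> l / 2 * (Z (Suc k) w)\<^sup>2 + 1 / (2 * l) * (Y (Suc k) w)\<^sup>2" .
    qed (use XE(2)[of "Suc k"] Z2int Y2int in auto)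
    also have "\<dots> = l / 2 * z k + 1 / (2 * l) * (LINT w|P. (Y (Suc k) w)\<^sup>2)"
      unfolding z_def using Z2int Y2int by (simp add: Bochner_Integration.integral_add)
    also have "\<dots> \<le> l / 2 * z k + 1 / (2 * l) * B"
      using EY l by (intro add_left_mono mult_left_mono) auto
    finally show ?thesis by simp
  qed
  have "\<bar>X\<bar> \<le> B / (2 * l)" if l: "l > 0" for l
  proof -
    have "(\<lambda>k. l / 2 * z k + B / (2 * l)) \<longlonglongrightarrow> l / 2 * 0 + B / (2 * l)"
      by (intro tendsto_intros z_lim)
    then show ?thesis
      using key[OF l] by (intro LIMSEQ_le_const[of _ "B / (2 * l)" "\<bar>X\<bar>"]) auto
  qed
  \<comment> \<open>This weight gives |X| \<le> |X| / 2.\<close>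
  from this[of "B / \<bar>X\<bar>"] have "X = 0"
    using B by (cases "X = 0") auto
  then show "(LINT w|P. indicator A w * (R t w - R s w)) = 0"
    by (simp add: X_def G_def)
qed

end

section \<open>Taylor expansion along a path\<close>

definition cstate :: "(real \<Rightarrow> int \<Rightarrow> real) \<Rightarrow> real \<Rightarrow> int \<Rightarrow> complex" where
  "cstate S r = (\<lambda>i. of_real (S r i))"

text \<open>The first order part of the density of p with respect to the clock; the second order
  term in coordinate 0 is kept apart.\<close>

definition drift :: "int set \<Rightarrow> ((int \<Rightarrow> complex) \<Rightarrow> complex) \<Rightarrow> (real \<Rightarrow> int \<Rightarrow> real) \<Rightarrow> (real \<Rightarrow> int \<Rightarrow> real) \<Rightarrow> real \<Rightarrow> complex" where
  "drift I p S d r = (\<Sum>i\<in>I. pdiff i p (cstate S r) * of_real (d r i))"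

text \<open>One time step \<open>[u, v]\<close> of a path of an Ito process driven by \<open>W\<close> and \<open>q\<close>: coordinate \<open>0\<close> has
  martingale part \<open>\<sigma> W\<close>, the other coordinates have finite variation. The constants of the
  estimates below depend on \<open>I, \<sigma>, B, E\<close> only.\<close>

definition ito_step :: "int set \<Rightarrow> real \<Rightarrow> real \<Rightarrow> real \<Rightarrow> (real \<Rightarrow> real) \<Rightarrow> (real \<Rightarrow> real) \<Rightarrow>
    (real \<Rightarrow> int \<Rightarrow> real) \<Rightarrow> (real \<Rightarrow> int \<Rightarrow> real) \<Rightarrow> real \<Rightarrow> real \<Rightarrow> real \<Rightarrow> bool" where
  "ito_step I \<sigma> B E q W S d u v e \<longleftrightarrow> clock_path q \<and> 0 \<le> u \<and> u \<le> v \<and> 0 \<le> e \<and> e \<le> E \<and>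
     (\<forall>r\<in>{u..v}. \<bar>W r - W u\<bar> \<le> e \<and> q r - q u \<le> e) \<and>
     (\<forall>i\<in>I. \<forall>r\<in>{u..v}. \<bar>S r i\<bar> \<le> B) \<and> (\<forall>i\<in>I. \<forall>r\<in>{u<..v}. \<bar>d r i\<bar> \<le> B) \<and>
     (\<forall>i\<in>I. continuous_on {u..v} (\<lambda>r. S r i)) \<and> (\<forall>i\<in>I. set_borel_measurable borel {u<..v} (\<lambda>r. d r i)) \<and>
     (\<forall>i\<in>I. \<forall>r\<in>{u..v}. S r i - S u i = (if i = 0 then \<sigma> * (W r - W u) else 0) + (LINT a:{u<..r}|stieltjes q. d a i))"

lemma set_borel_measurable_subset_real:
  fixes f :: "real \<Rightarrow> 'b :: {banach, second_countable_topology}"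
  assumes "set_borel_measurable borel A f" "B \<in> sets borel" "B \<subseteq> A"
  shows "set_borel_measurable borel B f"
  by (rule set_borel_measurable_subset[OF assms(1)]) (use assms in auto)

lemma polyfun_bounded:
  assumes "p \<in> polyfun I"
  shows "\<exists>C\<ge>0. \<forall>s. (\<forall>i\<in>I. norm (s i) \<le> B) \<longrightarrow> norm (p s) \<le> C"
  using assms
proof induction
  case (const c)
  then show ?case by (intro exI[of _ "norm c"]) auto
next
  case (coord i)
  then show ?case by (intro exI[of _ "max 0 B"]) (auto simp: le_max_iff_disj)
next
  case (add p q)
  then obtain C1 C2 where "C1 \<ge> 0" "\<forall>s. (\<forall>i\<in>I. norm (s i) \<le> B) \<longrightarrow> norm (p s) \<le> C1"
    "C2 \<ge> 0" "\<forall>s. (\<forall>i\<in>I. norm (s i) \<le> B) \<longrightarrow> norm (q s) \<le> C2" by auto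
  then show ?case
    by (intro exI[of _ "C1 + C2"]) (auto intro!: norm_triangle_le add_mono)
next
  case (mult p q)
  then obtain C1 C2 where "C1 \<ge> 0" "\<forall>s. (\<forall>i\<in>I. norm (s i) \<le> B) \<longrightarrow> norm (p s) \<le> C1"
    "C2 \<ge> 0" "\<forall>s. (\<forall>i\<in>I. norm (s i) \<le> B) \<longrightarrow> norm (q s) \<le> C2" by auto
  then show ?case
    by (intro exI[of _ "C1 * C2"]) (auto simp: norm_mult intro!: mult_mono)
qed

lemma ito_step_bounded:
  assumes "p \<in> polyfun I"
  obtains C where "C \<ge> 0" "\<And>q W S d u v e r. ito_step I \<sigma> B E q W S d u v e \<Longrightarrow> r \<in> {u..v} \<Longrightarrow> norm (p (cstate S r)) \<le> C"
proof -
  obtain C where C: "C \<ge> 0" "\<forall>s. (\<forall>i\<in>I. norm (s i) \<le> B) \<longrightarrow> norm (p s) \<le> C"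
    using polyfun_bounded[OF assms] by blast
  show thesis
  proof (rule that[OF C(1)])
    fix q W S d u v e r assume "ito_step I \<sigma> B E q W S d u v e" "r \<in> {u..v}"
    then have "\<forall>i\<in>I. norm (cstate S r i) \<le> B" by (auto simp: ito_step_def cstate_def)
    then show "norm (p (cstate S r)) \<le> C" using C(2) by blast
  qed
qed

lemma ito_step_continuous:
  assumes "p \<in> polyfun I" "ito_step I \<sigma> B E q W S d u v e"
  shows "continuous_on {u..v} (\<lambda>r. p (cstate S r))"
  using assms by (induction rule: polyfun.induct) (auto simp: ito_step_def cstate_def intro!: continuous_intros)

lemma ito_step_drift:
  assumes I: "finite I" and p: "p \<in> polyfun I"
  obtains C where "C \<ge> 0" "\<And>q W S d u v e. ito_step I \<sigma> B E q W S d u v e \<Longrightarrow>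
      set_borel_measurable borel {u<..v} (drift I p S d) \<and> (\<forall>r\<in>{u<..v}. norm (drift I p S d r) \<le> C)"
proof -
  have "\<exists>C\<ge>0. \<forall>q W S d u v e r. ito_step I \<sigma> B E q W S d u v e \<longrightarrow> r \<in> {u..v} \<longrightarrow> norm (pdiff i p (cstate S r)) \<le> C" for i
    by (rule ito_step_bounded[OF pdiff_polyfun[OF p], where \<sigma> = \<sigma> and B = B and E = E]) blast
  then have "\<forall>i. \<exists>C. C \<ge> 0 \<and> (\<forall>q W S d u v e r. ito_step I \<sigma> B E q W S d u v e \<longrightarrow> r \<in> {u..v} \<longrightarrow> norm (pdiff i p (cstate S r)) \<le> C)"
    by blast
  from choice[OF this] obtain C where C: "\<And>i. C i \<ge> 0"
    "\<And>i q W S d u v e r. ito_step I \<sigma> B E q W S d u v e \<Longrightarrow> r \<in> {u..v} \<Longrightarrow> norm (pdiff i p (cstate S r)) \<le> C i"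
    by blast
  show thesis
  proof (rule that[of "\<Sum>i\<in>I. C i * \<bar>B\<bar>"])
    show "(\<Sum>i\<in>I. C i * \<bar>B\<bar>) \<ge> 0" by (intro sum_nonneg mult_nonneg_nonneg C) auto
    fix q W S d u v e assume step: "ito_step I \<sigma> B E q W S d u v e"
    have "norm (drift I p S d r) \<le> (\<Sum>i\<in>I. C i * \<bar>B\<bar>)" if r: "r \<in> {u<..v}" for r
      unfolding drift_def
    proof (rule sum_norm_le)
      fix i assume i: "i \<in> I"
      have "\<bar>d r i\<bar> \<le> B" using step r i by (auto simp: ito_step_def)
      then show "norm (pdiff i p (cstate S r) * of_real (d r i)) \<le> C i * \<bar>B\<bar>"
        unfolding norm_mult using r C by (intro mult_mono C(2)[OF step]) auto
    qed
    moreover have "set_borel_measurable borel {u<..v} (drift I p S d)"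
    proof -
      have m: "(\<lambda>r. indicator {u<..v} r *\<^sub>R d r i) \<in> borel_measurable borel" if "i \<in> I" for i
        using step that by (auto simp: ito_step_def set_borel_measurable_def)
      have "set_borel_measurable borel {u<..v} (\<lambda>r. pdiff i p (cstate S r))" for i
        using ito_step_continuous[OF pdiff_polyfun[OF p] step, of i]
        by (intro borel_measurable_continuous_on_indicator[folded set_borel_measurable_def])
          (auto intro: continuous_on_subset)
      then have m': "(\<lambda>r. indicator {u<..v} r *\<^sub>R pdiff i p (cstate S r)) \<in> borel_measurable borel" for i
        by (simp add: set_borel_measurable_def)
      have "(\<lambda>r. indicator {u<..v} r *\<^sub>R drift I p S d r)
        = (\<lambda>r. \<Sum>i\<in>I. (indicator {u<..v} r *\<^sub>R pdiff i p (cstate S r)) * of_real (indicator {u<..v} r *\<^sub>R d r i))"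
        by (rule ext) (simp add: drift_def indicator_def)
      also have "\<dots> \<in> borel_measurable borel"
        by (intro borel_measurable_sum borel_measurable_times m' measurable_compose[OF m borel_measurable_of_real])
      finally show ?thesis by (simp add: set_borel_measurable_def)
    qed
    ultimately show "set_borel_measurable borel {u<..v} (drift I p S d) \<and> (\<forall>r\<in>{u<..v}. norm (drift I p S d r) \<le> (\<Sum>i\<in>I. C i * \<bar>B\<bar>))"
      by blast
  qed
qed

lemma ito_step_lipschitz:
  assumes "p \<in> polyfun I"
  shows "\<exists>C\<ge>0. \<forall>q W S d u v e. ito_step I \<sigma> B E q W S d u v e \<longrightarrow>
    (\<forall>r\<in>{u..v}. norm (p (cstate S r) - p (cstate S u)) \<le> C * e)"
  using assms
proof induction
  case (const c)
  then show ?case by (intro exI[of _ 0]) auto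
next
  case (coord i)
  show ?case
  proof (intro exI[of _ "\<bar>\<sigma>\<bar> + \<bar>B\<bar>"] conjI allI impI ballI)
    fix q W S d u v e r assume step: "ito_step I \<sigma> B E q W S d u v e" and r: "r \<in> {u..v}"
    interpret clock_path q using step by (simp add: ito_step_def)
    have *: "0 \<le> u" "u \<le> r" "0 \<le> e" "\<bar>W r - W u\<bar> \<le> e" "q r - q u \<le> e" "\<forall>a\<in>{u<..r}. norm (d a i) \<le> \<bar>B\<bar>"
      "S r i - S u i = (if i = 0 then \<sigma> * (W r - W u) else 0) + (LINT a:{u<..r}|stieltjes q. d a i)"
      using step r coord by (auto simp: ito_step_def intro: order_trans[OF _ abs_ge_self])
    have "norm (LINT a:{u<..r}|stieltjes q. d a i) \<le> \<bar>B\<bar> * (q r - q u)"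
      using * by (intro stieltjes_integral_bound) auto
    also have "\<dots> \<le> \<bar>B\<bar> * e" using * by (intro mult_left_mono) auto
    finally have 1: "\<bar>LINT a:{u<..r}|stieltjes q. d a i\<bar> \<le> \<bar>B\<bar> * e" by simp
    have 2: "\<bar>if i = 0 then \<sigma> * (W r - W u) else 0\<bar> \<le> \<bar>\<sigma>\<bar> * e"
      using * by (auto simp: abs_mult intro!: mult_left_mono)
    have "\<bar>S r i - S u i\<bar> \<le> (\<bar>\<sigma>\<bar> + \<bar>B\<bar>) * e"
      unfolding *(7) distrib_right using 1 2 by linarith
    then show "norm (cstate S r i - cstate S u i) \<le> (\<bar>\<sigma>\<bar> + \<bar>B\<bar>) * e"
      by (simp add: cstate_def norm_of_real flip: of_real_diff)
  qed simp
next
  case (add p q)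
  obtain C1 where C1: "C1 \<ge> 0"
    "\<And>q W S d u v e r. ito_step I \<sigma> B E q W S d u v e \<Longrightarrow> r \<in> {u..v} \<Longrightarrow> norm (p (cstate S r) - p (cstate S u)) \<le> C1 * e"
    using add.IH(1) by blast
  obtain C2 where C2: "C2 \<ge> 0"
    "\<And>q' W S d u v e r. ito_step I \<sigma> B E q' W S d u v e \<Longrightarrow> r \<in> {u..v} \<Longrightarrow> norm (q (cstate S r) - q (cstate S u)) \<le> C2 * e"
    using add.IH(2) by blast
  note C = C1(1) C2(1) C1(2) C2(2)
  show ?case
  proof (intro exI[of _ "C1 + C2"] conjI allI impI ballI)
    fix q' W S d u v e r assume step: "ito_step I \<sigma> B E q' W S d u v e" and r: "r \<in> {u..v}"
    have "p (cstate S r) + q (cstate S r) - (p (cstate S u) + q (cstate S u))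
        = (p (cstate S r) - p (cstate S u)) + (q (cstate S r) - q (cstate S u))" by simp
    also have "norm \<dots> \<le> C1 * e + C2 * e"
      by (intro norm_triangle_le add_mono C(3)[OF step r] C(4)[OF step r])
    finally show "norm (p (cstate S r) + q (cstate S r) - (p (cstate S u) + q (cstate S u))) \<le> (C1 + C2) * e"
      by (simp add: distrib_right)
  qed (use C in auto)
next
  case (mult p q)
  obtain C1 where C1: "C1 \<ge> 0"
    "\<And>q W S d u v e r. ito_step I \<sigma> B E q W S d u v e \<Longrightarrow> r \<in> {u..v} \<Longrightarrow> norm (p (cstate S r) - p (cstate S u)) \<le> C1 * e"
    using mult.IH(1) by blast
  obtain C2 where C2: "C2 \<ge> 0"
    "\<And>q' W S d u v e r. ito_step I \<sigma> B E q' W S d u v e \<Longrightarrow> r \<in> {u..v} \<Longrightarrow> norm (q (cstate S r) - q (cstate S u)) \<le> C2 * e"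
    using mult.IH(2) by blast
  note C = C1(1) C2(1) C1(2) C2(2)
  obtain D1 where D1: "D1 \<ge> 0" "\<And>q W S d u v e r. ito_step I \<sigma> B E q W S d u v e \<Longrightarrow> r \<in> {u..v} \<Longrightarrow> norm (p (cstate S r)) \<le> D1"
    by (rule ito_step_bounded[OF mult.hyps(1), where \<sigma> = \<sigma> and B = B and E = E]) blast
  obtain D2 where D2: "D2 \<ge> 0" "\<And>q' W S d u v e r. ito_step I \<sigma> B E q' W S d u v e \<Longrightarrow> r \<in> {u..v} \<Longrightarrow> norm (q (cstate S r)) \<le> D2"
    by (rule ito_step_bounded[OF mult.hyps(2), where \<sigma> = \<sigma> and B = B and E = E]) blast
  show ?case
  proof (intro exI[of _ "C1 * D2 + D1 * C2"] conjI allI impI ballI)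
    fix q' W S d u v e r assume step: "ito_step I \<sigma> B E q' W S d u v e" and r: "r \<in> {u..v}"
    have u: "u \<in> {u..v}" using r by auto
    have "p (cstate S r) * q (cstate S r) - p (cstate S u) * q (cstate S u)
        = (p (cstate S r) - p (cstate S u)) * q (cstate S r) + p (cstate S u) * (q (cstate S r) - q (cstate S u))"
      by (simp add: algebra_simps)
    also have "norm \<dots> \<le> (C1 * e) * D2 + D1 * (C2 * e)"
      by (intro norm_triangle_le add_mono norm_mult_ineq[THEN order_trans] mult_mono C(3)[OF step r] C(4)[OF step r] D1(2)[OF step u] D2(2)[OF step r])
        (use step C D1 in \<open>auto simp: ito_step_def\<close>)
    finally show "norm (p (cstate S r) * q (cstate S r) - p (cstate S u) * q (cstate S u)) \<le> (C1 * D2 + D1 * C2) * e"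
      by (simp add: algebra_simps)
  qed (use C D1 D2 in auto)
qed

text \<open>The remainder of the Ito formula in which the second order term still carries
  (\<Delta>W)^2 instead of \<Delta>q. In this form products of increments match the product rule for
  second derivatives.\<close>

definition ito_error :: "int set \<Rightarrow> real \<Rightarrow> ((int \<Rightarrow> complex) \<Rightarrow> complex) \<Rightarrow> (real \<Rightarrow> real) \<Rightarrow> (real \<Rightarrow> real) \<Rightarrow>
    (real \<Rightarrow> int \<Rightarrow> real) \<Rightarrow> (real \<Rightarrow> int \<Rightarrow> real) \<Rightarrow> real \<Rightarrow> real \<Rightarrow> complex" where
  "ito_error I \<sigma> p q W S d u v = p (cstate S v) - p (cstate S u)
     - of_real (\<sigma> * (W v - W u)) * pdiff 0 p (cstate S u)
     - of_real (\<sigma>\<^sup>2 / 2 * (W v - W u)\<^sup>2) * pdiff 0 (pdiff 0 p) (cstate S u)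
     - (LINT r:{u<..v}|stieltjes q. drift I p S d r)"

text \<open>Induction over the polynomial. Coordinates have no error. For a product, \<Delta>a
  \<Delta>b contributes \<sigma>^2 (\<Delta>W)^2 a_1 b_1 with a_1, b_1 the derivatives at u, which
  is the mixed part of the second derivative of a b; all other products of increments gain a factor
  e.\<close>

lemma ito_expansion:
  assumes I: "finite I" and p: "p \<in> polyfun I" and E: "0 \<le> E"
  shows "\<exists>C\<ge>0. \<forall>q W S d u v e. ito_step I \<sigma> B E q W S d u v e \<longrightarrow>
    norm (ito_error I \<sigma> p q W S d u v) \<le> C * e * ((W v - W u)\<^sup>2 + (q v - q u))"
  using p
proof induction
  case (const c)
  have "ito_error I \<sigma> (\<lambda>_. c) q W S d u v = 0" for q W S d u v
    by (simp add: ito_error_def drift_def pdiff_const pdiff_const[abs_def])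
  then show ?case by (intro exI[of _ 0]) simp
next
  case (coord j)
  have "ito_error I \<sigma> (\<lambda>s. s j) q W S d u v = 0" if step: "ito_step I \<sigma> B E q W S d u v e" for q W S d u v e
  proof -
    have eq: "S v j - S u j = (if j = 0 then \<sigma> * (W v - W u) else 0) + (LINT a:{u<..v}|stieltjes q. d a j)"
      using step coord by (auto simp: ito_step_def)
    have "drift I (\<lambda>s. s j) S d = (\<lambda>r. complex_of_real (d r j))"
      unfolding drift_def pdiff_coord using I coord by (simp add: if_distrib[of "\<lambda>x. x * _"] cong: if_cong)
    then have "(LINT r:{u<..v}|stieltjes q. drift I (\<lambda>s. s j) S d r) = of_real (LINT a:{u<..v}|stieltjes q. d a j)"
      by (simp only: set_integral_complex_of_real)
    then show ?thesis
      using arg_cong[OF eq, of complex_of_real]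
      by (auto simp: ito_error_def pdiff_coord pdiff_coord[abs_def] pdiff_const cstate_def split: if_splits)
  qed
  then show ?case by (intro exI[of _ 0]) auto
next
  case (add a b)
  obtain C1 where C1: "C1 \<ge> 0"
    "\<And>q W S d u v e. ito_step I \<sigma> B E q W S d u v e \<Longrightarrow> norm (ito_error I \<sigma> a q W S d u v) \<le> C1 * e * ((W v - W u)\<^sup>2 + (q v - q u))"
    using add.IH(1) by blast
  obtain C2 where C2: "C2 \<ge> 0"
    "\<And>q W S d u v e. ito_step I \<sigma> B E q W S d u v e \<Longrightarrow> norm (ito_error I \<sigma> b q W S d u v) \<le> C2 * e * ((W v - W u)\<^sup>2 + (q v - q u))"
    using add.IH(2) by blast
  note C = C1(1) C2(1) C1(2) C2(2)
  obtain D1 where D1: "\<And>q W S d u v e. ito_step I \<sigma> B E q W S d u v e \<Longrightarrow>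
      set_borel_measurable borel {u<..v} (drift I a S d) \<and> (\<forall>r\<in>{u<..v}. norm (drift I a S d r) \<le> D1)"
    by (rule ito_step_drift[OF I add.hyps(1), where \<sigma> = \<sigma> and B = B and E = E]) blast
  obtain D2 where D2: "\<And>q W S d u v e. ito_step I \<sigma> B E q W S d u v e \<Longrightarrow>
      set_borel_measurable borel {u<..v} (drift I b S d) \<and> (\<forall>r\<in>{u<..v}. norm (drift I b S d r) \<le> D2)"
    by (rule ito_step_drift[OF I add.hyps(2), where \<sigma> = \<sigma> and B = B and E = E]) blast
  have p0: "pdiff 0 (\<lambda>s. a s + b s) = (\<lambda>s. pdiff 0 a s + pdiff 0 b s)"
    by (rule ext) (rule pdiff_add[OF add.hyps])
  have p00: "pdiff 0 (pdiff 0 (\<lambda>s. a s + b s)) s = pdiff 0 (pdiff 0 a) s + pdiff 0 (pdiff 0 b) s" for s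
    unfolding p0 by (rule pdiff_add[OF pdiff_polyfun[OF add.hyps(1)] pdiff_polyfun[OF add.hyps(2)]])
  show ?case
  proof (intro exI[of _ "C1 + C2"] conjI allI impI)
    fix q W S d u v e assume step: "ito_step I \<sigma> B E q W S d u v e"
    interpret clock_path q using step by (simp add: ito_step_def)
    have sub: "{u<..v} \<subseteq> {0..v}" using step by (auto simp: ito_step_def)
    have i1: "set_integrable (stieltjes q) {u<..v} (drift I a S d)"
      using D1[OF step] by (intro stieltjes_set_integrable[OF sub]) auto
    have i2: "set_integrable (stieltjes q) {u<..v} (drift I b S d)"
      using D2[OF step] by (intro stieltjes_set_integrable[OF sub]) auto
    have "drift I (\<lambda>s. a s + b s) S d = (\<lambda>r. drift I a S d r + drift I b S d r)"
      by (rule ext) (simp add: drift_def pdiff_add[OF add.hyps] distrib_right sum.distrib)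
    then have "(LINT r:{u<..v}|stieltjes q. drift I (\<lambda>s. a s + b s) S d r)
        = (LINT r:{u<..v}|stieltjes q. drift I a S d r) + (LINT r:{u<..v}|stieltjes q. drift I b S d r)"
      by (simp only: set_integral_add(2)[OF i1 i2])
    then have "ito_error I \<sigma> (\<lambda>s. a s + b s) q W S d u v = ito_error I \<sigma> a q W S d u v + ito_error I \<sigma> b q W S d u v"
      by (simp add: ito_error_def p0 p00[unfolded p0] algebra_simps)
    also have "norm \<dots> \<le> C1 * e * ((W v - W u)\<^sup>2 + (q v - q u)) + C2 * e * ((W v - W u)\<^sup>2 + (q v - q u))"
      by (intro norm_triangle_le add_mono C step)
    finally show "norm (ito_error I \<sigma> (\<lambda>s. a s + b s) q W S d u v) \<le> (C1 + C2) * e * ((W v - W u)\<^sup>2 + (q v - q u))"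
      by (simp add: distrib_right)
  qed (use C in auto)
next
  case (mult a b)
  define stp where "stp = ito_step I \<sigma> B E"
  obtain C1 where C1: "C1 \<ge> 0"
    "\<And>q W S d u v e. stp q W S d u v e \<Longrightarrow> norm (ito_error I \<sigma> a q W S d u v) \<le> C1 * e * ((W v - W u)\<^sup>2 + (q v - q u))"
    using mult.IH(1) unfolding stp_def by blast
  obtain C2 where C2: "C2 \<ge> 0"
    "\<And>q W S d u v e. stp q W S d u v e \<Longrightarrow> norm (ito_error I \<sigma> b q W S d u v) \<le> C2 * e * ((W v - W u)\<^sup>2 + (q v - q u))"
    using mult.IH(2) unfolding stp_def by blast
  note C = C1(1) C2(1) C1(2) C2(2)
  obtain D1 where D1: "D1 \<ge> 0" "\<And>q W S d u v e. stp q W S d u v e \<Longrightarrow>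
      set_borel_measurable borel {u<..v} (drift I a S d) \<and> (\<forall>r\<in>{u<..v}. norm (drift I a S d r) \<le> D1)"
    unfolding stp_def by (rule ito_step_drift[OF I mult.hyps(1), where \<sigma> = \<sigma> and B = B and E = E]) blast
  obtain D2 where D2: "D2 \<ge> 0" "\<And>q W S d u v e. stp q W S d u v e \<Longrightarrow>
      set_borel_measurable borel {u<..v} (drift I b S d) \<and> (\<forall>r\<in>{u<..v}. norm (drift I b S d r) \<le> D2)"
    unfolding stp_def by (rule ito_step_drift[OF I mult.hyps(2), where \<sigma> = \<sigma> and B = B and E = E]) blast
  obtain D3 where D3: "D3 \<ge> 0" "\<And>q W S d u v e. stp q W S d u v e \<Longrightarrow>
      set_borel_measurable borel {u<..v} (drift I (\<lambda>s. a s * b s) S d) \<and> (\<forall>r\<in>{u<..v}. norm (drift I (\<lambda>s. a s * b s) S d r) \<le> D3)"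
    unfolding stp_def by (rule ito_step_drift[OF I polyfun.mult[OF mult.hyps], where \<sigma> = \<sigma> and B = B and E = E]) blast
  have bd: "\<exists>M\<ge>0. \<forall>q W S d u v e r. stp q W S d u v e \<longrightarrow> r \<in> {u..v} \<longrightarrow> norm (f (cstate S r)) \<le> M" if "f \<in> polyfun I" for f
    unfolding stp_def by (rule ito_step_bounded[OF that, where \<sigma> = \<sigma> and B = B and E = E]) blast
  obtain Ma where Ma: "Ma \<ge> 0" "\<And>q W S d u v e r. stp q W S d u v e \<Longrightarrow> r \<in> {u..v} \<Longrightarrow> norm (a (cstate S r)) \<le> Ma"
    using bd[OF mult.hyps(1)] by blast
  obtain Mb where Mb: "Mb \<ge> 0" "\<And>q W S d u v e r. stp q W S d u v e \<Longrightarrow> r \<in> {u..v} \<Longrightarrow> norm (b (cstate S r)) \<le> Mb"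
    using bd[OF mult.hyps(2)] by blast
  obtain Ma1 where Ma1: "Ma1 \<ge> 0" "\<And>q W S d u v e r. stp q W S d u v e \<Longrightarrow> r \<in> {u..v} \<Longrightarrow> norm (pdiff 0 a (cstate S r)) \<le> Ma1"
    using bd[OF pdiff_polyfun[OF mult.hyps(1)], of 0] by blast
  obtain Mb1 where Mb1: "Mb1 \<ge> 0" "\<And>q W S d u v e r. stp q W S d u v e \<Longrightarrow> r \<in> {u..v} \<Longrightarrow> norm (pdiff 0 b (cstate S r)) \<le> Mb1"
    using bd[OF pdiff_polyfun[OF mult.hyps(2)], of 0] by blast
  obtain Ma2 where Ma2: "Ma2 \<ge> 0" "\<And>q W S d u v e r. stp q W S d u v e \<Longrightarrow> r \<in> {u..v} \<Longrightarrow> norm (pdiff 0 (pdiff 0 a) (cstate S r)) \<le> Ma2"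
    using bd[OF pdiff_polyfun[OF pdiff_polyfun[OF mult.hyps(1)]], of 0 0] by blast
  obtain Mb2 where Mb2: "Mb2 \<ge> 0" "\<And>q W S d u v e r. stp q W S d u v e \<Longrightarrow> r \<in> {u..v} \<Longrightarrow> norm (pdiff 0 (pdiff 0 b) (cstate S r)) \<le> Mb2"
    using bd[OF pdiff_polyfun[OF pdiff_polyfun[OF mult.hyps(2)]], of 0 0] by blast
  obtain La where La: "La \<ge> 0" "\<And>q W S d u v e r. stp q W S d u v e \<Longrightarrow> r \<in> {u..v} \<Longrightarrow> norm (a (cstate S r) - a (cstate S u)) \<le> La * e"
    using ito_step_lipschitz[OF mult.hyps(1), where \<sigma> = \<sigma> and B = B and E = E, folded stp_def] by blast
  obtain Lb where Lb: "Lb \<ge> 0" "\<And>q W S d u v e r. stp q W S d u v e \<Longrightarrow> r \<in> {u..v} \<Longrightarrow> norm (b (cstate S r) - b (cstate S u)) \<le> Lb * e"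
    using ito_step_lipschitz[OF mult.hyps(2), where \<sigma> = \<sigma> and B = B and E = E, folded stp_def] by blast
  note Mab = Ma(1) Ma(2) Mb(1) Mb(2) and M1 = Ma1(1) Ma1(2) Mb1(1) Mb1(2) and M2 = Ma2(1) Ma2(2) Mb2(1) Mb2(2)
    and L = La(1) La(2) Lb(1) Lb(2)
  have p0: "pdiff 0 (\<lambda>s. a s * b s) = (\<lambda>s. pdiff 0 a s * b s + a s * pdiff 0 b s)"
    by (rule ext) (rule pdiff_mult[OF mult.hyps])
  have p00: "pdiff 0 (pdiff 0 (\<lambda>s. a s * b s)) s = pdiff 0 (pdiff 0 a) s * b s + 2 * (pdiff 0 a s * pdiff 0 b s) + a s * pdiff 0 (pdiff 0 b) s" for s
    unfolding p0
    by (subst pdiff_add[OF polyfun.mult[OF pdiff_polyfun[OF mult.hyps(1)] mult.hyps(2)] polyfun.mult[OF mult.hyps(1) pdiff_polyfun[OF mult.hyps(2)]]])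
      (simp add: pdiff_mult[OF pdiff_polyfun[OF mult.hyps(1)] mult.hyps(2)] pdiff_mult[OF mult.hyps(1) pdiff_polyfun[OF mult.hyps(2)]])
  \<comment> \<open>\<Delta>a equals \<sigma> \<Delta>W a_1 up to Ra ((\<Delta>W)^2 + \<Delta>q).
    The factor e in the error of a is estimated by E here, since the other factor of the product
    will provide one.\<close>
  define Ra where "Ra = C1 * E + \<sigma>\<^sup>2 / 2 * Ma2 + D1"
  define Rb where "Rb = C2 * E + \<sigma>\<^sup>2 / 2 * Mb2 + D2"
  define C where "C = Ma * C2 + Mb * C1 + (\<bar>\<sigma>\<bar> * Ma1 * Rb + Ra * Lb) + (La * D2 + Lb * D1)"
  have nn: "Ra \<ge> 0" "Rb \<ge> 0" unfolding Ra_def Rb_def using C D1 D2 M2 E by (auto intro!: add_nonneg_nonneg mult_nonneg_nonneg)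
  show ?case
  proof (intro exI[of _ C] conjI allI impI)
    show "C \<ge> 0"
      unfolding C_def using C Mab M1 L D1 D2 nn by (auto intro!: add_nonneg_nonneg mult_nonneg_nonneg)
    fix q W S d u v e assume step': "ito_step I \<sigma> B E q W S d u v e"
    then have step: "stp q W S d u v e" by (simp add: stp_def)
    interpret clock_path q using step' by (simp add: ito_step_def)
    have *: "0 \<le> u" "u \<le> v" "0 \<le> e" "e \<le> E" "\<bar>W v - W u\<bar> \<le> e" "u \<in> {u..v}" "v \<in> {u..v}"
      using step' by (auto simp: ito_step_def)
    define w where "w = W v - W u"
    define \<Theta> where "\<Theta> = w\<^sup>2 + (q v - q u)"
    have Q: "0 \<le> q v - q u" using q_le[of u v] * by simp
    have \<Theta>: "0 \<le> \<Theta>" "q v - q u \<le> \<Theta>" "w\<^sup>2 \<le> \<Theta>" using Q by (auto simp: \<Theta>_def)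
    define au bu av bv where "au = a (cstate S u)" and "bu = b (cstate S u)" and "av = a (cstate S v)" and "bv = b (cstate S v)"
    define a1 b1 a2 b2 where "a1 = pdiff 0 a (cstate S u)" and "b1 = pdiff 0 b (cstate S u)"
      and "a2 = pdiff 0 (pdiff 0 a) (cstate S u)" and "b2 = pdiff 0 (pdiff 0 b) (cstate S u)"
    define da db dab where "da = drift I a S d" and "db = drift I b S d" and "dab = drift I (\<lambda>s. a s * b s) S d"
    define J where "J = (\<lambda>f :: real \<Rightarrow> complex. LINT r:{u<..v}|stieltjes q. f r)"
    define ea eb where "ea = ito_error I \<sigma> a q W S d u v" and "eb = ito_error I \<sigma> b q W S d u v"
    have sub: "{u<..v} \<subseteq> {0..v}" using * by auto
    have ia: "set_integrable (stieltjes q) {u<..v} da"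
      unfolding da_def using D1(2)[OF step] by (intro stieltjes_set_integrable[OF sub]) auto
    have ib: "set_integrable (stieltjes q) {u<..v} db"
      unfolding db_def using D2(2)[OF step] by (intro stieltjes_set_integrable[OF sub]) auto
    have iab: "set_integrable (stieltjes q) {u<..v} dab"
      unfolding dab_def using D3(2)[OF step] by (intro stieltjes_set_integrable[OF sub]) auto
    have Ja: "norm (J da) \<le> D1 * \<Theta>"
    proof -
      have "norm (J da) \<le> D1 * (q v - q u)"
        unfolding J_def da_def using D1 step * by (intro stieltjes_integral_bound) auto
      also have "\<dots> \<le> D1 * \<Theta>" using \<Theta> D1 by (intro mult_left_mono)
      finally show ?thesis .
    qed
    have Jb: "norm (J db) \<le> D2 * \<Theta>"
    proof -
      have "norm (J db) \<le> D2 * (q v - q u)"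
        unfolding J_def db_def using D2 step * by (intro stieltjes_integral_bound) auto
      also have "\<dots> \<le> D2 * \<Theta>" using \<Theta> D2 by (intro mult_left_mono)
      finally show ?thesis .
    qed
    have ea: "norm ea \<le> C1 * e * \<Theta>" and eb: "norm eb \<le> C2 * e * \<Theta>"
      unfolding ea_def eb_def \<Theta>_def w_def by (rule C(3)[OF step] C(4)[OF step])+
    define \<rho>a \<rho>b where "\<rho>a = ea + of_real (\<sigma>\<^sup>2 / 2 * w\<^sup>2) * a2 + J da" and "\<rho>b = eb + of_real (\<sigma>\<^sup>2 / 2 * w\<^sup>2) * b2 + J db"
    have da_eq: "av - au = of_real (\<sigma> * w) * a1 + \<rho>a"
      by (simp add: \<rho>a_def ea_def ito_error_def av_def au_def a1_def a2_def J_def da_def w_def)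
    have db_eq: "bv - bu = of_real (\<sigma> * w) * b1 + \<rho>b"
      by (simp add: \<rho>b_def eb_def ito_error_def bv_def bu_def b1_def b2_def J_def db_def w_def)
    have \<rho>_bd: "norm (x + of_real (\<sigma>\<^sup>2 / 2 * w\<^sup>2) * y + z) \<le> (c * E + \<sigma>\<^sup>2 / 2 * m + D) * \<Theta>"
      if "norm x \<le> c * e * \<Theta>" "norm y \<le> m" "norm z \<le> D * \<Theta>" "c \<ge> 0" "m \<ge> 0" for x y z :: complex and c m D
    proof -
      have "norm (of_real (\<sigma>\<^sup>2 / 2 * w\<^sup>2) * y) \<le> (\<sigma>\<^sup>2 / 2 * \<Theta>) * m"
        unfolding norm_mult norm_of_real using \<Theta> that by (intro mult_mono) (auto simp: abs_mult mult_left_mono)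
      moreover have "norm x \<le> c * E * \<Theta>"
        using that(1) *(3,4) that(4) \<Theta> by (elim order_trans) (intro mult_right_mono mult_left_mono)
      moreover have "norm (x + of_real (\<sigma>\<^sup>2 / 2 * w\<^sup>2) * y + z) \<le> norm x + norm (of_real (\<sigma>\<^sup>2 / 2 * w\<^sup>2) * y) + norm z"
        by (intro norm_triangle_le add_mono order_refl)
      ultimately show ?thesis using that(3) by (simp add: algebra_simps)
    qed
    have \<rho>a: "norm \<rho>a \<le> Ra * \<Theta>"
      unfolding \<rho>a_def Ra_def by (rule \<rho>_bd[OF ea _ Ja C(1) M2(1)]) (simp add: a2_def M2(2)[OF step *(6)])
    have \<rho>b: "norm \<rho>b \<le> Rb * \<Theta>"
      unfolding \<rho>b_def Rb_def by (rule \<rho>_bd[OF eb _ Jb C(2) M2(3)]) (simp add: b2_def M2(4)[OF step *(6)])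
    \<comment> \<open>In both remaining products one factor is of order e and the other of order
      \<Theta>.\<close>
    have cross: "norm ((av - au) * (bv - bu) - of_real (\<sigma>\<^sup>2 * w\<^sup>2) * (a1 * b1)) \<le> (\<bar>\<sigma>\<bar> * Ma1 * Rb + Ra * Lb) * e * \<Theta>"
    proof -
      have "(av - au) * (bv - bu) - of_real (\<sigma>\<^sup>2 * w\<^sup>2) * (a1 * b1) = (of_real (\<sigma> * w) * a1) * \<rho>b + \<rho>a * (bv - bu)"
        unfolding da_eq by (simp add: db_eq power2_eq_square algebra_simps)
      also have "norm \<dots> \<le> norm (of_real (\<sigma> * w) * a1) * norm \<rho>b + norm \<rho>a * norm (bv - bu)"
        unfolding norm_mult[symmetric] by (rule norm_triangle_ineq)
      also have "\<dots> \<le> (\<bar>\<sigma>\<bar> * e * Ma1) * (Rb * \<Theta>) + (Ra * \<Theta>) * (Lb * e)"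
      proof (rule add_mono; rule mult_mono)
        show "norm (of_real (\<sigma> * w) * a1) \<le> \<bar>\<sigma>\<bar> * e * Ma1"
          unfolding norm_mult norm_of_real abs_mult using *(3,5) M1 M1(2)[OF step *(6)]
          by (intro mult_mono) (auto simp: w_def a1_def)
        show "norm (bv - bu) \<le> Lb * e" unfolding bv_def bu_def by (rule L(4)[OF step *(7)])
      qed (use \<rho>a \<rho>b \<Theta> nn *(3) M1 L in auto)
      finally show ?thesis by (simp add: algebra_simps)
    qed
    have drift_mult: "dab r = a (cstate S r) * db r + b (cstate S r) * da r" for r
      by (simp add: dab_def da_def db_def drift_def pdiff_mult[OF mult.hyps] sum_distrib_left sum.distrib[symmetric] algebra_simps)
    \<comment> \<open>In the drift of the product the undifferentiated factors vary with r; freezing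
      them at u costs a multiple of e \<Delta>q by the Lipschitz estimates.\<close>
    have Jint: "norm (J dab - (au * J db + bu * J da)) \<le> (La * D2 + Lb * D1) * e * \<Theta>"
    proof -
      have i2: "set_integrable (stieltjes q) {u<..v} (\<lambda>r. au * db r + bu * da r)"
        using ia ib by (intro set_integral_add set_integrable_mult_right) auto
      have "J dab - (au * J db + bu * J da) = (LINT r:{u<..v}|stieltjes q. dab r - (au * db r + bu * da r))"
        unfolding J_def using ia ib
        by (subst set_integral_diff(2)[OF iab i2]) (simp add: set_integral_add(2) set_integrable_mult_right)
      also have "norm \<dots> \<le> ((La * D2 + Lb * D1) * e) * (q v - q u)"
      proof (rule stieltjes_integral_bound)
        fix r assume r: "r \<in> {u<..v}"
        then have r': "r \<in> {u..v}" by auto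
        have "dab r - (au * db r + bu * da r) = (a (cstate S r) - au) * db r + (b (cstate S r) - bu) * da r"
          by (simp add: drift_mult algebra_simps)
        also have "norm \<dots> \<le> (La * e) * D2 + (Lb * e) * D1"
          unfolding au_def bu_def
          by (intro norm_triangle_le add_mono norm_mult_ineq[THEN order_trans] mult_mono L(2)[OF step r'] L(4)[OF step r'])
            (use r D1(2)[OF step] D2(2)[OF step] L *(3) in \<open>auto simp: da_def db_def\<close>)
        finally show "norm (dab r - (au * db r + bu * da r)) \<le> (La * D2 + Lb * D1) * e" by (simp add: algebra_simps)
      qed (use * L D1 D2 in auto)
      also have "\<dots> \<le> ((La * D2 + Lb * D1) * e) * \<Theta>"
        using \<Theta> *(3) L D1 D2 by (intro mult_left_mono) auto
      finally show ?thesis .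
    qed
    have "ito_error I \<sigma> (\<lambda>s. a s * b s) q W S d u v = au * eb + bu * ea
        + ((av - au) * (bv - bu) - of_real (\<sigma>\<^sup>2 * w\<^sup>2) * (a1 * b1)) - (J dab - (au * J db + bu * J da))"
      unfolding ito_error_def p00 ea_def eb_def
      unfolding p0 au_def[symmetric] bu_def[symmetric] av_def[symmetric] bv_def[symmetric] a1_def[symmetric] b1_def[symmetric]
        a2_def[symmetric] b2_def[symmetric] da_def[symmetric] db_def[symmetric] dab_def[symmetric] w_def[symmetric] J_def[symmetric]
      by (simp add: algebra_simps)
    also have "norm \<dots> \<le> norm (au * eb) + norm (bu * ea) + norm ((av - au) * (bv - bu) - of_real (\<sigma>\<^sup>2 * w\<^sup>2) * (a1 * b1))
        + norm (J dab - (au * J db + bu * J da))"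
      by (intro order_trans[OF norm_triangle_ineq4] add_right_mono norm_triangle_le add_mono order_refl)
    also have "\<dots> \<le> Ma * (C2 * e * \<Theta>) + Mb * (C1 * e * \<Theta>) + (\<bar>\<sigma>\<bar> * Ma1 * Rb + Ra * Lb) * e * \<Theta> + (La * D2 + Lb * D1) * e * \<Theta>"
    proof (intro add_mono cross Jint)
      show "norm (au * eb) \<le> Ma * (C2 * e * \<Theta>)"
        unfolding norm_mult using Mab eb by (intro mult_mono) (auto simp: au_def intro: Mab(2)[OF step *(6)])
      show "norm (bu * ea) \<le> Mb * (C1 * e * \<Theta>)"
        unfolding norm_mult using Mab ea by (intro mult_mono) (auto simp: bu_def intro: Mab(4)[OF step *(6)])
    qed
    also have "\<dots> = C * e * \<Theta>" by (simp add: C_def algebra_simps)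
    finally show "norm (ito_error I \<sigma> (\<lambda>s. a s * b s) q W S d u v) \<le> C * e * ((W v - W u)\<^sup>2 + (q v - q u))"
      by (simp add: \<Theta>_def w_def)
  qed
qed

text \<open>If the generator vanishes along the path, the drift integral is - \<sigma>^2/2 times the
  integral of the second derivative. Freezing the latter at u turns (\<Delta>W)^2 into (\<Delta>W)^2
  - \<Delta>q, so that only martingale increments remain.\<close>

lemma ito_expansion_driftless:
  assumes I: "finite I" and p: "p \<in> polyfun I" and E: "0 \<le> E"
  shows "\<exists>C\<ge>0. \<forall>q W S d u v e. ito_step I \<sigma> B E q W S d u v e \<longrightarrow>
    (\<forall>r\<in>{u<..<v}. of_real (\<sigma>\<^sup>2 / 2) * pdiff 0 (pdiff 0 p) (cstate S r) + drift I p S d r = 0) \<longrightarrow>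
    norm (p (cstate S v) - p (cstate S u) - of_real (W v - W u) * (of_real \<sigma> * pdiff 0 p (cstate S u))
       - of_real ((W v - W u)\<^sup>2 - (q v - q u)) * (of_real (\<sigma>\<^sup>2 / 2) * pdiff 0 (pdiff 0 p) (cstate S u)))
     \<le> C * e * ((W v - W u)\<^sup>2 + (q v - q u))"
proof -
  define p2 where "p2 = pdiff 0 (pdiff 0 p)"
  have p2: "p2 \<in> polyfun I" unfolding p2_def by (intro pdiff_polyfun p)
  obtain C1 where C1: "C1 \<ge> 0" "\<And>q W S d u v e. ito_step I \<sigma> B E q W S d u v e \<Longrightarrow>
      norm (ito_error I \<sigma> p q W S d u v) \<le> C1 * e * ((W v - W u)\<^sup>2 + (q v - q u))"
    using ito_expansion[OF I p E, where \<sigma> = \<sigma> and B = B] by blast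
  obtain C2 where C2: "C2 \<ge> 0" "\<And>q W S d u v e r. ito_step I \<sigma> B E q W S d u v e \<Longrightarrow> r \<in> {u..v} \<Longrightarrow>
      norm (p2 (cstate S r) - p2 (cstate S u)) \<le> C2 * e"
    using ito_step_lipschitz[OF p2, where \<sigma> = \<sigma> and B = B and E = E] by blast
  show ?thesis
  proof (intro exI[of _ "C1 + \<sigma>\<^sup>2 / 2 * C2"] conjI allI impI)
    fix q W S d u v e assume step: "ito_step I \<sigma> B E q W S d u v e"
      and zero: "\<forall>r\<in>{u<..<v}. of_real (\<sigma>\<^sup>2 / 2) * pdiff 0 (pdiff 0 p) (cstate S r) + drift I p S d r = 0"
    interpret clock_path q using step by (simp add: ito_step_def)
    have *: "0 \<le> u" "u \<le> v" "0 \<le> e" using step by (auto simp: ito_step_def)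
    define k where "k = complex_of_real (\<sigma>\<^sup>2 / 2)"
    have norm_k: "norm k = \<sigma>\<^sup>2 / 2" by (simp add: k_def norm_divide norm_power)
    have Q: "0 \<le> q v - q u" using q_le[of u v] * by simp
    have open_eq: "(LINT r:{u<..v}|stieltjes q. f r) = (LINT r:{u<..<v}|stieltjes q. f r)" for f :: "real \<Rightarrow> complex"
      using * by (intro set_integral_discrete_difference[of "{v}"]) (auto simp: stieltjes_point)
    have "(LINT r:{u<..v}|stieltjes q. drift I p S d r) = (LINT r:{u<..<v}|stieltjes q. - (k * p2 (cstate S r)))"
      unfolding open_eq using zero
      by (intro set_lebesgue_integral_cong) (auto simp: k_def p2_def eq_neg_iff_add_eq_0 add.commute)
    also have "\<dots> = (LINT r:{u<..v}|stieltjes q. - (k * p2 (cstate S r)))" by (rule open_eq[symmetric])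
    finally have dr: "(LINT r:{u<..v}|stieltjes q. drift I p S d r) = (LINT r:{u<..v}|stieltjes q. - (k * p2 (cstate S r)))" .
    have cont: "continuous_on {u..v} (\<lambda>r. p2 (cstate S r))" by (rule ito_step_continuous[OF p2 step])
    obtain M where M: "\<forall>r\<in>{u..v}. norm (p2 (cstate S r)) \<le> M"
      using compact_imp_bounded[OF compact_continuous_image[OF cont compact_Icc]] by (auto simp: bounded_iff)
    have i1: "set_integrable (stieltjes q) {u<..v} (\<lambda>r. p2 (cstate S r))"
      using * M by (intro stieltjes_set_integrable[of _ v _ M] continuous_set_borel_measurable continuous_on_subset[OF cont]) auto
    have i0: "set_integrable (stieltjes q) {u<..v} (\<lambda>r. p2 (cstate S u))"
      using * by (intro stieltjes_set_integrable[of _ v _ "norm (p2 (cstate S u))"] continuous_set_borel_measurable continuous_intros) auto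
    have const: "(LINT r:{u<..v}|stieltjes q. p2 (cstate S u)) = of_real (q v - q u) * p2 (cstate S u)"
    proof -
      have "(LINT r:{u<..v}|stieltjes q. p2 (cstate S u)) = measure (stieltjes q) {u<..v} *\<^sub>R p2 (cstate S u)"
        unfolding set_lebesgue_integral_def
      proof (intro has_bochner_integral_integral_eq has_bochner_integral_indicator)
        have "{u<..v} \<subseteq> {0..v}" using * by auto
        then show "emeasure (stieltjes q) {u<..v} < \<infinity>" by (rule stieltjes_subset_finite) simp
      qed simp
      then show ?thesis using * by (simp add: measure_stieltjes_Ioc scaleR_conv_of_real)
    qed
    have "(LINT r:{u<..v}|stieltjes q. drift I p S d r) + k * (of_real (q v - q u) * p2 (cstate S u))
        = - k * (LINT r:{u<..v}|stieltjes q. p2 (cstate S r) - p2 (cstate S u))"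
      unfolding dr set_integral_diff(2)[OF i1 i0] const by (simp add: set_integral_uminus set_integrable_mult_right i1 algebra_simps)
    then have "norm ((LINT r:{u<..v}|stieltjes q. drift I p S d r) + k * (of_real (q v - q u) * p2 (cstate S u)))
        = \<sigma>\<^sup>2 / 2 * norm (LINT r:{u<..v}|stieltjes q. p2 (cstate S r) - p2 (cstate S u))"
      by (simp only: norm_mult norm_minus_cancel norm_k mult_minus_left)
    also have "\<dots> \<le> \<sigma>\<^sup>2 / 2 * (C2 * e * (q v - q u))"
      using * C2 step by (intro mult_left_mono stieltjes_integral_bound) (auto intro!: C2(2)[OF step])
    also have "\<dots> \<le> \<sigma>\<^sup>2 / 2 * (C2 * e * ((W v - W u)\<^sup>2 + (q v - q u)))"
      using *(3) C2(1) by (intro mult_left_mono) auto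
    finally have dbd: "norm ((LINT r:{u<..v}|stieltjes q. drift I p S d r) + k * (of_real (q v - q u) * p2 (cstate S u)))
        \<le> \<sigma>\<^sup>2 / 2 * C2 * e * ((W v - W u)\<^sup>2 + (q v - q u))" by (simp add: mult.assoc)
    have "p (cstate S v) - p (cstate S u) - of_real (W v - W u) * (of_real \<sigma> * pdiff 0 p (cstate S u))
       - of_real ((W v - W u)\<^sup>2 - (q v - q u)) * (of_real (\<sigma>\<^sup>2 / 2) * pdiff 0 (pdiff 0 p) (cstate S u))
      = ito_error I \<sigma> p q W S d u v + ((LINT r:{u<..v}|stieltjes q. drift I p S d r) + k * (of_real (q v - q u) * p2 (cstate S u)))"
    proof -
      have e: "of_real (\<sigma> * (W v - W u)) = of_real (W v - W u) * complex_of_real \<sigma>"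
        "complex_of_real (\<sigma>\<^sup>2 / 2 * (W v - W u)\<^sup>2) = k * of_real ((W v - W u)\<^sup>2)"
        "complex_of_real ((W v - W u)\<^sup>2 - (q v - q u)) = of_real ((W v - W u)\<^sup>2) - of_real (q v - q u)"
        by (simp_all add: k_def)
      have alg: "x - y - w * (s * p1) - (w2 - Q) * (k * p2) = (x - y - w * s * p1 - k * w2 * p2 - J) + (J + k * (Q * p2))"
        for x y w s p1 w2 Q p2 J :: complex
        by (simp add: algebra_simps)
      show ?thesis
        unfolding ito_error_def e p2_def[symmetric] k_def[symmetric] by (rule alg)
    qed
    also have "norm \<dots> \<le> C1 * e * ((W v - W u)\<^sup>2 + (q v - q u)) + \<sigma>\<^sup>2 / 2 * C2 * e * ((W v - W u)\<^sup>2 + (q v - q u))"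
      by (intro norm_triangle_le add_mono C1(2)[OF step] dbd)
    finally show "norm (p (cstate S v) - p (cstate S u) - of_real (W v - W u) * (of_real \<sigma> * pdiff 0 p (cstate S u))
       - of_real ((W v - W u)\<^sup>2 - (q v - q u)) * (of_real (\<sigma>\<^sup>2 / 2) * pdiff 0 (pdiff 0 p) (cstate S u)))
     \<le> (C1 + \<sigma>\<^sup>2 / 2 * C2) * e * ((W v - W u)\<^sup>2 + (q v - q u))"
      by (simp add: algebra_simps)
  qed (use C1 C2 in auto)
qed

section \<open>Exit times and the stopped clock\<close>

text \<open>Inserting \<tau> gives the value \<tau> if the level is never reached. Such paths are
  not stopped before \<tau>, so whatever is evaluated at the exit time has to make sense
  there.\<close>

definition exit_time :: "('a \<Rightarrow> ennreal) \<Rightarrow> (real \<Rightarrow> 'a \<Rightarrow> real) \<Rightarrow> nat \<Rightarrow> 'a \<Rightarrow> ennreal" where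
  "exit_time \<tau> \<Phi> n w = Inf (insert (\<tau> w) {ennreal t |t. 0 \<le> t \<and> ennreal t < \<tau> w \<and> real n \<le> \<Phi> t w})"

lemma exit_time_le: "exit_time \<tau> \<Phi> n w \<le> \<tau> w"
  unfolding exit_time_def by (rule Inf_lower) simp

lemma exit_time_before:
  assumes "0 \<le> t" "ennreal t < exit_time \<tau> \<Phi> n w"
  shows "ennreal t < \<tau> w" "\<Phi> t w < real n"
proof -
  show *: "ennreal t < \<tau> w" by (rule order_less_le_trans[OF assms(2) exit_time_le])
  show "\<Phi> t w < real n"
  proof (rule ccontr)
    assume "\<not> \<Phi> t w < real n"
    then have "exit_time \<tau> \<Phi> n w \<le> ennreal t"
      unfolding exit_time_def using assms(1) * by (intro Inf_lower) auto
    then show False using assms(2) by simp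
  qed
qed

lemma exit_time_ge:
  assumes "\<And>r. 0 \<le> r \<Longrightarrow> r < t \<Longrightarrow> ennreal r < \<tau> w \<Longrightarrow> \<Phi> r w < real n" "ennreal t \<le> \<tau> w"
  shows "ennreal t \<le> exit_time \<tau> \<Phi> n w"
  unfolding exit_time_def
proof (rule Inf_greatest)
  fix a assume "a \<in> insert (\<tau> w) {ennreal t |t. 0 \<le> t \<and> ennreal t < \<tau> w \<and> real n \<le> \<Phi> t w}"
  then consider "a = \<tau> w" | r where "a = ennreal r" "0 \<le> r" "ennreal r < \<tau> w" "real n \<le> \<Phi> r w" by auto
  then show "ennreal t \<le> a"
  proof cases
    case 2
    then have "\<not> r < t" using assms(1)[of r] by auto
    then show ?thesis using 2 by (auto intro: ennreal_leI)
  qed (use assms in auto)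
qed

lemma exit_time_incseq: "incseq (\<lambda>n. exit_time \<tau> \<Phi> n w)"
  unfolding exit_time_def incseq_def by (intro allI impI Inf_superset_mono) force

text \<open>On [0, t] with t < \<tau> the level is bounded by compactness, so for large n the exit
  time is at least t.\<close>

lemma exit_time_tendsto:
  assumes "continuous_on {t. 0 \<le> t \<and> ennreal t < \<tau> w} (\<lambda>t. \<Phi> t w)"
  shows "(\<lambda>n. exit_time \<tau> \<Phi> n w) \<longlonglongrightarrow> \<tau> w"
proof (rule order_tendstoI)
  fix a assume "a < \<tau> w"
  then obtain z where z: "a < z" "z < \<tau> w" using dense by blast
  then obtain t where t: "z = ennreal t" "0 \<le> t" by (cases z) auto
  have "{0..t} \<subseteq> {t. 0 \<le> t \<and> ennreal t < \<tau> w}"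
    using z(2) t by (auto intro: order_le_less_trans[OF ennreal_leI])
  then have "continuous_on {0..t} (\<lambda>t. \<Phi> t w)" by (rule continuous_on_subset[OF assms])
  from compact_imp_bounded[OF compact_continuous_image[OF this compact_Icc]]
  obtain C where C: "\<And>r. r \<in> {0..t} \<Longrightarrow> norm (\<Phi> r w) \<le> C" unfolding bounded_iff by blast
  obtain m where m: "C < real m" using reals_Archimedean2 by blast
  show "\<forall>\<^sub>F n in sequentially. a < exit_time \<tau> \<Phi> n w"
  proof (rule eventually_sequentiallyI)
    fix n assume n: "m \<le> n"
    have "ennreal t \<le> exit_time \<tau> \<Phi> n w"
    proof (rule exit_time_ge)
      fix r assume "0 \<le> r" "r < t"
      then show "\<Phi> r w < real n" using C[of r] m n by auto
    qed (use z t in auto)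
    then show "a < exit_time \<tau> \<Phi> n w" using z t by auto
  qed
next
  fix a assume "\<tau> w < a"
  then show "\<forall>\<^sub>F n in sequentially. exit_time \<tau> \<Phi> n w < a"
    by (intro always_eventually allI order_le_less_trans[OF exit_time_le])
qed

text \<open>By continuity the level is attained, so that the event is decided at time \<open>t\<close> and not just after it.\<close>

lemma exit_time_le_iff:
  assumes cont: "continuous_on {t. 0 \<le> t \<and> ennreal t < \<tau> w} (\<lambda>t. \<Phi> t w)" and t: "0 \<le> t" and \<tau>: "ennreal t < \<tau> w"
  shows "exit_time \<tau> \<Phi> n w \<le> ennreal t \<longleftrightarrow> (\<exists>s\<in>{0..t}. real n \<le> \<Phi> s w)"
proof
  assume "\<exists>s\<in>{0..t}. real n \<le> \<Phi> s w"
  then obtain s where s: "s \<in> {0..t}" "real n \<le> \<Phi> s w" by blast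
  then have "ennreal s \<le> ennreal t" by (auto intro: ennreal_leI)
  moreover have "exit_time \<tau> \<Phi> n w \<le> ennreal s"
    unfolding exit_time_def using s order_le_less_trans[OF \<open>ennreal s \<le> ennreal t\<close> \<tau>] by (intro Inf_lower) auto
  ultimately show "exit_time \<tau> \<Phi> n w \<le> ennreal t" by simp
next
  assume le: "exit_time \<tau> \<Phi> n w \<le> ennreal t"
  show "\<exists>s\<in>{0..t}. real n \<le> \<Phi> s w"
  proof (rule ccontr)
    assume "\<not> ?thesis"
    then have lt: "\<Phi> s w < real n" if "s \<in> {0..t}" for s by (meson not_le that)
    define J where "J = {t. 0 \<le> t \<and> ennreal t < \<tau> w}"
    have "t \<in> J" using t \<tau> by (simp add: J_def)
    have "((\<lambda>t. \<Phi> t w) \<longlongrightarrow> \<Phi> t w) (at t within J)"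
      using cont \<open>t \<in> J\<close> by (auto simp: continuous_on_def J_def)
    then have "eventually (\<lambda>s. \<Phi> s w < real n) (at t within J)"
      using lt[of t] t by (intro order_tendstoD) auto
    then obtain d where d: "d > 0" "\<And>s. s \<in> J \<Longrightarrow> s \<noteq> t \<Longrightarrow> dist s t < d \<Longrightarrow> \<Phi> s w < real n"
      unfolding eventually_at by blast
    obtain z where z: "ennreal t < z" "z < \<tau> w" using dense[OF \<tau>] by blast
    then obtain z' where z': "z = ennreal z'" "0 \<le> z'" by (cases z) auto
    define u where "u = min (t + d) z'"
    have tz: "t < z'" using z z' t by (simp add: ennreal_less_iff)
    have "ennreal u \<le> z" unfolding z' u_def by (rule ennreal_leI) simp
    have "ennreal u \<le> exit_time \<tau> \<Phi> n w"
    proof (rule exit_time_ge)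
      fix r assume r: "0 \<le> r" "r < u" "ennreal r < \<tau> w"
      show "\<Phi> r w < real n"
      proof (cases "r \<le> t")
        case True
        then show ?thesis using lt r by auto
      next
        case False
        then show ?thesis using r by (intro d) (auto simp: J_def dist_real_def u_def)
      qed
    qed (use \<open>ennreal u \<le> z\<close> z in auto)
    then have "ennreal u \<le> ennreal t" using le by simp
    moreover have "ennreal t < ennreal u" using tz d(1) t by (simp add: ennreal_less_iff u_def)
    ultimately show False by simp
  qed
qed

context filtered_prob
begin

text \<open>While \<tau> > t, the event says that the maximum of the level on [0, t] reaches n. Its
  complement has a countable description: on a countable dense set the level stays below n by some 1
  / (j + 1).\<close>

lemma stopping_time_exit_time:
  assumes \<tau>: "stopping_time F \<tau>" and \<Phi>: "\<And>t. t \<ge> 0 \<Longrightarrow> \<Phi> t \<in> borel_measurable (F (ennreal t))"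
    and cont: "\<And>w. w \<in> space P \<Longrightarrow> continuous_on {t. 0 \<le> t \<and> ennreal t < \<tau> w} (\<lambda>t. \<Phi> t w)"
  shows "stopping_time F (exit_time \<tau> \<Phi> n)"
  unfolding stopping_time_def
proof
  fix a :: ennreal
  show "Measurable.pred (F a) (\<lambda>w. exit_time \<tau> \<Phi> n w \<le> a)"
  proof (cases a)
    case (real t)
    obtain D where D: "countable D" "D \<subseteq> {0..t}" "{0..t} \<subseteq> closure D" using separable by blast
    have clD: "closure D = {0..t}" using D closure_minimal[OF D(2)] by auto
    have [measurable]: "\<Phi> s \<in> borel_measurable (F a)" if "s \<in> D" for s
      by (rule measurable_F_mono[OF \<Phi>]) (use that D(2) real in \<open>auto intro: ennreal_leI\<close>)
    have [measurable]: "Measurable.pred (F a) (\<lambda>w. \<tau> w \<le> a)" using \<tau> by (simp add: stopping_time_def)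
    have eq: "exit_time \<tau> \<Phi> n w \<le> a \<longleftrightarrow> \<tau> w \<le> a \<or> \<not> (\<exists>j. \<forall>s\<in>D. \<Phi> s w \<le> real n - 1 / real (Suc j))"
      if w: "w \<in> space (F a)" for w
    proof (cases "\<tau> w \<le> a")
      case True
      then show ?thesis using order_trans[OF exit_time_le[of \<tau> \<Phi> n w] True] by simp
    next
      case False
      have w: "w \<in> space P" using w by (simp add: space_F)
      have lt: "ennreal t < \<tau> w" using False real by simp
      have sub: "{0..t} \<subseteq> {t. 0 \<le> t \<and> ennreal t < \<tau> w}"
        using lt by (auto intro: order_le_less_trans[OF ennreal_leI])
      have cont': "continuous_on {0..t} (\<lambda>t. \<Phi> t w)" by (rule continuous_on_subset[OF cont[OF w] sub])
      have "(\<exists>s\<in>{0..t}. real n \<le> \<Phi> s w) \<longleftrightarrow> \<not> (\<exists>j. \<forall>s\<in>D. \<Phi> s w \<le> real n - 1 / real (Suc j))"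
      proof
        assume "\<exists>s\<in>{0..t}. real n \<le> \<Phi> s w"
        then obtain s where s: "s \<in> {0..t}" "real n \<le> \<Phi> s w" by blast
        show "\<not> (\<exists>j. \<forall>s\<in>D. \<Phi> s w \<le> real n - 1 / real (Suc j))"
        proof
          assume "\<exists>j. \<forall>s\<in>D. \<Phi> s w \<le> real n - 1 / real (Suc j)"
          then obtain j where j: "\<forall>s\<in>D. \<Phi> s w \<le> real n - 1 / real (Suc j)" ..
          have "\<Phi> s w \<le> real n - 1 / real (Suc j)"
          proof (rule continuous_le_on_closure[where S = D and f = "\<lambda>s. \<Phi> s w"])
            show "continuous_on (closure D) (\<lambda>s. \<Phi> s w)" unfolding clD by (rule cont')
            show "s \<in> closure D" unfolding clD by (rule s(1))
          qed (rule bspec[OF j])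
          moreover have "1 / real (Suc j) > 0" by (rule divide_pos_pos) simp_all
          ultimately show False using s(2) by linarith
        qed
      next
        assume no: "\<not> (\<exists>j. \<forall>s\<in>D. \<Phi> s w \<le> real n - 1 / real (Suc j))"
        obtain m where m: "m \<in> {0..t}" "\<And>s. s \<in> {0..t} \<Longrightarrow> \<Phi> s w \<le> \<Phi> m w"
          using continuous_attains_sup[OF compact_Icc _ cont'] real by auto
        have "real n \<le> \<Phi> m w"
        proof (rule ccontr)
          assume "\<not> real n \<le> \<Phi> m w"
          then obtain j where j: "1 / real (Suc j) < real n - \<Phi> m w" using nat_approx_posE[of "real n - \<Phi> m w"] by auto
          have "\<forall>s\<in>D. \<Phi> s w \<le> real n - 1 / real (Suc j)"
          proof
            fix s assume "s \<in> D"
            then have "\<Phi> s w \<le> \<Phi> m w" using D(2) by (intro m(2)) auto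
            then show "\<Phi> s w \<le> real n - 1 / real (Suc j)" using j by linarith
          qed
          then show False using no by (auto intro: exI[of _ j])
        qed
        then show "\<exists>s\<in>{0..t}. real n \<le> \<Phi> s w" using m(1) by blast
      qed
      then show ?thesis
        using exit_time_le_iff[where \<tau> = \<tau> and \<Phi> = \<Phi> and w = w and t = t and n = n, OF cont[OF w] _ lt] False real by simp
    qed
    have "Measurable.pred (F a) (\<lambda>w. \<tau> w \<le> a \<or> \<not> (\<exists>j. \<forall>s\<in>D. \<Phi> s w \<le> real n - 1 / real (Suc j)))"
      using D(1) by measurable
    then show ?thesis by (subst measurable_cong[OF eq]) auto
  next
    case top
    then show ?thesis by simp
  qed
qed

end

section \<open>Stopping processes that are bounded before the stopping time\<close>

text \<open>Bounds that hold strictly before T extend to T by continuity; T > 0 ensures that there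
  is a time before T.\<close>

lemma stop_le_bound:
  assumes f: "continuous_on {0..} f" and T: "0 < T" and bd: "\<And>r. 0 \<le> r \<Longrightarrow> ennreal r < T \<Longrightarrow> f r \<le> (c::real)" and t: "0 \<le> t"
  shows "f (stop T t) \<le> c"
proof (cases "stop T t = 0")
  case True
  then show ?thesis using bd[of 0] T by simp
next
  case False
  then have pos: "0 < stop T t" using stop_bounds(1)[of T t] by simp
  have cl: "closure {0..<stop T t} = {0..stop T t}" using pos by (simp add: closure_atLeastLessThan)
  have bd': "f r \<le> c" if "r \<in> {0..<stop T t}" for r
  proof (rule bd)
    have "ennreal r < ennreal (stop T t)" using that by (intro ennreal_lessI) auto
    then show "ennreal r < T" by (rule order_less_le_trans[OF _ stop_le])
  qed (use that in auto)
  show ?thesis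
  proof (rule continuous_le_on_closure[where S = "{0..<stop T t}" and f = f])
    show "continuous_on (closure {0..<stop T t}) f"
      unfolding cl by (rule continuous_on_subset[OF f]) simp
    show "stop T t \<in> closure {0..<stop T t}" unfolding cl using pos by simp
  qed (rule bd')
qed

lemma stop_abs_bound:
  assumes f: "continuous_on {0..} f" and T: "0 < T" and bd: "\<And>r. 0 \<le> r \<Longrightarrow> ennreal r < T \<Longrightarrow> \<bar>f r\<bar> \<le> (c::real)" and t: "0 \<le> t"
  shows "\<bar>f (stop T t)\<bar> \<le> c"
  using stop_le_bound[OF continuous_on_rabs[OF f] T bd t] .

lemma stop_eq:
  assumes f: "continuous_on {0..} f" "continuous_on {0..} g" and T: "0 < T"
    and eq: "\<And>r. 0 \<le> r \<Longrightarrow> ennreal r < T \<Longrightarrow> f r = (g r :: real)" and t: "0 \<le> t"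
  shows "f (stop T t) = g (stop T t)"
  using stop_abs_bound[OF continuous_on_diff[OF f] T _ t, of 0] eq by simp

context filtered_prob
begin

lemma stopped_martingale_increment:
  assumes N: "martingale P F N" and cont: "\<And>w. w \<in> space P \<Longrightarrow> continuous_on {0..} (\<lambda>t. N t w)"
    and T: "stopping_time F T" and st: "0 \<le> s" "s \<le> t"
    and bd: "\<And>w r. w \<in> space P \<Longrightarrow> 0 \<le> r \<Longrightarrow> ennreal r < T w \<Longrightarrow> \<bar>N r w\<bar> \<le> c" and c: "0 \<le> c"
    and H: "H \<in> borel_measurable (F (ennreal s))" "\<And>w. w \<in> space P \<Longrightarrow> \<bar>H w\<bar> \<le> h"
  shows "(LINT w|P. H w * (N (stop (T w) t) w - N (stop (T w) s) w)) = 0"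
proof (rule optional_stopping_bounded[OF N _ T st H c])
  have NF: "\<And>t. t \<ge> 0 \<Longrightarrow> N t \<in> borel_measurable (F (ennreal t))" using N by (auto simp: martingale_def)
  show "AE w in P. continuous_on {0..} (\<lambda>t. N t w)" using cont by (auto intro!: AE_I2)
  show "AE w in P. ennreal s < T w \<longrightarrow> \<bar>N (stop (T w) t) w\<bar> \<le> c"
  proof (intro AE_I2 impI)
    fix w assume w: "w \<in> space P" and "ennreal s < T w"
    then have "0 < T w" using st by (auto intro: order_le_less_trans)
    then show "\<bar>N (stop (T w) t) w\<bar> \<le> c"
      using st by (intro stop_abs_bound[where f = "\<lambda>t. N t w"] cont[OF w] bd[OF w]) auto
  qed
  show "(\<lambda>w. N (stop (T w) t) w - N (stop (T w) s) w) \<in> borel_measurable P"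
    using st by (intro borel_measurable_diff measurable_F_P[OF stopped_adapted[OF T NF cont]]) auto
  show "AE w in P. N (stop (T w) t) w - N (stop (T w) s) w = (if ennreal s < T w then N (stop (T w) t) w - N s w else 0)"
    using st by (intro AE_I2) (auto simp: stop_before not_less dest!: stop_after[OF _ st])
qed

text \<open>Localise further by the minimum of T and U k, up to which the local martingale is a true
  one, and let k tend to infinity; the bound before T dominates the increments.\<close>

lemma stopped_local_martingale_increment:
  assumes R: "local_martingale_on P F (\<lambda>_. \<infinity>) R" and RF: "\<And>t. t \<ge> 0 \<Longrightarrow> R t \<in> borel_measurable (F (ennreal t))"
    and cont: "\<And>w. w \<in> space P \<Longrightarrow> continuous_on {0..} (\<lambda>t. R t w)"
    and T: "stopping_time F T" and st: "0 \<le> s" "s \<le> t"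
    and bd: "\<And>w r. w \<in> space P \<Longrightarrow> 0 \<le> r \<Longrightarrow> ennreal r < T w \<Longrightarrow> \<bar>R r w\<bar> \<le> c" and c: "0 \<le> c"
    and H: "H \<in> borel_measurable (F (ennreal s))" "\<And>w. w \<in> space P \<Longrightarrow> \<bar>H w\<bar> \<le> h"
  shows "(LINT w|P. H w * (R (stop (T w) t) w - R (stop (T w) s) w)) = 0"
proof -
  have t: "0 \<le> t" using st by simp
  obtain U N where U: "\<And>k. stopping_time F (U k)" and Ulim: "AE w in P. incseq (\<lambda>k. U k w) \<and> (\<lambda>k. U k w) \<longlonglongrightarrow> \<infinity>"
    and N: "\<And>k::nat. martingale P F (N k)" and Ncont: "\<And>k. AE w in P. continuous_on {0..} (\<lambda>t. N k t w)"
    and NR: "\<And>k. AE w in P. \<forall>t\<ge>0. ennreal t < U k w \<longrightarrow> R t w = N k t w"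
    using R unfolding local_martingale_on_def by blast
  define V where "V = (\<lambda>k w. min (T w) (U k w))"
  have V: "stopping_time F (V k)" for k unfolding V_def by (rule stopping_time_min[OF T U])
  define D where "D = (\<lambda>k w. R (stop (V k w) t) w - R (stop (V k w) s) w)"
  have RV: "\<bar>R (stop (V k w) r) w\<bar> \<le> c" if "w \<in> space P" "0 < T w" "0 \<le> r" for k w r
  proof (cases "0 < V k w")
    case True
    then show ?thesis
      using that by (intro stop_abs_bound[where f = "\<lambda>t. R t w"] cont bd) (auto simp: V_def)
  next
    case False
    then show ?thesis using bd[OF that(1), of 0] that by (simp add: stop_def)
  qed
  have Dbd: "\<bar>D k w\<bar> \<le> 2 * c" if "w \<in> space P" for k w
  proof (cases "0 < T w")
    case True
    then show ?thesis using RV[OF that True t, of k] RV[OF that True st(1), of k] by (simp add: D_def)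
  next
    case False
    then show ?thesis using c by (simp add: D_def V_def stop_def)
  qed
  have Dm[measurable]: "D k \<in> borel_measurable P" for k
    unfolding D_def using st t by (intro borel_measurable_diff measurable_F_P[OF stopped_adapted[OF V RF cont]]) auto
  have zero: "(LINT w|P. H w * D k w) = 0" for k
  proof (rule optional_stopping_bounded[OF N Ncont V st H c _ Dm])
    have *: "AE w in P. ennreal s < V k w \<longrightarrow> N k (stop (V k w) t) w = R (stop (V k w) t) w \<and> N k s w = R s w"
      using Ncont[of k] NR[of k] AE_space
    proof eventually_elim
      case (elim w)
      show ?case
      proof (intro impI conjI)
        assume sV: "ennreal s < V k w"
        then have "0 < V k w" by (auto intro: order_le_less_trans)
        then show "N k (stop (V k w) t) w = R (stop (V k w) t) w"
          using elim t by (intro stop_eq[where f = "\<lambda>t. N k t w" and g = "\<lambda>t. R t w"] cont) (auto simp: V_def)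
        show "N k s w = R s w" using elim st sV by (auto simp: V_def)
      qed
    qed
    show "AE w in P. ennreal s < V k w \<longrightarrow> \<bar>N k (stop (V k w) t) w\<bar> \<le> c"
      using * AE_space
    proof eventually_elim
      case (elim w)
      show ?case
      proof
        assume sV: "ennreal s < V k w"
        then have "0 < T w" by (auto intro: order_le_less_trans simp: V_def)
        then show "\<bar>N k (stop (V k w) t) w\<bar> \<le> c" using elim sV RV[of w t k] t by simp
      qed
    qed
    show "AE w in P. D k w = (if ennreal s < V k w then N k (stop (V k w) t) w - N k s w else 0)"
      using *
    proof eventually_elim
      case (elim w)
      then show ?case using st by (auto simp: D_def stop_before not_less dest!: stop_after[OF _ st])
    qed
  qed
  have HP[measurable]: "H \<in> borel_measurable P" by (rule measurable_F_P[OF H(1)])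
  have Rm[measurable]: "(\<lambda>w. R (stop (T w) t) w - R (stop (T w) s) w) \<in> borel_measurable P"
    using st t by (intro borel_measurable_diff measurable_F_P[OF stopped_adapted[OF T RF cont]]) auto
  have "(\<lambda>k. LINT w|P. H w * D k w) \<longlonglongrightarrow> (LINT w|P. H w * (R (stop (T w) t) w - R (stop (T w) s) w))"
  proof (rule integral_dominated_convergence[where w = "\<lambda>_. h * (2 * c)"])
    show "AE w in P. (\<lambda>k. H w * D k w) \<longlonglongrightarrow> H w * (R (stop (T w) t) w - R (stop (T w) s) w)"
      using Ulim
    proof eventually_elim
      case (elim w)
      then have "eventually (\<lambda>k. ennreal t < U k w) sequentially" by (auto intro: order_tendstoD)
      then have "eventually (\<lambda>k. H w * (R (stop (T w) t) w - R (stop (T w) s) w) = H w * D k w) sequentially"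
      proof eventually_elim
        case (elim k)
        have "min (U k w) (ennreal r) = ennreal r" if "r \<le> t" for r
          using elim ennreal_leI[OF that] by (intro min_absorb2) (meson less_imp_le order_trans)
        then have "stop (V k w) r = stop (T w) r" if "r \<le> t" for r
          using that by (simp add: stop_def V_def min.assoc)
        then show ?case using st by (simp add: D_def)
      qed
      then show ?case by (rule Lim_transform_eventually[OF tendsto_const])
    qed
    show "AE w in P. norm (H w * D k w) \<le> h * (2 * c)" for k
    proof (rule AE_I2)
      fix w assume w: "w \<in> space P"
      show "norm (H w * D k w) \<le> h * (2 * c)"
        unfolding real_norm_def abs_mult
        by (intro mult_mono H(2)[OF w] Dbd[OF w] abs_ge_zero order_trans[OF abs_ge_zero H(2)[OF w]])
    qed
  qed auto
  then show ?thesis by (simp add: zero LIMSEQ_const_iff)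
qed

text \<open>A 0 is subtracted because it need not be bounded: where T = 0 the difference vanishes,
  and elsewhere the bound before T includes time 0.\<close>

lemma stopped_ito_clock:
  assumes A: "martingale P F A" and Acont: "\<And>w. w \<in> space P \<Longrightarrow> continuous_on {0..} (\<lambda>t. A t w)"
    and Q: "quadratic_variation P F A Q" and T: "stopping_time F T" and n: "0 \<le> n"
    and bdA: "\<And>w r. w \<in> space P \<Longrightarrow> 0 \<le> r \<Longrightarrow> ennreal r < T w \<Longrightarrow> \<bar>A r w\<bar> \<le> n"
    and bdQ: "\<And>w r. w \<in> space P \<Longrightarrow> 0 \<le> r \<Longrightarrow> ennreal r < T w \<Longrightarrow> Q r w \<le> n"
  shows "ito_clock P F (\<lambda>t w. A (stop (T w) t) w - A 0 w) (\<lambda>t w. Q (stop (T w) t) w) (2 * n)"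
proof
  have QF: "\<And>t. t \<ge> 0 \<Longrightarrow> Q t \<in> borel_measurable (F (ennreal t))"
    and Qcont: "\<And>w. w \<in> space P \<Longrightarrow> continuous_on {0..} (\<lambda>t. Q t w)"
    and Q0: "\<And>w. w \<in> space P \<Longrightarrow> Q 0 w = 0" and Qmono: "\<And>w. w \<in> space P \<Longrightarrow> mono_on {0..} (\<lambda>t. Q t w)"
    and Qloc: "local_martingale_on P F (\<lambda>_. \<infinity>) (\<lambda>t w. (A t w)\<^sup>2 - Q t w)"
    using Q by (auto simp: quadratic_variation_def)
  have AF: "\<And>t. t \<ge> 0 \<Longrightarrow> A t \<in> borel_measurable (F (ennreal t))" using A by (auto simp: martingale_def)
  have A0: "A 0 \<in> borel_measurable (F (ennreal t))" if "0 \<le> t" for t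
    by (rule measurable_F_mono[OF AF]) (use that in \<open>auto intro: ennreal_leI\<close>)
  note stop_cont = stop_continuous_on
  show "(\<lambda>w. A (stop (T w) t) w - A 0 w) \<in> borel_measurable (F (ennreal t))" if "0 \<le> t" for t
    by (intro borel_measurable_diff stopped_adapted[OF T AF Acont that] A0[OF that])
  show "(\<lambda>w. Q (stop (T w) t) w) \<in> borel_measurable (F (ennreal t))" if "0 \<le> t" for t
    by (rule stopped_adapted[OF T QF Qcont that])
  show "continuous_on {0..} (\<lambda>t. A (stop (T w) t) w - A 0 w)" if "w \<in> space P" for w
    by (intro continuous_intros continuous_on_compose2[OF Acont[OF that] stop_cont]) (auto simp: stop_bounds)
  show "continuous_on {0..} (\<lambda>t. Q (stop (T w) t) w)" if "w \<in> space P" for w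
    by (intro continuous_on_compose2[OF Qcont[OF that] stop_cont]) (auto simp: stop_bounds)
  show "Q (stop (T w) s) w \<le> Q (stop (T w) t) w" if "w \<in> space P" "0 \<le> s" "s \<le> t" for w s t
    using Qmono[OF that(1)] stop_mono[OF that(2,3), of "T w"] by (auto simp: mono_on_def stop_bounds)
  have A_bd: "\<bar>A (stop (T w) t) w\<bar> \<le> n" if "w \<in> space P" "0 \<le> t" "0 < T w" for w t
    using that by (intro stop_abs_bound[where f = "\<lambda>t. A t w"] Acont bdA) auto
  show "\<bar>A (stop (T w) t) w - A 0 w\<bar> \<le> 2 * n" if "w \<in> space P" "0 \<le> t" for w t
  proof (cases "0 < T w")
    case True
    then show ?thesis using A_bd[OF that True] bdA[OF that(1), of 0] by simp
  next
    case False
    then show ?thesis using n by (simp add: stop_def)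
  qed
  have Q_nonneg: "0 \<le> Q t w" if "w \<in> space P" "0 \<le> t" for w t
    using Q0[OF that(1)] mono_onD[OF Qmono[OF that(1)], of 0 t] that by simp
  show "0 \<le> Q (stop (T w) t) w \<and> Q (stop (T w) t) w \<le> 2 * n" if "w \<in> space P" "0 \<le> t" for w t
  proof (cases "0 < T w")
    case True
    have "Q (stop (T w) t) w \<le> n"
      using that True by (intro stop_le_bound[where f = "\<lambda>t. Q t w"] Qcont bdQ) auto
    then show ?thesis using n Q_nonneg[OF that(1)] by (auto simp: stop_bounds)
  next
    case False
    then show ?thesis using n Q0[OF that(1)] by (simp add: stop_def)
  qed
  have W: "(LINT w|P. H w * ((A (stop (T w) t) w - A 0 w) - (A (stop (T w) s) w - A 0 w))) = 0"
    if "0 \<le> s" "s \<le> t" "H \<in> borel_measurable (F (ennreal s))" "\<And>w. w \<in> space P \<Longrightarrow> \<bar>H w\<bar> \<le> h" for s t H h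
    using stopped_martingale_increment[OF A Acont T that(1,2) bdA n that(3,4)] by simp
  then show "(LINT w|P. H w * ((A (stop (T w) t) w - A 0 w) - (A (stop (T w) s) w - A 0 w))) = 0"
    if "0 \<le> s" "s \<le> t" "H \<in> borel_measurable (F (ennreal s))" "\<And>w. w \<in> space P \<Longrightarrow> \<bar>H w\<bar> \<le> h" for s t H h
    using that by blast
  fix s t h :: real and H :: "'a \<Rightarrow> real"
  assume st: "0 \<le> s" "s \<le> t" and H: "H \<in> borel_measurable (F (ennreal s))" "\<And>w. w \<in> space P \<Longrightarrow> \<bar>H w\<bar> \<le> h"
  have t: "0 \<le> t" using st by simp
  define R where "R = (\<lambda>t w. (A t w)\<^sup>2 - Q t w)"
  \<comment> \<open>Increments of (A - A_0)^2 - Q differ from those of A^2 - Q by - 2 A_0 \<Delta>A.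
    The factor is an admissible weight once restricted to s < T, where A_0 is bounded; otherwise the
    stopped increments vanish.\<close>
  define H' where "H' = (\<lambda>w. if ennreal s < T w then 2 * H w * A 0 w else 0)"
  have RF: "R t \<in> borel_measurable (F (ennreal t))" if "0 \<le> t" for t
    unfolding R_def using AF[OF that] QF[OF that] by measurable
  have Rcont: "continuous_on {0..} (\<lambda>t. R t w)" if "w \<in> space P" for w
    unfolding R_def by (intro continuous_intros Acont[OF that] Qcont[OF that])
  have Rbd: "\<bar>R r w\<bar> \<le> n\<^sup>2 + n" if "w \<in> space P" "0 \<le> r" "ennreal r < T w" for w r
  proof -
    have "(A r w)\<^sup>2 \<le> n\<^sup>2" using bdA[OF that] n by (simp add: abs_le_square_iff[symmetric])
    then show ?thesis using bdQ[OF that] Q_nonneg[OF that(1,2)] unfolding R_def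
      using zero_le_power2[of "A r w"] zero_le_power2[of n] by (intro abs_leI) linarith+
  qed
  have R0: "(LINT w|P. H w * (R (stop (T w) t) w - R (stop (T w) s) w)) = 0"
    using n by (intro stopped_local_martingale_increment[OF Qloc[folded R_def] RF Rcont T st Rbd _ H]) auto
  have H'F: "H' \<in> borel_measurable (F (ennreal s))"
    unfolding H'_def using H(1) A0[OF st(1)] by (intro indicator_before_measurable[OF T]) auto
  have H'bd: "\<bar>H' w\<bar> \<le> 2 * h * n" if "w \<in> space P" for w
  proof -
    have h: "0 \<le> h" using H(2)[OF that] by linarith
    show ?thesis
    proof (cases "ennreal s < T w")
      case True
      then have "0 < T w" by (auto intro: order_le_less_trans)
      then have "\<bar>A 0 w\<bar> \<le> n" using bdA[OF that, of 0] by simp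
      then show ?thesis using True H(2)[OF that] h by (auto simp: H'_def abs_mult intro!: mult_mono)
    next
      case False
      then show ?thesis using h n by (simp add: H'_def)
    qed
  qed
  have W0: "(LINT w|P. H' w * ((A (stop (T w) t) w - A 0 w) - (A (stop (T w) s) w - A 0 w))) = 0"
    by (rule W[OF st H'F H'bd])
  have bdstop: "\<bar>A (stop (T w) t) w - A (stop (T w) s) w\<bar> \<le> 2 * n \<and> \<bar>R (stop (T w) t) w - R (stop (T w) s) w\<bar> \<le> 2 * (n\<^sup>2 + n)"
    if w: "w \<in> space P" for w
  proof (cases "0 < T w")
    case True
    have "\<bar>R (stop (T w) r) w\<bar> \<le> n\<^sup>2 + n" if "0 \<le> r" for r
      using that True w by (intro stop_abs_bound[where f = "\<lambda>t. R t w"] Rcont Rbd) auto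
    from this[OF t] this[OF st(1)] A_bd[OF w t True] A_bd[OF w st(1) True]
      abs_triangle_ineq4[of "A (stop (T w) t) w" "A (stop (T w) s) w"]
      abs_triangle_ineq4[of "R (stop (T w) t) w" "R (stop (T w) s) w"]
    show ?thesis by (simp add: algebra_simps)
  next
    case False
    then show ?thesis using n by (simp add: stop_def)
  qed
  have [measurable]: "H \<in> borel_measurable P" "H' \<in> borel_measurable P"
    by (rule measurable_F_P[OF H(1)] measurable_F_P[OF H'F])+
  have [measurable]: "(\<lambda>w. A (stop (T w) t) w) \<in> borel_measurable P" "(\<lambda>w. A (stop (T w) s) w) \<in> borel_measurable P"
    "(\<lambda>w. R (stop (T w) t) w) \<in> borel_measurable P" "(\<lambda>w. R (stop (T w) s) w) \<in> borel_measurable P"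
    by (rule measurable_F_P[OF stopped_adapted[OF T AF Acont t]] measurable_F_P[OF stopped_adapted[OF T AF Acont st(1)]]
        measurable_F_P[OF stopped_adapted[OF T RF Rcont t]] measurable_F_P[OF stopped_adapted[OF T RF Rcont st(1)]]; assumption)+
  have int1: "integrable P (\<lambda>w. H w * (R (stop (T w) t) w - R (stop (T w) s) w))"
  proof (rule integrable_bounded)
    fix w assume w: "w \<in> space P"
    show "\<bar>H w * (R (stop (T w) t) w - R (stop (T w) s) w)\<bar> \<le> h * (2 * (n\<^sup>2 + n))"
      unfolding abs_mult
      by (intro mult_mono H(2)[OF w] conjunct2[OF bdstop[OF w]] abs_ge_zero order_trans[OF abs_ge_zero H(2)[OF w]])
  qed measurable
  have int2: "integrable P (\<lambda>w. H' w * ((A (stop (T w) t) w - A 0 w) - (A (stop (T w) s) w - A 0 w)))"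
  proof (rule integrable_bounded)
    fix w assume w: "w \<in> space P"
    have "\<bar>(A (stop (T w) t) w - A 0 w) - (A (stop (T w) s) w - A 0 w)\<bar> \<le> 2 * n"
      using conjunct1[OF bdstop[OF w]] by simp
    then show "\<bar>H' w * ((A (stop (T w) t) w - A 0 w) - (A (stop (T w) s) w - A 0 w))\<bar> \<le> 2 * h * n * (2 * n)"
      unfolding abs_mult
      by (intro mult_mono H'bd[OF w] abs_ge_zero order_trans[OF abs_ge_zero H'bd[OF w]])
  next
    have "(\<lambda>w. H' w * (A (stop (T w) t) w - A (stop (T w) s) w)) \<in> borel_measurable P" by measurable
    then show "(\<lambda>w. H' w * ((A (stop (T w) t) w - A 0 w) - (A (stop (T w) s) w - A 0 w))) \<in> borel_measurable P"
      by simp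
  qed
  have "H w * (((A (stop (T w) t) w - A 0 w)\<^sup>2 - Q (stop (T w) t) w) - ((A (stop (T w) s) w - A 0 w)\<^sup>2 - Q (stop (T w) s) w))
     = H w * (R (stop (T w) t) w - R (stop (T w) s) w)
       - H' w * ((A (stop (T w) t) w - A 0 w) - (A (stop (T w) s) w - A 0 w))" for w
  proof (cases "ennreal s < T w")
    case True
    then show ?thesis by (simp add: R_def H'_def power2_eq_square algebra_simps)
  next
    case False
    then show ?thesis using stop_after[OF _ st, of "T w"] by simp
  qed
  then show "(LINT w|P. H w * (((A (stop (T w) t) w - A 0 w)\<^sup>2 - Q (stop (T w) t) w) - ((A (stop (T w) s) w - A 0 w)\<^sup>2 - Q (stop (T w) s) w))) = 0"
    using Bochner_Integration.integral_diff[OF int1 int2] R0 W0 by simp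
qed

end

section \<open>Adaptedness of integrals with cut-off integrands\<close>

lemma hcoef_bounded: "\<exists>C\<ge>0. \<forall>m\<le>n. \<forall>x c. \<bar>x\<bar> \<le> B \<longrightarrow> (\<forall>i<n. \<bar>c i\<bar> \<le> B) \<longrightarrow> \<bar>hcoef x c m :: real\<bar> \<le> C"
proof (induction n)
  case 0
  show ?case by (intro exI[of _ 0]) simp
next
  case (Suc n)
  then obtain C where C: "C \<ge> 0" "\<And>m x c. m \<le> n \<Longrightarrow> \<bar>x\<bar> \<le> B \<Longrightarrow> (\<forall>i<n. \<bar>c i\<bar> \<le> B) \<Longrightarrow> \<bar>hcoef x c m :: real\<bar> \<le> C" by blast
  have step: "\<bar>hcoef x c (Suc n)\<bar> \<le> 1 + (1 + real n) * (\<bar>B\<bar> * C)" if x: "\<bar>x\<bar> \<le> B" and c: "\<forall>i<Suc n. \<bar>c i\<bar> \<le> B" for x c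
  proof (cases n)
    case 0
    then show ?thesis using C by simp
  next
    case (Suc k)
    have B: "\<bar>B\<bar> = B" using x by simp
    have "\<bar>\<Sum>i<k. c (Suc i) * hcoef x c (k - i)\<bar> \<le> (\<Sum>i<k. B * C)"
      unfolding abs_mult using c x Suc C(1)
      by (intro order_trans[OF sum_abs] sum_mono) (auto simp: abs_mult intro!: mult_mono C(2))
    moreover have "\<bar>x * hcoef x c (Suc k)\<bar> \<le> B * C"
      unfolding abs_mult using x c Suc by (intro mult_mono C(2)) auto
    ultimately have "\<bar>hcoef x c (Suc (Suc k))\<bar> \<le> B * C + real k * (B * C)" by simp
    moreover have "0 \<le> B * C" using B C(1) by (metis abs_ge_zero mult_nonneg_nonneg)
    ultimately show ?thesis unfolding Suc B by (simp add: algebra_simps)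
  qed
  show ?case
  proof (intro exI[of _ "C + (1 + (1 + real n) * (\<bar>B\<bar> * C))"] conjI allI impI)
    fix m x c assume m: "m \<le> Suc n" and x: "\<bar>x\<bar> \<le> B" and c: "\<forall>i<Suc n. \<bar>c i\<bar> \<le> B"
    have "0 \<le> (1 + real n) * (\<bar>B\<bar> * C)" using C(1) by simp
    then show "\<bar>hcoef x c m\<bar> \<le> C + (1 + (1 + real n) * (\<bar>B\<bar> * C))"
      using step[OF x c] C(1) C(2)[of m x c] m x c by (cases "m = Suc n") auto
  qed (use C in auto)
qed

lemma hcoef_measurable:
  fixes x :: "'a \<Rightarrow> real"
  assumes "x \<in> borel_measurable N" "\<And>i. i < n \<Longrightarrow> (\<lambda>w. c w i) \<in> borel_measurable N"
  shows "(\<lambda>w. hcoef (x w) (c w) n) \<in> borel_measurable N"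
  using assms(2)
proof (induction n rule: less_induct)
  case (less n)
  consider "n = 0" | "n = 1" | m where "n = Suc (Suc m)"
    by (metis One_nat_def not0_implies_Suc)
  then show ?case
  proof cases
    case 3
    then show ?thesis using assms(1) less by (auto intro!: borel_measurable_diff borel_measurable_times borel_measurable_sum)
  qed simp_all
qed

lemma cutoff_measurable:
  fixes b :: "real \<Rightarrow> real"
  assumes "continuous_on {r. 0 \<le> r \<and> ennreal r < T} b"
  shows "set_borel_measurable borel {0..t} (\<lambda>r. if ennreal r < T then b r else 0)"
proof -
  have "{r. 0 \<le> r \<and> ennreal r < T} \<inter> {..t} = {r\<in>space borel. 0 \<le> r \<and> ennreal r < T \<and> r \<le> t}" by auto
  also have "\<dots> \<in> sets borel" by measurable
  finally have "set_borel_measurable borel ({r. 0 \<le> r \<and> ennreal r < T} \<inter> {..t}) b"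
    unfolding set_borel_measurable_def
    by (rule borel_measurable_continuous_on_indicator) (rule continuous_on_subset[OF assms], auto)
  moreover have "(\<lambda>r. indicator {0..t} r *\<^sub>R (if ennreal r < T then b r else 0)) =
      (\<lambda>r. indicator ({r. 0 \<le> r \<and> ennreal r < T} \<inter> {..t}) r *\<^sub>R b r)"
    by (auto simp: indicator_def fun_eq_iff)
  ultimately show ?thesis by (simp add: set_borel_measurable_def)
qed

context clock_path
begin

lemma stieltjes_integral_0: "(LINT r:{0}|stieltjes q. f r :: real) = 0"
  using stieltjes_integral_Icc[of 0 0 f] by (simp add: set_lebesgue_integral_def)

text \<open>Up to the stopped time the cut-off is inactive except possibly at the endpoint, which
  has no mass.\<close>

lemma stieltjes_integral_cutoff:
  fixes b :: "real \<Rightarrow> real"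
  assumes b: "continuous_on {0..stop T t} b"
  shows "(LINT r:{0..stop T t}|stieltjes q. if ennreal r < T then b r else 0) = (LINT r:{0..stop T t}|stieltjes q. b r)"
  unfolding set_lebesgue_integral_def
proof (rule integral_cong_AE)
  have L: "0 \<le> stop T t" by (rule stop_bounds)
  have "AE r in stieltjes q. r \<notin> {stop T t}"
    using stieltjes_point[OF L] by (intro AE_not_in) (auto simp: null_sets_def)
  then show "AE r in stieltjes q. indicator {0..stop T t} r *\<^sub>R (if ennreal r < T then b r else 0) = indicator {0..stop T t} r *\<^sub>R b r"
  proof eventually_elim
    case (elim r)
    show ?case
    proof (cases "r \<in> {0..stop T t}")
      case True
      then have "ennreal r < ennreal (stop T t)" using elim by (intro ennreal_lessI) auto
      then have "ennreal r < T" by (rule order_less_le_trans[OF _ stop_le])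
      then show ?thesis by simp
    qed simp
  qed
  have m: "set_borel_measurable borel {0..stop T t} b" by (rule continuous_set_borel_measurable[OF b]) simp
  then show "(\<lambda>r. indicator {0..stop T t} r *\<^sub>R b r) \<in> borel_measurable (stieltjes q)"
    by (simp add: set_borel_measurable_def)
  have "(\<lambda>r. if ennreal r < T then indicator {0..stop T t} r *\<^sub>R b r else 0) \<in> borel_measurable borel"
    using m by (intro measurable_If) (auto simp: set_borel_measurable_def)
  moreover have "(\<lambda>r. if ennreal r < T then indicator {0..stop T t} r *\<^sub>R b r else 0) =
      (\<lambda>r. indicator {0..stop T t} r *\<^sub>R (if ennreal r < T then b r else 0))" by auto
  ultimately show "(\<lambda>r. indicator {0..stop T t} r *\<^sub>R (if ennreal r < T then b r else 0)) \<in> borel_measurable (stieltjes q)"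
    by simp
qed

text \<open>Left endpoint sums are used because their terms are measurable at time t. They are
  integrals of step functions that converge pointwise for 0 < r < T and are dominated by c; b is
  continuous before T only.\<close>

lemma riemann_sums_tendsto:
  fixes b :: "real \<Rightarrow> real"
  assumes cont: "continuous_on {r. 0 \<le> r \<and> ennreal r < T} b"
    and bd: "\<And>r. 0 \<le> r \<Longrightarrow> ennreal r < T \<Longrightarrow> \<bar>b r\<bar> \<le> c" and t: "0 \<le> t"
  shows "(\<lambda>k. \<Sum>i<k. if ennreal (grid 0 t k i) < T
      then b (grid 0 t k i) * (q (stop T (grid 0 t k (Suc i))) - q (stop T (grid 0 t k i))) else 0)
    \<longlonglongrightarrow> (LINT r:{0..stop T t}|stieltjes q. if ennreal r < T then b r else 0)"
proof (cases "t = 0")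
  case True
  then show ?thesis
    using stieltjes_integral_0 by (simp add: grid_def stop_def cong: if_cong)
next
  case False
  then have t: "0 < t" using t by simp
  define b' where "b' = (\<lambda>r. if ennreal r < T then b r else 0)"
  \<comment> \<open>The value of b' at the left endpoint of the grid cell containing r. The ceiling
    makes the cells open on the left and closed on the right, as in the additive form of the
    integral.\<close>
  define \<phi> where "\<phi> = (\<lambda>k r. b' (grid 0 t k (nat (\<lceil>r * real k / t\<rceil> - 1))))"
  have g0: "0 \<le> grid 0 t k i" for k i using t by (simp add: grid_def)
  have b'bd: "\<bar>b' r\<bar> \<le> \<bar>c\<bar>" if "0 \<le> r" for r using bd[OF that] by (auto simp: b'_def)
  have \<phi>bd: "\<bar>\<phi> k r\<bar> \<le> \<bar>c\<bar>" for k r unfolding \<phi>_def by (intro b'bd g0)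
  have \<phi>m[measurable]: "\<phi> k \<in> borel_measurable borel" for k
  proof -
    have "(\<lambda>r::real. nat (\<lceil>r * real k / t\<rceil> - 1)) \<in> measurable borel (count_space UNIV)" by measurable
    from measurable_compose[OF this, of "\<lambda>i. b' (grid 0 t k i)" borel] show ?thesis by (simp add: \<phi>_def)
  qed
  have \<phi>int: "set_integrable (stieltjes q) {0..v} (\<phi> k)" for k v
    by (rule stieltjes_set_integrable[where t = v and C = "\<bar>c\<bar>"]) (auto simp: set_borel_measurable_def \<phi>bd)
  have sum: "(LINT r:{0..stop T (grid 0 t k j)}|stieltjes q. \<phi> k r) =
      (\<Sum>i<j. b' (grid 0 t k i) * (q (stop T (grid 0 t k (Suc i))) - q (stop T (grid 0 t k i))))" if k: "0 < k" for k j
  proof (induction j)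
    case 0
    show ?case using stieltjes_integral_0 by (simp add: stop_def)
  next
    case (Suc j)
    define u v where "u = stop T (grid 0 t k j)" and "v = stop T (grid 0 t k (Suc j))"
    have uv: "0 \<le> u" "u \<le> v" unfolding u_def v_def using t by (auto simp: stop_bounds intro!: stop_mono g0 grid_mono)
    have "(LINT r:{u<..v}|stieltjes q. \<phi> k r) = (LINT r:{u<..v}|stieltjes q. b' (grid 0 t k j))"
    proof (rule set_lebesgue_integral_cong)
      show "\<forall>r. r \<in> {u<..v} \<longrightarrow> \<phi> k r = b' (grid 0 t k j)"
      proof (intro allI impI)
        fix r assume r: "r \<in> {u<..v}"
        have "\<not> T \<le> ennreal (grid 0 t k j)"
        proof
          assume "T \<le> ennreal (grid 0 t k j)"
          then have "v = u" unfolding u_def v_def using t by (intro stop_after g0 grid_mono) auto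
          then show False using r by simp
        qed
        then have "u = grid 0 t k j" unfolding u_def by (intro stop_before g0) auto
        moreover have "v \<le> grid 0 t k (Suc j)" unfolding v_def by (intro stop_bounds g0)
        ultimately have "t * real j / real k < r" "r \<le> t * real (Suc j) / real k" using r by (auto simp: grid_def)
        then have "real j < r * real k / t" "r * real k / t \<le> real (Suc j)"
          using t k by (auto simp: field_simps)
        then have "\<lceil>r * real k / t\<rceil> = int (Suc j)" by (intro ceiling_unique) auto
        then show "\<phi> k r = b' (grid 0 t k j)" by (simp add: \<phi>_def)
      qed
    qed simp
    also have "\<dots> = b' (grid 0 t k j) * (q v - q u)"
      using uv by (simp add: set_lebesgue_integral_def measure_stieltjes_Ioc mult.commute)
    finally show ?case
      using Suc.IH stieltjes_integral_split[OF uv \<phi>int[where v = v and k = k]] by (simp add: u_def v_def)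
  qed
  define L where "L = stop T t"
  have L: "0 \<le> L" unfolding L_def by (rule stop_bounds)
  have lim: "(\<lambda>k. \<phi> k r) \<longlonglongrightarrow> b' r" if r: "0 < r" "ennreal r < T" for r
  proof -
    define x where "x = (\<lambda>k. grid 0 t k (nat (\<lceil>r * real k / t\<rceil> - 1)))"
    have x: "x k < r" "r - x k \<le> t / real k" if "k \<ge> 1" for k
    proof -
      define m where "m = \<lceil>r * real k / t\<rceil>"
      have pos: "0 < r * real k / t" using r t that by simp
      have m: "of_int m - 1 < r * real k / t" "r * real k / t \<le> of_int m" unfolding m_def by linarith+
      have "m \<ge> 1" using m(2) pos by linarith
      then have "real (nat (m - 1)) = of_int m - 1" by simp
      then have "x k = t * (of_int m - 1) / real k" by (simp add: x_def m_def[symmetric] grid_def)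
      moreover have k: "0 < real k" using that by simp
      moreover have "t * (of_int m - 1) < r * real k" "r * real k \<le> t * of_int m"
        using m t by (simp_all add: pos_less_divide_eq pos_divide_le_eq mult.commute)
      then have "t * (of_int m - 1) / real k < r" "r \<le> t * of_int m / real k"
        using k by (simp_all add: pos_divide_less_eq pos_le_divide_eq)
      ultimately show "x k < r" "r - x k \<le> t / real k" by (simp_all add: right_diff_distrib diff_divide_distrib)
    qed
    have x': "norm (x k - r) \<le> t / real k" if "k \<ge> 1" for k using x[OF that] by simp
    have "(\<lambda>k. t / real k) \<longlonglongrightarrow> 0" by (rule lim_const_over_n)
    then have "(\<lambda>k. x k - r) \<longlonglongrightarrow> 0"
      by (rule Lim_null_comparison[rotated]) (rule eventually_sequentiallyI[of 1], rule x')
    then have xr: "x \<longlonglongrightarrow> r" by (rule Lim_null[THEN iffD2])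
    have xT: "ennreal (x k) < T" if "k \<ge> 1" for k
      by (rule order_le_less_trans[OF _ r(2)]) (use x[OF that] in \<open>auto intro: ennreal_leI\<close>)
    have "(\<lambda>k. b (x k)) \<longlonglongrightarrow> b r"
      using r xT g0 by (intro continuous_on_tendsto_compose[OF cont xr] eventually_sequentiallyI[of 1]) (auto simp: x_def)
    then have "(\<lambda>k. \<phi> k r) \<longlonglongrightarrow> b r"
    proof (rule Lim_transform_eventually, intro eventually_sequentiallyI[of 1])
      fix k :: nat assume "1 \<le> k"
      then have "\<phi> k r = b' (x k)" "b' (x k) = b (x k)" using xT[of k] by (simp_all add: \<phi>_def x_def b'_def)
      then show "b (x k) = \<phi> k r" by simp
    qed
    then show ?thesis using r by (simp add: b'_def)
  qed
  have null: "{a} \<in> null_sets (stieltjes q)" if "0 \<le> a" for a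
    using stieltjes_point[OF that] by (auto simp: null_sets_def)
  have "(\<lambda>k. LINT r:{0..L}|stieltjes q. \<phi> k r) \<longlonglongrightarrow> (LINT r:{0..L}|stieltjes q. b' r)"
    unfolding set_lebesgue_integral_def
  proof (rule integral_dominated_convergence[where w = "\<lambda>r. indicator {0..L} r *\<^sub>R \<bar>c\<bar>"])
    show "(\<lambda>r. indicator {0..L} r *\<^sub>R b' r) \<in> borel_measurable (stieltjes q)"
      using cutoff_measurable[OF cont, of L] by (simp add: set_borel_measurable_def b'_def)
    show "integrable (stieltjes q) (\<lambda>r. indicator {0..L} r *\<^sub>R \<bar>c\<bar>)"
      using stieltjes_set_integrable[of "{0..L}" L "\<lambda>_. \<bar>c\<bar>" "\<bar>c\<bar>"] by (simp add: set_integrable_def set_borel_measurable_def)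
    show "AE r in stieltjes q. (\<lambda>k. indicator {0..L} r *\<^sub>R \<phi> k r) \<longlonglongrightarrow> indicator {0..L} r *\<^sub>R b' r"
      using AE_not_in[OF null[OF order_refl]] AE_not_in[OF null[OF L]]
    proof eventually_elim
      case (elim r)
      show ?case
      proof (cases "r \<in> {0..L}")
        case True
        then have "0 < r" "r < L" using elim by auto
        then have "ennreal r < ennreal L" by (intro ennreal_lessI) auto
        then have "ennreal r < T" unfolding L_def by (rule order_less_le_trans[OF _ stop_le])
        then show ?thesis using True lim[OF \<open>0 < r\<close>] by simp
      qed simp
    qed
    show "AE r in stieltjes q. norm (indicator {0..L} r *\<^sub>R \<phi> k r) \<le> indicator {0..L} r *\<^sub>R \<bar>c\<bar>" for k
      using \<phi>bd by (auto intro!: AE_I2 simp: indicator_def)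
  qed auto
  then have "(\<lambda>k. \<Sum>i<k. b' (grid 0 t k i) * (q (stop T (grid 0 t k (Suc i))) - q (stop T (grid 0 t k i))))
      \<longlonglongrightarrow> (LINT r:{0..L}|stieltjes q. b' r)"
    by (rule Lim_transform_eventually)
      (auto intro!: eventually_sequentiallyI[of 1] simp: sum[symmetric] grid_k L_def)
  then show ?thesis
    unfolding b'_def L_def by (simp add: if_distrib[of "\<lambda>x. x * _"] cong: if_cong)
qed

end

context filtered_prob
begin

lemma stieltjes_integral_adapted:
  fixes b :: "real \<Rightarrow> 'a \<Rightarrow> real"
  assumes T: "stopping_time F T" and Q: "\<And>w. w \<in> space P \<Longrightarrow> clock_path (\<lambda>t. Q t w)"
    and QF: "\<And>t. t \<ge> 0 \<Longrightarrow> Q t \<in> borel_measurable (F (ennreal t))"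
    and bF: "\<And>t. t \<ge> 0 \<Longrightarrow> b t \<in> borel_measurable (F (ennreal t))"
    and cont: "\<And>w. w \<in> space P \<Longrightarrow> continuous_on {r. 0 \<le> r \<and> ennreal r < T w} (\<lambda>r. b r w)"
    and bd: "\<And>w r. w \<in> space P \<Longrightarrow> 0 \<le> r \<Longrightarrow> ennreal r < T w \<Longrightarrow> \<bar>b r w\<bar> \<le> c" and t: "0 \<le> t"
  shows "(\<lambda>w. LINT r:{0..stop (T w) t}|stieltjes (\<lambda>t. Q t w). if ennreal r < T w then b r w else 0)
    \<in> borel_measurable (F (ennreal t))"
proof (rule borel_measurable_LIMSEQ_real)
  define f where "f = (\<lambda>k w. \<Sum>i<k. if ennreal (grid 0 t k i) < T w
      then b (grid 0 t k i) w * (Q (stop (T w) (grid 0 t k (Suc i))) w - Q (stop (T w) (grid 0 t k i)) w) else 0)"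
  show "(\<lambda>k. f k w) \<longlonglongrightarrow> (LINT r:{0..stop (T w) t}|stieltjes (\<lambda>t. Q t w). if ennreal r < T w then b r w else 0)"
    if "w \<in> space (F (ennreal t))" for w
  proof -
    have w: "w \<in> space P" using that by (simp add: space_F)
    interpret clock_path "\<lambda>t. Q t w" by (rule Q[OF w])
    show ?thesis unfolding f_def by (rule riemann_sums_tendsto[OF cont[OF w] bd[OF w] t])
  qed
  have Qst: "(\<lambda>w. Q (stop (T w) r) w) \<in> borel_measurable (F (ennreal t))" if r: "0 \<le> r" "r \<le> t" for r
    by (rule measurable_F_mono[OF stopped_adapted[OF T QF _ r(1)] ennreal_leI[OF r(2)]])
      (use Q in \<open>auto simp: clock_path_def\<close>)
  have bF': "b r \<in> borel_measurable (F (ennreal t))" if r: "0 \<le> r" "r \<le> t" for r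
    by (rule measurable_F_mono[OF bF[OF r(1)] ennreal_leI[OF r(2)]])
  show "f k \<in> borel_measurable (F (ennreal t))" for k
    unfolding f_def
  proof (intro borel_measurable_sum indicator_before_measurable[OF T] borel_measurable_times borel_measurable_diff Qst bF')
    fix i assume "i \<in> {..<k}"
    then show "0 \<le> grid 0 t k (Suc i)" "grid 0 t k (Suc i) \<le> t" "0 \<le> grid 0 t k i" "grid 0 t k i \<le> t"
      "0 \<le> grid 0 t k i" "grid 0 t k i \<le> t" "ennreal (grid 0 t k i) \<le> ennreal t"
      using grid_bounds[OF t, where k = k and i = i] grid_bounds[OF t, where k = k and i = "Suc i"] by (auto intro!: ennreal_leI)
  qed
qed

end

section \<open>The regularised SLE process\<close>

lemma continuous_on_halfline:
  fixes f :: "real \<Rightarrow> 'b :: topological_space"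
  assumes "\<And>t. continuous_on {0..t} f"
  shows "continuous_on {0..} f"
  unfolding continuous_on_def
proof
  fix x :: real assume "x \<in> {0..}"
  then have "(f \<longlongrightarrow> f x) (at x within {0..x + 1})" using assms[of "x + 1"] by (auto simp: continuous_on_def)
  moreover have "at x within {0..} = at x within {0..x + 1}"
    by (rule at_within_nhd[of _ "{..<x + 1}"]) auto
  ultimately show "(f \<longlongrightarrow> f x) (at x within {0..})" by simp
qed

sublocale sle_kappa_rho \<subseteq> filtered_prob P F
  by unfold_locales (rule subalg)

context sle_kappa_rho
begin

lemma A_adapted: "0 \<le> t \<Longrightarrow> A t \<in> borel_measurable (F (ennreal t))"
  using A_martingale by (simp add: martingale_def)

lemma Q_adapted: "0 \<le> t \<Longrightarrow> Q t \<in> borel_measurable (F (ennreal t))"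
  and Q_continuous: "w \<in> space P \<Longrightarrow> continuous_on {0..} (\<lambda>t. Q t w)"
  and Q_0: "w \<in> space P \<Longrightarrow> Q 0 w = 0"
  and Q_clock: "w \<in> space P \<Longrightarrow> clock_path (\<lambda>t. Q t w)"
  using Q_quadratic_variation by (auto simp: quadratic_variation_def clock_path_def)

lemma Q_nonneg: "w \<in> space P \<Longrightarrow> 0 \<le> t \<Longrightarrow> 0 \<le> Q t w"
  using clock_path.q_le[OF Q_clock, of w 0 t] Q_0 by simp

text \<open>A and Q control the martingale part of X and the clock, the inverse distances control
  the forces; together they bound the whole state up to the exit time, see
  \<open>state_bounded\<close>.\<close>

definition level :: "real \<Rightarrow> 'a \<Rightarrow> real" where
  "level t w = \<bar>A t w\<bar> + Q t w + (\<Sum>K=1..M. 1 / \<bar>X t w - Y K t w\<bar>)"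

definition exit :: "nat \<Rightarrow> 'a \<Rightarrow> ennreal" where
  "exit = exit_time \<tau> level"

lemma no_hit: "w \<in> space P \<Longrightarrow> 0 \<le> t \<Longrightarrow> ennreal t < \<tau> w \<Longrightarrow> K \<in> {1..M} \<Longrightarrow> X t w \<noteq> Y K t w"
  using no_collision by blast

lemma level_adapted: "0 \<le> t \<Longrightarrow> level t \<in> borel_measurable (F (ennreal t))"
  unfolding level_def[abs_def]
  by (intro borel_measurable_add borel_measurable_abs borel_measurable_sum borel_measurable_divide
      borel_measurable_diff borel_measurable_const A_adapted Q_adapted X_adapted Y_adapted)

lemma level_continuous:
  assumes "w \<in> space P"
  shows "continuous_on {t. 0 \<le> t \<and> ennreal t < \<tau> w} (\<lambda>t. level t w)"
  unfolding level_def
proof (intro continuous_on_add continuous_on_rabs continuous_on_sum continuous_on_divide continuous_on_const continuous_on_diff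
    X_continuous[OF assms] Y_continuous[OF _ assms])
  show "continuous_on {t. 0 \<le> t \<and> ennreal t < \<tau> w} (\<lambda>t. A t w)" "continuous_on {t. 0 \<le> t \<and> ennreal t < \<tau> w} (\<lambda>t. Q t w)"
    by (rule continuous_on_subset[OF A_continuous[OF assms]] continuous_on_subset[OF Q_continuous[OF assms]]; auto)+
  show "\<forall>t\<in>{t. 0 \<le> t \<and> ennreal t < \<tau> w}. \<bar>X t w - Y K t w\<bar> \<noteq> 0" if "K \<in> {1..M}" for K
    using no_hit[OF assms _ _ that] by auto
qed

lemma exit_stopping: "stopping_time F (exit n)"
  unfolding exit_def by (rule stopping_time_exit_time[OF \<tau>_stopping level_adapted level_continuous])

lemma exit_before:
  assumes "w \<in> space P" "0 \<le> t" "ennreal t < exit n w"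
  shows "ennreal t < \<tau> w" "\<bar>A t w\<bar> \<le> real n" "Q t w \<le> real n"
    "K \<in> {1..M} \<Longrightarrow> 1 / \<bar>X t w - Y K t w\<bar> \<le> real n"
proof -
  show "ennreal t < \<tau> w" using exit_time_before(1)[OF assms(2) assms(3)[unfolded exit_def]] .
  have lev: "level t w < real n" using exit_time_before(2)[OF assms(2) assms(3)[unfolded exit_def]] .
  have sum: "0 \<le> (\<Sum>K=1..M. 1 / \<bar>X t w - Y K t w\<bar>)" by (intro sum_nonneg) auto
  show "\<bar>A t w\<bar> \<le> real n" "Q t w \<le> real n"
    using lev sum Q_nonneg[OF assms(1,2)] unfolding level_def by linarith+
  assume "K \<in> {1..M}"
  then have "1 / \<bar>X t w - Y K t w\<bar> \<le> (\<Sum>K=1..M. 1 / \<bar>X t w - Y K t w\<bar>)"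
    by (intro member_le_sum) auto
  then show "1 / \<bar>X t w - Y K t w\<bar> \<le> real n"
    using lev Q_nonneg[OF assms(1,2)] unfolding level_def by linarith
qed

lemma exit_clock: "ito_clock P F (\<lambda>t w. A (stop (exit n w) t) w - A 0 w) (\<lambda>t w. Q (stop (exit n w) t) w) (2 * real n)"
  by (rule stopped_ito_clock[OF A_martingale A_continuous Q_quadratic_variation exit_stopping])
    (auto intro: exit_before)

definition force :: "int \<Rightarrow> real \<Rightarrow> 'a \<Rightarrow> real" where
  "force i t w = (if i = 0 then (\<Sum>K=1..M. \<rho> K / (X t w - Y K t w)) else 2 / (Y (nat i) t w - X t w))"

definition force_bound :: "nat \<Rightarrow> real" where
  "force_bound n = (2 + (\<Sum>K=1..M. \<bar>\<rho> K\<bar>)) * real n"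

lemma force_bound_nonneg: "0 \<le> force_bound n"
  unfolding force_bound_def by (intro mult_nonneg_nonneg add_nonneg_nonneg sum_nonneg) auto

lemma force_adapted: "i \<in> {0..int M} \<Longrightarrow> 0 \<le> t \<Longrightarrow> force i t \<in> borel_measurable (F (ennreal t))"
  unfolding force_def[abs_def]
  by (cases "i = 0") (auto intro!: borel_measurable_sum borel_measurable_divide borel_measurable_diff X_adapted Y_adapted)

lemma force_continuous:
  assumes w: "w \<in> space P" and i: "i \<in> {0..int M}"
  shows "continuous_on {r. 0 \<le> r \<and> ennreal r < exit n w} (\<lambda>r. force i r w)"
proof -
  define J where "J = {r. 0 \<le> r \<and> ennreal r < exit n w}"
  have J: "J \<subseteq> {r. 0 \<le> r \<and> ennreal r < \<tau> w}" using exit_before(1)[OF w] by (auto simp: J_def)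
  have X: "continuous_on J (\<lambda>r. X r w)" by (rule continuous_on_subset[OF X_continuous[OF w] J])
  have Y: "continuous_on J (\<lambda>r. Y K r w)" if "K \<in> {1..M}" for K
    by (rule continuous_on_subset[OF Y_continuous[OF that w] J])
  have ne: "X r w - Y K r w \<noteq> 0" "Y K r w - X r w \<noteq> 0" if "r \<in> J" "K \<in> {1..M}" for r K
    using no_hit[OF w _ _ that(2), of r] that(1) J by auto
  show ?thesis
    unfolding J_def[symmetric]
  proof (cases "i = 0")
    case True
    then show "continuous_on J (\<lambda>r. force i r w)"
      unfolding force_def by (simp, intro continuous_on_sum continuous_on_divide continuous_on_const continuous_on_diff X Y)
        (use ne in auto)
  next
    case False
    then have "nat i \<in> {1..M}" using i by auto
    with False show "continuous_on J (\<lambda>r. force i r w)"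
      unfolding force_def using ne by (simp, intro continuous_on_divide continuous_on_const continuous_on_diff X Y) auto
  qed
qed

lemma force_bounded:
  assumes "w \<in> space P" "0 \<le> r" "ennreal r < exit n w" "i \<in> {0..int M}"
  shows "\<bar>force i r w\<bar> \<le> force_bound n"
proof -
  note inv = exit_before(4)[OF assms(1-3)]
  have \<rho>: "0 \<le> (\<Sum>K=1..M. \<bar>\<rho> K\<bar>)" by (intro sum_nonneg) auto
  show ?thesis
  proof (cases "i = 0")
    case True
    have "\<bar>force 0 r w\<bar> \<le> (\<Sum>K=1..M. \<bar>\<rho> K\<bar> * (1 / \<bar>X r w - Y K r w\<bar>))"
      unfolding force_def by (simp, intro order_trans[OF sum_abs]) (simp add: abs_divide)
    also have "\<dots> \<le> (\<Sum>K=1..M. \<bar>\<rho> K\<bar> * real n)" by (intro sum_mono mult_left_mono inv) auto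
    also have "\<dots> \<le> force_bound n"
      by (simp add: force_bound_def sum_distrib_right[symmetric] distrib_right)
    finally show ?thesis using True by simp
  next
    case False
    then have "nat i \<in> {1..M}" using assms(4) by auto
    from inv[OF this] have "\<bar>force i r w\<bar> \<le> 2 * real n"
      using False by (simp add: force_def abs_divide abs_minus_commute)
    also have "\<dots> \<le> force_bound n" using \<rho> by (simp add: force_bound_def distrib_right)
    finally show ?thesis .
  qed
qed

text \<open>The cut-off makes the integrand bounded at all times, whatever X and Y do from \<tau>
  on.\<close>

definition cut_force :: "nat \<Rightarrow> int \<Rightarrow> real \<Rightarrow> 'a \<Rightarrow> real" where
  "cut_force n i t w = (if ennreal t < exit n w then force i t w else 0)"

text \<open>The right-hand side of the equation of X with the cut-off force. It makes sense for
  every path, whereas the equation itself holds almost surely and before \<tau>.\<close>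

definition drive :: "nat \<Rightarrow> 'a \<Rightarrow> real \<Rightarrow> real" where
  "drive n w t = x0 + sqrt \<kappa> * (A t w - A 0 w) + (LINT r:{0..t}|stieltjes (\<lambda>r. Q r w). cut_force n 0 r w)"

text \<open>The coordinates \<open>0\<close>, \<open>K\<close>, \<open>-1 - i\<close> stand for \<open>X\<close>, \<open>Y\<^sup>K\<close> and the coefficient of \<open>z\<^bsup>-i\<^esup>\<close> of \<open>g\<close>.
  Unlike \<open>X, Y, g\<close>, this process is defined and regular for all \<open>w\<close> and up to and including the exit time.\<close>

definition state :: "nat \<Rightarrow> 'a \<Rightarrow> real \<Rightarrow> int \<Rightarrow> real" where
  "state n w t i =
    (if i = 0 then drive n w t
     else if i \<in> {1..int M} then y0 (nat i) + (LINT r:{0..t}|stieltjes (\<lambda>r. Q r w). cut_force n i r w)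
     else if i < 0 then lcoef (\<lambda>r. Q r w) (drive n w) (nat (- 1 - i)) t else 0)"

text \<open>The density of the finite variation part with respect to Q, see
  \<open>state_increment\<close>.\<close>

definition state_density :: "nat \<Rightarrow> 'a \<Rightarrow> real \<Rightarrow> int \<Rightarrow> real" where
  "state_density n w t i =
    (if i \<in> {0..int M} then cut_force n i t w
     else if i < 0 then 2 * hcoef (drive n w t) (\<lambda>j. lcoef (\<lambda>r. Q r w) (drive n w) j t) (nat (- 1 - i)) else 0)"

lemma cut_force_bounded: "w \<in> space P \<Longrightarrow> i \<in> {0..int M} \<Longrightarrow> 0 \<le> r \<Longrightarrow> \<bar>cut_force n i r w\<bar> \<le> force_bound n"
  using force_bounded[of w r n i] force_bound_nonneg[of n] by (auto simp: cut_force_def)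

lemma cut_force_measurable: "w \<in> space P \<Longrightarrow> i \<in> {0..int M} \<Longrightarrow> set_borel_measurable borel {0..t} (\<lambda>r. cut_force n i r w)"
  unfolding cut_force_def by (rule cutoff_measurable[OF force_continuous])

lemma cut_force_integrable:
  assumes "w \<in> space P" "i \<in> {0..int M}"
  shows "set_integrable (stieltjes (\<lambda>r. Q r w)) {0..t} (\<lambda>r. cut_force n i r w)"
proof -
  interpret clock_path "\<lambda>r. Q r w" by (rule Q_clock[OF assms(1)])
  show ?thesis
    by (rule stieltjes_set_integrable[OF order_refl _ cut_force_measurable[OF assms]])
      (use cut_force_bounded[OF assms] in auto)
qed

lemma cut_force_integral_continuous:
  assumes "w \<in> space P" "i \<in> {0..int M}"
  shows "continuous_on {0..t} (\<lambda>s. LINT r:{0..s}|stieltjes (\<lambda>r. Q r w). cut_force n i r w)"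
proof -
  interpret clock_path "\<lambda>r. Q r w" by (rule Q_clock[OF assms(1)])
  show ?thesis
    by (rule stieltjes_integral_continuous_on[OF cut_force_measurable[OF assms]]) (use cut_force_bounded[OF assms] in auto)
qed

lemma drive_continuous:
  assumes "w \<in> space P"
  shows "continuous_on {0..t} (drive n w)"
  unfolding drive_def[abs_def]
  by (intro continuous_intros cut_force_integral_continuous[OF assms] continuous_on_subset[OF A_continuous[OF assms]]) auto

lemma lcoef_drive_continuous: "w \<in> space P \<Longrightarrow> continuous_on {0..t} (lcoef (\<lambda>r. Q r w) (drive n w) m)"
  by (rule clock_path.lcoef_continuous_on[OF Q_clock drive_continuous])

lemma hcoef_drive_continuous:
  "w \<in> space P \<Longrightarrow> continuous_on {0..t} (\<lambda>r. 2 * hcoef (drive n w r) (\<lambda>j. lcoef (\<lambda>r. Q r w) (drive n w) j r) m)"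
  by (intro continuous_on_mult continuous_on_const hcoef_continuous_on drive_continuous lcoef_drive_continuous)

lemma state_continuous: "w \<in> space P \<Longrightarrow> continuous_on {0..t} (\<lambda>r. state n w r i)"
  unfolding state_def using drive_continuous[of w t n] cut_force_integral_continuous[of w i t n] lcoef_drive_continuous[of w t n]
  by (cases "i = 0"; cases "i \<in> {1..int M}"; cases "i < 0") (auto intro!: continuous_intros)

lemma state_density_integrable:
  assumes w: "w \<in> space P"
  shows "set_integrable (stieltjes (\<lambda>r. Q r w)) {0..t} (\<lambda>r. state_density n w r i)"
proof -
  interpret clock_path "\<lambda>r. Q r w" by (rule Q_clock[OF w])
  consider "i \<in> {0..int M}" | "i < 0" | "i \<notin> {0..int M}" "\<not> i < 0" by fastforce
  then show ?thesis
  proof cases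
    case 1
    then show ?thesis using cut_force_integrable[OF w 1, of t n] by (simp add: state_density_def)
  next
    case 2
    then show ?thesis
      using continuous_set_integrable[OF hcoef_drive_continuous[OF w, of t n "nat (- 1 - i)"]] by (simp add: state_density_def)
  qed (simp add: state_density_def set_integrable_def)
qed

lemma state_density_measurable: "w \<in> space P \<Longrightarrow> set_borel_measurable borel {0..t} (\<lambda>r. state_density n w r i)"
  using borel_measurable_integrable[OF state_density_integrable[unfolded set_integrable_def], of w t n i]
  by (simp add: set_borel_measurable_def stieltjes_def cong: measurable_cong_sets)

lemma state_increment:
  assumes w: "w \<in> space P" and ur: "0 \<le> u" "u \<le> r"
  shows "state n w r i - state n w u i =
    (if i = 0 then sqrt \<kappa> * (A r w - A u w) else 0) + (LINT a:{u<..r}|stieltjes (\<lambda>r. Q r w). state_density n w a i)"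
proof -
  interpret clock_path "\<lambda>r. Q r w" by (rule Q_clock[OF w])
  note split = stieltjes_integral_split[OF ur state_density_integrable[OF w], of n i]
  have lc: "lcoef (\<lambda>r. Q r w) (drive n w) m s = (LINT r:{0..s}|stieltjes (\<lambda>r. Q r w). 2 * hcoef (drive n w r) (\<lambda>j. lcoef (\<lambda>r. Q r w) (drive n w) j r) m)" for m s
    by (rule lcoef_eq)
  consider "i = 0" | "i \<in> {1..int M}" | "i < 0" | "i > int M" by fastforce
  then show ?thesis
  proof cases
    case 1
    then show ?thesis using split by (simp add: state_density_def state_def drive_def algebra_simps)
  next
    case 2
    then show ?thesis using split by (simp add: state_density_def state_def)
  next
    case 3
    then show ?thesis using split lc[of "nat (- 1 - i)" r] lc[of "nat (- 1 - i)" u] by (simp add: state_density_def state_def)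
  next
    case 4
    then show ?thesis by (simp add: state_density_def state_def set_lebesgue_integral_def)
  qed
qed

lemma lcoef_bounded:
  assumes B0: "\<And>w r. w \<in> space P \<Longrightarrow> 0 \<le> r \<Longrightarrow> ennreal r \<le> exit n w \<Longrightarrow> \<bar>drive n w r\<bar> \<le> B0 \<and> Q r w \<le> q"
  shows "\<exists>B\<ge>B0. \<forall>m\<le>N. \<forall>w\<in>space P. \<forall>r\<ge>0. ennreal r \<le> exit n w \<longrightarrow> \<bar>lcoef (\<lambda>r. Q r w) (drive n w) m r\<bar> \<le> B"
proof (induction N)
  case 0
  have "lcoef (\<lambda>r. Q r w) (drive n w) 0 r = 0" for w r
    by (subst lcoef_eq) (simp add: set_lebesgue_integral_def)
  then show ?case by (intro exI[of _ "\<bar>B0\<bar>"]) auto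
next
  case (Suc N)
  then obtain B where B: "B \<ge> B0" "\<And>m w r. m \<le> N \<Longrightarrow> w \<in> space P \<Longrightarrow> 0 \<le> r \<Longrightarrow> ennreal r \<le> exit n w \<Longrightarrow> \<bar>lcoef (\<lambda>r. Q r w) (drive n w) m r\<bar> \<le> B"
    by blast
  obtain C where C: "C \<ge> 0" "\<forall>m\<le>Suc N. \<forall>x c. \<bar>x\<bar> \<le> B \<longrightarrow> (\<forall>i<Suc N. \<bar>c i\<bar> \<le> B) \<longrightarrow> \<bar>hcoef x c m\<bar> \<le> C"
    using hcoef_bounded[of "Suc N" B] by blast
  have new: "\<bar>lcoef (\<lambda>r. Q r w) (drive n w) (Suc N) r\<bar> \<le> \<bar>2 * C * q\<bar>"
    if w: "w \<in> space P" and r: "0 \<le> r" "ennreal r \<le> exit n w" for w r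
  proof -
    interpret clock_path "\<lambda>r. Q r w" by (rule Q_clock[OF w])
    have "norm (LINT s:{0<..r}|stieltjes (\<lambda>r. Q r w). 2 * hcoef (drive n w s) (\<lambda>i. lcoef (\<lambda>r. Q r w) (drive n w) i s) (Suc N)) \<le> 2 * C * (Q r w - Q 0 w)"
    proof (rule stieltjes_integral_bound)
      fix s assume "s \<in> {0<..r}"
      then have s: "0 \<le> s" "ennreal s \<le> exit n w" using r order_trans[OF ennreal_leI r(2), of s] by auto
      have "\<bar>drive n w s\<bar> \<le> B" using B0[OF w s] B(1) by auto
      moreover have "\<forall>i<Suc N. \<bar>lcoef (\<lambda>r. Q r w) (drive n w) i s\<bar> \<le> B" using B(2)[OF _ w s] by simp
      ultimately have "\<bar>hcoef (drive n w s) (\<lambda>i. lcoef (\<lambda>r. Q r w) (drive n w) i s) (Suc N)\<bar> \<le> C"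
        using C(2)[rule_format, OF order_refl, of "drive n w s" "\<lambda>i. lcoef (\<lambda>r. Q r w) (drive n w) i s"] by blast
      then show "norm (2 * hcoef (drive n w s) (\<lambda>i. lcoef (\<lambda>r. Q r w) (drive n w) i s) (Suc N)) \<le> 2 * C"
        by (simp add: abs_mult)
    qed (use r C in auto)
    also have "\<dots> \<le> 2 * C * q" using Q_0[OF w] B0[OF w r] C(1) by (intro mult_left_mono) auto
    finally show ?thesis
      by (subst lcoef_eq) (simp add: stieltjes_integral_Icc)
  qed
  show ?case
  proof (intro exI[of _ "\<bar>B\<bar> + \<bar>2 * C * q\<bar>"] conjI allI ballI impI)
    show "B0 \<le> \<bar>B\<bar> + \<bar>2 * C * q\<bar>" using B(1) by linarith
    fix m w r assume "m \<le> Suc N" "w \<in> space P" "0 \<le> r" "ennreal r \<le> exit n w"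
    then show "\<bar>lcoef (\<lambda>r. Q r w) (drive n w) m r\<bar> \<le> \<bar>B\<bar> + \<bar>2 * C * q\<bar>"
      using new[of w r] B(2)[of m w r] by (cases "m = Suc N") auto
  qed
qed

lemma state_bounded:
  "\<exists>B\<ge>0. \<forall>i\<in>{- 1 - int N..int M}. \<forall>w\<in>space P. \<forall>r\<ge>0. ennreal r \<le> exit n w \<longrightarrow>
     \<bar>state n w r i\<bar> \<le> B \<and> \<bar>state_density n w r i\<bar> \<le> B"
proof -
  interpret W: ito_clock P F "\<lambda>t w. A (stop (exit n w) t) w - A 0 w" "\<lambda>t w. Q (stop (exit n w) t) w" "2 * real n"
    by (rule exit_clock)
  define B0 where "B0 = \<bar>x0\<bar> + (\<Sum>K=1..M. \<bar>y0 K\<bar>) + \<bar>sqrt \<kappa>\<bar> * (2 * real n) + force_bound n * (2 * real n)"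
  have y0: "0 \<le> (\<Sum>K=1..M. \<bar>y0 K\<bar>)" by (intro sum_nonneg) auto
  have AQ: "\<bar>A r w - A 0 w\<bar> \<le> 2 * real n" "Q r w \<le> 2 * real n" if "w \<in> space P" "0 \<le> r" "ennreal r \<le> exit n w" for w r
    using W.W_bd[OF that(1,2)] W.q_bd[OF that(1,2)] stop_before[OF that(2,3)] by simp_all
  have int: "\<bar>LINT s:{0..r}|stieltjes (\<lambda>r. Q r w). cut_force n i s w\<bar> \<le> force_bound n * (2 * real n)"
    if w: "w \<in> space P" and r: "0 \<le> r" "ennreal r \<le> exit n w" and i: "i \<in> {0..int M}" for w r i
  proof -
    interpret clock_path "\<lambda>r. Q r w" by (rule Q_clock[OF w])
    have "norm (LINT s:{0<..r}|stieltjes (\<lambda>r. Q r w). cut_force n i s w) \<le> force_bound n * (Q r w - Q 0 w)"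
      using r cut_force_bounded[OF w i] force_bound_nonneg by (intro stieltjes_integral_bound) auto
    also have "\<dots> \<le> force_bound n * (2 * real n)"
      using AQ[OF w r] Q_0[OF w] force_bound_nonneg by (intro mult_left_mono) auto
    finally show ?thesis by (simp add: stieltjes_integral_Icc)
  qed
  have drive_bd: "\<bar>drive n w r\<bar> \<le> B0" if "w \<in> space P" "0 \<le> r" "ennreal r \<le> exit n w" for w r
  proof -
    have "\<bar>sqrt \<kappa> * (A r w - A 0 w)\<bar> \<le> \<bar>sqrt \<kappa>\<bar> * (2 * real n)"
      unfolding abs_mult using AQ(1)[OF that] by (intro mult_left_mono) auto
    moreover have "\<bar>LINT s:{0..r}|stieltjes (\<lambda>r. Q r w). cut_force n 0 s w\<bar> \<le> force_bound n * (2 * real n)"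
      using int[OF that, of 0] by simp
    ultimately show ?thesis
      unfolding drive_def B0_def using y0 by linarith
  qed
  obtain B where B: "B \<ge> B0" "\<And>m w r. m \<le> N \<Longrightarrow> w \<in> space P \<Longrightarrow> 0 \<le> r \<Longrightarrow> ennreal r \<le> exit n w \<Longrightarrow> \<bar>lcoef (\<lambda>r. Q r w) (drive n w) m r\<bar> \<le> B"
    using lcoef_bounded[of n B0 "2 * real n" N] drive_bd AQ(2) by blast
  obtain C where C: "C \<ge> 0" "\<forall>m\<le>N. \<forall>x c. \<bar>x\<bar> \<le> B \<longrightarrow> (\<forall>i<N. \<bar>c i\<bar> \<le> B) \<longrightarrow> \<bar>hcoef x c m\<bar> \<le> C"
    using hcoef_bounded[of N B] by blast
  define D where "D = \<bar>B\<bar> + 2 * C + force_bound n"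
  show ?thesis
  proof (intro exI[of _ D] conjI ballI allI impI)
    show "0 \<le> D" using C(1) force_bound_nonneg by (simp add: D_def)
    fix i w r assume i: "i \<in> {- 1 - int N..int M}" and w: "w \<in> space P" and r: "0 \<le> r" "ennreal r \<le> exit n w"
    have d: "\<bar>drive n w r\<bar> \<le> B" using drive_bd[OF w r] B(1) by linarith
    consider "i = 0" | "i \<in> {1..int M}" | "i < 0" using i by fastforce
    then have "\<bar>state n w r i\<bar> \<le> \<bar>B\<bar>"
    proof cases
      case 1
      then show ?thesis using d by (simp add: state_def)
    next
      case 2
      then have "nat i \<in> {1..M}" by auto
      then have "\<bar>y0 (nat i)\<bar> \<le> (\<Sum>K=1..M. \<bar>y0 K\<bar>)" by (intro member_le_sum) auto
      moreover have "0 \<le> \<bar>sqrt \<kappa>\<bar> * (2 * real n)" by simp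
      moreover have "\<bar>LINT s:{0..r}|stieltjes (\<lambda>r. Q r w). cut_force n i s w\<bar> \<le> force_bound n * (2 * real n)"
        using int[OF w r, of i] 2 by simp
      ultimately have "\<bar>y0 (nat i) + (LINT s:{0..r}|stieltjes (\<lambda>r. Q r w). cut_force n i s w)\<bar> \<le> B0"
        unfolding B0_def by linarith
      then show ?thesis using 2 B(1) by (simp add: state_def)
    next
      case 3
      then have "\<bar>lcoef (\<lambda>r. Q r w) (drive n w) (nat (- 1 - i)) r\<bar> \<le> B" using i by (intro B(2)[OF _ w r]) auto
      also have "\<dots> \<le> \<bar>B\<bar>" by simp
      finally show ?thesis using 3 by (simp add: state_def)
    qed
    then show "\<bar>state n w r i\<bar> \<le> D" using C(1) force_bound_nonneg[of n] by (simp add: D_def)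
    show "\<bar>state_density n w r i\<bar> \<le> D"
    proof (cases "i < 0")
      case True
      have "\<forall>i<N. \<bar>lcoef (\<lambda>r. Q r w) (drive n w) i r\<bar> \<le> B" using B(2)[OF _ w r] by simp
      moreover have "nat (- 1 - i) \<le> N" using i by auto
      ultimately have "\<bar>hcoef (drive n w r) (\<lambda>j. lcoef (\<lambda>r. Q r w) (drive n w) j r) (nat (- 1 - i))\<bar> \<le> C"
        using C(2)[rule_format, OF _ d, of "nat (- 1 - i)" "\<lambda>j. lcoef (\<lambda>r. Q r w) (drive n w) j r"] by blast
      then show ?thesis using True force_bound_nonneg[of n] by (simp add: state_density_def D_def abs_mult)
    next
      case False
      then show ?thesis using cut_force_bounded[OF w _ r(1), of i n] C(1) i by (auto simp: state_density_def D_def)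
    qed
  qed
qed

lemma cut_force_integral_adapted:
  assumes "i \<in> {0..int M}" "0 \<le> t"
  shows "(\<lambda>w. LINT r:{0..stop (exit n w) t}|stieltjes (\<lambda>r. Q r w). cut_force n i r w) \<in> borel_measurable (F (ennreal t))"
  unfolding cut_force_def
  by (rule stieltjes_integral_adapted[OF exit_stopping Q_clock Q_adapted force_adapted[OF assms(1)]
        force_continuous[OF _ assms(1)] force_bounded[OF _ _ _ assms(1)] assms(2)])

lemma drive_adapted:
  assumes "0 \<le> t"
  shows "(\<lambda>w. drive n w (stop (exit n w) t)) \<in> borel_measurable (F (ennreal t))"
  unfolding drive_def
proof (intro borel_measurable_add borel_measurable_times borel_measurable_diff borel_measurable_const)
  show "(\<lambda>w. A (stop (exit n w) t) w) \<in> borel_measurable (F (ennreal t))"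
    by (rule stopped_adapted[OF exit_stopping A_adapted A_continuous assms])
  show "A 0 \<in> borel_measurable (F (ennreal t))"
    by (rule measurable_F_mono[OF A_adapted[OF order_refl]]) simp
qed (use cut_force_integral_adapted[OF _ assms] in auto)

text \<open>Strong induction along the triangular system. The integrand is evaluated at stopped
  times to be adapted; it agrees with the original one before the exit time, which is all that the
  cut-off integral sees.\<close>

lemma lcoef_adapted:
  "0 \<le> t \<Longrightarrow> (\<lambda>w. lcoef (\<lambda>r. Q r w) (drive n w) m (stop (exit n w) t)) \<in> borel_measurable (F (ennreal t))"
proof (induction m arbitrary: t rule: less_induct)
  case (less m)
  define b where "b = (\<lambda>r w. 2 * hcoef (drive n w (stop (exit n w) r)) (\<lambda>j. lcoef (\<lambda>r. Q r w) (drive n w) j (stop (exit n w) r)) m)"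
  have b_eq: "b r w = 2 * hcoef (drive n w r) (\<lambda>j. lcoef (\<lambda>r. Q r w) (drive n w) j r) m"
    if "0 \<le> r" "ennreal r \<le> exit n w" for r w
    using stop_before[OF that] by (simp add: b_def)
  obtain B where B: "\<forall>i\<in>{- 1 - int m..int M}. \<forall>w\<in>space P. \<forall>r\<ge>0. ennreal r \<le> exit n w \<longrightarrow> \<bar>state n w r i\<bar> \<le> B \<and> \<bar>state_density n w r i\<bar> \<le> B"
    using state_bounded[of m n] by blast
  have eq: "lcoef (\<lambda>r. Q r w) (drive n w) m (stop (exit n w) t) =
      (LINT r:{0..stop (exit n w) t}|stieltjes (\<lambda>r. Q r w). if ennreal r < exit n w then b r w else 0)"
    if w: "w \<in> space (F (ennreal t))" for w
  proof -
    have w: "w \<in> space P" using w by (simp add: space_F)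
    interpret clock_path "\<lambda>r. Q r w" by (rule Q_clock[OF w])
    have "(LINT r:{0..stop (exit n w) t}|stieltjes (\<lambda>r. Q r w). if ennreal r < exit n w then b r w else 0) =
      (LINT r:{0..stop (exit n w) t}|stieltjes (\<lambda>r. Q r w). if ennreal r < exit n w
         then 2 * hcoef (drive n w r) (\<lambda>j. lcoef (\<lambda>r. Q r w) (drive n w) j r) m else 0)"
      by (rule set_lebesgue_integral_cong) (auto simp: b_eq)
    also have "\<dots> = lcoef (\<lambda>r. Q r w) (drive n w) m (stop (exit n w) t)"
      by (subst lcoef_eq) (rule stieltjes_integral_cutoff[OF hcoef_drive_continuous[OF w]])
    finally show ?thesis ..
  qed
  show ?case
  proof (subst measurable_cong[OF eq], assumption, rule stieltjes_integral_adapted[OF exit_stopping Q_clock Q_adapted _ _ _ less.prems, where c = "\<bar>B\<bar>"])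
    fix r :: real assume r: "0 \<le> r"
    show "b r \<in> borel_measurable (F (ennreal r))"
      unfolding b_def by (intro borel_measurable_times borel_measurable_const hcoef_measurable drive_adapted[OF r] less.IH r)
  next
    fix w assume w: "w \<in> space P"
    define b' where "b' = (\<lambda>r. 2 * hcoef (drive n w r) (\<lambda>j. lcoef (\<lambda>r. Q r w) (drive n w) j r) m)"
    have "continuous_on {0..} (drive n w)" "continuous_on {0..} (lcoef (\<lambda>r. Q r w) (drive n w) j)" for j
      by (auto intro!: continuous_on_halfline drive_continuous[OF w] lcoef_drive_continuous[OF w])
    then have "continuous_on {0..} b'" unfolding b'_def by (intro continuous_on_mult continuous_on_const hcoef_continuous_on)
    then have "continuous_on {r. 0 \<le> r \<and> ennreal r < exit n w} b'" by (rule continuous_on_subset) auto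
    then show "continuous_on {r. 0 \<le> r \<and> ennreal r < exit n w} (\<lambda>r. b r w)"
      by (rule continuous_on_eq) (auto simp: b_eq b'_def)
    fix r assume r: "0 \<le> r" "ennreal r < exit n w"
    have "\<bar>state_density n w r (- 1 - int m)\<bar> \<le> B" using B w r by auto
    then show "\<bar>b r w\<bar> \<le> \<bar>B\<bar>" using r by (simp add: state_density_def b_eq)
  qed
qed

lemma state_adapted:
  assumes "0 \<le> t"
  shows "(\<lambda>w. state n w (stop (exit n w) t) i) \<in> borel_measurable (F (ennreal t))"
  unfolding state_def using drive_adapted[OF assms, of n] cut_force_integral_adapted[OF _ assms, of i n] lcoef_adapted[OF assms, of n]
  by (cases "i = 0"; cases "i \<in> {1..int M}"; cases "i < 0") auto

end

section \<open>The generator along the regularised process\<close>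

text \<open>The generator per unit of the clock; N is the number of coefficients of g that are
  followed, and the last sum is their drift under the Loewner flow.\<close>

definition sle_generator :: "real \<Rightarrow> nat \<Rightarrow> (nat \<Rightarrow> real) \<Rightarrow> nat \<Rightarrow> ((int \<Rightarrow> complex) \<Rightarrow> complex) \<Rightarrow> (int \<Rightarrow> complex) \<Rightarrow> complex" where
  "sle_generator \<kappa> M \<rho> N p s =
     of_real (\<kappa> / 2) * pdiff 0 (pdiff 0 p) s
     + (\<Sum>K=1..M. of_real (\<rho> K) / (s 0 - s (int K))) * pdiff 0 p s
     + (\<Sum>K=1..M. 2 / (s (int K) - s 0) * pdiff (int K) p s)
     + (\<Sum>i=1..N. 2 * hcoef (s 0) (\<lambda>i. s (- 1 - int i)) i * pdiff (- 1 - int i) p s)"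

lemma sle_generator_cmult:
  assumes "p \<in> polyfun I"
  shows "sle_generator \<kappa> M \<rho> N (\<lambda>s. c * p s) s = c * sle_generator \<kappa> M \<rho> N p s"
proof -
  have 1: "pdiff i (\<lambda>s. c * p s) = (\<lambda>s. c * pdiff i p s)" for i by (rule ext) (rule pdiff_cmult[OF assms])
  have 2: "pdiff 0 (\<lambda>s. c * pdiff 0 p s) s = c * pdiff 0 (pdiff 0 p) s" by (rule pdiff_cmult[OF pdiff_polyfun[OF assms]])
  show ?thesis unfolding sle_generator_def 1 2 by (simp add: sum_distrib_left algebra_simps)
qed

definition sle_index :: "nat \<Rightarrow> nat \<Rightarrow> int set" where
  "sle_index M N = {0..int M} \<union> {- 1 - int N..-2}"

lemma sum_sle_index:
  "(\<Sum>i\<in>sle_index M N. f i) = f 0 + (\<Sum>K=1..M. f (int K)) + (\<Sum>i=1..N. f (- 1 - int i) :: 'b :: comm_monoid_add)"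
proof -
  have neg: "{- 1 - int N..-2} = (\<lambda>i. - 1 - int i) ` {1..N}"
  proof (rule set_eqI)
    fix x show "x \<in> {- 1 - int N..-2} \<longleftrightarrow> x \<in> (\<lambda>i. - 1 - int i) ` {1..N}"
      by (auto intro!: image_eqI[where x = "nat (- 1 - x)"])
  qed
  have pos: "{1..int M} = int ` {1..M}" by (simp add: image_int_atLeastAtMost)
  have "sle_index M N = insert 0 ({1..int M} \<union> {- 1 - int N..-2})" by (auto simp: sle_index_def)
  then have "(\<Sum>i\<in>sle_index M N. f i) = f 0 + (sum f {1..int M} + sum f {- 1 - int N..-2})"
    by (simp add: sum.union_disjoint)
  also have "sum f {1..int M} = (\<Sum>K=1..M. f (int K))" unfolding pos by (subst sum.reindex) auto
  also have "sum f {- 1 - int N..-2} = (\<Sum>i=1..N. f (- 1 - int i))" unfolding neg by (subst sum.reindex) (auto simp: inj_on_def)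
  finally show ?thesis by (simp add: add.assoc)
qed

lemma finite_sle_index: "finite (sle_index M N)" by (simp add: sle_index_def)

context sle_kappa_rho
begin

text \<open>X agrees with \<open>drive\<close> on all of [0, t] and not just at t;
  \<open>lcoef_cong\<close> then passes from the coefficients driven by X to those driven by
  \<open>drive\<close>.\<close>

lemma state_identification:
  "AE w in P. \<forall>n t. 0 \<le> t \<longrightarrow> ennreal t < exit n w \<longrightarrow>
     state n w t 0 = X t w \<and> (\<forall>K\<in>{1..M}. state n w t (int K) = Y K t w) \<and>
     (\<forall>m\<ge>1. gc t w (- 1 - int m) = of_real (state n w t (- 1 - int m)))"
  using X_sde Y_ode loewner expansion AE_space
proof eventually_elim
  case (elim w)
  show ?case
  proof (intro allI impI)
    fix n and t :: real assume t: "0 \<le> t" and lt: "ennreal t < exit n w"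
    have w: "w \<in> space P" using elim by simp
    interpret clock_path "\<lambda>r. Q r w" by (rule Q_clock[OF w])
    have before: "ennreal r < exit n w" "ennreal r < \<tau> w" if "0 \<le> r" "r \<le> t" for r
    proof -
      show *: "ennreal r < exit n w" by (rule order_le_less_trans[OF ennreal_leI[OF that(2)] lt])
      show "ennreal r < \<tau> w" by (rule exit_before(1)[OF w that(1) *])
    qed
    have cutf: "(LINT r:{0..s}|stieltjes (\<lambda>r. Q r w). cut_force n i r w) = (LINT r:{0..s}|stieltjes (\<lambda>r. Q r w). force i r w)"
      if "s \<le> t" for s i
      by (rule set_lebesgue_integral_cong) (use that before in \<open>auto simp: cut_force_def\<close>)
    have X: "X s w = drive n w s" if s: "s \<in> {0..t}" for s
      using elim(1) before(2)[of s] s cutf[of s 0] by (simp add: drive_def force_def)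
    have Y: "Y K t w = state n w t (int K)" if K: "K \<in> {1..M}" for K
      using elim(2) before(2)[of t] t cutf[of t "int K"] K by (simp add: state_def force_def)
    have gc: "gc t w (- 1 - int m) = of_real (state n w t (- 1 - int m))" if m: "1 \<le> m" for m
    proof -
      obtain R where R: "\<And>z. Im z > 0 \<Longrightarrow> norm z > R \<Longrightarrow> ((\<lambda>m. gc t w m * z powi (1 + m)) has_sum (g t w z - z)) {..-2}"
        using elim(4) t before(2)[OF t] by blast
      have sol: "loewner_solution (\<lambda>s. Q s w) (\<lambda>s. X s w) t z (\<lambda>s. g s w z)"
        if "Im z > 0" "\<exists>v. loewner_solution (\<lambda>s. Q s w) (\<lambda>s. X s w) t z v" for z
        using elim(3) t before(2)[OF t] that by blast
      have "continuous_on {0..t} (\<lambda>s. X s w)"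
        by (rule continuous_on_subset[OF X_continuous[OF w]]) (use before(2) in auto)
      from expansion_coefficients[OF t this sol R m]
      have "gc t w (- 1 - int m) = of_real (lcoef (\<lambda>s. Q s w) (\<lambda>s. X s w) m t)" by blast
      also have "lcoef (\<lambda>s. Q s w) (\<lambda>s. X s w) m t = lcoef (\<lambda>s. Q s w) (drive n w) m t"
        by (rule lcoef_cong[OF X]) (use t in auto)
      finally show ?thesis by (simp add: state_def)
    qed
    show "state n w t 0 = X t w \<and> (\<forall>K\<in>{1..M}. state n w t (int K) = Y K t w) \<and>
      (\<forall>m\<ge>1. gc t w (- 1 - int m) = of_real (state n w t (- 1 - int m)))"
      using X[of t] Y gc t by (auto simp: state_def)
  qed
qed

lemma drift_eq_generator:
  assumes w: "w \<in> space P" and t: "0 \<le> t" "ennreal t < exit n w"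
    and X: "state n w t 0 = X t w" and Y: "\<And>K. K \<in> {1..M} \<Longrightarrow> state n w t (int K) = Y K t w"
  shows "of_real (\<kappa> / 2) * pdiff 0 (pdiff 0 p) (cstate (state n w) t) + drift (sle_index M N) p (state n w) (state_density n w) t
    = sle_generator \<kappa> M \<rho> N p (cstate (state n w) t)"
proof -
  define s where "s = cstate (state n w) t"
  have s: "s 0 = of_real (X t w)" "\<And>K. K \<in> {1..M} \<Longrightarrow> s (int K) = of_real (Y K t w)"
    using X Y by (simp_all add: s_def cstate_def)
  have d0: "complex_of_real (state_density n w t 0) = (\<Sum>K=1..M. of_real (\<rho> K) / (s 0 - s (int K)))"
    using t s by (simp add: state_density_def cut_force_def force_def)
  have dK: "complex_of_real (state_density n w t (int K)) = 2 / (s (int K) - s 0)" if "K \<in> {1..M}" for K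
    using t s(1) s(2)[OF that] that by (simp add: state_density_def cut_force_def force_def)
  have "s 0 = of_real (drive n w t)" "s (- 1 - int j) = of_real (lcoef (\<lambda>r. Q r w) (drive n w) j t)" for j
    by (simp_all add: s_def cstate_def state_def)
  then have di: "complex_of_real (state_density n w t (- 1 - int i)) = 2 * hcoef (s 0) (\<lambda>j. s (- 1 - int j)) i" for i
    by (simp add: state_density_def hcoef_of_real)
  show ?thesis
    unfolding drift_def sum_sle_index sle_generator_def s_def[symmetric] d0 di
    using dK by (simp add: mult.commute add.assoc)
qed

lemma polyfun_state_adapted:
  assumes "p \<in> polyfun I" "0 \<le> t"
  shows "(\<lambda>w. p (cstate (state n w) (stop (exit n w) t))) \<in> borel_measurable (F (ennreal t))"
  using assms(1)
proof induction
  case (coord i)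
  show ?case unfolding cstate_def
    using state_adapted[OF assms(2), of n i] by measurable
qed auto

lemma polyfun_state_bounded:
  assumes "p \<in> polyfun (sle_index M N)"
  shows "\<exists>C. \<forall>w\<in>space P. \<forall>t\<ge>0. norm (p (cstate (state n w) (stop (exit n w) t))) \<le> C"
proof -
  obtain B where B: "\<forall>i\<in>{- 1 - int N..int M}. \<forall>w\<in>space P. \<forall>r\<ge>0. ennreal r \<le> exit n w \<longrightarrow>
      \<bar>state n w r i\<bar> \<le> B \<and> \<bar>state_density n w r i\<bar> \<le> B"
    using state_bounded[of N n] by blast
  obtain C where C: "\<forall>s. (\<forall>i\<in>sle_index M N. norm (s i) \<le> B) \<longrightarrow> norm (p s) \<le> C"
    using polyfun_bounded[OF assms, of B] by blast
  show ?thesis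
  proof (intro exI[of _ C] ballI allI impI)
    fix w and t :: real assume w: "w \<in> space P" and t: "0 \<le> t"
    have "norm (cstate (state n w) (stop (exit n w) t) i) \<le> B" if "i \<in> sle_index M N" for i
    proof -
      have "i \<in> {- 1 - int N..int M}" using that by (auto simp: sle_index_def)
      then show ?thesis using B w stop_bounds(1)[of "exit n w" t] stop_le[of "exit n w" t] by (simp add: cstate_def)
    qed
    then show "norm (p (cstate (state n w) (stop (exit n w) t))) \<le> C" using C by blast
  qed
qed

lemma polyfun_state_continuous:
  assumes "p \<in> polyfun I" "w \<in> space P"
  shows "continuous_on {0..} (\<lambda>t. p (cstate (state n w) (stop (exit n w) t)))"
  using assms(1)
proof induction
  case (coord i)
  have "continuous_on {0..} (\<lambda>r. state n w r i)" by (rule continuous_on_halfline[OF state_continuous[OF assms(2)]])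
  then have "continuous_on {0..} (\<lambda>t. state n w (stop (exit n w) t) i)"
    by (rule continuous_on_compose2[OF _ stop_continuous_on]) (auto simp: stop_bounds)
  then show ?case unfolding cstate_def by (rule continuous_on_of_real)
qed (auto intro!: continuous_intros)

text \<open>Translates oscillation bounds for the stopped processes on [s, t] into those for the
  path on the interval between the stopped times.\<close>

lemma state_ito_step:
  assumes w: "w \<in> space P" and st: "0 \<le> s" "s \<le> t" and e: "e \<le> E"
    and osc: "\<And>r. r \<in> {s..t} \<Longrightarrow> \<bar>A (stop (exit n w) r) w - A (stop (exit n w) s) w\<bar> \<le> e \<and>
      Q (stop (exit n w) r) w - Q (stop (exit n w) s) w \<le> e"
    and B: "\<forall>i\<in>{- 1 - int N..int M}. \<forall>w\<in>space P. \<forall>r\<ge>0. ennreal r \<le> exit n w \<longrightarrow>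
      \<bar>state n w r i\<bar> \<le> B \<and> \<bar>state_density n w r i\<bar> \<le> B"
  shows "ito_step (sle_index M N) (sqrt \<kappa>) B E (\<lambda>r. Q r w) (\<lambda>r. A r w) (state n w) (state_density n w)
    (stop (exit n w) s) (stop (exit n w) t) e"
proof -
  define u v where "u = stop (exit n w) s" and "v = stop (exit n w) t"
  have uv: "0 \<le> u" "u \<le> v" unfolding u_def v_def using st by (auto intro: stop_bounds stop_mono)
  have vt: "v \<le> t" unfolding v_def using st by (intro stop_bounds) simp
  have before: "ennreal r \<le> exit n w" if "r \<le> v" for r
    by (rule order_trans[OF ennreal_leI[OF that]]) (simp add: v_def stop_le)
  have I: "i \<in> {- 1 - int N..int M}" if "i \<in> sle_index M N" for i using that by (auto simp: sle_index_def)
  have osc': "\<bar>A r w - A u w\<bar> \<le> e \<and> Q r w - Q u w \<le> e" if r: "r \<in> {u..v}" for r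
  proof (cases "s \<le> r")
    case True
    have "stop (exit n w) r = r" using r uv before by (intro stop_before) auto
    then show ?thesis using osc[of r] True r vt by (simp add: u_def)
  next
    case False
    \<comment> \<open>A time of [u, v] below s occurs only if the exit is not after s, and then the
      interval is a point.\<close>
    have "exit n w \<le> ennreal s"
    proof (rule ccontr)
      assume "\<not> exit n w \<le> ennreal s"
      then have "u = s" unfolding u_def using st by (intro stop_before) auto
      then show False using False r by simp
    qed
    then have "v = u" unfolding u_def v_def using st by (intro stop_after)
    then have "r = u" using r by simp
    then show ?thesis using osc[of s] st by simp
  qed
  have "0 \<le> e" using osc[of s] st by simp
  then show ?thesis
    unfolding ito_step_def u_def[symmetric] v_def[symmetric]
  proof (intro conjI ballI)
    fix i assume i: "i \<in> sle_index M N"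
    show "\<bar>state n w r i\<bar> \<le> B" if "r \<in> {u..v}" for r using B I[OF i] w before[of r] uv that by simp
    show "\<bar>state_density n w r i\<bar> \<le> B" if "r \<in> {u<..v}" for r using B I[OF i] w before[of r] uv that by simp
    show "continuous_on {u..v} (\<lambda>r. state n w r i)"
      by (rule continuous_on_subset[OF state_continuous[OF w, of v]]) (use uv in auto)
    show "set_borel_measurable borel {u<..v} (\<lambda>r. state_density n w r i)"
      by (rule set_borel_measurable_subset_real[OF state_density_measurable[OF w, of v]]) (use uv in auto)
    show "state n w r i - state n w u i = (if i = 0 then sqrt \<kappa> * (A r w - A u w) else 0)
        + (LINT a:{u<..r}|stieltjes (\<lambda>r. Q r w). state_density n w a i)" if "r \<in> {u..v}" for r
      using that uv by (intro state_increment[OF w]) auto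
  qed (use osc' uv e Q_clock[OF w] in auto)
qed

text \<open>The criterion is applied with multiples of the first and second derivative of p as H and
  K. Before the exit time X differs from every Y^K, so the generator vanishes there.\<close>

lemma generator_martingale:
  assumes \<kappa>: "0 < \<kappa>" and p: "p \<in> polyfun (sle_index M N)"
    and gen: "\<And>s. (\<And>K. K \<in> {1..M} \<Longrightarrow> s 0 \<noteq> s (int K)) \<Longrightarrow> sle_generator \<kappa> M \<rho> N p s = 0"
  shows "martingale P F (\<lambda>t w. Re (p (cstate (state n w) (stop (exit n w) t))))"
proof -
  interpret W: ito_clock P F "\<lambda>t w. A (stop (exit n w) t) w - A 0 w" "\<lambda>t w. Q (stop (exit n w) t) w" "2 * real n"
    by (rule exit_clock)
  define I where "I = sle_index M N"
  define \<sigma> where "\<sigma> = sqrt \<kappa>"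
  define pH where "pH = (\<lambda>s. of_real \<sigma> * pdiff 0 p s)"
  define pK where "pK = (\<lambda>s. of_real (\<sigma>\<^sup>2 / 2) * pdiff 0 (pdiff 0 p) s)"
  have pI: "p \<in> polyfun I" "pH \<in> polyfun I" "pK \<in> polyfun I"
    unfolding pH_def pK_def I_def by (intro p polyfun_cmult pdiff_polyfun)+
  define Z where "Z = (\<lambda>f :: (int \<Rightarrow> complex) \<Rightarrow> complex. \<lambda>t w. f (cstate (state n w) (stop (exit n w) t)))"
  have Zm: "(\<lambda>w. Re (Z f t w)) \<in> borel_measurable (F (ennreal t))" if "f \<in> polyfun I" "0 \<le> t" for f t
    using polyfun_state_adapted[OF that, of n] unfolding Z_def by measurable
  have Zbd: "\<exists>C. \<forall>w\<in>space P. \<forall>t\<ge>0. norm (Z f t w) \<le> C" if "f \<in> polyfun I" for f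
    unfolding Z_def by (rule polyfun_state_bounded[OF that[unfolded I_def]])
  obtain C1 where C1: "\<forall>w\<in>space P. \<forall>t\<ge>0. norm (Z p t w) \<le> C1" using Zbd[OF pI(1)] by blast
  obtain C2 where C2: "\<forall>w\<in>space P. \<forall>t\<ge>0. norm (Z pH t w) \<le> C2" using Zbd[OF pI(2)] by blast
  obtain C3 where C3: "\<forall>w\<in>space P. \<forall>t\<ge>0. norm (Z pK t w) \<le> C3" using Zbd[OF pI(3)] by blast
  define b where "b = max C1 (max C2 C3)"
  have Rebd: "\<bar>Re (Z p t w)\<bar> \<le> b" "\<bar>Re (Z pH t w)\<bar> \<le> b" "\<bar>Re (Z pK t w)\<bar> \<le> b" if "w \<in> space P" "0 \<le> t" for t w
    using C1 C2 C3 that abs_Re_le_cmod[of "Z p t w"] abs_Re_le_cmod[of "Z pH t w"] abs_Re_le_cmod[of "Z pK t w"]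
    unfolding b_def by (fastforce simp: le_max_iff_disj)+
  obtain B where B: "\<forall>i\<in>{- 1 - int N..int M}. \<forall>w\<in>space P. \<forall>r\<ge>0. ennreal r \<le> exit n w \<longrightarrow>
      \<bar>state n w r i\<bar> \<le> B \<and> \<bar>state_density n w r i\<bar> \<le> B"
    using state_bounded[of N n] by blast
  \<comment> \<open>Twice the bound 2 n of the stopped clock: the largest oscillation for which
    \<open>ito_martingale\<close> asks for the error estimate.\<close>
  define E where "E = 2 * (2 * real n)"
  have "\<exists>C\<ge>0. \<forall>q W S d u v e. ito_step I \<sigma> B E q W S d u v e \<longrightarrow>
    (\<forall>r\<in>{u<..<v}. of_real (\<sigma>\<^sup>2 / 2) * pdiff 0 (pdiff 0 p) (cstate S r) + drift I p S d r = 0) \<longrightarrow>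
    norm (p (cstate S v) - p (cstate S u) - of_real (W v - W u) * pH (cstate S u)
       - of_real ((W v - W u)\<^sup>2 - (q v - q u)) * pK (cstate S u))
     \<le> C * e * ((W v - W u)\<^sup>2 + (q v - q u))"
    unfolding pH_def pK_def by (rule ito_expansion_driftless) (simp_all add: I_def finite_sle_index p E_def)
  then obtain C where C: "0 \<le> C" "\<And>q W S d u v e. ito_step I \<sigma> B E q W S d u v e \<Longrightarrow>
    (\<forall>r\<in>{u<..<v}. of_real (\<sigma>\<^sup>2 / 2) * pdiff 0 (pdiff 0 p) (cstate S r) + drift I p S d r = 0) \<Longrightarrow>
    norm (p (cstate S v) - p (cstate S u) - of_real (W v - W u) * pH (cstate S u)
       - of_real ((W v - W u)\<^sup>2 - (q v - q u)) * pK (cstate S u))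
     \<le> C * e * ((W v - W u)\<^sup>2 + (q v - q u))"
    by blast
  have "martingale P F (\<lambda>t w. Re (Z p t w))"
  proof (rule W.ito_martingale[where H = "\<lambda>t w. Re (Z pH t w)" and K = "\<lambda>t w. Re (Z pK t w)" and b = b and C = C,
        OF Zm[OF pI(1)] Rebd(1) Zm[OF pI(2)] Rebd(2) Zm[OF pI(3)] Rebd(3) C(1)])
    show "AE w in P. \<forall>s t e. 0 \<le> s \<longrightarrow> s \<le> t \<longrightarrow> e \<le> 2 * (2 * real n) \<longrightarrow>
       (\<forall>r\<in>{s..t}. \<bar>(A (stop (exit n w) r) w - A 0 w) - (A (stop (exit n w) s) w - A 0 w)\<bar> \<le> e
          \<and> Q (stop (exit n w) r) w - Q (stop (exit n w) s) w \<le> e) \<longrightarrow>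
       \<bar>Re (Z p t w) - Re (Z p s w) - Re (Z pH s w) * ((A (stop (exit n w) t) w - A 0 w) - (A (stop (exit n w) s) w - A 0 w))
          - Re (Z pK s w) * (((A (stop (exit n w) t) w - A 0 w) - (A (stop (exit n w) s) w - A 0 w))\<^sup>2
              - (Q (stop (exit n w) t) w - Q (stop (exit n w) s) w))\<bar>
         \<le> C * e * (((A (stop (exit n w) t) w - A 0 w) - (A (stop (exit n w) s) w - A 0 w))\<^sup>2
              + (Q (stop (exit n w) t) w - Q (stop (exit n w) s) w))"
      using state_identification AE_space
    proof eventually_elim
      case (elim w)
      show ?case
      proof (intro allI impI)
        fix s t e :: real
        assume st: "0 \<le> s" "s \<le> t" and e: "e \<le> 2 * (2 * real n)"
          and osc: "\<forall>r\<in>{s..t}. \<bar>(A (stop (exit n w) r) w - A 0 w) - (A (stop (exit n w) s) w - A 0 w)\<bar> \<le> e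
            \<and> Q (stop (exit n w) r) w - Q (stop (exit n w) s) w \<le> e"
        define u v where "u = stop (exit n w) s" and "v = stop (exit n w) t"
        have w: "w \<in> space P" using elim by simp
        have step: "ito_step I \<sigma> B E (\<lambda>r. Q r w) (\<lambda>r. A r w) (state n w) (state_density n w) u v e"
          unfolding I_def \<sigma>_def u_def v_def by (rule state_ito_step[OF w st _ _ B]) (use osc e in \<open>auto simp: E_def\<close>)
        have drift0: "\<forall>r\<in>{u<..<v}. of_real (\<sigma>\<^sup>2 / 2) * pdiff 0 (pdiff 0 p) (cstate (state n w) r)
            + drift I p (state n w) (state_density n w) r = 0"
        proof
          fix r assume r: "r \<in> {u<..<v}"
          have r0: "0 \<le> r" using r stop_bounds(1)[of "exit n w" s] by (simp add: u_def)
          have "ennreal r < ennreal v" using r r0 by (intro ennreal_lessI) auto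
          then have rT: "ennreal r < exit n w" unfolding v_def by (rule order_less_le_trans[OF _ stop_le])
          have X: "state n w r 0 = X r w" and Y: "\<And>K. K \<in> {1..M} \<Longrightarrow> state n w r (int K) = Y K r w"
            using elim(1) r0 rT by blast+
          have "cstate (state n w) r 0 \<noteq> cstate (state n w) r (int K)" if "K \<in> {1..M}" for K
            using no_hit[OF w r0 exit_before(1)[OF w r0 rT] that] X Y[OF that] by (simp add: cstate_def)
          then have "sle_generator \<kappa> M \<rho> N p (cstate (state n w) r) = 0" by (rule gen)
          then show "of_real (\<sigma>\<^sup>2 / 2) * pdiff 0 (pdiff 0 p) (cstate (state n w) r)
            + drift I p (state n w) (state_density n w) r = 0"
            using drift_eq_generator[OF w r0 rT X Y, of p N] \<kappa> by (simp add: I_def \<sigma>_def)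
        qed
        have "norm (Z p t w - Z p s w - of_real (A v w - A u w) * Z pH s w
            - of_real ((A v w - A u w)\<^sup>2 - (Q v w - Q u w)) * Z pK s w)
          \<le> C * e * ((A v w - A u w)\<^sup>2 + (Q v w - Q u w))"
          using C(2)[OF step drift0] by (simp add: Z_def u_def v_def)
        from order_trans[OF abs_Re_le_cmod this]
        show "\<bar>Re (Z p t w) - Re (Z p s w) - Re (Z pH s w) * ((A (stop (exit n w) t) w - A 0 w) - (A (stop (exit n w) s) w - A 0 w))
          - Re (Z pK s w) * (((A (stop (exit n w) t) w - A 0 w) - (A (stop (exit n w) s) w - A 0 w))\<^sup>2
              - (Q (stop (exit n w) t) w - Q (stop (exit n w) s) w))\<bar>
         \<le> C * e * (((A (stop (exit n w) t) w - A 0 w) - (A (stop (exit n w) s) w - A 0 w))\<^sup>2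
              + (Q (stop (exit n w) t) w - Q (stop (exit n w) s) w))"
          by (simp add: u_def v_def mult.commute)
      qed
    qed
  qed assumption+
  then show ?thesis by (simp add: Z_def)
qed

lemma generator_local_martingale:
  assumes \<kappa>: "0 < \<kappa>" and p: "p \<in> polyfun (sle_index M N)"
    and gen: "\<And>s. (\<And>K. K \<in> {1..M} \<Longrightarrow> s 0 \<noteq> s (int K)) \<Longrightarrow> sle_generator \<kappa> M \<rho> N p s = 0"
    and V: "AE w in P. \<forall>n t. 0 \<le> t \<longrightarrow> ennreal t < exit n w \<longrightarrow> V t w = p (cstate (state n w) t)"
  shows "local_martingale_on P F \<tau> (\<lambda>t w. Re (V t w))"
  unfolding local_martingale_on_def
proof (intro exI[of _ exit] exI[of _ "\<lambda>n t w. Re (p (cstate (state n w) (stop (exit n w) t)))"] conjI allI)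
  show "stopping_time F (exit n)" for n by (rule exit_stopping)
  show "AE w in P. incseq (\<lambda>n. exit n w) \<and> (\<lambda>n. exit n w) \<longlonglongrightarrow> \<tau> w"
    unfolding exit_def by (intro AE_I2 conjI exit_time_incseq exit_time_tendsto level_continuous)
  show "martingale P F (\<lambda>t w. Re (p (cstate (state n w) (stop (exit n w) t))))" for n
    by (rule generator_martingale[OF \<kappa> p gen])
  show "AE w in P. continuous_on {0..} (\<lambda>t. Re (p (cstate (state n w) (stop (exit n w) t))))" for n
    by (intro AE_I2 continuous_on_Re polyfun_state_continuous[OF p])
  show "AE w in P. \<forall>t\<ge>0. ennreal t < exit n w \<longrightarrow> Re (V t w) = Re (p (cstate (state n w) (stop (exit n w) t)))" for n
    using V
  proof eventually_elim
    case (elim w)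
    then show ?case by (auto simp: stop_before)
  qed
qed

lemma generator_complex_local_martingale:
  assumes \<kappa>: "0 < \<kappa>" and p: "p \<in> polyfun (sle_index M N)"
    and gen: "\<And>s. (\<And>K. K \<in> {1..M} \<Longrightarrow> s 0 \<noteq> s (int K)) \<Longrightarrow> sle_generator \<kappa> M \<rho> N p s = 0"
    and V: "AE w in P. \<forall>n t. 0 \<le> t \<longrightarrow> ennreal t < exit n w \<longrightarrow> V t w = p (cstate (state n w) t)"
  shows "complex_local_martingale_on P F \<tau> V"
  unfolding complex_local_martingale_on_def
proof
  show "local_martingale_on P F \<tau> (\<lambda>t w. Re (V t w))" by (rule generator_local_martingale[OF assms])
  \<comment> \<open>Im V is the real part of - i V, and the generator is complex linear.\<close>
  have "local_martingale_on P F \<tau> (\<lambda>t w. Re (- \<i> * V t w))"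
  proof (rule generator_local_martingale[OF \<kappa> polyfun_cmult[OF p, of "- \<i>"]])
    show "sle_generator \<kappa> M \<rho> N (\<lambda>s. - \<i> * p s) s = 0" if "\<And>K. K \<in> {1..M} \<Longrightarrow> s 0 \<noteq> s (int K)" for s
      using gen[OF that] by (simp only: sle_generator_cmult[OF p] mult_zero_right)
    show "AE w in P. \<forall>n t. 0 \<le> t \<longrightarrow> ennreal t < exit n w \<longrightarrow> - \<i> * V t w = - \<i> * p (cstate (state n w) t)"
      using V by eventually_elim simp
  qed
  then show "local_martingale_on P F \<tau> (\<lambda>t w. Im (V t w))" by simp
qed

end

section \<open>The normalisation by the partition function\<close>

lemma sgn_constant:
  fixes f :: "real \<Rightarrow> real"
  assumes f: "continuous_on {0..t} f" and t: "0 \<le> t" and ne: "\<And>r. r \<in> {0..t} \<Longrightarrow> f r \<noteq> 0"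
  shows "sgn (f t) = sgn (f 0)"
proof -
  have "\<not> (f 0 < 0 \<and> 0 < f t)"
  proof
    assume *: "f 0 < 0 \<and> 0 < f t"
    have "\<exists>x\<ge>0. x \<le> t \<and> f x = 0" by (rule IVT') (use * t f in auto)
    then show False using ne by auto
  qed
  moreover have "\<not> (f t < 0 \<and> 0 < f 0)"
  proof
    assume *: "f t < 0 \<and> 0 < f 0"
    have "\<exists>x\<ge>0. x \<le> t \<and> f x = 0" by (rule IVT2') (use * t f in auto)
    then show False using ne by auto
  qed
  moreover have "f 0 \<noteq> 0" "f t \<noteq> 0" using ne t by auto
  ultimately show ?thesis by (auto simp: sgn_if)
qed

lemma branch_power_nonzero: "branch_power b r p \<noteq> 0"
  by (simp add: branch_power_def)

text \<open>The modulus depends on |r| and the phase on the sign of r; at 1 and -1 only the phase is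
  left.\<close>

lemma branch_power_sgn:
  assumes "r \<noteq> 0"
  shows "branch_power b r p = of_real (\<bar>r\<bar> powr p) * branch_power b (sgn r) p"
proof -
  have "complex_of_real (\<bar>r\<bar> powr p) = exp (of_real p * of_real (ln \<bar>r\<bar>))"
    using assms by (simp add: powr_def exp_of_real[symmetric])
  moreover have "\<bar>sgn r\<bar> = 1" using assms by (simp add: abs_sgn_eq)
  ultimately show ?thesis by (simp add: branch_power_def exp_add[symmetric] distrib_left)
qed

text \<open>The product of all phases. It depends on the points through their order alone and
  becomes the constant of the theorem.\<close>

definition branch_constant :: "int \<Rightarrow> real \<Rightarrow> nat \<Rightarrow> (nat \<Rightarrow> real) \<Rightarrow> real \<Rightarrow> (nat \<Rightarrow> real) \<Rightarrow> complex" where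
  "branch_constant b \<alpha> M \<alpha>s x y =
     (\<Prod>K=1..M. branch_power b (sgn (x - y K)) (2 * \<alpha> * \<alpha>s K)) *
     (\<Prod>K=1..M. \<Prod>J\<in>{1..<K}. branch_power b (sgn (y J - y K)) (2 * \<alpha>s J * \<alpha>s K))"

lemma branch_constant_nonzero: "branch_constant b \<alpha> M \<alpha>s x y \<noteq> 0"
  by (simp add: branch_constant_def branch_power_nonzero)

text \<open>For these charges the exponents in the prefactor of V are those of Z, so the prefactor
  is Z times a product of phases.\<close>

lemma V_vac_eq:
  assumes \<kappa>: "\<kappa> > 0" and \<alpha>: "\<alpha> = 1 / sqrt \<kappa>" and \<alpha>s: "\<And>K. \<alpha>s K = \<rho> K / (2 * sqrt \<kappa>)"
    and x: "\<And>K. K \<in> {1..M} \<Longrightarrow> x \<noteq> y K" and y: "inj_on y {1..M}"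
  shows "V_vac b \<alpha> M \<alpha>s x y = (\<lambda>\<nu>. of_real (sle_Z \<kappa> M \<rho> x y) * branch_constant b \<alpha> M \<alpha>s x y *
    U_minus (\<alpha> + (\<Sum>K=1..M. \<alpha>s K)) \<alpha> M \<alpha>s x y fock_vac \<nu>)"
proof -
  have sq: "sqrt \<kappa> * sqrt \<kappa> = \<kappa>" using \<kappa> by simp
  have e1: "2 * \<alpha> * \<alpha>s K = \<rho> K / \<kappa>" for K unfolding \<alpha> \<alpha>s using sq by simp
  have e2: "2 * \<alpha>s J * \<alpha>s K = \<rho> J * \<rho> K / (2 * \<kappa>)" for J K unfolding \<alpha>s using sq by simp
  have "(\<Prod>K=1..M. branch_power b (x - y K) (2 * \<alpha> * \<alpha>s K)) =
      (\<Prod>K=1..M. of_real (\<bar>y K - x\<bar> powr (\<rho> K / \<kappa>)) * branch_power b (sgn (x - y K)) (2 * \<alpha> * \<alpha>s K))"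
  proof (rule prod.cong[OF refl])
    fix K assume "K \<in> {1..M}"
    then have "x - y K \<noteq> 0" using x by simp
    from branch_power_sgn[OF this] show "branch_power b (x - y K) (2 * \<alpha> * \<alpha>s K) =
      of_real (\<bar>y K - x\<bar> powr (\<rho> K / \<kappa>)) * branch_power b (sgn (x - y K)) (2 * \<alpha> * \<alpha>s K)"
      unfolding e1 by (simp add: abs_minus_commute)
  qed
  moreover have "(\<Prod>K=1..M. \<Prod>J\<in>{1..<K}. branch_power b (y J - y K) (2 * \<alpha>s J * \<alpha>s K)) =
      (\<Prod>K=1..M. \<Prod>J\<in>{1..<K}. of_real (\<bar>y J - y K\<bar> powr (\<rho> J * \<rho> K / (2 * \<kappa>))) * branch_power b (sgn (y J - y K)) (2 * \<alpha>s J * \<alpha>s K))"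
  proof (intro prod.cong refl)
    fix K J assume "K \<in> {1..M}" "J \<in> {1..<K}"
    then have "J \<in> {1..M}" "K \<in> {1..M}" "J \<noteq> K" by auto
    then have "y J - y K \<noteq> 0" using inj_onD[OF y, of J K] by auto
    from branch_power_sgn[OF this] show "branch_power b (y J - y K) (2 * \<alpha>s J * \<alpha>s K) =
      of_real (\<bar>y J - y K\<bar> powr (\<rho> J * \<rho> K / (2 * \<kappa>))) * branch_power b (sgn (y J - y K)) (2 * \<alpha>s J * \<alpha>s K)"
      unfolding e2 by simp
  qed
  ultimately show ?thesis
    unfolding V_vac_def sle_Z_def branch_constant_def by (simp add: prod.distrib fun_eq_iff mult_ac)
qed

lemma sle_Z_positive:
  assumes "\<And>K. K \<in> {1..M} \<Longrightarrow> x \<noteq> y K" and "inj_on y {1..M}"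
  shows "sle_Z \<kappa> M \<rho> x y > 0"
  unfolding sle_Z_def
proof (intro mult_pos_pos prod_pos)
  show "\<bar>y K - x\<bar> powr (\<rho> K / \<kappa>) > 0" if "K \<in> {1..M}" for K using assms(1)[OF that] by simp
  show "\<bar>y J - y K\<bar> powr (\<rho> J * \<rho> K / (2 * \<kappa>)) > 0" if "K \<in> {1..M}" "J \<in> {1..<K}" for J K
    using that inj_onD[OF assms(2), of J K] by auto
qed

lemma U_minus_eq_ustate:
  assumes "s 0 = of_real x" "\<And>K. K \<in> {1..M} \<Longrightarrow> s (int K) = of_real (y K)"
  shows "U_minus \<gamma> \<alpha> M \<alpha>s x y fock_vac = ustate \<alpha> M \<alpha>s s"
proof -
  have "usym \<alpha> M \<alpha>s s n = of_real (\<alpha> * x ^ n + (\<Sum>K=1..M. \<alpha>s K * y K ^ n))" for n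
    using assms by (simp add: usym_def)
  then show ?thesis by (simp add: U_minus_eq_ucoef ustate_def)
qed

context sle_kappa_rho
begin

text \<open>Without collisions the continuous differences keep their signs. The initial values come
  from the integral equations at time 0, hence almost surely.\<close>

lemma order_preserved:
  "AE \<omega> in P. \<forall>t\<ge>0. ennreal t < \<tau> \<omega> \<longrightarrow>
     (\<forall>K\<in>{1..M}. sgn (X t \<omega> - Y K t \<omega>) = sgn (x0 - y0 K)) \<and>
     (\<forall>J\<in>{1..M}. \<forall>K\<in>{1..M}. J \<noteq> K \<longrightarrow> sgn (Y J t \<omega> - Y K t \<omega>) = sgn (y0 J - y0 K))"
  using X_sde Y_ode AE_space
proof eventually_elim
  case (elim \<omega>)
  show ?case
  proof (intro allI impI)
    fix t :: real assume t: "0 \<le> t" "ennreal t < \<tau> \<omega>"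
    have \<omega>: "\<omega> \<in> space P" using elim by simp
    interpret clock_path "\<lambda>r. Q r \<omega>" by (rule Q_clock[OF \<omega>])
    have before: "ennreal r < \<tau> \<omega>" if "r \<in> {0..t}" for r
      by (rule order_le_less_trans[OF ennreal_leI t(2)]) (use that in auto)
    have z: "ennreal 0 < \<tau> \<omega>" using before[of 0] t by simp
    have int0: "(LINT s:{0..0}|stieltjes (\<lambda>r. Q r \<omega>). f s :: real) = 0" for f
      using stieltjes_integral_0[of f] by simp
    have X0: "X 0 \<omega> = x0" using elim(1)[rule_format, OF order_refl z] unfolding int0 by simp
    have Y0: "Y K 0 \<omega> = y0 K" if "K \<in> {1..M}" for K
      using elim(2)[rule_format, OF that order_refl z] unfolding int0 by simp
    have sub: "{0..t} \<subseteq> {t. 0 \<le> t \<and> ennreal t < \<tau> \<omega>}" using before by auto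
    have Xc: "continuous_on {0..t} (\<lambda>t. X t \<omega>)" by (rule continuous_on_subset[OF X_continuous[OF \<omega>] sub])
    have Yc: "continuous_on {0..t} (\<lambda>t. Y K t \<omega>)" if "K \<in> {1..M}" for K
      by (rule continuous_on_subset[OF Y_continuous[OF that \<omega>] sub])
    have inj: "inj_on (\<lambda>K. Y K r \<omega>) {1..M}" if "r \<in> {0..t}" for r
      using no_collision[OF \<omega> _ before[OF that]] that by simp
    have XK: "sgn (X t \<omega> - Y K t \<omega>) = sgn (x0 - y0 K)" if K: "K \<in> {1..M}" for K
    proof -
      have ne: "X r \<omega> - Y K r \<omega> \<noteq> 0" if "r \<in> {0..t}" for r using no_hit[OF \<omega> _ before[OF that] K] that by simp
      show ?thesis using sgn_constant[OF continuous_on_diff[OF Xc Yc[OF K]] t(1) ne] by (simp add: X0 Y0[OF K])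
    qed
    have JK: "sgn (Y J t \<omega> - Y K t \<omega>) = sgn (y0 J - y0 K)" if J: "J \<in> {1..M}" and K: "K \<in> {1..M}" and JK: "J \<noteq> K" for J K
    proof -
      have ne: "Y J r \<omega> - Y K r \<omega> \<noteq> 0" if "r \<in> {0..t}" for r using inj_onD[OF inj[OF that] _ J K] JK by auto
      show ?thesis using sgn_constant[OF continuous_on_diff[OF Yc[OF J] Yc[OF K]] t(1) ne] by (simp add: Y0[OF J] Y0[OF K])
    qed
    show "(\<forall>K\<in>{1..M}. sgn (X t \<omega> - Y K t \<omega>) = sgn (x0 - y0 K)) \<and>
     (\<forall>J\<in>{1..M}. \<forall>K\<in>{1..M}. J \<noteq> K \<longrightarrow> sgn (Y J t \<omega> - Y K t \<omega>) = sgn (y0 J - y0 K))"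
      using XK JK by blast
  qed
qed

end

theorem theorem5p2:
  fixes P :: "'a measure" and F :: "ennreal \<Rightarrow> 'a measure"
    and \<kappa> :: real and M :: nat and \<rho> :: "nat \<Rightarrow> real"
    and A Q :: "real \<Rightarrow> 'a \<Rightarrow> real" and \<tau> :: "'a \<Rightarrow> ennreal"
    and x0 :: real and y0 :: "nat \<Rightarrow> real"
    and X :: "real \<Rightarrow> 'a \<Rightarrow> real" and Y :: "nat \<Rightarrow> real \<Rightarrow> 'a \<Rightarrow> real"
    and g :: "real \<Rightarrow> 'a \<Rightarrow> complex \<Rightarrow> complex" and gc :: "real \<Rightarrow> 'a \<Rightarrow> int \<Rightarrow> complex"
    and G :: "(int \<Rightarrow> complex) \<Rightarrow> vir_series" and b :: int
    and \<alpha> \<beta> :: real and \<alpha>s :: "nat \<Rightarrow> real"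
    and Mt :: "real \<Rightarrow> 'a \<Rightarrow> fock"
  assumes "\<kappa> > 0" and "M \<ge> 1"
    and sle: "sle_kappa_rho P F \<kappa> M \<rho> A Q \<tau> x0 y0 X Y g gc"
    and G: "is_G G"
    and \<alpha>: "\<alpha> = 1 / sqrt \<kappa>"
    and \<alpha>s: "\<And>K. \<alpha>s K = \<rho> K / (2 * sqrt \<kappa>)"
    and \<beta>: "\<beta> = \<alpha> + (\<Sum>K=1..M. \<alpha>s K)"
    and Mt: "\<And>t \<omega>. Mt t \<omega> = (\<lambda>\<nu>.
      of_real (1 / sle_Z \<kappa> M \<rho> (X t \<omega>) (\<lambda>K. Y K t \<omega>)) *
      vir_action \<kappa> \<beta> (G (gc t \<omega>)) (V_vac b \<alpha> M \<alpha>s (X t \<omega>) (\<lambda>K. Y K t \<omega>)) \<nu>)"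
  shows "(\<exists>c::complex. c \<noteq> 0 \<and>
      (AE \<omega> in P. \<forall>t\<ge>0. ennreal t < \<tau> \<omega> \<longrightarrow>
         Mt t \<omega> = (\<lambda>\<nu>. c * vir_action \<kappa> \<beta> (G (gc t \<omega>))
                        (U_minus \<beta> \<alpha> M \<alpha>s (X t \<omega>) (\<lambda>K. Y K t \<omega>) fock_vac) \<nu>))) \<and>
    (\<forall>\<nu>. 0 \<notin># \<nu> \<longrightarrow> complex_local_martingale_on P F \<tau> (\<lambda>t \<omega>. Mt t \<omega> \<nu>))"
proof (intro conjI allI impI)
  interpret sle_kappa_rho P F \<kappa> M \<rho> A Q \<tau> x0 y0 X Y g gc by (rule sle)
  define c where "c = branch_constant b \<alpha> M \<alpha>s x0 y0"
  have Mt_eq: "AE \<omega> in P. \<forall>t\<ge>0. ennreal t < \<tau> \<omega> \<longrightarrow>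
         Mt t \<omega> = (\<lambda>\<nu>. c * vir_action \<kappa> \<beta> (G (gc t \<omega>))
                        (U_minus \<beta> \<alpha> M \<alpha>s (X t \<omega>) (\<lambda>K. Y K t \<omega>) fock_vac) \<nu>)"
    using order_preserved AE_space
  proof eventually_elim
    case (elim \<omega>)
    show ?case
    proof (intro allI impI)
      fix t :: real assume t: "0 \<le> t" "ennreal t < \<tau> \<omega>"
      have \<omega>: "\<omega> \<in> space P" using elim by simp
      note ne = no_hit[OF \<omega> t]
      have inj: "inj_on (\<lambda>K. Y K t \<omega>) {1..M}" using no_collision[OF \<omega> t] by blast
      have 1: "sgn (X t \<omega> - Y K t \<omega>) = sgn (x0 - y0 K)" if "K \<in> {1..M}" for K using elim(1) t that by blast
      have 2: "sgn (Y J t \<omega> - Y K t \<omega>) = sgn (y0 J - y0 K)" if "K \<in> {1..M}" "J \<in> {1..<K}" for J K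
      proof -
        have "J \<in> {1..M}" "J \<noteq> K" using that by auto
        then show ?thesis using elim(1) t that by blast
      qed
      have bc: "branch_constant b \<alpha> M \<alpha>s (X t \<omega>) (\<lambda>K. Y K t \<omega>) = c"
        unfolding branch_constant_def c_def using 1 2 by (intro arg_cong2[where f = "(*)"] prod.cong refl) auto
      have lin: "fock_linear (vir_action \<kappa> \<beta> (G (gc t \<omega>)))" by (rule fock_linear_vir_action[OF is_G_series[OF G]])
      have "sle_Z \<kappa> M \<rho> (X t \<omega>) (\<lambda>K. Y K t \<omega>) \<noteq> 0" using sle_Z_positive[OF ne inj, of \<kappa> \<rho>] by simp
      moreover have V: "V_vac b \<alpha> M \<alpha>s (X t \<omega>) (\<lambda>K. Y K t \<omega>) = (\<lambda>\<nu>. (of_real (sle_Z \<kappa> M \<rho> (X t \<omega>) (\<lambda>K. Y K t \<omega>)) * c) *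
          U_minus \<beta> \<alpha> M \<alpha>s (X t \<omega>) (\<lambda>K. Y K t \<omega>) fock_vac \<nu>)"
        unfolding bc[symmetric] \<beta>
      proof (rule V_vac_eq[OF \<open>\<kappa> > 0\<close> \<alpha>])
        show "\<alpha>s K = \<rho> K / (2 * sqrt \<kappa>)" for K by (rule \<alpha>s)
        show "X t \<omega> \<noteq> Y K t \<omega>" if "K \<in> {1..M}" for K by (rule ne[OF that])
        show "inj_on (\<lambda>K. Y K t \<omega>) {1..M}" by (rule inj)
      qed
      ultimately show "Mt t \<omega> = (\<lambda>\<nu>. c * vir_action \<kappa> \<beta> (G (gc t \<omega>))
                        (U_minus \<beta> \<alpha> M \<alpha>s (X t \<omega>) (\<lambda>K. Y K t \<omega>) fock_vac) \<nu>)"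
        unfolding Mt V fock_linear_scale[OF lin] by (simp add: fun_eq_iff)
    qed
  qed
  show "\<exists>c::complex. c \<noteq> 0 \<and> (AE \<omega> in P. \<forall>t\<ge>0. ennreal t < \<tau> \<omega> \<longrightarrow>
         Mt t \<omega> = (\<lambda>\<nu>. c * vir_action \<kappa> \<beta> (G (gc t \<omega>))
                        (U_minus \<beta> \<alpha> M \<alpha>s (X t \<omega>) (\<lambda>K. Y K t \<omega>) fock_vac) \<nu>))"
  proof (intro exI[of _ c] conjI Mt_eq)
    show "c \<noteq> 0" unfolding c_def by (rule branch_constant_nonzero)
  qed
  fix \<nu> :: "nat multiset" assume \<nu>: "0 \<notin># \<nu>"
  \<comment> \<open>With Z divided out, each coefficient of M is c times this polynomial evaluated
    along the state.\<close>
  define p where "p = (\<lambda>s. vir_action \<kappa> \<beta> (G s) (ustate \<alpha> M \<alpha>s s) \<nu>)"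
  have "\<exists>N. p \<in> polyfun (sle_index M N) \<and>
      (\<forall>s. (\<forall>K\<in>{1..M}. s 0 \<noteq> s (int K)) \<longrightarrow> sle_generator \<kappa> M \<rho> N p s = 0)"
    unfolding p_def sle_index_def sle_generator_def
    apply (rule sle_state_generator[OF \<open>\<kappa> > 0\<close> \<alpha> _ \<beta> G \<nu>])
     apply (rule \<alpha>s)
    subgoal premises prems for N
      by (intro exI[of _ N] conjI allI impI, rule prems(1), rule prems(2)) blast
    done
  then obtain N where p: "p \<in> polyfun (sle_index M N)"
    and gen: "\<And>s. (\<And>K. K \<in> {1..M} \<Longrightarrow> s 0 \<noteq> s (int K)) \<Longrightarrow> sle_generator \<kappa> M \<rho> N p s = 0"
    by (elim exE conjE) simp
  show "complex_local_martingale_on P F \<tau> (\<lambda>t \<omega>. Mt t \<omega> \<nu>)"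
  proof (rule generator_complex_local_martingale[OF \<open>\<kappa> > 0\<close> polyfun_cmult[OF p, of c]])
    show "sle_generator \<kappa> M \<rho> N (\<lambda>s. c * p s) s = 0" if "\<And>K. K \<in> {1..M} \<Longrightarrow> s 0 \<noteq> s (int K)" for s
      using gen[OF that] by (simp only: sle_generator_cmult[OF p] mult_zero_right)
    show "AE \<omega> in P. \<forall>n t. 0 \<le> t \<longrightarrow> ennreal t < exit n \<omega> \<longrightarrow> Mt t \<omega> \<nu> = c * p (cstate (state n \<omega>) t)"
      using Mt_eq state_identification AE_space
    proof eventually_elim
      case (elim \<omega>)
      show ?case
      proof (intro allI impI)
        fix n and t :: real assume t: "0 \<le> t" "ennreal t < exit n \<omega>"
        have \<omega>: "\<omega> \<in> space P" using elim by simp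
        define s where "s = cstate (state n \<omega>) t"
        have id: "state n \<omega> t 0 = X t \<omega>" "\<And>K. K \<in> {1..M} \<Longrightarrow> state n \<omega> t (int K) = Y K t \<omega>"
          "\<And>m. m \<ge> 1 \<Longrightarrow> gc t \<omega> (- 1 - int m) = of_real (state n \<omega> t (- 1 - int m))"
          using elim(2) t by blast+
        \<comment> \<open>The two sequences agree at m \<le> -2 only; at nonnegative indices s holds
          X and Y.\<close>
        have "G (gc t \<omega>) = G s"
        proof (rule is_G_cong[OF G])
          fix m :: int assume "m \<le> -2"
          then have "m = - 1 - int (nat (- 1 - m))" "nat (- 1 - m) \<ge> 1" by auto
          then show "gc t \<omega> m = s m" using id(3)[of "nat (- 1 - m)"] by (simp add: s_def cstate_def)
        qed
        moreover have "U_minus \<beta> \<alpha> M \<alpha>s (X t \<omega>) (\<lambda>K. Y K t \<omega>) fock_vac = ustate \<alpha> M \<alpha>s s"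
          by (rule U_minus_eq_ustate) (use id in \<open>auto simp: s_def cstate_def\<close>)
        ultimately show "Mt t \<omega> \<nu> = c * p (cstate (state n \<omega>) t)"
          using elim(1) t exit_before(1)[OF \<omega> t] by (simp add: p_def s_def)
      qed
    qed
  qed
qed

end
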